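(* Let $\Sigma$ be a unimodular fan in $N_{\mathbb R}$. For every non-negative integer $p$, the cohomology of the cochain complex $\bigl(C_\square^{p,\bullet}(\overline\Sigma,\mathbb Z),\mathrm d_\square\bigr)$, $$C_\square^{p,q}(\overline\Sigma,\mathbb Z)=\bigoplus_{\sigma\in\Sigma,\ |\sigma|=q}\mathbf F^{p-q}(\infty_\sigma,\mathbb Z),$$ is isomorphic to $H^{p,\bullet}(\overline\Sigma,\mathbb Z)$, i.e. $H^q\bigl(C_\square^{p,\bullet}(\overline\Sigma,\mathbb Z)\bigr)\simeq H^{p,q}(\overline\Sigma,\mathbb Z)$ for all $q$. The same statement holds with rational coefficients for simplicial rational fans.
   Context: **Fans.** $N$ is a free $\mathbb Z$-module of finite rank, $N_{\mathbb R}=N\otimes\mathbb R$. Cones are strictly convex polyhedral cones, rational with respect to $N$; fans are finite. $\underline 0=\{0\}$, $|\sigma|=\dim\sigma$, and $\tau\prec\sigma$ means that $\tau$ is a face of $\sigma$ (equality allowed). $N_{\sigma,\mathbb R}$ is the span of $\sigma$, $N_\sigma=N\cap N_{\sigma,\mathbb R}$, $N^\sigma=N/N_\sigma$, $N^\sigma_{\mathbb R}=N_{\mathbb R}/N_{\sigma,\mathbb R}$. If $\tau\prec\sigma$ has codimension one, $e^\tau_\sigma$ is the generator of $N_\sigma/N_\tau\simeq\mathbb Z$ lying in the image of $\sigma$. $\Sigma$ is simplicial if each cone is generated by as many rays as its dimension; unimodular if moreover the primitive vectors of the rays of any cone are part of a basis of $N$. **Canonical compactification.** Let $\mathbb T_+=\mathbb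 R_{\ge0}\cup\{\infty\}$. For a cone $\sigma$ with dual cone $\sigma^\vee$, $\overline\sigma=\mathrm{Hom}_{\mathbb R_+}(\sigma^\vee,\mathbb T_+)$ (morphisms of $\mathbb R_{+}$-modules); $\overline\Sigma$ is the union of the $\overline\sigma$, glued along $\overline\tau\subseteq\overline\sigma$ for $\tau\prec\sigma$. For $\Sigma$ simplicial, its closed faces are hypercubes $\square^\tau_\sigma\simeq\mathbb T_+^{|\sigma|-|\tau|}$ indexed by pairs $\tau\prec\sigma$: $\square^\tau_\sigma$ is the closure of the copy, in the stratum at infinity $N^\tau_{\mathbb R}$, of the projection of $\sigma$ to $N^\tau_{\mathbb R}$. One has $\square^{\tau'}_{\sigma'}\subseteq\square^\tau_\sigma$ iff $\tau\prec\tau'\prec\sigma'\prec\sigma$; $\square^{\underline0}_\sigma=\overline\sigma$; $\square^\sigma_\sigma=\{\infty_\sigma\}$ is a point, also denoted $\infty_\sigma$. **Tropical cohomology.** For $\delta=\square^\tau_\sigma$ put $N_\delta=N_\sigma/N_\tau$, $$\mathbf F_p(\delta)=\sum_{\eta\succ\sigma}\textstyle\bigwedge^p(N_\eta/N_\tau)\subseteq\bigwedge^pN^\tau,\qquad \mathbf F^p(\delta)=\mathbf F^p(\delta,\mathbb Z)=\mathrm{Hom}(\mathbf F_p(\delta),\mathbb Z)$$ (zero for $p<0$). For $\gamma=\square^{\tau'}_{\sigma'}\subseteq\delta=\square^\tau_\sigma$, the projection $N^\tau\to N^{\tau'}$ induces $\mathbf F_p(\delta)\to\mathbf F_p(\gamma)$.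 Fix a generator $\nu_\delta$ of $\bigwedge^{\dim\delta}N_\delta$ for every face (equal to $1$ for points and to the primitive generator $e^\tau_\sigma$ in dimension one). For a codimension-one face $\gamma$ of $\delta=\square^\tau_\sigma$, $\mathrm{sign}(\gamma,\delta)\in\{\pm1\}$ is defined by $n\wedge\nu_\gamma=\mathrm{sign}(\gamma,\delta)\nu_\delta$ if $\gamma=\square^\tau_{\sigma'}$, $n$ any lift of $e^{\sigma'}_\sigma$; and by $e^\tau_{\tau'}\wedge\nu'=-\mathrm{sign}(\gamma,\delta)\nu_\delta$ if $\gamma=\square^{\tau'}_\sigma$, $\nu'$ any lift of $\nu_\gamma$. $C_{p,q}(\overline\Sigma)=\bigoplus_{\dim\delta=q}\mathbf F_p(\delta)$ with $\partial$ the sum of the maps $\mathbf F_p(\delta)\to\mathbf F_p(\gamma)$ multiplied by $\mathrm{sign}(\gamma,\delta)$; $C^{p,\bullet}(\overline\Sigma)$ is the dual cochain complex and $H^{p,q}(\overline\Sigma,\mathbb Z)=H^q(C^{p,\bullet}(\overline\Sigma))$. Rational versions by tensoring the complexes with $\mathbb Q$. **The differential $\mathrm d_\square$.** For $\tau$ a codimension-one face of $\sigma\in\Sigma$, let $\pi\colon N^\tau\to N^\sigma$ be the projection and define $\mathbf F^k(\infty_\tau)\to\mathbf F^{k-1}(\infty_\sigma)$, $\alpha\mapsto\pi_*\kappa_{e^\tau_\sigma}(\alpha)$, where $\pi_*\kappa_{e^\tau_\sigma}(\alpha)$ takes on $\beta\in\mathbf F_{k-1}(\infty_\sigma)$ the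 value $\alpha(e^\tau_\sigma\wedge\beta')$, for any lift $\beta'\in\mathbf F_{k-1}(\square^\tau_\sigma)\subseteq\mathbf F_{k-1}(\infty_\tau)$ of $\beta$ under $\pi$ (the value does not depend on the lift). The differential $\mathrm d_\square^q\colon C^{p,q}_\square\to C^{p,q+1}_\square$ is the sum of these maps over all pairs $\tau\prec\sigma$ with $|\tau|=q$, $|\sigma|=q+1$. *)

theory Defs
  imports "HOL-Analysis.Polytope" "HOL-Algebra.Free_Abelian_Groups"
begin

section \<open>Abelian groups\<close>

text \<open>
  Abelian groups are the (multiplicatively written) groups of HOL-Algebra.
\<close>

definition additive_group :: "'a::ab_group_add set \<Rightarrow> 'a monoid" where
  "additive_group A = \<lparr>carrier = A, monoid.mult = (+), one = 0\<rparr>"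

text \<open>Homomorphisms are made extensional so that equality in \<open>hom_group G H\<close> is equality on
  \<open>carrier G\<close>.\<close>

definition hom_group :: "('a, 'c) monoid_scheme \<Rightarrow> ('b, 'd) monoid_scheme \<Rightarrow> ('a \<Rightarrow> 'b) monoid" where
  "hom_group G H =
    \<lparr>carrier = hom G H \<inter> extensional (carrier G),
     monoid.mult = (\<lambda>f g. \<lambda>x\<in>carrier G. f x \<otimes>\<^bsub>H\<^esub> g x),
     one = (\<lambda>x\<in>carrier G. \<one>\<^bsub>H\<^esub>)\<rparr>"

text \<open>
  The map into \<open>G Mod K\<close> induced by \<open>f\<close> on cosets. When \<open>f\<close> is compatible with the
  relations, all the cosets in the union coincide.
\<close>

definition coset_map :: "('b, 'c) monoid_scheme \<Rightarrow> 'b set \<Rightarrow> ('a \<Rightarrow> 'b) \<Rightarrow> 'a set \<Rightarrow> 'b set" where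
  "coset_map G K f X = (\<Union>x\<in>X. K #>\<^bsub>G\<^esub> f x)"

subsection \<open>Exterior powers\<close>

text \<open>
  \<open>ext_power p G\<close> is the exterior power of the \<open>\<int>\<close>-module \<open>G\<close>: the free abelian group on the
  \<open>p\<close>-tuples of elements of \<open>G\<close> modulo the multilinear and alternating relations.
\<close>

definition ext_free :: "nat \<Rightarrow> ('a, 'c) monoid_scheme \<Rightarrow> ('a list \<Rightarrow>\<^sub>0 int) monoid" where
  "ext_free p G = free_Abelian_group {xs. length xs = p \<and> set xs \<subseteq> carrier G}"

definition ext_rel :: "nat \<Rightarrow> ('a, 'c) monoid_scheme \<Rightarrow> ('a list \<Rightarrow>\<^sub>0 int) set" where
  "ext_rel p G = generate (ext_free p G)
     ({frag_of (us @ [x \<otimes>\<^bsub>G\<^esub> y] @ vs) - frag_of (us @ [x] @ vs) - frag_of (us @ [y] @ vs) | us vs x y.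
         length us + 1 + length vs = p \<and> set us \<union> set vs \<union> {x, y} \<subseteq> carrier G} \<union>
      {frag_of xs | xs. length xs = p \<and> set xs \<subseteq> carrier G \<and> \<not> distinct xs})"

definition ext_power :: "nat \<Rightarrow> ('a, 'c) monoid_scheme \<Rightarrow> ('a list \<Rightarrow>\<^sub>0 int) set monoid" where
  "ext_power p G = ext_free p G Mod ext_rel p G"

text \<open>The decomposable element \<open>x\<^sub>1 \<and> \<dots> \<and> x\<^sub>p\<close>; \<open>ext_mono 0 G []\<close> is the unit \<open>1\<close> of
  \<open>ext_power 0 G\<close>, which is a copy of \<open>\<int>\<close>.\<close>

definition ext_mono :: "nat \<Rightarrow> ('a, 'c) monoid_scheme \<Rightarrow> 'a list \<Rightarrow> ('a list \<Rightarrow>\<^sub>0 int) set" where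
  "ext_mono p G xs = ext_rel p G #>\<^bsub>ext_free p G\<^esub> frag_of xs"

text \<open>\<open>ext_map p H f\<close> is the map on \<open>p\<close>-th exterior powers induced by a homomorphism \<open>f\<close> with
  values in \<open>H\<close>.\<close>

definition ext_map ::
  "nat \<Rightarrow> ('b, 'c) monoid_scheme \<Rightarrow> ('a \<Rightarrow> 'b) \<Rightarrow> ('a list \<Rightarrow>\<^sub>0 int) set \<Rightarrow> ('b list \<Rightarrow>\<^sub>0 int) set" where
  "ext_map p H f = coset_map (ext_free p H) (ext_rel p H) (frag_extend (\<lambda>xs. frag_of (map f xs)))"

text \<open>\<open>wedge p G x\<close> is \<open>\<beta> \<mapsto> x \<and> \<beta>\<close>, from \<open>ext_power p G\<close> to \<open>ext_power (p + 1) G\<close>.\<close>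

definition wedge ::
  "nat \<Rightarrow> ('a, 'c) monoid_scheme \<Rightarrow> 'a \<Rightarrow> ('a list \<Rightarrow>\<^sub>0 int) set \<Rightarrow> ('a list \<Rightarrow>\<^sub>0 int) set" where
  "wedge p G x =
     coset_map (ext_free (Suc p) G) (ext_rel (Suc p) G) (frag_extend (\<lambda>xs. frag_of (x # xs)))"

subsection \<open>Tensor product with the rationals\<close>

definition tensor_free :: "('a, 'c) monoid_scheme \<Rightarrow> ('a \<times> rat \<Rightarrow>\<^sub>0 int) monoid" where
  "tensor_free A = free_Abelian_group (carrier A \<times> UNIV)"

definition tensor_rel :: "('a, 'c) monoid_scheme \<Rightarrow> ('a \<times> rat \<Rightarrow>\<^sub>0 int) set" where
  "tensor_rel A = generate (tensor_free A)
     ({frag_of (a \<otimes>\<^bsub>A\<^esub> b, r) - frag_of (a, r) - frag_of (b, r) | a b r.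
         a \<in> carrier A \<and> b \<in> carrier A} \<union>
      {frag_of (a, r + s) - frag_of (a, r) - frag_of (a, s) | a r s. a \<in> carrier A})"

definition tensor_rat :: "('a, 'c) monoid_scheme \<Rightarrow> ('a \<times> rat \<Rightarrow>\<^sub>0 int) set monoid" where
  "tensor_rat A = tensor_free A Mod tensor_rel A"

text \<open>\<open>tensor_rat_map B f\<close> is \<open>f \<otimes> id\<close>, for \<open>f\<close> with values in \<open>B\<close>.\<close>

definition tensor_rat_map ::
  "('b, 'c) monoid_scheme \<Rightarrow> ('a \<Rightarrow> 'b) \<Rightarrow> ('a \<times> rat \<Rightarrow>\<^sub>0 int) set \<Rightarrow> ('b \<times> rat \<Rightarrow>\<^sub>0 int) set" where
  "tensor_rat_map B f =
     coset_map (tensor_free B) (tensor_rel B) (frag_extend (\<lambda>(a, r). frag_of (f a, r)))"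

subsection \<open>Cohomology of a cochain complex\<close>

text \<open>\<open>A q\<close> is the group in degree \<open>q \<ge> 0\<close> and \<open>d q\<close> maps \<open>A q\<close> to \<open>A (q + 1)\<close>; the complex is
  zero in negative degrees.\<close>

definition cohomology_group ::
  "(nat \<Rightarrow> 'a monoid) \<Rightarrow> (nat \<Rightarrow> 'a \<Rightarrow> 'a) \<Rightarrow> nat \<Rightarrow> 'a set monoid" where
  "cohomology_group A d q =
     (A q)\<lparr>carrier := kernel (A q) (A (Suc q)) (d q)\<rparr>
       Mod (case q of 0 \<Rightarrow> {\<one>\<^bsub>A 0\<^esub>} | Suc r \<Rightarrow> d r ` carrier (A r))"

section \<open>Lattices, cones and fans\<close>

text \<open>
  A free \<open>\<int>\<close>-module of finite rank is realised as a lattice \<open>N\<close> spanned by finitely many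
  linearly independent vectors of an ambient real vector space, which may be larger than
  \<open>N\<^sub>\<real> = N \<otimes> \<real> = span N\<close>. The rank may be zero.
\<close>

definition lattice_basis :: "'a::real_vector set \<Rightarrow> 'a set \<Rightarrow> bool" where
  "lattice_basis N B \<longleftrightarrow>
     finite B \<and> independent B \<and> N = {\<Sum>b\<in>B. of_int (c b) *\<^sub>R b | c :: 'a \<Rightarrow> int. True}"

definition free_lattice :: "'a::real_vector set \<Rightarrow> bool" where
  "free_lattice N \<longleftrightarrow> (\<exists>B. lattice_basis N B)"

definition rational_cone :: "'a::real_vector set \<Rightarrow> 'a set \<Rightarrow> bool" where
  "rational_cone N \<sigma> \<longleftrightarrow>
     (\<exists>S. finite S \<and> S \<subseteq> N \<and> \<sigma> = convex_cone hull S) \<and> (\<forall>x. x \<in> \<sigma> \<and> - x \<in> \<sigma> \<longrightarrow> x = 0)"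

text \<open>The empty set satisfies the library's \<open>face_of\<close> but is not a face of a cone.\<close>

definition cone_face :: "'a::real_vector set \<Rightarrow> 'a set \<Rightarrow> bool" where
  "cone_face \<tau> \<sigma> \<longleftrightarrow> \<tau> face_of \<sigma> \<and> \<tau> \<noteq> {}"

definition fan :: "'a::real_vector set \<Rightarrow> 'a set set \<Rightarrow> bool" where
  "fan N \<Sigma> \<longleftrightarrow> finite \<Sigma> \<and>
     (\<forall>\<sigma>\<in>\<Sigma>. rational_cone N \<sigma>) \<and>
     (\<forall>\<sigma>\<in>\<Sigma>. \<forall>\<tau>. cone_face \<tau> \<sigma> \<longrightarrow> \<tau> \<in> \<Sigma>) \<and>
     (\<forall>\<sigma>\<in>\<Sigma>. \<forall>\<sigma>'\<in>\<Sigma>. cone_face (\<sigma> \<inter> \<sigma>') \<sigma> \<and> cone_face (\<sigma> \<inter> \<sigma>') \<sigma>')"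

definition rays :: "'a::real_vector set \<Rightarrow> 'a set set" where
  "rays \<sigma> = {\<rho>. cone_face \<rho> \<sigma> \<and> dim \<rho> = 1}"

definition simplicial_fan :: "'a::real_vector set set \<Rightarrow> bool" where
  "simplicial_fan \<Sigma> \<longleftrightarrow>
     (\<forall>\<sigma>\<in>\<Sigma>. \<exists>R \<subseteq> rays \<sigma>. finite R \<and> card R = dim \<sigma> \<and> \<sigma> = convex_cone hull (\<Union>R))"

definition primitive_vector :: "'a::real_vector set \<Rightarrow> 'a set \<Rightarrow> 'a" where
  "primitive_vector N \<rho> =
     (THE v. v \<in> \<rho> \<inter> N \<and> v \<noteq> 0 \<and> \<rho> \<inter> N = {of_nat k *\<^sub>R v | k :: nat. True})"

definition unimodular_fan :: "'a::real_vector set \<Rightarrow> 'a set set \<Rightarrow> bool" where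
  "unimodular_fan N \<Sigma> \<longleftrightarrow> simplicial_fan \<Sigma> \<and>
     (\<forall>\<sigma>\<in>\<Sigma>. \<exists>B. lattice_basis N B \<and> primitive_vector N ` rays \<sigma> \<subseteq> B)"

text \<open>The lattice \<open>N\<^sub>\<sigma>\<close>, and the quotients \<open>N\<^sub>\<sigma> / N\<^sub>\<tau>\<close> and \<open>N\<^sup>\<tau> = N / N\<^sub>\<tau>\<close>. Elements of both
  quotients are cosets of \<open>N\<^sub>\<tau>\<close>, so \<open>N\<^sub>\<sigma> / N\<^sub>\<tau>\<close> is literally contained in \<open>N\<^sup>\<tau>\<close>.\<close>

definition cone_lattice :: "'a::real_vector set \<Rightarrow> 'a set \<Rightarrow> 'a set" where
  "cone_lattice N \<sigma> = N \<inter> span \<sigma>"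

definition rel_lattice :: "'a::real_vector set \<Rightarrow> 'a set \<Rightarrow> 'a set \<Rightarrow> 'a set monoid" where
  "rel_lattice N \<sigma> \<tau> = additive_group (cone_lattice N \<sigma>) Mod cone_lattice N \<tau>"

definition quot_lattice :: "'a::real_vector set \<Rightarrow> 'a set \<Rightarrow> 'a set monoid" where
  "quot_lattice N \<tau> = additive_group N Mod cone_lattice N \<tau>"

text \<open>For \<open>\<tau>\<close> a face of \<open>\<tau>'\<close>: the projection from cosets of \<open>N\<^sub>\<tau>\<close> to cosets of \<open>N\<^sub>\<tau>\<^sub>'\<close>.\<close>

definition lattice_proj :: "'a::real_vector set \<Rightarrow> 'a set \<Rightarrow> 'a set \<Rightarrow> 'a set" where
  "lattice_proj N \<tau>' X = cone_lattice N \<tau>' <#>\<^bsub>additive_group N\<^esub> X"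

text \<open>The generator \<open>e\<^sup>\<tau>\<^sub>\<sigma>\<close> of \<open>N\<^sub>\<sigma> / N\<^sub>\<tau>\<close>, for \<open>\<tau>\<close> of codimension one in \<open>\<sigma>\<close>. The last condition says
  that it lies in the image of \<open>\<sigma>\<close> in \<open>span \<sigma> / span \<tau>\<close>.\<close>

definition normal_gen :: "'a::real_vector set \<Rightarrow> 'a set \<Rightarrow> 'a set \<Rightarrow> 'a set" where
  "normal_gen N \<tau> \<sigma> =
     (THE X. X \<in> carrier (rel_lattice N \<sigma> \<tau>) \<and>
             generate (rel_lattice N \<sigma> \<tau>) {X} = carrier (rel_lattice N \<sigma> \<tau>) \<and>
             (\<exists>n\<in>X. \<exists>s\<in>\<sigma>. s - n \<in> span \<tau>))"

section \<open>Tropical cohomology of the canonical compactification\<close>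

text \<open>
  The pair \<open>(\<tau>, \<sigma>)\<close>, with \<open>\<tau>\<close> a face of \<open>\<sigma>\<close>, stands for the closed face \<open>\<square>\<^sup>\<tau>\<^sub>\<sigma>\<close> of the canonical
  compactification; it has dimension \<open>dim \<sigma> - dim \<tau>\<close>. The point \<open>\<infinity>\<^sub>\<sigma>\<close> is \<open>(\<sigma>, \<sigma>)\<close>.
\<close>

type_synonym 'a cface = "'a set \<times> 'a set"
type_synonym 'a multivec = "('a set list \<Rightarrow>\<^sub>0 int) set"

definition faces :: "'a::real_vector set set \<Rightarrow> nat \<Rightarrow> 'a cface set" where
  "faces \<Sigma> q = {(\<tau>, \<sigma>). \<tau> \<in> \<Sigma> \<and> \<sigma> \<in> \<Sigma> \<and> cone_face \<tau> \<sigma> \<and> dim \<sigma> - dim \<tau> = q}"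

fun subface :: "'a::real_vector cface \<Rightarrow> 'a cface \<Rightarrow> bool" where
  "subface (\<tau>', \<sigma>') (\<tau>, \<sigma>) \<longleftrightarrow> cone_face \<tau> \<tau>' \<and> cone_face \<tau>' \<sigma>' \<and> cone_face \<sigma>' \<sigma>"

fun face_lattice :: "'a::real_vector set \<Rightarrow> 'a cface \<Rightarrow> 'a set monoid" where
  "face_lattice N (\<tau>, \<sigma>) = rel_lattice N \<sigma> \<tau>"

text \<open>The coefficient group \<open>F\<^sub>p(\<delta>)\<close>. \<open>ext_map\<close> of the identity is the inclusion of the exterior
  power of \<open>N\<^sub>\<eta> / N\<^sub>\<tau>\<close> into that of \<open>N\<^sup>\<tau>\<close>; the sum of subgroups is the subgroup generated by
  their union.\<close>

fun F_lower :: "'a::real_vector set \<Rightarrow> 'a set set \<Rightarrow> nat \<Rightarrow> 'a cface \<Rightarrow> 'a multivec monoid" where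
  "F_lower N \<Sigma> p (\<tau>, \<sigma>) =
     subgroup_generated (ext_power p (quot_lattice N \<tau>))
       (\<Union>\<eta>\<in>{\<eta> \<in> \<Sigma>. cone_face \<sigma> \<eta>}.
          ext_map p (quot_lattice N \<tau>) (\<lambda>x. x) ` carrier (ext_power p (rel_lattice N \<eta> \<tau>)))"

text \<open>The map \<open>F\<^sub>p(\<delta>) \<rightarrow> F\<^sub>p(\<gamma>)\<close>, for \<open>\<gamma>\<close> a subface of \<open>\<delta>\<close>; it only depends on the first component of
  \<open>\<gamma>\<close>.\<close>

definition F_proj :: "'a::real_vector set \<Rightarrow> nat \<Rightarrow> 'a cface \<Rightarrow> 'a multivec \<Rightarrow> 'a multivec" where
  "F_proj N p \<gamma> = ext_map p (quot_lattice N (fst \<gamma>)) (lattice_proj N (fst \<gamma>))"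

text \<open>The dual group \<open>F\<^sup>k(\<delta>) = F\<^sup>k(\<delta>, \<int>)\<close>, with \<open>k\<close> an integer since it vanishes for \<open>k < 0\<close>.\<close>

definition F_upper ::
  "'a::real_vector set \<Rightarrow> 'a set set \<Rightarrow> int \<Rightarrow> 'a cface \<Rightarrow> ('a multivec \<Rightarrow> int) monoid" where
  "F_upper N \<Sigma> k \<delta> =
     (if k < 0 then singleton_group undefined
      else hom_group (F_lower N \<Sigma> (nat k) \<delta>) integer_group)"

subsection \<open>Orientations and signs\<close>

text \<open>A choice \<open>\<nu>\<close> of a generator of the top exterior power of \<open>N\<^sub>\<delta>\<close> for every face \<open>\<delta>\<close>.\<close>

definition orientation ::
  "'a::real_vector set \<Rightarrow> 'a set set \<Rightarrow> ('a cface \<Rightarrow> 'a multivec) \<Rightarrow> bool" where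
  "orientation N \<Sigma> \<nu> \<longleftrightarrow>
     (\<forall>q. \<forall>\<delta>\<in>faces \<Sigma> q.
        \<nu> \<delta> \<in> carrier (ext_power q (face_lattice N \<delta>)) \<and>
        generate (ext_power q (face_lattice N \<delta>)) {\<nu> \<delta>} = carrier (ext_power q (face_lattice N \<delta>))) \<and>
     (\<forall>\<delta>\<in>faces \<Sigma> 0. \<nu> \<delta> = ext_mono 0 (face_lattice N \<delta>) []) \<and>
     (\<forall>\<delta>\<in>faces \<Sigma> 1. \<nu> \<delta> = ext_mono 1 (face_lattice N \<delta>) [normal_gen N (fst \<delta>) (snd \<delta>)])"

text \<open>The sign of a codimension-one subface \<open>\<gamma> = (\<tau>', \<sigma>')\<close> of \<open>\<delta> = (\<tau>, \<sigma>)\<close>: either \<open>\<tau>' = \<tau>\<close> and \<open>\<sigma>'\<close>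
  has codimension one in \<open>\<sigma>\<close>, or \<open>\<sigma>' = \<sigma>\<close> and \<open>\<tau>\<close> has codimension one in \<open>\<tau>'\<close>. Powers are integer
  multiples, the groups being written multiplicatively.\<close>

fun face_sign ::
  "'a::real_vector set \<Rightarrow> ('a cface \<Rightarrow> 'a multivec) \<Rightarrow> 'a cface \<Rightarrow> 'a cface \<Rightarrow> int" where
  "face_sign N \<nu> (\<tau>', \<sigma>') (\<tau>, \<sigma>) =
     (let G = rel_lattice N \<sigma> \<tau>; d = dim \<sigma>' - dim \<tau>' in
      THE s. s \<in> {1, -1} \<and>
        (if \<tau>' = \<tau> then
           \<forall>n\<in>carrier G. lattice_proj N \<sigma>' n = normal_gen N \<sigma>' \<sigma> \<longrightarrow>
             wedge d G n (ext_map d G (\<lambda>x. x) (\<nu> (\<tau>', \<sigma>')))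
               = \<nu> (\<tau>, \<sigma>) [^]\<^bsub>ext_power (Suc d) G\<^esub> s
         else
           \<forall>\<nu>'\<in>carrier (ext_power d G).
             ext_map d (rel_lattice N \<sigma> \<tau>') (lattice_proj N \<tau>') \<nu>' = \<nu> (\<tau>', \<sigma>') \<longrightarrow>
             wedge d G (normal_gen N \<tau> \<tau>') \<nu>' = \<nu> (\<tau>, \<sigma>) [^]\<^bsub>ext_power (Suc d) G\<^esub> (- s)))"

subsection \<open>The cellular complexes\<close>

definition trop_chain ::
  "'a::real_vector set \<Rightarrow> 'a set set \<Rightarrow> nat \<Rightarrow> nat \<Rightarrow> ('a cface \<Rightarrow> 'a multivec) monoid" where
  "trop_chain N \<Sigma> p q = sum_group (faces \<Sigma> q) (F_lower N \<Sigma> p)"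

text \<open>\<open>trop_boundary N \<Sigma> \<nu> p q\<close> goes from \<open>trop_chain N \<Sigma> p (q + 1)\<close> to \<open>trop_chain N \<Sigma> p q\<close>.\<close>

definition trop_boundary ::
  "'a::real_vector set \<Rightarrow> 'a set set \<Rightarrow> ('a cface \<Rightarrow> 'a multivec) \<Rightarrow> nat \<Rightarrow> nat \<Rightarrow>
     ('a cface \<Rightarrow> 'a multivec) \<Rightarrow> ('a cface \<Rightarrow> 'a multivec)" where
  "trop_boundary N \<Sigma> \<nu> p q c =
     (\<lambda>\<gamma>\<in>faces \<Sigma> q.
        \<Otimes>\<^bsub>F_lower N \<Sigma> p \<gamma>\<^esub>\<delta>\<in>{\<delta> \<in> faces \<Sigma> (Suc q). subface \<gamma> \<delta>}.
          F_proj N p \<gamma> (c \<delta>) [^]\<^bsub>F_lower N \<Sigma> p \<gamma>\<^esub> face_sign N \<nu> \<gamma> \<delta>)"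

definition trop_cochain ::
  "'a::real_vector set \<Rightarrow> 'a set set \<Rightarrow> nat \<Rightarrow> nat \<Rightarrow> (('a cface \<Rightarrow> 'a multivec) \<Rightarrow> int) monoid" where
  "trop_cochain N \<Sigma> p q = hom_group (trop_chain N \<Sigma> p q) integer_group"

definition trop_coboundary ::
  "'a::real_vector set \<Rightarrow> 'a set set \<Rightarrow> ('a cface \<Rightarrow> 'a multivec) \<Rightarrow> nat \<Rightarrow> nat \<Rightarrow>
     (('a cface \<Rightarrow> 'a multivec) \<Rightarrow> int) \<Rightarrow> (('a cface \<Rightarrow> 'a multivec) \<Rightarrow> int)" where
  "trop_coboundary N \<Sigma> \<nu> p q f =
     (\<lambda>c\<in>carrier (trop_chain N \<Sigma> p (Suc q)). f (trop_boundary N \<Sigma> \<nu> p q c))"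

text \<open>The cohomology groups \<open>H\<^sup>p\<^sup>,\<^sup>q\<close> of the canonical compactification, with coefficients in \<open>\<int>\<close> and
  in \<open>\<rat>\<close>.\<close>

definition trop_cohomology where
  "trop_cohomology N \<Sigma> \<nu> p q =
     cohomology_group (trop_cochain N \<Sigma> p) (trop_coboundary N \<Sigma> \<nu> p) q"

definition trop_cohomology_rat where
  "trop_cohomology_rat N \<Sigma> \<nu> p q =
     cohomology_group (\<lambda>r. tensor_rat (trop_cochain N \<Sigma> p r))
       (\<lambda>r. tensor_rat_map (trop_cochain N \<Sigma> p (Suc r)) (trop_coboundary N \<Sigma> \<nu> p r)) q"

subsection \<open>The complex with differential \<open>d\<^sub>\<square>\<close>\<close>

text \<open>The map \<open>F\<^sup>k(\<infinity>\<^sub>\<tau>) \<rightarrow> F\<^sup>k\<^sup>-\<^sup>1(\<infinity>\<^sub>\<sigma>)\<close> for \<open>\<tau>\<close> of codimension one in \<open>\<sigma>\<close>. The value does not depend on the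
  lift picked by \<open>SOME\<close>.\<close>

definition contract_map ::
  "'a::real_vector set \<Rightarrow> 'a set set \<Rightarrow> int \<Rightarrow> 'a set \<Rightarrow> 'a set \<Rightarrow>
     ('a multivec \<Rightarrow> int) \<Rightarrow> ('a multivec \<Rightarrow> int)" where
  "contract_map N \<Sigma> k \<tau> \<sigma> \<alpha> =
     (if k - 1 < 0 then \<one>\<^bsub>F_upper N \<Sigma> (k - 1) (\<sigma>, \<sigma>)\<^esub>
      else let m = nat (k - 1) in
        (\<lambda>\<beta>\<in>carrier (F_lower N \<Sigma> m (\<sigma>, \<sigma>)).
          \<alpha> (wedge m (quot_lattice N \<tau>) (normal_gen N \<tau> \<sigma>)
               (SOME \<beta>'. \<beta>' \<in> carrier (F_lower N \<Sigma> m (\<tau>, \<sigma>)) \<and> F_proj N m (\<sigma>, \<sigma>) \<beta>' = \<beta>))))"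

definition square_cochain ::
  "'a::real_vector set \<Rightarrow> 'a set set \<Rightarrow> nat \<Rightarrow> nat \<Rightarrow> ('a set \<Rightarrow> 'a multivec \<Rightarrow> int) monoid" where
  "square_cochain N \<Sigma> p q =
     sum_group {\<sigma> \<in> \<Sigma>. dim \<sigma> = q} (\<lambda>\<sigma>. F_upper N \<Sigma> (int p - int q) (\<sigma>, \<sigma>))"

definition square_diff ::
  "'a::real_vector set \<Rightarrow> 'a set set \<Rightarrow> nat \<Rightarrow> nat \<Rightarrow>
     ('a set \<Rightarrow> 'a multivec \<Rightarrow> int) \<Rightarrow> ('a set \<Rightarrow> 'a multivec \<Rightarrow> int)" where
  "square_diff N \<Sigma> p q a =
     (\<lambda>\<sigma>\<in>{\<sigma> \<in> \<Sigma>. dim \<sigma> = Suc q}.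
        \<Otimes>\<^bsub>F_upper N \<Sigma> (int p - int (Suc q)) (\<sigma>, \<sigma>)\<^esub>\<tau>\<in>{\<tau> \<in> \<Sigma>. dim \<tau> = q \<and> cone_face \<tau> \<sigma>}.
          contract_map N \<Sigma> (int p - int q) \<tau> \<sigma> (a \<tau>))"

definition square_cohomology where
  "square_cohomology N \<Sigma> p q =
     cohomology_group (square_cochain N \<Sigma> p) (square_diff N \<Sigma> p) q"

definition square_cohomology_rat where
  "square_cohomology_rat N \<Sigma> p q =
     cohomology_group (\<lambda>r. tensor_rat (square_cochain N \<Sigma> p r))
       (\<lambda>r. tensor_rat_map (square_cochain N \<Sigma> p (Suc r)) (square_diff N \<Sigma> p r)) q"

end

theory Submission
  imports Defs
begin

text \<open>
  Let \<open>\<sigma>\<close> have the primitive vectors \<open>B\<close> and dimension \<open>q\<close>, and let \<open>e\<^sub>B\<close> be the wedge of the elements of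
  \<open>B\<close>. Evaluating a tropical cochain on \<open>e\<^sub>B \<and> w\<close> at the faces \<open>\<square>\<^sup>0\<^sub>\<sigma>\<close> defines a functional of degree \<open>p - q\<close> at
  \<open>\<infinity>\<^sub>\<sigma>\<close>, and this is a morphism from the tropical complex to the complex with differential \<open>d\<^sub>\<square>\<close>. It is
  onto, because contraction with the coordinates dual to \<open>B\<close> is a section. Its kernel is acyclic: filter
  it by \<open>dim \<sigma>\<close>; for a fixed \<open>\<sigma>\<close> the faces \<open>\<square>\<^sup>\<tau>\<^sub>\<sigma>\<close> form a cube, and the projections along the rays contract
  the coboundary of this cube up to the part that factors through \<open>e\<^sub>B\<close>.

  For a simplicial fan the dual coordinates are integral only after multiplication by some \<open>M\<close>, so that
  surjectivity and acyclicity hold up to multiples, which are invertible over the rationals. Unimodular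
  fans are the case \<open>M = 1\<close>.
\<close>

section \<open>Exterior powers by generators and relations\<close>

text \<open>The groups \<open>F_p\<close> of the faces are not exterior powers but sums over all
  cones containing a given one, so a splitting has to respect every summand at once. Projection
  along a ray \<open>b\<close> does: it changes a vector only by a multiple of \<open>b\<close>,
  hence preserves \<open>NL C\<close> for each \<open>C\<close> containing \<open>b\<close>. All
  classes are handled through formal sums of tuples of vectors in \<open>N\<close>. One sum then
  represents an element at many faces \<open>\<square>^A_B\<close>, since enlarging \<open>A\<close>
  only adds relations and shrinking \<open>B\<close> only admits more tuples; all terms of a
  coboundary can be evaluated at the same argument. Orientations are removed by comparing the chosen
  generator with the wedge of \<open>B - A\<close> in a fixed order; multiplied by the sign of this
  comparison, cochains have the incidence signs of a cube. In the simplicial case the primitive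
  vector of a ray is only a multiple of \<open>e^\<tau>_\<sigma>\<close> modulo the facet, which
  weights on the cones compensate, and several identities between wedge products are obtained only
  after multiplication by a positive integer; functionals with integer values do not see such a
  factor.\<close>

inductive_set zspan :: "'b::ab_group_add set \<Rightarrow> 'b set" for X where
  zspan_zero: "0 \<in> zspan X"
| zspan_base: "x \<in> X \<Longrightarrow> x \<in> zspan X"
| zspan_diff: "x \<in> zspan X \<Longrightarrow> y \<in> zspan X \<Longrightarrow> x - y \<in> zspan X"

lemma zspan_uminus: "x \<in> zspan X \<Longrightarrow> - x \<in> zspan X"
  using zspan_diff[OF zspan_zero] by fastforce

lemma zspan_add: "x \<in> zspan X \<Longrightarrow> y \<in> zspan X \<Longrightarrow> x + y \<in> zspan X"
  using zspan_diff[OF _ zspan_uminus] by fastforce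

lemma zspan_cmul: "x \<in> zspan X \<Longrightarrow> frag_cmul k x \<in> zspan X"
  by (rule frag_closure_minus_cmul) (auto intro: zspan_diff zspan_zero)

lemma zspan_minimal:
  assumes "x \<in> zspan X" "0 \<in> S" "\<And>x. x \<in> X \<Longrightarrow> x \<in> S" "\<And>x y. x \<in> S \<Longrightarrow> y \<in> S \<Longrightarrow> x - y \<in> S"
  shows "x \<in> S"
  using assms(1) by (induction rule: zspan.induct) (use assms in auto)

lemma zspan_image:
  assumes "x \<in> zspan X" "\<And>x y. f (x - y) = f x - f y" "\<And>x. x \<in> X \<Longrightarrow> f x \<in> zspan Y"
  shows "f x \<in> zspan Y"
proof -
  have "f 0 = 0"
    using assms(2)[of 0 0] by simp
  then show ?thesis
    using zspan_minimal[OF assms(1), of "f -` zspan Y"] assms(2,3)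
    by (auto intro: zspan_zero zspan_diff)
qed

lemma zspan_trans_diff: "x - y \<in> zspan X \<Longrightarrow> y - z \<in> zspan X \<Longrightarrow> x - z \<in> zspan X"
  using zspan_add[of "x - y" X "y - z"] by simp

lemma zspan_sym_diff: "x - y \<in> zspan X \<Longrightarrow> y - x \<in> zspan X"
  using zspan_uminus[of "x - y" X] by simp

lemma zspan_mono: "X \<subseteq> Y \<Longrightarrow> x \<in> zspan X \<Longrightarrow> x \<in> zspan Y"
  by (erule zspan_minimal) (auto intro: zspan.intros)

definition frags :: "'b set \<Rightarrow> ('b \<Rightarrow>\<^sub>0 int) set" where
  "frags S = {v. Poly_Mapping.keys v \<subseteq> S}"

lemma frags_of [simp]: "frag_of x \<in> frags S \<longleftrightarrow> x \<in> S"
  by (simp add: frags_def)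

lemma frags_zero [simp]: "0 \<in> frags S"
  by (simp add: frags_def)

lemma frags_diff: "x \<in> frags S \<Longrightarrow> y \<in> frags S \<Longrightarrow> x - y \<in> frags S"
  using keys_diff[of x y] by (auto simp: frags_def)

lemma frags_add: "x \<in> frags S \<Longrightarrow> y \<in> frags S \<Longrightarrow> x + y \<in> frags S"
  using keys_add[of x y] by (auto simp: frags_def)

lemma frags_uminus: "x \<in> frags S \<Longrightarrow> - x \<in> frags S"
  by (simp add: frags_def)

lemma frags_cmul: "x \<in> frags S \<Longrightarrow> frag_cmul k x \<in> frags S"
  by (auto simp: frags_def)

lemma frags_mono: "S \<subseteq> T \<Longrightarrow> x \<in> frags S \<Longrightarrow> x \<in> frags T"
  by (auto simp: frags_def)

lemma frags_UNIV [simp]: "x \<in> frags UNIV"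
  by (simp add: frags_def)

lemma frags_induct [consumes 1, case_names zero of diff]:
  assumes "x \<in> frags S" "P 0" "\<And>s. s \<in> S \<Longrightarrow> P (frag_of s)" "\<And>x y. P x \<Longrightarrow> P y \<Longrightarrow> P (x - y)"
  shows "P x"
  using assms(1) frag_induction[of x S P] assms(2-4) by (auto simp: frags_def)

lemma frags_extend:
  assumes "v \<in> frags S" "\<And>s. s \<in> S \<Longrightarrow> f s \<in> frags T"
  shows "frag_extend f v \<in> frags T"
  using assms keys_frag_extend[of f v] by (fastforce simp: frags_def)

definition add_closed :: "'a::ab_group_add set \<Rightarrow> bool" where
  "add_closed L \<longleftrightarrow> 0 \<in> L \<and> (\<forall>x\<in>L. \<forall>y\<in>L. x - y \<in> L)"

lemma add_closedD:
  assumes "add_closed L"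
  shows "0 \<in> L" "x \<in> L \<Longrightarrow> y \<in> L \<Longrightarrow> x - y \<in> L" "x \<in> L \<Longrightarrow> - x \<in> L" "x \<in> L \<Longrightarrow> y \<in> L \<Longrightarrow> x + y \<in> L"
proof -
  show *: "0 \<in> L" "x \<in> L \<Longrightarrow> y \<in> L \<Longrightarrow> x - y \<in> L" for x y
    using assms by (auto simp: add_closed_def)
  show "x \<in> L \<Longrightarrow> - x \<in> L" for x
    using *(2)[of 0 x] *(1) by simp
  then show "x \<in> L \<Longrightarrow> y \<in> L \<Longrightarrow> x + y \<in> L"
    using *(2)[of x "- y"] by simp
qed

lemma add_closed_int:
  fixes x :: "'a::real_vector"
  assumes "add_closed L" "x \<in> L"
  shows "of_int k *\<^sub>R x \<in> L"
proof (induction k rule: int_induct[where k=0])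
  case base
  then show ?case using assms by (simp add: add_closedD)
next
  case (step1 i)
  then show ?case using add_closedD(4)[OF assms(1) step1(2) assms(2)] by (simp add: algebra_simps)
next
  case (step2 i)
  then show ?case using add_closedD(2)[OF assms(1) step2(2) assms(2)] by (simp add: algebra_simps)
qed

lemma add_closed_sum:
  assumes "add_closed L" "\<And>i. i \<in> I \<Longrightarrow> f i \<in> L"
  shows "sum f I \<in> L"
  using assms(2) by (induction I rule: infinite_finite_induct) (auto simp: add_closedD[OF assms(1)])

section \<open>Left multiplication and functoriality on formal sums of tuples\<close>

text \<open>Formal sums may contain tuples of all lengths, so that one operator is left
  multiplication by \<open>x\<close> in every degree.\<close>

definition wdg :: "'a \<Rightarrow> ('a list \<Rightarrow>\<^sub>0 int) \<Rightarrow> ('a list \<Rightarrow>\<^sub>0 int)" where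
  "wdg x = frag_extend (\<lambda>xs. frag_of (x # xs))"

definition pmap :: "('a \<Rightarrow> 'b) \<Rightarrow> ('a list \<Rightarrow>\<^sub>0 int) \<Rightarrow> ('b list \<Rightarrow>\<^sub>0 int)" where
  "pmap g = frag_extend (\<lambda>xs. frag_of (map g xs))"

lemma wdg_of [simp]: "wdg x (frag_of xs) = frag_of (x # xs)"
  by (simp add: wdg_def)

lemma wdg_simps [simp]:
  "wdg x 0 = 0" "wdg x (v - w) = wdg x v - wdg x w" "wdg x (v + w) = wdg x v + wdg x w"
  "wdg x (- v) = - wdg x v" "wdg x (frag_cmul k v) = frag_cmul k (wdg x v)"
  by (simp_all add: wdg_def frag_extend_diff frag_extend_add frag_extend_minus frag_extend_cmul)

lemma pmap_of [simp]: "pmap g (frag_of xs) = frag_of (map g xs)"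
  by (simp add: pmap_def)

lemma pmap_simps [simp]:
  "pmap g 0 = 0" "pmap g (v - w) = pmap g v - pmap g w" "pmap g (v + w) = pmap g v + pmap g w"
  "pmap g (- v) = - pmap g v" "pmap g (frag_cmul k v) = frag_cmul k (pmap g v)"
  by (simp_all add: pmap_def frag_extend_diff frag_extend_add frag_extend_minus frag_extend_cmul)

lemma pmap_wdg: "pmap g (wdg x v) = wdg (g x) (pmap g v)"
  by (rule frags_induct[of v UNIV]) auto

declare minus_frag_cmul [simp del]

lemma frag_cmul_minus_left [simp]: "frag_cmul (- k) v = - frag_cmul k v"
  by (rule poly_mapping_eqI) simp

lemma frag_cmul_minus_right [simp]: "frag_cmul k (- v) = - frag_cmul k v"
  by (rule poly_mapping_eqI) simp

lemma frag_cmul_diff_right [simp]: "frag_cmul k (v - w) = frag_cmul k v - frag_cmul k w"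
  by (rule poly_mapping_eqI) (simp add: algebra_simps lookup_minus)

lemma frag_cmul_add_right [simp]: "frag_cmul k (v + w) = frag_cmul k v + frag_cmul k w"
  by (rule frag_cmul_distrib2)

section \<open>Relations of the exterior algebra\<close>

definition lsts :: "nat \<Rightarrow> 'a set \<Rightarrow> 'a list set" where
  "lsts p L = {xs. length xs = p \<and> set xs \<subseteq> L}"

text \<open>The relations of all degrees defining the exterior algebra of \<open>L / T\<close>, in terms of
  representatives in \<open>L\<close>.\<close>

inductive_set ext_gens :: "'a::ab_group_add set \<Rightarrow> 'a set \<Rightarrow> ('a list \<Rightarrow>\<^sub>0 int) set" for L T where
  linear: "set us \<subseteq> L \<Longrightarrow> set vs \<subseteq> L \<Longrightarrow> x \<in> L \<Longrightarrow> y \<in> L \<Longrightarrow>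
     frag_of (us @ [x + y] @ vs) - frag_of (us @ [x] @ vs) - frag_of (us @ [y] @ vs) \<in> ext_gens L T"
| alternating: "set xs \<subseteq> L \<Longrightarrow> \<not> distinct xs \<Longrightarrow> frag_of xs \<in> ext_gens L T"
| torsion: "set us \<subseteq> L \<Longrightarrow> set vs \<subseteq> L \<Longrightarrow> t \<in> T \<Longrightarrow> frag_of (us @ [t] @ vs) \<in> ext_gens L T"

definition rels :: "'a::ab_group_add set \<Rightarrow> 'a set \<Rightarrow> ('a list \<Rightarrow>\<^sub>0 int) set" where
  "rels L T = zspan (ext_gens L T)"

lemma rels_zero [simp]: "0 \<in> rels L T" and rels_diff: "v \<in> rels L T \<Longrightarrow> w \<in> rels L T \<Longrightarrow> v - w \<in> rels L T"
  and rels_add: "v \<in> rels L T \<Longrightarrow> w \<in> rels L T \<Longrightarrow> v + w \<in> rels L T"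
  and rels_uminus: "v \<in> rels L T \<Longrightarrow> - v \<in> rels L T"
  and rels_cmul: "v \<in> rels L T \<Longrightarrow> frag_cmul k v \<in> rels L T"
  and rels_trans: "u - v \<in> rels L T \<Longrightarrow> v - w \<in> rels L T \<Longrightarrow> u - w \<in> rels L T"
  and rels_sym: "u - v \<in> rels L T \<Longrightarrow> v - u \<in> rels L T"
  by (auto simp: rels_def intro: zspan_zero zspan_diff zspan_add zspan_uminus zspan_cmul
      zspan_trans_diff zspan_sym_diff)

lemma rels_mono: "L \<subseteq> L' \<Longrightarrow> T \<subseteq> T' \<Longrightarrow> v \<in> rels L T \<Longrightarrow> v \<in> rels L' T'"
  unfolding rels_def
  by (erule zspan_mono[rotated]) (force elim!: ext_gens.cases intro: ext_gens.intros)

lemma rels_image: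
  assumes "v \<in> rels L T" "\<And>x y. f (x - y) = f x - f y" "\<And>x. x \<in> ext_gens L T \<Longrightarrow> f x \<in> rels L' T'"
  shows "f v \<in> rels L' T'"
  using zspan_image[of v "ext_gens L T" f "ext_gens L' T'"] assms unfolding rels_def by blast

text \<open>Every generator carries an arbitrary prefix, which absorbs \<open>x\<close>; the
  relations thus form a left ideal.\<close>

lemma rels_wdg:
  assumes "v \<in> rels L T" "x \<in> L"
  shows "wdg x v \<in> rels L T"
proof (rule rels_image[OF assms(1)])
  fix g assume "g \<in> ext_gens L T"
  then show "wdg x g \<in> rels L T"
  proof cases
    case (linear us vs y z)
    then show ?thesis
      using ext_gens.linear[of "x # us" L vs y z T] assms(2) by (auto simp: rels_def intro: zspan_base)
  next
    case (alternating xs)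
    then show ?thesis
      using ext_gens.alternating[of "x # xs" L T] assms(2) by (auto simp: rels_def intro: zspan_base)
  next
    case (torsion us vs t)
    then show ?thesis
      using ext_gens.torsion[of "x # us" L vs t T] assms(2) by (auto simp: rels_def intro: zspan_base)
  qed
qed simp

abbreviation flists :: "'a set \<Rightarrow> ('a list \<Rightarrow>\<^sub>0 int) set" where
  "flists L \<equiv> frags (lists L)"

lemma flists_wdg: "v \<in> flists L \<Longrightarrow> x \<in> L \<Longrightarrow> wdg x v \<in> flists L"
  unfolding wdg_def by (rule frags_extend) auto

lemma rels_wdg_add:
  assumes "v \<in> flists L" "x \<in> L" "y \<in> L"
  shows "wdg (x + y) v - wdg x v - wdg y v \<in> rels L T"
  using assms(1)
proof (induction rule: frags_induct)
  case (of s)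
  then show ?case
    using ext_gens.linear[of "[]" L s x y T] assms(2,3) by (auto simp: rels_def intro: zspan_base)
next
  case (diff v w)
  have "wdg (x + y) (v - w) - wdg x (v - w) - wdg y (v - w) =
     (wdg (x + y) v - wdg x v - wdg y v) - (wdg (x + y) w - wdg x w - wdg y w)"
    by simp
  then show ?case
    using diff by (metis rels_diff)
qed auto

lemma rels_wdg_torsion:
  assumes "v \<in> flists L" "t \<in> T"
  shows "wdg t v \<in> rels L T"
  using assms(1)
proof (induction rule: frags_induct)
  case (of s)
  then show ?case
    using ext_gens.torsion[of "[]" L s t T] assms(2) by (auto simp: rels_def intro: zspan_base)
qed (auto intro: rels_diff)

lemma rels_wdg_twice:
  assumes "v \<in> flists L" "x \<in> L"
  shows "wdg x (wdg x v) \<in> rels L T"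
  using assms(1)
proof (induction rule: frags_induct)
  case (of s)
  then show ?case
    using ext_gens.alternating[of "x # x # s" L T] assms(2) by (auto simp: rels_def intro: zspan_base)
qed (auto intro: rels_diff)

lemma rels_wdg_diff:
  assumes "add_closed L" "v \<in> flists L" "x \<in> L" "y \<in> L"
  shows "wdg (x - y) v - (wdg x v - wdg y v) \<in> rels L T"
proof -
  have "wdg (x - y + y) v - wdg (x - y) v - wdg y v \<in> rels L T"
    by (rule rels_wdg_add) (use assms add_closedD(2) in auto)
  then have "- (wdg (x - y + y) v - wdg (x - y) v - wdg y v) \<in> rels L T"
    by (rule rels_uminus)
  then show ?thesis by (simp add: algebra_simps)
qed

lemma rels_wdg_zero:
  assumes "add_closed L" "v \<in> flists L"
  shows "wdg 0 v \<in> rels L T"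
  using rels_wdg_diff[OF assms(1,2), of 0 0] assms(1) by (simp add: add_closedD)

lemma rels_wdg_scale:
  fixes x :: "'a::real_vector"
  assumes "add_closed L" "v \<in> flists L" "x \<in> L"
  shows "wdg (of_int k *\<^sub>R x) v - frag_cmul k (wdg x v) \<in> rels L T"
proof (induction k rule: int_induct[where k=0])
  case base
  then show ?case using rels_wdg_zero[OF assms(1,2)] by simp
next
  case (step1 i)
  have "wdg (of_int i *\<^sub>R x + x) v - wdg (of_int i *\<^sub>R x) v - wdg x v \<in> rels L T"
    by (rule rels_wdg_add) (use assms add_closed_int in auto)
  from rels_add[OF this step1(2)] show ?case
    by (simp add: algebra_simps frag_cmul_distrib)
next
  case (step2 i)
  have "wdg (of_int i *\<^sub>R x - x) v - (wdg (of_int i *\<^sub>R x) v - wdg x v) \<in> rels L T"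
    by (rule rels_wdg_diff) (use assms add_closed_int in auto)
  from rels_add[OF this step2(2)] show ?case
    by (simp add: algebra_simps frag_cmul_diff_distrib)
qed

text \<open>Polarisation: expand the square of \<open>x + y\<close> and subtract the squares of
  \<open>x\<close> and \<open>y\<close>.\<close>

lemma rels_wdg_swap:
  assumes "v \<in> flists L" "x \<in> L" "y \<in> L" "add_closed L"
  shows "wdg x (wdg y v) + wdg y (wdg x v) \<in> rels L T"
proof -
  have xy: "x + y \<in> L" using assms by (simp add: add_closedD)
  note f = flists_wdg[OF assms(1)]
  have 1: "wdg (x + y) (wdg (x + y) v) \<in> rels L T"
    by (rule rels_wdg_twice) (use assms xy in auto)
  have 2: "wdg (x + y) (wdg (x + y) v - wdg x v - wdg y v) \<in> rels L T"
    by (rule rels_wdg[OF rels_wdg_add]) (use assms xy in auto)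
  have 3: "wdg (x + y) (wdg x v) - wdg x (wdg x v) - wdg y (wdg x v) \<in> rels L T"
     "wdg (x + y) (wdg y v) - wdg x (wdg y v) - wdg y (wdg y v) \<in> rels L T"
    by (rule rels_wdg_add; use assms f in auto)+
  have 4: "wdg x (wdg x v) \<in> rels L T" "wdg y (wdg y v) \<in> rels L T"
    by (rule rels_wdg_twice; use assms in auto)+
  have "wdg x (wdg y v) + wdg y (wdg x v) = wdg (x + y) (wdg (x + y) v)
     - wdg (x + y) (wdg (x + y) v - wdg x v - wdg y v)
     - (wdg (x + y) (wdg x v) - wdg x (wdg x v) - wdg y (wdg x v))
     - (wdg (x + y) (wdg y v) - wdg x (wdg y v) - wdg y (wdg y v))
     - wdg x (wdg x v) - wdg y (wdg y v)"
    by simp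
  then show ?thesis
    using 1 2 3 4 by (simp only: rels_diff)
qed

section \<open>Iterated wedge products\<close>

definition wdgs :: "'a list \<Rightarrow> ('a list \<Rightarrow>\<^sub>0 int) \<Rightarrow> ('a list \<Rightarrow>\<^sub>0 int)" where
  "wdgs us v = foldr wdg us v"

lemma wdgs_simps [simp]:
  "wdgs [] v = v" "wdgs (u # us) v = wdg u (wdgs us v)" "wdgs (us @ vs) v = wdgs us (wdgs vs v)"
  by (simp_all add: wdgs_def)

lemma wdgs_linear [simp]:
  "wdgs us 0 = 0" "wdgs us (v - w) = wdgs us v - wdgs us w" "wdgs us (v + w) = wdgs us v + wdgs us w"
  "wdgs us (- v) = - wdgs us v" "wdgs us (frag_cmul k v) = frag_cmul k (wdgs us v)"
  by (induction us) auto

lemma wdgs_of: "wdgs us (frag_of vs) = frag_of (us @ vs)"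
  by (induction us) auto

lemma pmap_wdgs: "pmap g (wdgs us v) = wdgs (map g us) (pmap g v)"
  by (induction us) (auto simp: pmap_wdg)

lemma flists_wdgs: "v \<in> flists L \<Longrightarrow> set us \<subseteq> L \<Longrightarrow> wdgs us v \<in> flists L"
  by (induction us) (auto intro: flists_wdg)

lemma rels_wdgs: "v \<in> rels L T \<Longrightarrow> set us \<subseteq> L \<Longrightarrow> wdgs us v \<in> rels L T"
  by (induction us) (auto intro: rels_wdg)

text \<open>Each factor of \<open>us\<close> that \<open>x\<close> passes costs one sign, by
  \<open>rels_wdg_swap\<close>.\<close>

lemma rels_wdgs_move:
  assumes "v \<in> flists L" "set us \<subseteq> L" "x \<in> L" "add_closed L"
  shows "wdgs us (wdg x v) - frag_cmul ((-1) ^ length us) (wdg x (wdgs us v)) \<in> rels L T"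
  using assms(2)
proof (induction us)
  case (Cons u us)
  let ?s = "(-1) ^ length us :: int"
  have 1: "wdg u (wdgs us (wdg x v) - frag_cmul ?s (wdg x (wdgs us v))) \<in> rels L T"
    by (rule rels_wdg) (use Cons in auto)
  have 2: "frag_cmul ?s (wdg u (wdg x (wdgs us v)) + wdg x (wdg u (wdgs us v))) \<in> rels L T"
    by (intro rels_cmul rels_wdg_swap flists_wdgs) (use Cons assms in auto)
  from rels_add[OF 1 2] show ?case
    by simp
qed auto

lemma rels_wdgs_torsion:
  assumes "v \<in> flists L" "set us \<subseteq> L" "t \<in> T" "t \<in> set us"
  shows "wdgs us v \<in> rels L T"
proof -
  obtain us1 us2 where us: "us = us1 @ t # us2"
    using assms(4) by (meson split_list)
  have "wdg t (wdgs us2 v) \<in> rels L T"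
    by (rule rels_wdg_torsion) (use assms us in \<open>auto intro: flists_wdgs\<close>)
  then show ?thesis
    using rels_wdgs[of _ L T us1] assms us by auto
qed

lemma rels_wdgs_repeat:
  assumes "v \<in> flists L" "set us \<subseteq> L" "x \<in> set us"
  shows "wdg x (wdgs us v) \<in> rels L T"
  using assms(1)
proof (induction rule: frags_induct)
  case (of s)
  then show ?case
    using ext_gens.alternating[of "x # us @ s" L T] assms
    by (auto simp: rels_def wdgs_of intro: zspan_base)
qed (auto intro: rels_diff)

lemma rels_pmap:
  assumes "v \<in> rels L T" "\<And>x. x \<in> L \<Longrightarrow> g x \<in> L'" "\<And>x y. x \<in> L \<Longrightarrow> y \<in> L \<Longrightarrow> g (x + y) = g x + g y"
    and "\<And>t. t \<in> T \<Longrightarrow> g t \<in> T'"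
  shows "pmap g v \<in> rels L' T'"
proof (rule rels_image[OF assms(1)])
  fix w assume "w \<in> ext_gens L T"
  then show "pmap g w \<in> rels L' T'"
  proof cases
    case (linear us vs y z)
    then show ?thesis
      using ext_gens.linear[of "map g us" L' "map g vs" "g y" "g z" T'] assms(2,3)
      by (auto simp: rels_def intro!: zspan_base)
  next
    case (alternating xs)
    then show ?thesis
      using ext_gens.alternating[of "map g xs" L' T'] assms(2)
      by (auto simp: rels_def distinct_map intro!: zspan_base)
  next
    case (torsion us vs t)
    then show ?thesis
      using ext_gens.torsion[of "map g us" L' "map g vs" "g t" T'] assms(2,4)
      by (auto simp: rels_def intro!: zspan_base)
  qed
qed simp

text \<open>Each of the \<open>p\<close> entries is replaced by \<open>M\<close> times itself modulo
  \<open>T\<close> and contributes one factor \<open>M\<close>. This serves for \<open>M\<close>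
  times a projection along a vector of \<open>T\<close> and, with \<open>M = 1\<close>, for a choice
  of representatives modulo \<open>T\<close>.\<close>

lemma rels_pmap_scale:
  fixes M :: int and L :: "'a::real_vector set"
  assumes "v \<in> frags (lsts p L)" "add_closed L" "\<And>x. x \<in> L \<Longrightarrow> g x \<in> L"
    and "\<And>x. x \<in> L \<Longrightarrow> g x - of_int M *\<^sub>R x \<in> T"
  shows "pmap g v - frag_cmul (M ^ p) v \<in> rels L T"
  using assms(1)
proof (induction rule: frags_induct)
  case (of s)
  then show ?case
  proof (induction p arbitrary: s)
    case (Suc p)
    then obtain x xs where s: "s = x # xs" "x \<in> L" "xs \<in> lsts p L"
      by (cases s) (auto simp: lsts_def)
    let ?v = "frag_of xs"
    have v: "?v \<in> flists L" "pmap g ?v \<in> flists L"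
      using s by (auto simp: lsts_def intro!: assms(3))
    have 1: "wdg (of_int M *\<^sub>R x) (pmap g ?v - frag_cmul (M ^ p) ?v) \<in> rels L T"
      by (rule rels_wdg[OF Suc(1)]) (use s assms add_closed_int in auto)
    have 2: "wdg (of_int M *\<^sub>R x) (pmap g ?v) - wdg (g x) (pmap g ?v) \<in> rels L T"
    proof -
      have "wdg (g x - of_int M *\<^sub>R x) (pmap g ?v) \<in> rels L T"
        by (rule rels_wdg_torsion) (use v assms s in auto)
      moreover have "wdg (g x - of_int M *\<^sub>R x) (pmap g ?v) - (wdg (g x) (pmap g ?v) - wdg (of_int M *\<^sub>R x) (pmap g ?v)) \<in> rels L T"
        by (rule rels_wdg_diff) (use v assms s add_closed_int in auto)
      ultimately show ?thesis
        using rels_diff by fastforce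
    qed
    have 3: "wdg (of_int M *\<^sub>R x) (frag_cmul (M ^ p) ?v) - frag_cmul M (wdg x (frag_cmul (M ^ p) ?v)) \<in> rels L T"
      by (rule rels_wdg_scale) (use v assms s in \<open>auto intro: frags_cmul\<close>)
    have 4: "wdg (g x) (pmap g ?v) - wdg (of_int M *\<^sub>R x) (frag_cmul (M ^ p) ?v) \<in> rels L T"
      using rels_diff[OF 1 2] by simp
    have "wdg (g x) (pmap g ?v) - frag_cmul M (wdg x (frag_cmul (M ^ p) ?v)) \<in> rels L T"
      by (rule rels_trans[OF 4 3])
    then show ?case
      using s by simp
  qed (auto simp: lsts_def)
next
  case (diff v w)
  have "pmap g (v - w) - frag_cmul (M ^ p) (v - w)
     = (pmap g v - frag_cmul (M ^ p) v) - (pmap g w - frag_cmul (M ^ p) w)"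
    by simp
  then show ?case
    using diff by (simp only: rels_diff)
qed auto

section \<open>Contraction with a linear form\<close>

text \<open>The antiderivation determined by \<open>l\<close>: the alternating sum over the
  positions of a tuple of the value of \<open>l\<close> there times the tuple with that entry
  removed.\<close>

fun contr_list :: "('a \<Rightarrow> int) \<Rightarrow> 'a list \<Rightarrow> ('a list \<Rightarrow>\<^sub>0 int)" where
  "contr_list l [] = 0"
| "contr_list l (x # xs) = frag_cmul (l x) (frag_of xs) - wdg x (contr_list l xs)"

definition contr :: "('a \<Rightarrow> int) \<Rightarrow> ('a list \<Rightarrow>\<^sub>0 int) \<Rightarrow> ('a list \<Rightarrow>\<^sub>0 int)" where
  "contr l = frag_extend (contr_list l)"

lemma contr_of [simp]: "contr l (frag_of xs) = contr_list l xs"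
  by (simp add: contr_def)

lemma contr_simps [simp]:
  "contr l 0 = 0" "contr l (v - w) = contr l v - contr l w" "contr l (v + w) = contr l v + contr l w"
  "contr l (- v) = - contr l v" "contr l (frag_cmul k v) = frag_cmul k (contr l v)"
  by (simp_all add: contr_def frag_extend_diff frag_extend_add frag_extend_minus frag_extend_cmul)

lemma contr_wdg: "contr l (wdg x v) = frag_cmul (l x) v - wdg x (contr l v)"
  by (rule frags_induct[of v UNIV]) auto

lemma contr_lists:
  assumes "v \<in> frags (lsts (Suc p) L)"
  shows "contr l v \<in> frags (lsts p L)"
  unfolding contr_def
proof (rule frags_extend[OF assms])
  show "contr_list l s \<in> frags (lsts p L)" if "s \<in> lsts (Suc p) L" for s
    using that
  proof (induction s arbitrary: p)
    case (Cons x s)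
    show ?case
    proof (cases p)
      case 0
      then show ?thesis using Cons by (auto simp: lsts_def intro: frags_cmul)
    next
      case (Suc q)
      have "contr_list l s \<in> frags (lsts q L)"
        using Cons Suc by (auto simp: lsts_def)
      then have "wdg x (contr_list l s) \<in> frags (lsts p L)"
        unfolding wdg_def by (rule frags_extend) (use Cons Suc in \<open>auto simp: lsts_def\<close>)
      then show ?thesis
        using Cons by (auto simp: lsts_def intro!: frags_cmul frags_diff)
    qed
  qed (simp add: lsts_def)
qed

lemma contr_flists:
  assumes "v \<in> flists L"
  shows "contr l v \<in> flists L"
  unfolding contr_def
proof (rule frags_extend[OF assms])
  show "contr_list l s \<in> flists L" if "s \<in> lists L" for s
    using that by (induction s) (auto intro!: frags_diff frags_cmul flists_wdg)
qed

text \<open>The contraction of a tuple with head \<open>x\<close> is \<open>l x\<close> times its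
  tail minus \<open>x\<close> wedge the contracted tail. If \<open>x\<close> also occurs in the
  tail, both terms agree modulo relations, and this is why contraction respects the alternating
  relations. The induction moves \<open>x\<close> past the entries before its second
  occurrence.\<close>

lemma contr_list_repeat:
  assumes "set (vs @ ws) \<subseteq> L" "x \<in> L" "add_closed L"
  shows "wdg x (contr_list l (vs @ x # ws)) - frag_cmul (l x) (frag_of (vs @ x # ws)) \<in> rels L T"
  using assms(1)
proof (induction vs)
  case Nil
  have "wdg x (wdg x (contr_list l ws)) \<in> rels L T"
    by (rule rels_wdg_twice) (use Nil assms contr_flists[of "frag_of ws" L l] in auto)
  then show ?case
    by (simp add: rels_uminus)
next
  case (Cons v vs)
  let ?w = "vs @ x # ws"
  have w: "frag_of ?w \<in> flists L" "contr_list l ?w \<in> flists L"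
    using Cons assms contr_flists[of "frag_of ?w" L l] by auto
  have 1: "frag_cmul (l v) (frag_of (x # ?w)) \<in> rels L T"
    by (intro rels_cmul) (auto simp: rels_def intro!: zspan_base ext_gens.alternating,
       use Cons assms in auto)
  have 2: "wdg x (wdg v (contr_list l ?w)) + wdg v (wdg x (contr_list l ?w)) \<in> rels L T"
    by (rule rels_wdg_swap) (use Cons assms w in auto)
  have 3: "wdg v (wdg x (contr_list l ?w) - frag_cmul (l x) (frag_of ?w)) \<in> rels L T"
    by (rule rels_wdg) (use Cons assms in auto)
  from rels_add[OF rels_diff[OF 1 2] 3] show ?case
    by simp
qed

text \<open>Contracting an entry of the prefix leaves a shorter relation, and keeping it leaves a
  wedge with a contracted relation; so each case is an induction on the prefix. At its end,
  additivity of \<open>l\<close> settles the linear relations, \<open>l = 0\<close> on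
  \<open>T\<close> the torsion relations, and \<open>contr_list_repeat\<close> the alternating
  ones.\<close>

lemma rels_contr:
  assumes "v \<in> rels L T" "add_closed L" "T \<subseteq> L"
    and l: "\<And>x y. x \<in> L \<Longrightarrow> y \<in> L \<Longrightarrow> l (x + y) = l x + l y" "\<And>t. t \<in> T \<Longrightarrow> l t = 0"
  shows "contr l v \<in> rels L T"
proof (rule rels_image[OF assms(1)])
  have cl: "contr_list l us \<in> flists L" if "set us \<subseteq> L" for us
    using contr_flists[of "frag_of us" L l] that by auto
  fix w assume w: "w \<in> ext_gens L T"
  then show "contr l w \<in> rels L T"
  proof cases
    case (linear us vs y z)
    show ?thesis
      unfolding linear(1) using linear(2)
    proof (induction us)
      case Nil
      have "wdg (y + z) (contr_list l vs) - wdg y (contr_list l vs) - wdg z (contr_list l vs) \<in> rels L T"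
        by (rule rels_wdg_add) (use linear cl in auto)
      then show ?case
        using rels_uminus l(1)[OF linear(4,5)] by (fastforce simp: frag_cmul_distrib algebra_simps)
    next
      case (Cons u us)
      have 1: "frag_cmul (l u) (frag_of (us @ [y + z] @ vs) - frag_of (us @ [y] @ vs) - frag_of (us @ [z] @ vs)) \<in> rels L T"
        using Cons linear by (intro rels_cmul) (auto simp: rels_def intro!: zspan_base ext_gens.linear[of us L vs, simplified])
      have 2: "wdg u (contr l (frag_of (us @ [y + z] @ vs) - frag_of (us @ [y] @ vs) - frag_of (us @ [z] @ vs))) \<in> rels L T"
        by (rule rels_wdg) (use Cons in auto)
      from rels_diff[OF 1 2] show ?case
        by (simp add: algebra_simps)
    qed
  next
    case (alternating xs)
    have "contr_list l xs \<in> rels L T"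
      using alternating(2,3)
    proof (induction xs)
      case (Cons x xs)
      show ?case
      proof (cases "distinct xs")
        case True
        then obtain us ws where xs: "xs = us @ x # ws"
          using Cons(3) by (meson distinct.simps(2) split_list)
        from rels_uminus[OF contr_list_repeat[of us ws L x l T]] show ?thesis
          using Cons assms by (simp add: xs)
      next
        case False
        then have "frag_of xs \<in> rels L T" "contr_list l xs \<in> rels L T"
          using Cons by (auto simp: rels_def intro!: zspan_base ext_gens.alternating)
        then show ?thesis
          using Cons by (auto intro!: rels_diff rels_cmul rels_wdg)
      qed
    qed simp
    then show ?thesis
      using alternating by simp
  next
    case (torsion us vs t)
    have "contr_list l (us @ [t] @ vs) \<in> rels L T"
      using torsion(2)
    proof (induction us)
      case Nil
      have "wdg t (contr_list l vs) \<in> rels L T"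
        by (rule rels_wdg_torsion) (use torsion cl in auto)
      then show ?case
        using torsion l(2) by (simp add: rels_uminus)
    next
      case (Cons u us)
      have "frag_of (us @ [t] @ vs) \<in> rels L T"
        using torsion Cons by (simp add: rels_def zspan_base ext_gens.torsion[of us L vs, simplified])
      then show ?case
        using Cons by (auto intro!: rels_diff rels_cmul rels_wdg)
    qed
    then show ?thesis
      using torsion by simp
  qed
qed simp

text \<open>All generators consist of nonempty tuples, so nothing is identified in degree 0. A full
  contraction of an element therefore yields a well-defined integer.\<close>

lemma rels_lookup_Nil:
  assumes "v \<in> rels L T"
  shows "Poly_Mapping.lookup v [] = 0"
proof -
  have "v \<in> {v. Poly_Mapping.lookup v [] = 0}"
    by (rule zspan_minimal[OF assms[unfolded rels_def]])
       (auto elim!: ext_gens.cases simp: lookup_minus)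
  then show ?thesis by simp
qed

section \<open>A combinatorial model of the two complexes\<close>

lemma sum_antisym_eq_0:
  fixes f :: "'b \<Rightarrow> 'b \<Rightarrow> int"
  assumes "finite S" "\<And>b c. b \<in> S \<Longrightarrow> c \<in> S \<Longrightarrow> b \<noteq> c \<Longrightarrow> f b c = - f c b"
  shows "(\<Sum>b\<in>S. \<Sum>c\<in>S - {b}. f b c) = 0"
proof -
  define g where "g b c = (if b = c then 0 else f b c)" for b c
  have g: "(\<Sum>c\<in>S - {b}. f b c) = (\<Sum>c\<in>S. g b c)" if "b \<in> S" for b
    using assms(1) that by (intro sum.mono_neutral_cong_left) (auto simp: g_def)
  have "g b c = - g c b" if "b \<in> S" "c \<in> S" for b c
    using assms(2)[OF that] by (simp add: g_def)
  then have *: "(\<Sum>c\<in>S. \<Sum>b\<in>S. g b c) = (\<Sum>c\<in>S. \<Sum>b\<in>S. - g c b)"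
    by (intro sum.cong refl) blast
  have "(\<Sum>b\<in>S. \<Sum>c\<in>S. g b c) = (\<Sum>c\<in>S. \<Sum>b\<in>S. g b c)"
    by (rule sum.swap)
  also have "\<dots> = (\<Sum>c\<in>S. \<Sum>b\<in>S. - g c b)"
    by (rule *)
  finally have "(\<Sum>b\<in>S. \<Sum>c\<in>S. g b c) = 0"
    by (simp add: sum_negf)
  then show ?thesis using g by simp
qed

lemma rels_wdg_sum:
  fixes f :: "'b \<Rightarrow> 'a::real_vector"
  assumes "finite I" "add_closed L" "v \<in> flists L" "\<And>i. i \<in> I \<Longrightarrow> f i \<in> L"
  shows "wdg (\<Sum>i\<in>I. of_int (k i) *\<^sub>R f i) v - (\<Sum>i\<in>I. frag_cmul (k i) (wdg (f i) v)) \<in> rels L T"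
  using assms(1,4)
proof (induction I)
  case empty
  then show ?case using rels_wdg_zero[OF assms(2,3)] by simp
next
  case (insert i I)
  let ?s = "\<Sum>i\<in>I. of_int (k i) *\<^sub>R f i" and ?x = "of_int (k i) *\<^sub>R f i"
  have s: "?s \<in> L" "?x \<in> L"
    using insert assms(2) by (auto intro!: add_closed_sum add_closed_int)
  have 1: "wdg (?x + ?s) v - wdg ?x v - wdg ?s v \<in> rels L T"
    by (rule rels_wdg_add) (use assms s in auto)
  have 2: "wdg ?x v - frag_cmul (k i) (wdg (f i) v) \<in> rels L T"
    by (rule rels_wdg_scale) (use assms insert in auto)
  have 3: "wdg ?s v - (\<Sum>i\<in>I. frag_cmul (k i) (wdg (f i) v)) \<in> rels L T"
    using insert by auto
  from rels_add[OF rels_add[OF 1 2] 3] show ?case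
    using insert by (simp add: algebra_simps)
qed

section \<open>Simplicial complexes of lattice vectors with dual coordinates\<close>

text \<open>\<open>\<Delta>\<close> is to consist of the sets of primitive ray vectors of the cones,
  with \<open>idx\<close> ordering the rays. The form \<open>ell B b\<close> is \<open>M\<close>
  times the coordinate of \<open>b\<close> on the span of \<open>B\<close>, extended to the whole
  space so as to be integral on \<open>N\<close>; the extensions for different \<open>B\<close> are
  unrelated. A pair \<open>A \<subseteq> B\<close> stands for the face
  \<open>\<square>^A_B\<close>.\<close>

locale toric_model =
  fixes N :: "'a::real_vector set" and \<Delta> :: "'a set set" and idx :: "'a \<Rightarrow> nat"
    and M :: int and ell :: "'a set \<Rightarrow> 'a \<Rightarrow> 'a \<Rightarrow> real"
  assumes N: "add_closed N"
    and fin\<Delta>: "finite \<Delta>" and fin: "B \<in> \<Delta> \<Longrightarrow> finite B"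
    and down: "B \<in> \<Delta> \<Longrightarrow> A \<subseteq> B \<Longrightarrow> A \<in> \<Delta>"
    and \<Delta>N: "B \<in> \<Delta> \<Longrightarrow> B \<subseteq> N"
    and idx: "inj_on idx (\<Union>\<Delta>)"
    and M: "M \<ge> 1"
    and ell_linear: "B \<in> \<Delta> \<Longrightarrow> b \<in> B \<Longrightarrow> linear (ell B b)"
    and ell_int: "B \<in> \<Delta> \<Longrightarrow> b \<in> B \<Longrightarrow> x \<in> N \<Longrightarrow> ell B b x \<in> \<int>"
    and ell_self: "B \<in> \<Delta> \<Longrightarrow> b \<in> B \<Longrightarrow> ell B b b = of_int M"
    and ell_other: "B \<in> \<Delta> \<Longrightarrow> b \<in> B \<Longrightarrow> b' \<in> B \<Longrightarrow> b' \<noteq> b \<Longrightarrow> ell B b b' = 0"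
begin

abbreviation NL :: "'a set \<Rightarrow> 'a set" where
  "NL A \<equiv> cone_lattice N A"

lemma NL_closed: "add_closed (NL A)"
  using N by (auto simp: cone_lattice_def add_closed_def span_zero span_diff)

lemma NL_mono: "A \<subseteq> B \<Longrightarrow> NL A \<subseteq> NL B"
  using span_mono[of A B] by (auto simp: cone_lattice_def)

lemma NL_sub: "NL A \<subseteq> N"
  by (auto simp: cone_lattice_def)

lemma NL_base: "B \<in> \<Delta> \<Longrightarrow> b \<in> B \<Longrightarrow> b \<in> NL B"
  using \<Delta>N by (auto simp: cone_lattice_def span_base)

lemma ell_zero:
  assumes "B \<in> \<Delta>" "b \<in> B" "A \<subseteq> B - {b}" "x \<in> span A"
  shows "ell B b x = 0"
  by (rule linear_eq_0_on_span[OF ell_linear _ assms(4)]) (use assms ell_other in auto)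

lemma coords:
  assumes "B \<in> \<Delta>" "x \<in> span B"
  shows "of_int M *\<^sub>R x = (\<Sum>b\<in>B. ell B b x *\<^sub>R b)"
proof -
  have l: "linear (\<lambda>x. \<Sum>b\<in>B. ell B b x *\<^sub>R b)"
    using ell_linear[OF assms(1)]
    by (auto intro!: linearI sum.cong
        simp: linear_add linear_cmul sum.distrib[symmetric] scaleR_add_left[symmetric] scaleR_sum_right)
  have *: "(\<Sum>c\<in>B. ell B c b *\<^sub>R c) = of_int M *\<^sub>R b" if "b \<in> B" for b
  proof -
    have "(\<Sum>c\<in>B. ell B c b *\<^sub>R c) = (\<Sum>c\<in>{b}. ell B c b *\<^sub>R c)"
      using fin[OF assms(1)] that assms(1) ell_other by (intro sum.mono_neutral_right) auto
    then show ?thesis using ell_self[OF assms(1) that] by simp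
  qed
  have l': "linear (\<lambda>x. of_int M *\<^sub>R x - (\<Sum>b\<in>B. ell B b x *\<^sub>R b))"
    by (intro linear_compose_sub l) auto
  have "of_int M *\<^sub>R x - (\<Sum>b\<in>B. ell B b x *\<^sub>R b) = 0"
    by (rule linear_eq_0_on_span[OF l' _ assms(2)]) (use * in auto)
  then show ?thesis by simp
qed

lemma span_remove:
  assumes "B \<in> \<Delta>" "b \<in> B" "x \<in> span B" "ell B b x = 0"
  shows "x \<in> span (B - {b})"
proof -
  have "of_int M *\<^sub>R x = (\<Sum>c\<in>B - {b}. ell B c x *\<^sub>R c)"
    using coords[OF assms(1,3)] assms fin[OF assms(1)] by (simp add: sum.remove[of B b])
  also have "\<dots> \<in> span (B - {b})"
    by (intro span_sum span_scale span_base) auto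
  finally have "(1 / of_int M) *\<^sub>R (of_int M *\<^sub>R x) \<in> span (B - {b})"
    by (rule span_scale)
  then show ?thesis using M by simp
qed

text \<open>The floor only changes the type: on \<open>N\<close> the form already takes integral
  values.\<close>

definition li :: "'a set \<Rightarrow> 'a \<Rightarrow> 'a \<Rightarrow> int" where
  "li B b x = \<lfloor>ell B b x\<rfloor>"

lemma li: "B \<in> \<Delta> \<Longrightarrow> b \<in> B \<Longrightarrow> x \<in> N \<Longrightarrow> of_int (li B b x) = ell B b x"
  using ell_int by (simp add: li_def)

lemma li_add:
  assumes "B \<in> \<Delta>" "b \<in> B" "x \<in> N" "y \<in> N"
  shows "li B b (x + y) = li B b x + li B b y"
proof -
  have "real_of_int (li B b (x + y)) = of_int (li B b x + li B b y)"
    using assms li linear_add[OF ell_linear] add_closedD(4)[OF N] by simp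
  then show ?thesis by (simp only: of_int_eq_iff)
qed

lemma li_self: "B \<in> \<Delta> \<Longrightarrow> b \<in> B \<Longrightarrow> li B b b = M"
  by (simp add: li_def ell_self)

lemma li_other: "B \<in> \<Delta> \<Longrightarrow> b \<in> B \<Longrightarrow> b' \<in> B \<Longrightarrow> b' \<noteq> b \<Longrightarrow> li B b b' = 0"
  by (simp add: li_def ell_other)

lemma li_zero: "B \<in> \<Delta> \<Longrightarrow> b \<in> B \<Longrightarrow> A \<subseteq> B - {b} \<Longrightarrow> x \<in> NL A \<Longrightarrow> li B b x = 0"
  using ell_zero by (auto simp: li_def cone_lattice_def)

text \<open>\<open>M\<close> times the projection along \<open>b\<close>; it splits the quotient map by \<open>b\<close> up to the factor \<open>M\<close>.\<close>

definition sx :: "'a set \<Rightarrow> 'a \<Rightarrow> 'a \<Rightarrow> 'a" where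
  "sx B b x = of_int M *\<^sub>R x - ell B b x *\<^sub>R b"

lemma sx_add: "B \<in> \<Delta> \<Longrightarrow> b \<in> B \<Longrightarrow> sx B b (x + y) = sx B b x + sx B b y"
  using linear_add[OF ell_linear] by (simp add: sx_def algebra_simps)

lemma sx_NL:
  assumes "B \<in> \<Delta>" "b \<in> B" "b \<in> C" "x \<in> NL C"
  shows "sx B b x \<in> NL C"
proof -
  have "sx B b x = of_int M *\<^sub>R x - of_int (li B b x) *\<^sub>R b"
    using li[OF assms(1,2), of x] assms(4) NL_sub[of C] by (auto simp: sx_def)
  moreover have "b \<in> NL C"
    using assms \<Delta>N by (auto simp: cone_lattice_def span_base)
  ultimately show ?thesis
    using assms NL_closed by (auto intro!: add_closedD(2) add_closed_int)
qed

lemma sx_N: "B \<in> \<Delta> \<Longrightarrow> b \<in> B \<Longrightarrow> x \<in> N \<Longrightarrow> sx B b x \<in> N"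
  using sx_NL[of B b UNIV x] by (simp add: cone_lattice_def)

text \<open>Modulo the span of \<open>A\<close>, such an \<open>x\<close> is a multiple of
  \<open>b\<close>, and the form \<open>ell B b\<close> vanishes on the rest of \<open>A\<close>; so
  what \<open>sx\<close> subtracts is exactly \<open>M\<close> times this multiple. If
  \<open>b\<close> is already in \<open>A\<close> there is nothing to remove.\<close>

lemma sx_drop:
  assumes "B \<in> \<Delta>" "b \<in> B" "A \<subseteq> B" "x \<in> NL (insert b A)"
  shows "sx B b x \<in> NL A"
proof (cases "b \<in> A")
  case True
  then show ?thesis using sx_NL assms by (simp add: insert_absorb)
next
  case False
  obtain k where k: "x - k *\<^sub>R b \<in> span A"
    using assms(4) by (auto simp: cone_lattice_def span_breakdown_eq)
  then have "ell B b (x - k *\<^sub>R b) = 0"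
    by (intro ell_zero[of B b A]) (use assms False in auto)
  then have "ell B b x = k * of_int M"
    using ell_linear[OF assms(1,2)] ell_self[OF assms(1,2)] by (simp add: linear_diff linear_cmul)
  then have "sx B b x = of_int M *\<^sub>R (x - k *\<^sub>R b)"
    by (simp add: sx_def algebra_simps)
  then have "sx B b x \<in> span A"
    using k by (simp only: span_scale)
  then show ?thesis
    using sx_N[OF assms(1,2)] assms(4) by (auto simp: cone_lattice_def)
qed

section \<open>Representatives, relations and functionals at the faces\<close>

text \<open>Representatives for the elements of \<open>F_d\<close> at a face with upper cone
  \<open>B\<close>: the entries of one tuple lie in a common cone containing \<open>B\<close>, but
  different tuples may use different cones. The degree is an integer because \<open>p - q\<close>
  can be negative, in which case only 0 remains.\<close>

definition SS :: "int \<Rightarrow> 'a set \<Rightarrow> ('a list \<Rightarrow>\<^sub>0 int) set" where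
  "SS d B = frags {xs. int (length xs) = d \<and> (\<exists>C\<in>\<Delta>. B \<subseteq> C \<and> set xs \<subseteq> NL C)}"

definition RR :: "'a set \<Rightarrow> ('a list \<Rightarrow>\<^sub>0 int) set" where
  "RR A = rels N (NL A)"

lemma SS_closed [intro]:
  "0 \<in> SS d B" "v \<in> SS d B \<Longrightarrow> w \<in> SS d B \<Longrightarrow> v - w \<in> SS d B" "v \<in> SS d B \<Longrightarrow> w \<in> SS d B \<Longrightarrow> v + w \<in> SS d B"
  "v \<in> SS d B \<Longrightarrow> - v \<in> SS d B" "v \<in> SS d B \<Longrightarrow> frag_cmul k v \<in> SS d B"
  by (auto simp: SS_def intro: frags_diff frags_add frags_uminus frags_cmul)

lemma SS_sum: "(\<And>i. i \<in> I \<Longrightarrow> f i \<in> SS d B) \<Longrightarrow> sum f I \<in> SS d B"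
  by (induction I rule: infinite_finite_induct) auto

lemma SS_anti: "A \<subseteq> B \<Longrightarrow> v \<in> SS d B \<Longrightarrow> v \<in> SS d A"
  unfolding SS_def by (erule frags_mono[rotated]) auto

lemma RR_mono: "A \<subseteq> B \<Longrightarrow> v \<in> RR A \<Longrightarrow> v \<in> RR B"
  unfolding RR_def by (rule rels_mono) (use NL_mono in auto)

lemma SS_lsts: "v \<in> SS d B \<Longrightarrow> v \<in> frags (lsts (nat d) N)"
  unfolding SS_def by (erule frags_mono[rotated]) (use NL_sub in \<open>auto simp: lsts_def\<close>)

lemma SS_flists: "v \<in> SS d B \<Longrightarrow> v \<in> flists N"
  unfolding SS_def by (erule frags_mono[rotated]) (use NL_sub in auto)

lemma SS_wdg:
  assumes "v \<in> SS d B" "x \<in> NL B"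
  shows "wdg x v \<in> SS (d + 1) B"
  using assms(1) unfolding SS_def wdg_def
proof (rule frags_extend)
  fix xs assume "xs \<in> {xs. int (length xs) = d \<and> (\<exists>C\<in>\<Delta>. B \<subseteq> C \<and> set xs \<subseteq> NL C)}"
  then obtain C where "int (length xs) = d" "C \<in> \<Delta>" "B \<subseteq> C" "set xs \<subseteq> NL C"
    by auto
  then show "frag_of (x # xs) \<in> frags {xs. int (length xs) = d + 1 \<and> (\<exists>C\<in>\<Delta>. B \<subseteq> C \<and> set xs \<subseteq> NL C)}"
    using assms(2) NL_mono[of B C] by auto
qed

lemma SS_wdgs: "v \<in> SS d B \<Longrightarrow> set us \<subseteq> NL B \<Longrightarrow> wdgs us v \<in> SS (d + int (length us)) B"
proof (induction us)
  case (Cons u us)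
  then have "wdg u (wdgs us v) \<in> SS (d + int (length us) + 1) B"
    by (intro SS_wdg) auto
  then show ?case by (simp add: algebra_simps)
qed auto

lemma SS_sx:
  assumes "v \<in> SS d B" "B \<in> \<Delta>" "b \<in> B"
  shows "pmap (sx B b) v \<in> SS d B"
  using assms(1) unfolding SS_def pmap_def
proof (rule frags_extend)
  fix xs assume "xs \<in> {xs. int (length xs) = d \<and> (\<exists>C\<in>\<Delta>. B \<subseteq> C \<and> set xs \<subseteq> NL C)}"
  then obtain C where "int (length xs) = d" "C \<in> \<Delta>" "B \<subseteq> C" "set xs \<subseteq> NL C"
    by auto
  then show "frag_of (map (sx B b) xs) \<in> frags {xs. int (length xs) = d \<and> (\<exists>C\<in>\<Delta>. B \<subseteq> C \<and> set xs \<subseteq> NL C)}"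
    using assms sx_NL[OF assms(2,3)] by (auto intro!: bexI[of _ C])
qed

lemma RR_closed [intro]:
  "0 \<in> RR A" "v \<in> RR A \<Longrightarrow> w \<in> RR A \<Longrightarrow> v - w \<in> RR A" "v \<in> RR A \<Longrightarrow> w \<in> RR A \<Longrightarrow> v + w \<in> RR A"
  "v \<in> RR A \<Longrightarrow> - v \<in> RR A" "v \<in> RR A \<Longrightarrow> frag_cmul k v \<in> RR A"
  by (auto simp: RR_def intro: rels_diff rels_add rels_uminus rels_cmul)

lemma RR_sum: "(\<And>i. i \<in> I \<Longrightarrow> f i \<in> RR A) \<Longrightarrow> sum f I \<in> RR A"
  by (induction I rule: infinite_finite_induct) auto

lemma RR_sx:
  assumes "B \<in> \<Delta>" "b \<in> B" "A \<subseteq> B" "v \<in> RR (insert b A)"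
  shows "pmap (sx B b) v \<in> RR A"
  unfolding RR_def
  by (rule rels_pmap[OF assms(4)[unfolded RR_def]])
     (use assms sx_N sx_add sx_drop in auto)

lemma RR_sx_same:
  assumes "B \<in> \<Delta>" "b \<in> B" "A \<subseteq> B" "v \<in> RR A"
  shows "pmap (sx B b) v \<in> RR A"
  using RR_sx[OF assms(1-3)] RR_mono[OF _ assms(4)] by blast

text \<open>\<open>sx B b\<close> is \<open>M\<close> times the identity modulo \<open>b\<close>,
  hence modulo \<open>NL A\<close>, which gives one factor \<open>M\<close> per entry.\<close>

lemma RR_sx_scale:
  assumes "B \<in> \<Delta>" "b \<in> A" "A \<subseteq> B" "v \<in> SS (int n) B'"
  shows "frag_cmul (M ^ n) v - pmap (sx B b) v \<in> RR A"
proof -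
  have b: "b \<in> B" "b \<in> NL A" using assms NL_base[OF down[OF assms(1,3)]] by auto
  have "pmap (sx B b) v - frag_cmul (M ^ n) v \<in> rels N (NL A)"
  proof (rule rels_pmap_scale[OF _ N])
    show "v \<in> frags (lsts n N)" using SS_lsts[OF assms(4)] by simp
    fix x assume x: "x \<in> N"
    show "sx B b x \<in> N" using sx_N x assms b by auto
    have "sx B b x - of_int M *\<^sub>R x = of_int (- li B b x) *\<^sub>R b"
      using li[OF assms(1) b(1) x] by (simp add: sx_def)
    then show "sx B b x - of_int M *\<^sub>R x \<in> NL A"
      using add_closed_int[OF NL_closed b(2)] by metis
  qed
  then show ?thesis unfolding RR_def by (rule rels_sym)
qed

lemma SS_induct [consumes 1, case_names zero of diff]:
  assumes "v \<in> SS d B" "P 0"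
    "\<And>xs C. int (length xs) = d \<Longrightarrow> C \<in> \<Delta> \<Longrightarrow> B \<subseteq> C \<Longrightarrow> set xs \<subseteq> NL C \<Longrightarrow> P (frag_of xs)"
    "\<And>v w. v \<in> SS d B \<Longrightarrow> w \<in> SS d B \<Longrightarrow> P v \<Longrightarrow> P w \<Longrightarrow> P (v - w)"
  shows "P v"
proof -
  have "v \<in> SS d B \<and> P v"
    using assms(1) unfolding SS_def
  proof (induction rule: frags_induct)
    case (diff x y)
    then show ?case using assms(4)[of x y] frags_diff by (auto simp: SS_def)
  qed (use assms in auto)
  then show ?thesis by simp
qed

text \<open>A function on representatives that descends to \<open>F_d(\<square>^A_B)\<close>, in
  other words an element of \<open>F^d(\<square>^A_B)\<close>. Values outside \<open>SS d B\<close>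
  are unconstrained.\<close>

definition Fun :: "int \<Rightarrow> 'a set \<Rightarrow> 'a set \<Rightarrow> (('a list \<Rightarrow>\<^sub>0 int) \<Rightarrow> int) \<Rightarrow> bool" where
  "Fun d A B u \<longleftrightarrow> (\<forall>v\<in>SS d B. \<forall>w\<in>SS d B. u (v - w) = u v - u w) \<and> (\<forall>v\<in>SS d B \<inter> RR A. u v = 0)"

lemma FunI:
  assumes "\<And>v w. v \<in> SS d B \<Longrightarrow> w \<in> SS d B \<Longrightarrow> u (v - w) = u v - u w"
    and "\<And>v. v \<in> SS d B \<Longrightarrow> v \<in> RR A \<Longrightarrow> u v = 0"
  shows "Fun d A B u"
  using assms by (auto simp: Fun_def)

lemma Fun_diff: "Fun d A B u \<Longrightarrow> v \<in> SS d B \<Longrightarrow> w \<in> SS d B \<Longrightarrow> u (v - w) = u v - u w"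
  and Fun_rel: "Fun d A B u \<Longrightarrow> v \<in> SS d B \<Longrightarrow> v \<in> RR A \<Longrightarrow> u v = 0"
  by (auto simp: Fun_def)

lemma Fun_0: "Fun d A B u \<Longrightarrow> u 0 = 0"
  by (rule Fun_rel) auto

lemma Fun_uminus: "Fun d A B u \<Longrightarrow> v \<in> SS d B \<Longrightarrow> u (- v) = - u v"
  using Fun_diff[of d A B u 0 v] Fun_0[of d A B u] by auto

lemma Fun_add: "Fun d A B u \<Longrightarrow> v \<in> SS d B \<Longrightarrow> w \<in> SS d B \<Longrightarrow> u (v + w) = u v + u w"
  using Fun_diff[of d A B u v "- w"] Fun_uminus[of d A B u w] by auto

lemma Fun_cmul:
  assumes "Fun d A B u" "v \<in> SS d B"
  shows "u (frag_cmul k v) = k * u v"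
proof (induction k rule: int_induct[where k=0])
  case base
  then show ?case using Fun_0[OF assms(1)] by simp
next
  case (step1 i)
  then show ?case
    using Fun_add[OF assms(1), of "frag_cmul i v" v] assms(2)
    by (auto simp: frag_cmul_distrib algebra_simps)
next
  case (step2 i)
  then show ?case
    using Fun_diff[OF assms(1), of "frag_cmul i v" v] assms(2)
    by (auto simp: frag_cmul_diff_distrib algebra_simps)
qed

lemma Fun_sum:
  assumes "Fun d A B u" "\<And>i. i \<in> I \<Longrightarrow> f i \<in> SS d B"
  shows "u (sum f I) = (\<Sum>i\<in>I. u (f i))"
  using assms(2)
  by (induction I rule: infinite_finite_induct) (auto simp: Fun_0[OF assms(1)] Fun_add[OF assms(1)] SS_sum)

lemma Fun_cong: "Fun d A B u \<Longrightarrow> v \<in> SS d B \<Longrightarrow> w \<in> SS d B \<Longrightarrow> v - w \<in> RR A \<Longrightarrow> u v = u w"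
  using Fun_diff[of d A B u v w] Fun_rel[of d A B u "v - w"] by auto

text \<open>Pullback from a subface to a larger face does not change the function on
  representatives.\<close>

lemma Fun_mono:
  assumes "Fun d A B u" "A' \<subseteq> A" "B \<subseteq> B'"
  shows "Fun d A' B' u"
  by (rule FunI) (use assms SS_anti[OF assms(3)] RR_mono[OF assms(2)] in \<open>auto intro: Fun_diff Fun_rel\<close>)

lemma Fun_lin: "Fun d A B u \<Longrightarrow> Fun d A B u' \<Longrightarrow> Fun d A B (\<lambda>v. k * u v + k' * u' v)"
  by (rule FunI) (auto simp: Fun_diff[of d A B] Fun_rel[of d A B] algebra_simps)

lemma Fun_zero: "Fun d A B (\<lambda>v. 0)"
  by (auto simp: Fun_def)

lemma Fun_linear_combination:
  assumes "\<And>i. i \<in> I \<Longrightarrow> Fun d A B (u i)"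
  shows "Fun d A B (\<lambda>v. \<Sum>i\<in>I. k i * u i v)"
  by (rule FunI)
     (auto simp: Fun_diff[OF assms] Fun_rel[OF assms] sum_subtractf[symmetric] algebra_simps intro!: sum.cong)

section \<open>Orderings, signs and the cubical coboundary\<close>

text \<open>The sign of moving \<open>b\<close> to the front of the increasing list of
  \<open>S\<close>.\<close>

definition eps :: "'a \<Rightarrow> 'a set \<Rightarrow> int" where
  "eps b S = (-1) ^ card {c \<in> S. idx c < idx b}"

lemma eps_sq [simp]: "eps b S * eps b S = 1" and eps_sq' [simp]: "eps b S * (eps b S * k) = k"
  by (auto simp: eps_def power_mult_distrib[symmetric] mult.assoc[symmetric])

text \<open>Removing the earlier of two elements shifts the position of the later one by 1, while
  removing the later one does not affect the earlier.\<close>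

lemma eps_anti:
  assumes "finite S" "a \<in> S" "b \<in> S" "a \<noteq> b" "inj_on idx S"
  shows "eps a S * eps b (S - {a}) = - (eps b S * eps a (S - {b}))"
proof -
  have *: "eps a S * eps b (S - {a}) = - (eps b S * eps a (S - {b}))"
    if "a \<in> S" "b \<in> S" "idx a < idx b" for a b
  proof -
    have "{c \<in> S. idx c < idx b} = insert a {c \<in> S - {a}. idx c < idx b}"
      using that by auto
    then have "card {c \<in> S. idx c < idx b} = Suc (card {c \<in> S - {a}. idx c < idx b})"
      using assms(1) by simp
    moreover have "{c \<in> S - {b}. idx c < idx a} = {c \<in> S. idx c < idx a}"
      using that by auto
    ultimately show ?thesis by (simp add: eps_def)
  qed
  have "idx a < idx b \<or> idx b < idx a"
    using assms by (meson inj_onD linorder_neqE_nat)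
  then show ?thesis using *[of a b] *[of b a] assms by auto
qed

lemma inj_idx: "B \<in> \<Delta> \<Longrightarrow> S \<subseteq> B \<Longrightarrow> inj_on idx S"
  using idx by (rule inj_on_subset) auto

lemma finS: "B \<in> \<Delta> \<Longrightarrow> S \<subseteq> B \<Longrightarrow> finite S"
  using fin finite_subset by blast

text \<open>Fixes the order of the factors in \<open>e_B\<close>.\<close>

definition sl :: "'a set \<Rightarrow> 'a list" where
  "sl B = map (inv_into B idx) (sorted_list_of_set (idx ` B))"

lemma sl:
  assumes "B \<in> \<Delta>"
  shows "set (sl B) = B" "distinct (sl B)" "map idx (sl B) = sorted_list_of_set (idx ` B)" "length (sl B) = card B"
proof -
  note i = inj_idx[OF assms order_refl] and f = fin[OF assms]
  show 1: "map idx (sl B) = sorted_list_of_set (idx ` B)"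
    using f by (auto simp: sl_def f_inv_into_f intro!: map_idI)
  show "set (sl B) = B"
    using f i by (auto simp: sl_def)
  show "distinct (sl B)"
    using 1 by (metis distinct_map distinct_sorted_list_of_set)
  show "length (sl B) = card B"
    using i by (simp add: sl_def card_image)
qed

text \<open>In a sorted list the entries before \<open>b\<close> are those of smaller index, so
  \<open>eps\<close> is the sign of a position in \<open>sl B\<close>.\<close>

lemma sl_split:
  assumes "B \<in> \<Delta>" "b \<in> B"
  obtains us vs where "sl B = us @ b # vs" "sl (B - {b}) = us @ vs" "eps b B = (-1) ^ length us"
    "set us \<subseteq> B - {b}" "set vs \<subseteq> B - {b}"
proof -
  obtain us vs where uv: "sl B = us @ b # vs"
    using split_list[of b "sl B"] sl(1)[OF assms(1)] assms(2) by auto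
  note d = sl(2)[OF assms(1)]
  have st: "sorted_wrt (<) (map idx (sl B))"
    using sl(3)[OF assms(1)] by simp
  have set: "set us \<union> set vs = B - {b}"
    using sl(1,2)[OF assms(1)] uv by auto
  have B': "B - {b} \<in> \<Delta>" using assms down by blast
  have "map idx (sl (B - {b})) = map idx (us @ vs)"
  proof (rule strict_sorted_equal)
    show "sorted_wrt (<) (map idx (us @ vs))"
      using st by (auto simp: uv sorted_wrt_append)
    show "set (map idx (sl (B - {b}))) = set (map idx (us @ vs))"
      using set sl(1)[OF B'] by (simp add: image_Un[symmetric])
  qed (simp add: sl(3)[OF B'])
  then have 1: "sl (B - {b}) = us @ vs"
    by (rule map_inj_on) (use sl(1)[OF B'] set inj_idx[OF B' order_refl] in auto)
  have "{c \<in> B. idx c < idx b} = set us"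
    using st sl(1)[OF assms(1)] by (force simp: uv sorted_wrt_append)
  moreover have "card (set us) = length us"
    using d uv by (simp add: distinct_card)
  ultimately have "eps b B = (-1) ^ length us"
    by (simp add: eps_def)
  with uv 1 show thesis
    by (rule that) (use set in auto)
qed

text \<open>The coboundary of a cube with coordinates \<open>B - A\<close>: for each
  \<open>b\<close> the facets \<open>(A, B - {b})\<close> and \<open>(insert b A, B)\<close> are
  opposite and have opposite signs. No projection is written because both functionals accept the
  representative \<open>v\<close> itself.\<close>

definition dl :: "('a set \<Rightarrow> 'a set \<Rightarrow> ('a list \<Rightarrow>\<^sub>0 int) \<Rightarrow> int) \<Rightarrow> 'a set \<Rightarrow> 'a set \<Rightarrow> ('a list \<Rightarrow>\<^sub>0 int) \<Rightarrow> int" where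
  "dl u A B v = (\<Sum>b\<in>B - A. eps b (B - A) * (u A (B - {b}) v - u (insert b A) B v))"

definition cell :: "nat \<Rightarrow> 'a set \<Rightarrow> 'a set \<Rightarrow> bool" where
  "cell q A B \<longleftrightarrow> A \<subseteq> B \<and> B \<in> \<Delta> \<and> card (B - A) = q"

lemma cell_faces:
  assumes "cell (Suc q) A B" "b \<in> B - A"
  shows "cell q A (B - {b})" "cell q (insert b A) B"
proof -
  have "card (B - A) = Suc (card (B - A - {b}))"
    using assms fin by (intro card.remove) (auto simp: cell_def)
  moreover have "B - {b} - A = B - A - {b}" "B - insert b A = B - A - {b}"
    by auto
  ultimately show "cell q A (B - {b})" "cell q (insert b A) B"
    using assms down[of B "B - {b}"] by (auto simp: cell_def)
qed

definition Fam :: "int \<Rightarrow> nat \<Rightarrow> ('a set \<Rightarrow> 'a set \<Rightarrow> ('a list \<Rightarrow>\<^sub>0 int) \<Rightarrow> int) \<Rightarrow> bool" where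
  "Fam d q u \<longleftrightarrow> (\<forall>A B. cell q A B \<longrightarrow> Fun d A B (u A B))"

lemma Fam_dl:
  assumes "Fam d q u"
  shows "Fam d (Suc q) (dl u)"
  unfolding Fam_def
proof (intro allI impI)
  fix A B assume AB: "cell (Suc q) A B"
  have "Fun d A B (\<lambda>v. \<Sum>b\<in>B - A. eps b (B - A) * (1 * u A (B - {b}) v + (-1) * u (insert b A) B v))"
  proof (intro Fun_linear_combination Fun_lin)
    fix b assume b: "b \<in> B - A"
    have "Fun d A (B - {b}) (u A (B - {b}))" "Fun d (insert b A) B (u (insert b A) B)"
      using assms cell_faces[OF AB b] by (auto simp: Fam_def)
    then show "Fun d A B (u A (B - {b}))" "Fun d A B (u (insert b A) B)"
      by (auto elim: Fun_mono)
  qed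
  then show "Fun d A B (dl u A B)"
    by (simp add: dl_def[abs_def])
qed

text \<open>Changing the two coordinates \<open>b\<close> and \<open>c\<close> gives a value
  symmetric in them, whereas the product of the signs is antisymmetric by
  \<open>eps_anti\<close>.\<close>

lemma dl_dl:
  assumes "A \<subseteq> B" "B \<in> \<Delta>"
  shows "dl (dl u) A B v = 0"
proof -
  let ?S = "B - A"
  define g where "g b c = u A (B - {b} - {c}) v - u (insert c A) (B - {b}) v - u (insert b A) (B - {c}) v
     + u (insert c (insert b A)) B v" for b c
  have e: "B - {b} - A = ?S - {b}" "B - insert b A = ?S - {b}" for b
    by auto
  have "dl (dl u) A B v = (\<Sum>b\<in>?S. \<Sum>c\<in>?S - {b}. eps b ?S * eps c (?S - {b}) * g b c)"
    unfolding dl_def e sum_subtractf[symmetric] sum_distrib_left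
    by (intro sum.cong refl) (simp add: g_def algebra_simps)
  also have "\<dots> = 0"
  proof (rule sum_antisym_eq_0)
    show "finite ?S" using assms fin by auto
    fix b c assume bc: "b \<in> ?S" "c \<in> ?S" "b \<noteq> c"
    have "g b c = g c b"
      by (simp add: g_def insert_commute Diff_insert2[symmetric] Diff_insert[symmetric])
    moreover have "eps b ?S * eps c (?S - {b}) = - (eps c ?S * eps b (?S - {c}))"
      by (rule eps_anti) (use bc assms finS inj_idx in auto)
    ultimately show "eps b ?S * eps c (?S - {b}) * g b c = - (eps c ?S * eps b (?S - {c}) * g c b)"
      by simp
  qed
  finally show ?thesis .
qed

lemma dl_lin: "dl (\<lambda>A B v. k * u A B v + k' * u' A B v) A B v = k * dl u A B v + k' * dl u' A B v"
  unfolding dl_def sum_distrib_left sum.distrib[symmetric]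
  by (rule sum.cong) (simp_all add: algebra_simps)

end

section \<open>Contracting the cube of a fixed cone\<close>

context toric_model
begin

text \<open>The product of the operators \<open>M ^ n - pmap (sx B c)\<close>. In degree
  \<open>n\<close> each of them vanishes modulo \<open>c\<close>, so the product isolates the part
  of an element that involves every vector of \<open>cs\<close>.\<close>

fun Qs :: "'a set \<Rightarrow> nat \<Rightarrow> 'a list \<Rightarrow> ('a list \<Rightarrow>\<^sub>0 int) \<Rightarrow> ('a list \<Rightarrow>\<^sub>0 int)" where
  "Qs B n [] v = v"
| "Qs B n (c # cs) v = frag_cmul (M ^ n) (Qs B n cs v) - pmap (sx B c) (Qs B n cs v)"

text \<open>Together with \<open>Qs\<close>, the operators \<open>HW\<close> telescope: \<open>\<Sum>\<^sub>b HW b + Qs = M\<^sup>n\<^sup>|\<^sup>B\<^sup>|\<close>.\<close>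

fun HW :: "'a set \<Rightarrow> nat \<Rightarrow> 'a list \<Rightarrow> 'a \<Rightarrow> ('a list \<Rightarrow>\<^sub>0 int) \<Rightarrow> ('a list \<Rightarrow>\<^sub>0 int)" where
  "HW B n [] b v = 0"
| "HW B n (c # cs) b v =
     (if b = c then pmap (sx B c) (Qs B n cs v) else frag_cmul (M ^ n) (HW B n cs b v))"

lemma Qs_diff [simp]: "Qs B n cs (v - w) = Qs B n cs v - Qs B n cs w"
  by (induction cs) auto

lemma HW_diff [simp]: "HW B n cs b (v - w) = HW B n cs b v - HW B n cs b w"
  by (induction cs) auto

lemma HW_sum: "distinct cs \<Longrightarrow> (\<Sum>b\<in>set cs. HW B n cs b v) + Qs B n cs v = frag_cmul (M ^ (n * length cs)) v"
proof (induction cs)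
  case (Cons c cs)
  have "(\<Sum>b\<in>set cs. HW B n (c # cs) b v) = frag_cmul (M ^ n) (\<Sum>b\<in>set cs. HW B n cs b v)"
    using Cons by (auto simp: frag_cmul_sum intro!: sum.cong)
  then have "(\<Sum>b\<in>set (c # cs). HW B n (c # cs) b v) + Qs B n (c # cs) v
      = frag_cmul (M ^ n) ((\<Sum>b\<in>set cs. HW B n cs b v) + Qs B n cs v)"
    using Cons.prems by simp
  also have "\<dots> = frag_cmul (M ^ n) (frag_cmul (M ^ (n * length cs)) v)"
    by (subst Cons.IH) (use Cons.prems in auto)
  finally show ?case by (simp add: power_add)
qed simp

lemma SS_Qs: "v \<in> SS d B \<Longrightarrow> B \<in> \<Delta> \<Longrightarrow> set cs \<subseteq> B \<Longrightarrow> Qs B n cs v \<in> SS d B"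
  by (induction cs) (auto intro: SS_sx)

lemma SS_HW: "v \<in> SS d B \<Longrightarrow> B \<in> \<Delta> \<Longrightarrow> set cs \<subseteq> B \<Longrightarrow> HW B n cs b v \<in> SS d B"
  by (induction cs) (auto intro: SS_sx SS_Qs)

lemma RR_Qs: "v \<in> RR A \<Longrightarrow> B \<in> \<Delta> \<Longrightarrow> A \<subseteq> B \<Longrightarrow> set cs \<subseteq> B \<Longrightarrow> Qs B n cs v \<in> RR A"
  by (induction cs) (auto intro: RR_sx_same)

text \<open>\<open>HW b\<close> contains the factor \<open>pmap (sx B b)\<close>, which turns
  relations modulo \<open>b\<close> into relations without it, and all its other factors respect
  \<open>RR A\<close>. This makes it possible to use a functional at \<open>A - {b}\<close> for
  classes modulo \<open>A\<close>.\<close>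

lemma RR_HW:
  assumes "v \<in> RR A" "B \<in> \<Delta>" "A \<subseteq> B" "set cs \<subseteq> B" "b \<in> A"
  shows "HW B n cs b v \<in> RR (A - {b})"
  using assms(4)
proof (induction cs)
  case (Cons c cs)
  have "pmap (sx B c) (Qs B n cs v) \<in> RR (A - {b})" if "b = c"
    by (rule RR_sx) (use RR_Qs[OF assms(1-3)] that assms Cons in \<open>auto simp: insert_absorb\<close>)
  then show ?case using Cons by auto
qed auto

text \<open>The factor belonging to \<open>b\<close> vanishes modulo \<open>NL A\<close>, and the
  factors applied after it preserve \<open>RR A\<close>.\<close>

lemma Qs_kill:
  assumes "v \<in> SS (int n) B" "B \<in> \<Delta>" "A \<subseteq> B" "b \<in> A" "set cs \<subseteq> B" "b \<in> set cs"
  shows "Qs B n cs v \<in> RR A"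
  using assms(5,6)
proof (induction cs)
  case (Cons c cs)
  show ?case
  proof (cases "b = c")
    case True
    then show ?thesis
      using RR_sx_scale[OF assms(2,4,3) SS_Qs[OF assms(1,2)], of cs n] Cons by simp
  next
    case False
    then have "Qs B n cs v \<in> RR A" using Cons by auto
    then show ?thesis
      using RR_sx_same[OF assms(2) _ assms(3)] Cons by auto
  qed
qed auto

text \<open>The homotopy shrinks \<open>A\<close> by one vector \<open>i\<close>; the operator
  \<open>HW\<close> for \<open>i\<close> first makes the argument independent of representatives
  modulo \<open>i\<close>.\<close>

definition rh :: "nat \<Rightarrow> ('a set \<Rightarrow> 'a set \<Rightarrow> ('a list \<Rightarrow>\<^sub>0 int) \<Rightarrow> int) \<Rightarrow> 'a set \<Rightarrow> 'a set \<Rightarrow> ('a list \<Rightarrow>\<^sub>0 int) \<Rightarrow> int" where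
  "rh n u A B v = (\<Sum>i\<in>A. eps i (B - (A - {i})) * u (A - {i}) B (HW B n (sl B) i v))"

text \<open>The part of \<open>dl\<close> in which \<open>B\<close> stays fixed, with the opposite
  sign.\<close>

definition dv :: "('a set \<Rightarrow> 'a set \<Rightarrow> ('a list \<Rightarrow>\<^sub>0 int) \<Rightarrow> int) \<Rightarrow> 'a set \<Rightarrow> 'a set \<Rightarrow> ('a list \<Rightarrow>\<^sub>0 int) \<Rightarrow> int" where
  "dv u A B v = (\<Sum>b\<in>B - A. eps b (B - A) * u (insert b A) B v)"

text \<open>For a fixed cone \<open>B\<close> the part of the coboundary that varies \<open>A\<close> is the differential of a
  cube, contracted by \<open>rh\<close> up to \<open>Qs\<close>.\<close>

lemma row_homotopy:
  assumes "A \<subseteq> B" "B \<in> \<Delta>" "v \<in> SS (int n) B" "Fun (int n) A B (u A B)"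
  shows "dv (rh n u) A B v + rh n (dv u) A B v + u A B (Qs B n (sl B) v) = M ^ (n * card B) * u A B v"
proof -
  let ?W = "\<lambda>i. HW B n (sl B) i v"
  let ?S = "B - A"
  \<comment> \<open>The mixed terms of both compositions evaluate the same cell at the same
    argument, so they cancel one by one as soon as their signs are opposite; only the terms with
    \<open>i\<close> removed and put back remain.\<close>
  define X where "X i j = u (insert j (A - {i})) B (?W i)" for i j
  note f = finS[OF assms(2)]
  have fA: "finite A" "finite ?S" using f assms by auto
  have 1: "dv (rh n u) A B v = (\<Sum>j\<in>?S. u A B (?W j)
      + (\<Sum>i\<in>A. eps j ?S * eps i (B - (insert j A - {i})) * X i j))"
    unfolding dv_def
  proof (intro sum.cong refl)
    fix j assume j: "j \<in> ?S"
    have "B - (insert j A - {j}) = ?S" "insert j A - {j} = A" using j by auto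
    moreover have "u (insert j A - {i}) B (?W i) = X i j" if "i \<in> A" for i
      using j that by (auto simp: X_def insert_Diff_if)
    ultimately show "eps j ?S * rh n u (insert j A) B v = u A B (?W j)
      + (\<Sum>i\<in>A. eps j ?S * eps i (B - (insert j A - {i})) * X i j)"
      using j fA by (simp add: rh_def sum_distrib_left distrib_left mult.assoc)
  qed
  have 2: "rh n (dv u) A B v = (\<Sum>i\<in>A. u A B (?W i)
      + (\<Sum>j\<in>?S. eps i (B - (A - {i})) * eps j (B - (A - {i})) * X i j))"
    unfolding rh_def
  proof (intro sum.cong refl)
    fix i assume i: "i \<in> A"
    then have e: "B - (A - {i}) = insert i ?S" "insert i (A - {i}) = A" "i \<notin> ?S"
      using assms by auto
    show "eps i (B - (A - {i})) * dv u (A - {i}) B (?W i) = u A B (?W i)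
      + (\<Sum>j\<in>?S. eps i (B - (A - {i})) * eps j (B - (A - {i})) * X i j)"
      unfolding dv_def e(1) using e fA
      by (simp add: sum_distrib_left distrib_left mult.assoc X_def)
  qed
  have 3: "eps j ?S * eps i (B - (insert j A - {i})) = - (eps i (B - (A - {i})) * eps j (B - (A - {i})))"
    if "i \<in> A" "j \<in> ?S" for i j
  proof -
    define T where "T = B - (A - {i})"
    have T: "?S = T - {i}" "B - (insert j A - {i}) = T - {j}" "i \<in> T" "j \<in> T" "i \<noteq> j" "T \<subseteq> B"
      using that assms by (auto simp: T_def)
    have a: "eps i T * eps j (T - {i}) = - (eps j T * eps i (T - {j}))"
      by (rule eps_anti) (use T f inj_idx assms in auto)
    have "eps j (T - {i}) = eps i T * (eps i T * eps j (T - {i}))"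
      by simp
    also have "\<dots> = - (eps i T * eps j T * eps i (T - {j}))"
      by (simp add: a)
    finally show ?thesis
      by (simp add: T(1,2) T_def[symmetric])
  qed
  have "dv (rh n u) A B v + rh n (dv u) A B v =
     (\<Sum>j\<in>?S. u A B (?W j)) + (\<Sum>i\<in>A. u A B (?W i))
     + ((\<Sum>j\<in>?S. \<Sum>i\<in>A. eps j ?S * eps i (B - (insert j A - {i})) * X i j)
       + (\<Sum>i\<in>A. \<Sum>j\<in>?S. eps i (B - (A - {i})) * eps j (B - (A - {i})) * X i j))"
    by (simp add: 1 2 sum.distrib)
  also have "(\<Sum>j\<in>?S. \<Sum>i\<in>A. eps j ?S * eps i (B - (insert j A - {i})) * X i j)
     = - (\<Sum>i\<in>A. \<Sum>j\<in>?S. eps i (B - (A - {i})) * eps j (B - (A - {i})) * X i j)"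
    by (subst sum.swap) (simp add: 3 sum_negf[symmetric])
  also have "(\<Sum>j\<in>?S. u A B (?W j)) + (\<Sum>i\<in>A. u A B (?W i)) = (\<Sum>i\<in>B. u A B (?W i))"
    using sum.subset_diff[of A B "\<lambda>i. u A B (?W i)"] assms f by simp
  also have "\<dots> = u A B (\<Sum>i\<in>B. ?W i)"
    by (rule Fun_sum[OF assms(4), symmetric]) (use SS_HW[OF assms(3,2)] sl(1)[OF assms(2)] in auto)
  also have "(\<Sum>i\<in>B. ?W i) = frag_cmul (M ^ (n * card B)) v - Qs B n (sl B) v"
    using HW_sum[OF sl(2)[OF assms(2)], of B n v] sl(1,4)[OF assms(2)] by (simp add: eq_diff_eq)
  also have "u A B (frag_cmul (M ^ (n * card B)) v - Qs B n (sl B) v)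
      = M ^ (n * card B) * u A B v - u A B (Qs B n (sl B) v)"
    using SS_Qs[OF assms(3,2), of "sl B" n] sl(1)[OF assms(2)] assms(3)
    by (subst Fun_diff[OF assms(4)]) (auto simp: Fun_cmul[OF assms(4)])
  finally show ?thesis by simp
qed


section \<open>The residual operator as a multiple of the wedge of the rays\<close>

lemma sx_wdg:
  assumes "B \<in> \<Delta>" "b \<in> B" "x \<in> N" "y \<in> flists N"
  shows "wdg (sx B b x) y - (frag_cmul M (wdg x y) - frag_cmul (li B b x) (wdg b y)) \<in> RR A"
proof -
  have b: "b \<in> N" using assms \<Delta>N by auto
  have e: "sx B b x = of_int M *\<^sub>R x - of_int (li B b x) *\<^sub>R b"
    using li assms by (simp add: sx_def)
  have 1: "wdg (sx B b x) y - (wdg (of_int M *\<^sub>R x) y - wdg (of_int (li B b x) *\<^sub>R b) y) \<in> RR A"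
    unfolding RR_def e by (rule rels_wdg_diff) (use assms b N in \<open>auto intro: add_closed_int\<close>)
  have 2: "wdg (of_int M *\<^sub>R x) y - frag_cmul M (wdg x y) \<in> RR A"
    "wdg (of_int (li B b x) *\<^sub>R b) y - frag_cmul (li B b x) (wdg b y) \<in> RR A"
    unfolding RR_def by (rule rels_wdg_scale; use assms b N in auto)+
  from RR_closed(3)[OF 1 RR_closed(2)[OF 2]] show ?thesis
    by (simp add: algebra_simps)
qed

text \<open>Expand the wedge of the factors \<open>M x - l(x) b\<close>. The term free of
  \<open>b\<close> is the tuple times a power of \<open>M\<close>; all others contain
  \<open>b\<close>, which can be brought to the front. The cofactor keeps its entries in
  \<open>NL C\<close>, so it is again a legitimate representative.\<close>

lemma sx_exterior_list:
  assumes "B \<in> \<Delta>" "b \<in> B" "b \<in> C" "set xs \<subseteq> NL C"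
  shows "\<exists>w\<in>frags {ys. Suc (length ys) = length xs \<and> set ys \<subseteq> NL C}.
    frag_cmul (M ^ length xs) (frag_of xs) - pmap (sx B b) (frag_of xs) - wdg b w \<in> RR {}"
  using assms(4)
proof (induction xs)
  case Nil
  then show ?case by (auto intro!: bexI[of _ 0])
next
  case (Cons x xs)
  let ?v = "frag_of xs" and ?k = "M ^ length xs" and ?l = "li B b x"
  define P where "P = pmap (sx B b) ?v"
  obtain w where w: "w \<in> frags {ys. Suc (length ys) = length xs \<and> set ys \<subseteq> NL C}"
    "frag_cmul ?k ?v - P - wdg b w \<in> RR {}"
    using Cons by (auto simp: P_def)
  define r where "r = frag_cmul ?k ?v - P - wdg b w"
  define y where "y = frag_cmul ?k ?v - wdg b w"
  \<comment> \<open>Read off from \<open>M x - l(x) b\<close> wedged with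
    \<open>M ^ k v - b \<and> w\<close>: the term with two factors \<open>b\<close> drops out, and
    moving \<open>b\<close> in front of \<open>x\<close> changes the sign.\<close>
  define w' where "w' = frag_cmul (?l * ?k) ?v - frag_cmul M (wdg x w)"
  have mem: "x \<in> N" "b \<in> N" "?v \<in> flists N"
    using Cons NL_sub[of C] assms \<Delta>N by auto
  have wN: "w \<in> flists N"
    using w(1) by (rule frags_mono[rotated]) (use NL_sub[of C] in auto)
  have yN: "y \<in> flists N"
    unfolding y_def by (intro frags_diff frags_cmul flists_wdg mem wN)
  have 1: "wdg (sx B b x) r \<in> RR {}"
    using w(2) unfolding RR_def r_def by (rule rels_wdg) (use sx_N assms mem in auto)
  have 2: "wdg (sx B b x) y - (frag_cmul M (wdg x y) - frag_cmul ?l (wdg b y)) \<in> RR {}"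
    by (rule sx_wdg) (use assms mem yN in auto)
  have 3: "frag_cmul M (wdg x (wdg b w) + wdg b (wdg x w)) \<in> RR {}"
    unfolding RR_def by (intro rels_cmul rels_wdg_swap wN mem N)
  have 4: "frag_cmul ?l (wdg b (wdg b w)) \<in> RR {}"
    unfolding RR_def by (intro rels_cmul rels_wdg_twice wN mem)
  have P: "P = y - r" by (simp add: y_def r_def)
  have "frag_cmul (M ^ length (x # xs)) (frag_of (x # xs)) - pmap (sx B b) (frag_of (x # xs)) - wdg b w'
     = wdg (sx B b x) r - (wdg (sx B b x) y - (frag_cmul M (wdg x y) - frag_cmul ?l (wdg b y)))
       + (frag_cmul M (wdg x (wdg b w) + wdg b (wdg x w)) - frag_cmul ?l (wdg b (wdg b w)))"
  proof -
    have "pmap (sx B b) (frag_of (x # xs)) = wdg (sx B b x) P"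
      by (simp add: P_def)
    then show ?thesis
      by (simp add: P w'_def y_def algebra_simps)
  qed
  also have "\<dots> \<in> RR {}"
    by (intro RR_closed(2,3) 1 2 3 4)
  finally have "frag_cmul (M ^ length (x # xs)) (frag_of (x # xs)) - pmap (sx B b) (frag_of (x # xs)) - wdg b w' \<in> RR {}" .
  moreover have "w' \<in> frags {ys. Suc (length ys) = length (x # xs) \<and> set ys \<subseteq> NL C}"
  proof -
    have "wdg x w \<in> frags {ys. Suc (length ys) = length (x # xs) \<and> set ys \<subseteq> NL C}"
      using w(1) unfolding wdg_def by (rule frags_extend) (use Cons in auto)
    then show ?thesis
      using Cons unfolding w'_def by (intro frags_diff frags_cmul) auto
  qed
  ultimately show ?case by blast
qed

lemma sx_exterior:
  assumes "B \<in> \<Delta>" "b \<in> B" "v \<in> SS d B"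
  shows "\<exists>w\<in>SS (d - 1) B. frag_cmul (M ^ nat d) v - pmap (sx B b) v - wdg b w \<in> RR {}"
  using assms(3)
proof (induction rule: SS_induct)
  case (of xs C)
  then obtain w where w: "w \<in> frags {ys. Suc (length ys) = length xs \<and> set ys \<subseteq> NL C}"
    "frag_cmul (M ^ length xs) (frag_of xs) - pmap (sx B b) (frag_of xs) - wdg b w \<in> RR {}"
    using sx_exterior_list[OF assms(1,2), of C xs] assms(2) by auto
  moreover have "w \<in> SS (d - 1) B"
    unfolding SS_def by (rule frags_mono[OF _ w(1)]) (use of in auto)
  moreover have "nat d = length xs"
    using of by auto
  ultimately show ?case by auto
next
  case (diff v w)
  then obtain v' w' where "v' \<in> SS (d - 1) B" "frag_cmul (M ^ nat d) v - pmap (sx B b) v - wdg b v' \<in> RR {}"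
     "w' \<in> SS (d - 1) B" "frag_cmul (M ^ nat d) w - pmap (sx B b) w - wdg b w' \<in> RR {}"
    by auto
  then have "v' - w' \<in> SS (d - 1) B"
    "(frag_cmul (M ^ nat d) v - pmap (sx B b) v - wdg b v') - (frag_cmul (M ^ nat d) w - pmap (sx B b) w - wdg b w') \<in> RR {}"
    by auto
  then show ?case
    by (intro bexI[of _ "v' - w'"]) (auto simp: algebra_simps)
qed (auto intro!: bexI[of _ 0])

lemma SS_negative: "v \<in> SS d B \<Longrightarrow> d < 0 \<Longrightarrow> v = 0"
  by (auto simp: SS_def frags_def)

lemma rels_wdgs_scale:
  assumes "v \<in> flists N" "set us \<subseteq> N"
  shows "wdgs (map (\<lambda>x. of_int k *\<^sub>R x) us) v - frag_cmul (k ^ length us) (wdgs us v) \<in> RR A"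
  using assms(2)
proof (induction us)
  case (Cons u us)
  let ?x = "wdgs (map (\<lambda>x. of_int k *\<^sub>R x) us) v"
  have f: "wdgs us v \<in> flists N" "?x \<in> flists N"
    using Cons N by (auto intro!: flists_wdgs assms add_closed_int)
  have 1: "wdg (of_int k *\<^sub>R u) ?x - frag_cmul k (wdg u ?x) \<in> RR A"
    unfolding RR_def by (rule rels_wdg_scale) (use N f Cons in auto)
  have 2: "frag_cmul k (wdg u (?x - frag_cmul (k ^ length us) (wdgs us v))) \<in> RR A"
    using Cons unfolding RR_def by (intro rels_cmul rels_wdg) auto
  from RR_closed(3)[OF 1 2] show ?case by simp
qed auto

text \<open>By \<open>sx_exterior\<close> each factor of \<open>Qs\<close> produces one wedge factor
  \<open>c\<close>. The factors \<open>cs\<close> obtained before are multiplied by \<open>M\<close>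
  under \<open>sx B c\<close>, because the coordinate of \<open>c\<close> vanishes on them. Hence
  \<open>M ^ length cs\<close> can be taken out, and \<open>sx_exterior\<close> is applied to the
  cofactor in its own, smaller degree.\<close>

lemma Qs_exterior:
  assumes "v \<in> SS (int n) B" "B \<in> \<Delta>" "distinct cs" "set cs \<subseteq> B"
  shows "\<exists>w\<in>SS (int n - int (length cs)) B. Qs B n cs v - wdgs cs w \<in> RR {}"
  using assms(3,4)
proof (induction cs)
  case Nil
  then show ?case using assms by (auto intro!: bexI[of _ v])
next
  case (Cons c cs)
  let ?X = "Qs B n cs v" and ?d = "int n - int (length cs)" and ?m = "M ^ length cs"
  let ?r = "(-1) ^ length cs :: int"
  obtain w where w: "w \<in> SS ?d B" "?X - wdgs cs w \<in> RR {}"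
    using Cons by auto
  have c: "c \<in> B" "set cs \<subseteq> N" "c \<in> N" using Cons \<Delta>N[OF assms(2)] by auto
  have 1: "Qs B n (c # cs) v - (frag_cmul (M ^ n) (wdgs cs w) - pmap (sx B c) (wdgs cs w)) \<in> RR {}"
  proof -
    have "frag_cmul (M ^ n) (?X - wdgs cs w) - pmap (sx B c) (?X - wdgs cs w) \<in> RR {}"
      by (rule RR_closed(2)[OF RR_closed(5)[OF w(2)] RR_sx_same[OF assms(2) c(1) empty_subsetI w(2)]])
    then show ?thesis by (simp add: algebra_simps)
  qed
  \<comment> \<open>With more factors than the degree the cofactor is 0. Otherwise
    \<open>M ^ n\<close> is the product of the power belonging to \<open>cs\<close> and the power
    belonging to the degree of the cofactor.\<close>
  show ?case
  proof (cases "?d < 0")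
    case True
    then have "w = 0" using SS_negative w by blast
    then show ?thesis using 1 by (auto intro!: bexI[of _ 0])
  next
    case False
    then have n: "M ^ n = ?m * M ^ nat ?d"
      by (simp add: power_add[symmetric] nat_diff_distrib)
    have "map (sx B c) cs = map (\<lambda>x. of_int M *\<^sub>R x) cs"
      using Cons c ell_other[OF assms(2) c(1)] by (auto simp: sx_def)
    then have "pmap (sx B c) (wdgs cs w) = wdgs (map (\<lambda>x. of_int M *\<^sub>R x) cs) (pmap (sx B c) w)"
      by (simp only: pmap_wdgs)
    then have 2: "pmap (sx B c) (wdgs cs w) - frag_cmul ?m (wdgs cs (pmap (sx B c) w)) \<in> RR {}"
      using rels_wdgs_scale[OF SS_flists[OF SS_sx[OF w(1) assms(2) c(1)]] c(2), of M "{}"] by simp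
    obtain w' where w': "w' \<in> SS (?d - 1) B"
      "frag_cmul (M ^ nat ?d) w - pmap (sx B c) w - wdg c w' \<in> RR {}"
      using sx_exterior[OF assms(2) c(1) w(1)] by auto
    have 3: "frag_cmul ?m (wdgs cs (frag_cmul (M ^ nat ?d) w - pmap (sx B c) w - wdg c w')) \<in> RR {}"
      using w'(2) c(2) unfolding RR_def by (intro rels_cmul rels_wdgs)
    have 4: "frag_cmul ?m (wdgs cs (wdg c w') - frag_cmul ?r (wdg c (wdgs cs w'))) \<in> RR {}"
      unfolding RR_def by (intro rels_cmul rels_wdgs_move N c SS_flists[OF w'(1)])
    let ?w = "frag_cmul (?m * ?r) w'"
    have "Qs B n (c # cs) v - wdgs (c # cs) ?w =
      (Qs B n (c # cs) v - (frag_cmul (M ^ n) (wdgs cs w) - pmap (sx B c) (wdgs cs w)))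
      - (pmap (sx B c) (wdgs cs w) - frag_cmul ?m (wdgs cs (pmap (sx B c) w)))
      + (frag_cmul ?m (wdgs cs (frag_cmul (M ^ nat ?d) w - pmap (sx B c) w - wdg c w'))
      + frag_cmul ?m (wdgs cs (wdg c w') - frag_cmul ?r (wdg c (wdgs cs w'))))"
      by (simp add: n del: Qs.simps)
    also have "\<dots> \<in> RR {}"
      by (intro RR_closed(2,3) 1 2 3 4)
    finally show ?thesis
      using w'(1) by (intro bexI[of _ ?w]) (auto simp: algebra_simps simp del: Qs.simps)
  qed
qed

section \<open>Acyclicity of the kernel\<close>

lemma drop_card:
  assumes "A \<subseteq> B" "B \<in> \<Delta>" "i \<in> A"
  shows "card (B - (A - {i})) = Suc (card (B - A))"
proof -
  have "B - (A - {i}) = insert i (B - A)" using assms by auto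
  then show ?thesis using assms fin by simp
qed

lemma rels_sl:
  assumes "B \<in> \<Delta>" "b \<in> B" "w \<in> SS d B'"
  shows "wdgs (sl B) w \<in> RR {b}"
  unfolding RR_def
  by (rule rels_wdgs_torsion[of _ _ _ b])
     (use assms SS_flists[OF assms(3)] sl(1)[OF assms(1)] \<Delta>N NL_base[OF down[OF assms(1), of "{b}"]] in auto)

lemma SS_sl:
  assumes "B \<in> \<Delta>" "w \<in> SS (d - int (card B)) B"
  shows "wdgs (sl B) w \<in> SS d B"
  using SS_wdgs[OF assms(2), of "sl B"] sl[OF assms(1)] NL_base[OF assms(1)] by auto

text \<open>One layer of the filtration by \<open>card B\<close>. Since \<open>u\<close> vanishes
  below \<open>m\<close>, at \<open>card B = m\<close> the cocycle condition involves only the cube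
  of \<open>B\<close>, and \<open>row_homotopy\<close> applies. Its residual term vanishes: for
  nonempty \<open>A\<close> by \<open>Qs_kill\<close>, and for \<open>A = {}\<close> because
  \<open>Qs\<close> gives a multiple of \<open>e_B\<close>, on which \<open>u\<close> is zero by
  assumption.\<close>

lemma acyclic_step:
  assumes u: "Fam (int p) q u"
    and cyc: "\<And>A B v. cell (Suc q) A B \<Longrightarrow> v \<in> SS (int p) B \<Longrightarrow> dl u A B v = 0"
    and ker: "\<And>B w. B \<in> \<Delta> \<Longrightarrow> card B = q \<Longrightarrow> w \<in> SS (int p - int q) B \<Longrightarrow> u {} B (wdgs (sl B) w) = 0"
    and van: "\<And>A B v. cell q A B \<Longrightarrow> card B < m \<Longrightarrow> v \<in> SS (int p) B \<Longrightarrow> u A B v = 0"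
  obtains h where "\<And>A B. A \<subseteq> B \<Longrightarrow> B \<in> \<Delta> \<Longrightarrow> Suc (card (B - A)) = q \<Longrightarrow> Fun (int p) A B (h A B)"
    "\<And>B v. h {} B v = 0"
    "\<And>A B v. cell q A B \<Longrightarrow> card B \<le> m \<Longrightarrow> v \<in> SS (int p) B \<Longrightarrow> M ^ (p * m) * u A B v = dl h A B v"
proof -
  \<comment> \<open>The sign compensates for \<open>dl\<close>, which subtracts the terms with
    enlarged \<open>A\<close>. The support in \<open>card B = m\<close> leaves the layers below
    untouched.\<close>
  define h where "h A B v = (if card B = m then - rh p u A B v else 0)" for A B v
  have 1: "Fun (int p) A B (h A B)" if AB: "A \<subseteq> B" "B \<in> \<Delta>" "Suc (card (B - A)) = q" for A B
  proof (cases "card B = m")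
    case True
    have "Fun (int p) A B (\<lambda>v. \<Sum>i\<in>A. (- eps i (B - (A - {i}))) * u (A - {i}) B (HW B p (sl B) i v))"
    proof (rule Fun_linear_combination)
      fix i assume i: "i \<in> A"
      have F: "Fun (int p) (A - {i}) B (u (A - {i}) B)"
        using u drop_card[OF AB(1,2) i] AB unfolding Fam_def cell_def by blast
      have s: "set (sl B) \<subseteq> B" using sl(1)[OF AB(2)] by simp
      show "Fun (int p) A B (\<lambda>v. u (A - {i}) B (HW B p (sl B) i v))"
        by (rule FunI)
           (use Fun_diff[OF F] Fun_rel[OF F] SS_HW[OF _ AB(2) s] RR_HW[OF _ AB(2,1) s i] in auto)
    qed
    then show ?thesis
      using True by (simp add: h_def[abs_def] rh_def sum_negf)
  next
    case False
    then show ?thesis by (simp add: h_def[abs_def] Fun_zero)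
  qed
  have 2: "h {} B v = 0" for B v
    by (simp add: h_def rh_def)
  have 3: "M ^ (p * m) * u A B v = dl h A B v"
    if AB: "cell q A B" and m: "card B \<le> m" and v: "v \<in> SS (int p) B" for A B v
  proof (cases "card B = m")
    case False
    have "h A (B - {b}) v = 0" "h (insert b A) B v = 0" for b
      using False m fin AB card_Diff1_le[of B b] by (auto simp: h_def cell_def)
    then show ?thesis
      using van[OF AB _ v] False m by (simp add: dl_def)
  next
    case True
    have AB': "A \<subseteq> B" "B \<in> \<Delta>" "card (B - A) = q" using AB by (auto simp: cell_def)
    note s = sl(1)[OF AB'(2)]
    have lt: "card (B - {b}) < m" if "b \<in> B" for b
      using True that fin[OF AB'(2)] card_Diff1_less by metis
    have F: "Fun (int p) A B (u A B)" using u AB by (auto simp: Fam_def)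
    have d: "dl h A B v = dv (rh p u) A B v"
      unfolding dl_def dv_def
      by (rule sum.cong) (use lt True in \<open>force simp: h_def\<close>)+
    \<comment> \<open>This is the cocycle condition of \<open>u\<close> on larger cells of the same
      cube; its terms with a smaller \<open>B\<close> lie in the layers where \<open>u\<close> is
      zero.\<close>
    have "rh p (dv u) A B v = 0"
      unfolding rh_def
    proof (intro sum.neutral ballI)
      fix i assume i: "i \<in> A"
      have c: "cell (Suc q) (A - {i}) B"
        using drop_card[OF AB'(1,2) i] AB' by (auto simp: cell_def)
      define w where "w = HW B p (sl B) i v"
      have w: "w \<in> SS (int p) B" unfolding w_def by (rule SS_HW[OF v AB'(2)]) (simp add: s)
      have "dl u (A - {i}) B w = - dv u (A - {i}) B w"
        unfolding dl_def dv_def sum_negf[symmetric]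
      proof (rule sum.cong)
        fix b assume b: "b \<in> B - (A - {i})"
        have "u (A - {i}) (B - {b}) w = 0"
          using cell_faces(1)[OF c b] lt b w by (intro van) (auto elim: SS_anti[rotated])
        then show "eps b (B - (A - {i})) * (u (A - {i}) (B - {b}) w - u (insert b (A - {i})) B w) =
          - (eps b (B - (A - {i})) * u (insert b (A - {i})) B w)"
          by simp
      qed simp
      then have "dv u (A - {i}) B w = 0"
        using cyc[OF c w] by simp
      then show "eps i (B - (A - {i})) * dv u (A - {i}) B (HW B p (sl B) i v) = 0"
        by (simp add: w_def)
    qed
    moreover have "u A B (Qs B p (sl B) v) = 0"
    proof (cases "A = {}")
      case False
      then obtain b where "b \<in> A" by auto
      then have "Qs B p (sl B) v \<in> RR A"
        using v AB' s by (intro Qs_kill[of _ _ _ _ b]) auto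
      then show ?thesis
        using F SS_Qs[OF v AB'(2), of "sl B"] s by (intro Fun_rel) auto
    next
      case True
      then have q: "card B = q" using AB' by simp
      obtain w where w: "w \<in> SS (int p - int q) B" "Qs B p (sl B) v - wdgs (sl B) w \<in> RR {}"
        using Qs_exterior[OF v AB'(2) sl(2)[OF AB'(2)]] s sl(4)[OF AB'(2)] q by auto
      have "u A B (Qs B p (sl B) v) = u A B (wdgs (sl B) w)"
        using F SS_Qs[OF v AB'(2), of "sl B"] s w True SS_sl[OF AB'(2), of w "int p"] q
        by (intro Fun_cong) auto
      then show ?thesis using ker[OF AB'(2) q w(1)] True by simp
    qed
    ultimately show ?thesis
      using row_homotopy[of A B v p u, OF AB'(1,2) v F] True d by simp
  qed
  show thesis by (rule that[of h]) (use 1 2 3 in auto)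
qed

text \<open>Induction over the layers, in which \<open>u\<close> is replaced by the error
  \<open>K u - dl h\<close>. The constant collects powers of \<open>M\<close>, so it is 1 if
  \<open>M\<close> is. The condition \<open>h {} B = 0\<close> puts the primitive into the kernel of
  the comparison map, and it ensures that the error is still zero on multiples of
  \<open>e_B\<close>.\<close>

theorem acyclic:
  assumes u: "Fam (int p) q u"
    and cyc: "\<And>A B v. cell (Suc q) A B \<Longrightarrow> v \<in> SS (int p) B \<Longrightarrow> dl u A B v = 0"
    and ker: "\<And>B w. B \<in> \<Delta> \<Longrightarrow> card B = q \<Longrightarrow> w \<in> SS (int p - int q) B \<Longrightarrow> u {} B (wdgs (sl B) w) = 0"
  obtains h K where "K \<ge> 1" "M = 1 \<Longrightarrow> K = 1"
    "\<And>A B. A \<subseteq> B \<Longrightarrow> B \<in> \<Delta> \<Longrightarrow> Suc (card (B - A)) = q \<Longrightarrow> Fun (int p) A B (h A B)"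
    "\<And>B v. h {} B v = 0"
    "\<And>A B v. cell q A B \<Longrightarrow> v \<in> SS (int p) B \<Longrightarrow> K * u A B v = dl h A B v"
proof -
  have "\<exists>h K. K \<ge> 1 \<and> (M = 1 \<longrightarrow> K = 1) \<and>
    (\<forall>A B. A \<subseteq> B \<longrightarrow> B \<in> \<Delta> \<longrightarrow> Suc (card (B - A)) = q \<longrightarrow> Fun (int p) A B (h A B)) \<and>
    (\<forall>B v. h {} B v = 0) \<and>
    (\<forall>A B v. cell q A B \<longrightarrow> card B < m \<longrightarrow> v \<in> SS (int p) B \<longrightarrow> K * u A B v = dl h A B v)" for m
  proof (induction m)
    case 0
    show ?case by (intro exI[of _ "\<lambda>_ _ _. 0"] exI[of _ 1]) (auto simp: Fun_zero)
  next
    case (Suc m)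
    then obtain h K where h: "K \<ge> 1" "M = 1 \<Longrightarrow> K = 1"
      "\<And>A B. A \<subseteq> B \<Longrightarrow> B \<in> \<Delta> \<Longrightarrow> Suc (card (B - A)) = q \<Longrightarrow> Fun (int p) A B (h A B)"
      "\<And>B v. h {} B v = 0"
      "\<And>A B v. cell q A B \<Longrightarrow> card B < m \<Longrightarrow> v \<in> SS (int p) B \<Longrightarrow> K * u A B v = dl h A B v"
      by blast
    define u1 where "u1 A B v = K * u A B v + (-1) * dl h A B v" for A B v
    have Fh: "Fam (int p) q (dl h)"
    proof (cases q)
      case 0
      have "dl h A B = (\<lambda>v. 0)" if "cell q A B" for A B
      proof -
        have e: "B - A = {}"
          using that 0 fin by (auto simp: cell_def)
        show ?thesis by (rule ext) (simp add: dl_def e del: Diff_eq_empty_iff)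
      qed
      then show ?thesis
        by (auto simp: Fam_def Fun_zero)
    next
      case (Suc q')
      then show ?thesis
        using h(3) Fam_dl[of "int p" q' h] by (auto simp: Fam_def cell_def)
    qed
    have u1: "Fam (int p) q u1"
      using u Fh unfolding Fam_def u1_def[abs_def] by (intro allI impI Fun_lin) auto
    obtain h1 where h1:
      "\<And>A B. A \<subseteq> B \<Longrightarrow> B \<in> \<Delta> \<Longrightarrow> Suc (card (B - A)) = q \<Longrightarrow> Fun (int p) A B (h1 A B)"
      "\<And>B v. h1 {} B v = 0"
      "\<And>A B v. cell q A B \<Longrightarrow> card B \<le> m \<Longrightarrow> v \<in> SS (int p) B \<Longrightarrow> M ^ (p * m) * u1 A B v = dl h1 A B v"
    proof (rule acyclic_step[OF u1, of m])
      show "dl u1 A B v = 0" if "cell (Suc q) A B" "v \<in> SS (int p) B" for A B v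
        unfolding u1_def[abs_def] dl_lin
        using cyc[OF that] dl_dl[of A B h v] that by (simp add: cell_def)
      show "u1 {} B (wdgs (sl B) w) = 0"
        if B: "B \<in> \<Delta>" "card B = q" and w: "w \<in> SS (int p - int q) B" for B w
      proof -
        \<comment> \<open>Both kinds of terms vanish: \<open>h\<close> is 0 at
          \<open>A = {}\<close>, and \<open>e_B\<close> is a relation modulo any of its factors
          \<open>b\<close>.\<close>
        have "dl h {} B (wdgs (sl B) w) = 0"
          unfolding dl_def
        proof (intro sum.neutral ballI)
          fix b assume b: "b \<in> B - {}"
          have "Suc (card (B - {b})) = q"
            using B b fin card_Suc_Diff1[of B b] by auto
          then have "Fun (int p) {b} B (h {b} B)" using h(3)[of "{b}" B] B b by auto
          moreover have "wdgs (sl B) w \<in> RR {b}" "wdgs (sl B) w \<in> SS (int p) B"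
            using rels_sl[OF B(1) _ w, of b] SS_sl[OF B(1), of w "int p"] B w b by auto
          ultimately have "h {b} B (wdgs (sl B) w) = 0"
            by (intro Fun_rel)
          then show "eps b (B - {}) * (h {} (B - {b}) (wdgs (sl B) w) - h {b} B (wdgs (sl B) w)) = 0"
            by (simp add: h(4))
        qed
        then show ?thesis using ker[OF B w] by (simp add: u1_def)
      qed
      show "u1 A B v = 0" if "cell q A B" "card B < m" "v \<in> SS (int p) B" for A B v
        using h(5)[OF that] by (simp add: u1_def)
    qed blast
    define h2 where "h2 A B v = M ^ (p * m) * h A B v + 1 * h1 A B v" for A B v
    show ?case
    proof (intro exI[of _ h2] exI[of _ "M ^ (p * m) * K"] conjI allI impI)
      show "1 \<le> M ^ (p * m) * K"
        using h(1) M one_le_power[of M "p * m"] mult_mono[of 1 "M ^ (p * m)" 1 K] by simp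
      show "M = 1 \<Longrightarrow> M ^ (p * m) * K = 1" using h(2) by simp
      show "Fun (int p) A B (h2 A B)" if "A \<subseteq> B" "B \<in> \<Delta>" "Suc (card (B - A)) = q" for A B
        unfolding h2_def[abs_def] by (intro Fun_lin h(3) h1(1) that)
      show "h2 {} B v = 0" for B v by (simp add: h2_def h(4) h1(2))
      show "M ^ (p * m) * K * u A B v = dl h2 A B v"
        if "cell q A B" "card B < Suc m" "v \<in> SS (int p) B" for A B v
        using h1(3)[of A B v] that unfolding h2_def[abs_def] dl_lin
        by (simp add: u1_def algebra_simps)
    qed
  qed
  \<comment> \<open>No cone has more rays than there are in total, so at this stage every cell is
    covered.\<close>
  from this[of "Suc (card (\<Union>\<Delta>))"] obtain h K where h: "K \<ge> 1" "M = 1 \<Longrightarrow> K = 1"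
    "\<And>A B. A \<subseteq> B \<Longrightarrow> B \<in> \<Delta> \<Longrightarrow> Suc (card (B - A)) = q \<Longrightarrow> Fun (int p) A B (h A B)"
    "\<And>B v. h {} B v = 0"
    "\<And>A B v. cell q A B \<Longrightarrow> card B < Suc (card (\<Union>\<Delta>)) \<Longrightarrow> v \<in> SS (int p) B \<Longrightarrow> K * u A B v = dl h A B v"
    by blast
  have "card B < Suc (card (\<Union>\<Delta>))" if "B \<in> \<Delta>" for B
    using card_mono[of "\<Union>\<Delta>" B] fin\<Delta> fin that by (auto simp: less_Suc_eq_le)
  then show thesis
    using that[of K h] h by (auto simp: cell_def)
qed

section \<open>Contraction as a section of the comparison map\<close>

text \<open>The head of the list is contracted first, and it is the outermost factor of
  \<open>wdgs cs v\<close>; therefore \<open>contrs_wdgs\<close> has no sign.\<close>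

fun contrs :: "'a set \<Rightarrow> 'a list \<Rightarrow> ('a list \<Rightarrow>\<^sub>0 int) \<Rightarrow> ('a list \<Rightarrow>\<^sub>0 int)" where
  "contrs B [] v = v"
| "contrs B (c # cs) v = contrs B cs (contr (li B c) v)"

lemma contrs_simps [simp]:
  "contrs B cs 0 = 0" "contrs B cs (v - w) = contrs B cs v - contrs B cs w"
  "contrs B cs (frag_cmul k v) = frag_cmul k (contrs B cs v)"
  by (induction cs arbitrary: v w) auto

lemma SS_contr:
  assumes "v \<in> SS d B"
  shows "contr l v \<in> SS (d - 1) B"
  using assms
proof (induction rule: SS_induct)
  case (of xs C)
  show ?case
  proof (cases xs)
    case (Cons y ys)
    have "contr l (frag_of xs) \<in> frags (lsts (length ys) (NL C))"
      by (rule contr_lists) (use of Cons in \<open>auto simp: lsts_def\<close>)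
    then show ?thesis
      unfolding SS_def by (rule frags_mono[rotated]) (use of Cons in \<open>auto simp: lsts_def\<close>)
  qed auto
qed auto

lemma SS_contrs: "v \<in> SS d B \<Longrightarrow> contrs B' cs v \<in> SS (d - int (length cs)) B"
proof (induction cs arbitrary: v d)
  case (Cons c cs)
  from Cons.IH[OF SS_contr[OF Cons.prems, of "li B' c"]] show ?case
    by (simp add: algebra_simps)
qed simp

lemma rels_contrs:
  assumes "B \<in> \<Delta>" "set cs \<subseteq> B - A" "A \<subseteq> B" "NL B \<subseteq> L" "L \<subseteq> N" "add_closed L"
  shows "v \<in> rels L (NL A) \<Longrightarrow> contrs B cs v \<in> rels L (NL A)"
  using assms(2)
proof (induction cs arbitrary: v)
  case (Cons c cs)
  have "contr (li B c) v \<in> rels L (NL A)"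
  proof (rule rels_contr)
    have c: "c \<in> B" "A \<subseteq> B - {c}" using Cons assms by auto
    show "li B c (x + y) = li B c x + li B c y" if "x \<in> L" "y \<in> L" for x y
      by (rule li_add[OF assms(1) c(1)]) (use that assms(5) in auto)
    show "li B c t = 0" if "t \<in> NL A" for t
      by (rule li_zero[OF assms(1) c that])
  qed (use Cons assms NL_mono[OF assms(3)] in auto)
  then show ?case using Cons by simp
qed simp

lemma contrs_wdg_other:
  assumes "B \<in> \<Delta>" "c \<in> B" "set cs \<subseteq> B - {c}"
  shows "\<exists>w. contrs B cs (wdg c v) = wdg c w \<and> (v \<in> flists N \<longrightarrow> w \<in> flists N)"
  using assms(3)
proof (induction cs arbitrary: v)
  case (Cons d cs)
  then have "contr (li B d) (wdg c v) = wdg c (- contr (li B d) v)"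
    using li_other[OF assms(1), of d c] assms by (auto simp: contr_wdg)
  then show ?case
    using Cons.IH[of "- contr (li B d) v"] Cons.prems contr_flists[of v N "li B d"]
    by (auto intro: frags_uminus)
qed auto

text \<open>Contracting \<open>c \<and> y\<close> with the coordinate of \<open>c\<close> gives
  \<open>M y\<close> minus a multiple of \<open>c\<close>. The remaining forms vanish at
  \<open>c\<close>, so the error stays a multiple of \<open>c\<close> and is a relation modulo the
  vectors of \<open>cs\<close>.\<close>

lemma contrs_wdgs:
  assumes "B \<in> \<Delta>" "distinct cs" "set cs \<subseteq> B" "v \<in> flists N"
  shows "contrs B cs (wdgs cs v) - frag_cmul (M ^ length cs) v \<in> RR (set cs)"
  using assms(2,3)
proof (induction cs)
  case (Cons c cs)
  let ?y = "wdgs cs v"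
  have c: "c \<in> B" "set cs \<subseteq> B - {c}" "set cs \<subseteq> N" using Cons \<Delta>N[OF assms(1)] by auto
  have y: "?y \<in> flists N" by (rule flists_wdgs) (use assms c in auto)
  obtain w where w: "contrs B cs (wdg c (contr (li B c) ?y)) = wdg c w" "w \<in> flists N"
    using contrs_wdg_other[OF assms(1) c(1,2), of "contr (li B c) ?y"] contr_flists[OF y] by auto
  have e: "contrs B (c # cs) (wdgs (c # cs) v) = frag_cmul M (contrs B cs ?y) - wdg c w"
    using li_self[OF assms(1) c(1)] w by (simp add: contr_wdg)
  have "wdg c w \<in> RR (set (c # cs))"
    unfolding RR_def
    by (rule rels_wdg_torsion) (use w NL_base[OF down[OF assms(1), of "set (c # cs)"]] Cons in auto)
  moreover have "frag_cmul M (contrs B cs ?y - frag_cmul (M ^ length cs) v) \<in> RR (set (c # cs))"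
    by (rule RR_closed(5), rule RR_mono[of "set cs"], use Cons in auto)
  ultimately have "frag_cmul M (contrs B cs ?y - frag_cmul (M ^ length cs) v) - wdg c w \<in> RR (set (c # cs))"
    by (rule RR_closed(2)[rotated])
  then show ?case unfolding e by (simp add: algebra_simps)
qed auto

text \<open>Contraction with all dual coordinates of \<open>B\<close> inverts the wedge with
  \<open>e_B\<close> up to \<open>M ^ q\<close>, and it respects the relations of \<open>N\<close>.
  So a functional at \<open>\<infinity>_\<sigma>\<close> is pulled back to one at the face
  \<open>({}, B)\<close>.\<close>

lemma surjective:
  assumes "B \<in> \<Delta>" "card B = q" "Fun (int p - int q) B B a"
  shows "Fun (int p) {} B (\<lambda>v. a (contrs B (sl B) v))"
    "w \<in> SS (int p - int q) B \<Longrightarrow> a (contrs B (sl B) (wdgs (sl B) w)) = M ^ q * a w"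
proof -
  note s = sl[OF assms(1)]
  have S: "contrs B (sl B) v \<in> SS (int p - int q) B" if "v \<in> SS (int p) B" for v
    using SS_contrs[OF that, of B "sl B"] s assms by simp
  have R: "contrs B (sl B) v \<in> RR B" if "v \<in> RR {}" for v
    using rels_contrs[OF assms(1), of "sl B" "{}" N v] that s NL_sub N RR_mono[of "{}" B]
    unfolding RR_def by auto
  show "Fun (int p) {} B (\<lambda>v. a (contrs B (sl B) v))"
    by (rule FunI) (use Fun_diff[OF assms(3)] Fun_rel[OF assms(3)] S R in auto)
  assume w: "w \<in> SS (int p - int q) B"
  have "contrs B (sl B) (wdgs (sl B) w) - frag_cmul (M ^ q) w \<in> RR B"
    using contrs_wdgs[OF assms(1) s(2) _ SS_flists[OF w]] s assms by simp
  then have "a (contrs B (sl B) (wdgs (sl B) w)) = a (frag_cmul (M ^ q) w)"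
    using S SS_sl[OF assms(1), of w "int p"] w assms by (intro Fun_cong[OF assms(3)]) auto
  then show "a (contrs B (sl B) (wdgs (sl B) w)) = M ^ q * a w"
    using Fun_cmul[OF assms(3) w] by simp
qed

section \<open>Values on multiples of the wedge of the rays\<close>

lemma wdgs_sl_split:
  assumes "B \<in> \<Delta>" "b \<in> B" "v \<in> flists L" "B \<subseteq> L" "add_closed L"
  shows "wdg b (wdgs (sl (B - {b})) v) - frag_cmul (eps b B) (wdgs (sl B) v) \<in> rels L T"
proof -
  obtain us vs where s: "sl B = us @ b # vs" "sl (B - {b}) = us @ vs" "eps b B = (-1) ^ length us"
    "set us \<subseteq> B - {b}" "set vs \<subseteq> B - {b}"
    using sl_split[OF assms(1,2)] by metis
  have "wdgs us (wdg b (wdgs vs v)) - frag_cmul ((-1) ^ length us) (wdg b (wdgs us (wdgs vs v))) \<in> rels L T"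
    by (intro rels_wdgs_move flists_wdgs) (use s assms in auto)
  then have "frag_cmul (- eps b B) (wdgs us (wdg b (wdgs vs v)) - frag_cmul (eps b B) (wdg b (wdgs us (wdgs vs v)))) \<in> rels L T"
    unfolding s(3) by (rule rels_cmul)
  then show ?thesis
    by (simp add: s(1,2) algebra_simps)
qed

text \<open>Only the faces \<open>({}, B - {b})\<close> contribute on \<open>e\<^sub>B \<and> w\<close>.\<close>

lemma dl_wdgs:
  assumes "Fam (int p) q u" "B \<in> \<Delta>" "card B = Suc q" "w \<in> SS (int p - int (Suc q)) B"
  shows "dl u {} B (wdgs (sl B) w) = (-1) ^ q * (\<Sum>b\<in>B. u {} (B - {b}) (wdgs (sl (B - {b})) (wdg b w)))"
  unfolding dl_def sum_distrib_left
proof (rule sum.cong)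
  fix b assume "b \<in> B"
  let ?B = "B - {b}"
  have b: "b \<in> B" "?B \<in> \<Delta>" "card ?B = q" "b \<in> N" "B \<subseteq> N"
    using \<open>b \<in> B\<close> assms down[OF assms(2)] \<Delta>N by auto
  have c: "cell q {} ?B" "cell q {b} B"
    using cell_faces[of q "{}" B b] assms b by (auto simp: cell_def)
  have F: "Fun (int p) {} ?B (u {} ?B)" "Fun (int p) {b} B (u {b} B)"
    using assms(1) c by (auto simp: Fam_def)
  note wN = SS_flists[OF assms(4)]
  have w': "wdg b w \<in> SS (int p - int q) B"
    using SS_wdg[OF assms(4) NL_base[OF assms(2) b(1)]] by (simp add: algebra_simps)
  have S1: "wdgs (sl B) w \<in> SS (int p) B"
    using SS_sl[OF assms(2), of w "int p"] assms by simp
  have S2: "wdgs (sl ?B) (wdg b w) \<in> SS (int p) ?B"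
    using SS_sl[OF b(2), of "wdg b w" "int p"] b SS_anti[OF _ w', of ?B] by auto
  have 0: "u {b} B (wdgs (sl B) w) = 0"
    by (rule Fun_rel[OF F(2) S1 rels_sl[OF assms(2) b(1) assms(4)]])
  have r1: "wdg b (wdgs (sl ?B) w) - frag_cmul (eps b B) (wdgs (sl B) w) \<in> RR {}"
    unfolding RR_def by (rule wdgs_sl_split) (use assms b wN N in auto)
  \<comment> \<open>Here \<open>b\<close> passes the \<open>q\<close> factors of the facet; this is
    the origin of the sign in the formula.\<close>
  have r2: "wdgs (sl ?B) (wdg b w) - frag_cmul ((-1) ^ q) (wdg b (wdgs (sl ?B) w)) \<in> RR {}"
    using rels_wdgs_move[OF wN, of "sl ?B" b "NL {}"] sl[OF b(2)] b N unfolding RR_def by auto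
  have "frag_cmul ((-1) ^ q) (wdgs (sl ?B) (wdg b w)) - frag_cmul (eps b B) (wdgs (sl B) w) \<in> RR {}"
    using RR_closed(3)[OF r1 RR_closed(5)[OF r2, of "(-1) ^ q"]]
    by (simp add: power_mult_distrib[symmetric])
  then have "u {} ?B (frag_cmul ((-1) ^ q) (wdgs (sl ?B) (wdg b w))) = u {} ?B (frag_cmul (eps b B) (wdgs (sl B) w))"
    using S1 S2 SS_anti[of ?B B] by (intro Fun_cong[OF F(1)]) auto
  then have "(-1) ^ q * u {} ?B (wdgs (sl ?B) (wdg b w)) = eps b B * u {} ?B (wdgs (sl B) w)"
    using Fun_cmul[OF F(1)] S1 S2 SS_anti[of ?B B] by auto
  then show "eps b (B - {}) * (u {} (B - {b}) (wdgs (sl B) w) - u {b} B (wdgs (sl B) w)) =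
    (-1) ^ q * u {} (B - {b}) (wdgs (sl (B - {b})) (wdg b w))"
    by (simp add: 0)
qed simp

text \<open>\<open>M t\<close> is an integral combination of the vectors of \<open>A\<close>, and
  each of these is already a factor of \<open>e_A\<close>. The coordinates of \<open>t\<close>
  itself need not be integral.\<close>

lemma wdgs_sl_torsion:
  assumes "A \<in> \<Delta>" "t \<in> NL A" "w \<in> flists N"
  shows "frag_cmul M (wdgs (sl A) (wdg t w)) \<in> RR {}"
proof -
  have A: "A \<subseteq> N" "t \<in> N" "t \<in> span A" using assms \<Delta>N by (auto simp: cone_lattice_def)
  note s = sl[OF assms(1)]
  have "of_int M *\<^sub>R t = (\<Sum>b\<in>A. of_int (li A b t) *\<^sub>R b)"
    using coords[OF assms(1) A(3)] li[OF assms(1)] A by (auto intro!: sum.cong)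
  then have 1: "wdg (of_int M *\<^sub>R t) w - (\<Sum>b\<in>A. frag_cmul (li A b t) (wdg b w)) \<in> RR {}"
    unfolding RR_def using rels_wdg_sum[OF fin[OF assms(1)] N assms(3), of "\<lambda>b. b" "\<lambda>b. li A b t" "NL {}"] A by auto
  have 2: "wdg (of_int M *\<^sub>R t) w - frag_cmul M (wdg t w) \<in> RR {}"
    unfolding RR_def by (rule rels_wdg_scale) (use N A assms in auto)
  have 3: "wdgs (sl A) (frag_cmul M (wdg t w) - (\<Sum>b\<in>A. frag_cmul (li A b t) (wdg b w))) \<in> RR {}"
    using RR_closed(2)[OF 1 2] s A unfolding RR_def by (intro rels_wdgs) auto
  have 4: "wdgs (sl A) (wdg b w) \<in> RR {}" if "b \<in> A" for b
  proof -
    have "wdgs (sl A) (wdg b w) - frag_cmul ((-1) ^ length (sl A)) (wdg b (wdgs (sl A) w)) \<in> RR {}"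
      unfolding RR_def by (rule rels_wdgs_move) (use assms s A N that in auto)
    moreover have "wdg b (wdgs (sl A) w) \<in> RR {}"
      unfolding RR_def by (rule rels_wdgs_repeat) (use assms s A that in auto)
    ultimately have "(wdgs (sl A) (wdg b w) - frag_cmul ((-1) ^ length (sl A)) (wdg b (wdgs (sl A) w)))
        + frag_cmul ((-1) ^ length (sl A)) (wdg b (wdgs (sl A) w)) \<in> RR {}"
      by (intro RR_closed(3,5))
    then show ?thesis by simp
  qed
  have lin: "wdgs (sl A) (sum f I) = (\<Sum>i\<in>I. wdgs (sl A) (f i))" for f :: "'a \<Rightarrow> _" and I
    by (induction I rule: infinite_finite_induct) auto
  have "wdgs (sl A) (\<Sum>b\<in>A. frag_cmul (li A b t) (wdg b w)) \<in> RR {}"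
    unfolding lin by (intro RR_sum) (auto intro: 4)
  from RR_closed(3)[OF 3 this] show ?thesis by simp
qed

text \<open>\<open>c n\<close> and \<open>b\<close> differ by a vector of \<open>NL A\<close>, which
  \<open>e_A\<close> annihilates up to the factor \<open>M\<close>; as \<open>u\<close> has integer
  values, this factor cancels. In this way primitive vectors are exchanged for lattice
  normals.\<close>

lemma Fun_wdgs_normal:
  assumes "Fun (int p) {} A u" "A \<in> \<Delta>" "card A = q" "b \<in> C" "C \<in> \<Delta>" "A = C - {b}"
    "n \<in> NL C" "of_int c *\<^sub>R n - b \<in> NL A" "w \<in> SS (int p - int (Suc q)) C"
  shows "u (wdgs (sl A) (wdg b w)) = c * u (wdgs (sl A) (wdg n w))"
proof -
  have S: "wdgs (sl A) (wdg x w) \<in> SS (int p) A" if "x \<in> NL C" for x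
  proof -
    have "wdg x w \<in> SS (int p - int q) C"
      using SS_wdg[OF assms(9) that] by (simp add: algebra_simps)
    then have "wdg x w \<in> SS (int p - int q) A"
      using assms(6) by (elim SS_anti[rotated]) auto
    then show ?thesis using SS_sl[OF assms(2), of "wdg x w" "int p"] assms(3) by simp
  qed
  note b = NL_base[OF assms(5,4)]
  note wN = SS_flists[OF assms(9)]
  let ?t = "of_int c *\<^sub>R n - b"
  have mem: "n \<in> N" "b \<in> N" "of_int c *\<^sub>R n \<in> N" "A \<subseteq> N"
    using assms b NL_sub \<Delta>N add_closed_int[OF N] by blast+
  have 1: "wdg ?t w - (wdg (of_int c *\<^sub>R n) w - wdg b w) \<in> RR {}"
    unfolding RR_def by (rule rels_wdg_diff) (use N mem wN in auto)
  have 2: "wdg (of_int c *\<^sub>R n) w - frag_cmul c (wdg n w) \<in> RR {}"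
    unfolding RR_def by (rule rels_wdg_scale) (use N mem wN in auto)
  have 3: "wdgs (sl A) (wdg ?t w - (frag_cmul c (wdg n w) - wdg b w)) \<in> RR {}"
    using RR_closed(3)[OF 1 2] sl[OF assms(2)] mem unfolding RR_def
    by (intro rels_wdgs) (auto simp: algebra_simps)
  have "frag_cmul M (wdgs (sl A) (wdg ?t w)) - frag_cmul M (wdgs (sl A) (wdg ?t w - (frag_cmul c (wdg n w) - wdg b w))) \<in> RR {}"
    by (intro RR_closed 3 wdgs_sl_torsion assms wN)
  then have "frag_cmul M (frag_cmul c (wdgs (sl A) (wdg n w)) - wdgs (sl A) (wdg b w)) \<in> RR {}"
    by simp
  moreover have m: "frag_cmul c (wdgs (sl A) (wdg n w)) - wdgs (sl A) (wdg b w) \<in> SS (int p) A"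
    using S assms(7) b by auto
  ultimately have "u (frag_cmul M (frag_cmul c (wdgs (sl A) (wdg n w)) - wdgs (sl A) (wdg b w))) = 0"
    by (intro Fun_rel[OF assms(1)] SS_closed(5))
  then have "M * (c * u (wdgs (sl A) (wdg n w)) - u (wdgs (sl A) (wdg b w))) = 0"
    using Fun_cmul[OF assms(1) m, of M] Fun_cmul[OF assms(1) S[OF assms(7)], of c]
      Fun_diff[OF assms(1) SS_closed(5)[OF S[OF assms(7)]] S[OF b], of c] by metis
  then show ?thesis using M by simp
qed

end

section \<open>Quotients and exterior powers in terms of representatives\<close>

declare mult_FactGroup [simp del] one_FactGroup [simp del]

definition coset :: "'b::ab_group_add set \<Rightarrow> 'b \<Rightarrow> 'b set" where
  "coset T x = (\<lambda>t. t + x) ` T"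

lemma coset_self: "add_closed T \<Longrightarrow> x \<in> coset T x"
  using add_closedD(1)[of T] by (force simp: coset_def)

lemma coset_eq_iff:
  assumes "add_closed T"
  shows "coset T x = coset T y \<longleftrightarrow> x - y \<in> T"
proof
  assume "coset T x = coset T y"
  then obtain t where "t \<in> T" "x = t + y"
    using coset_self[OF assms, of x] by (auto simp: coset_def)
  then show "x - y \<in> T" by simp
next
  assume xy: "x - y \<in> T"
  have "t + x = (t + (x - y)) + y" "t + y = (t - (x - y)) + x" for t by simp_all
  then show "coset T x = coset T y"
    using add_closedD(2,4)[OF assms _ xy] unfolding coset_def by blast
qed

lemma coset_zero [simp]: "coset T 0 = T"
  by (simp add: coset_def)

text \<open>Lattices and free abelian groups are both additive types viewed as multiplicative
  groups. Cosets, generated subgroups and quotients are translated into additive language here once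
  for both.\<close>

locale plus_group =
  fixes A :: "'b::ab_group_add monoid" (structure)
  assumes mult_plus: "x \<otimes>\<^bsub>A\<^esub> y = x + y" and one_zero: "\<one>\<^bsub>A\<^esub> = 0" and closed: "add_closed (carrier A)"
begin

sublocale comm_group A
  by (rule comm_groupI)
     (use closed add_closedD[OF closed] in \<open>auto simp: mult_plus one_zero algebra_simps intro!: bexI[of _ "- x" for x]\<close>)

lemma inv_uminus: "x \<in> carrier A \<Longrightarrow> inv x = - x"
  by (rule inv_equality) (use add_closedD(3)[OF closed] in \<open>auto simp: mult_plus one_zero\<close>)

lemma generate_zspan:
  assumes "X \<subseteq> carrier A"
  shows "generate A X = zspan X"
proof (intro equalityI subsetI)
  fix x assume "x \<in> generate A X"
  then show "x \<in> zspan X"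
  proof (induction rule: generate.induct)
    case (inv h)
    then have "inv h = - h" using assms inv_uminus by blast
    then show ?case using inv by (simp add: zspan_uminus zspan_base)
  qed (auto simp: one_zero mult_plus intro: zspan_zero zspan_base zspan_add)
next
  fix x assume "x \<in> zspan X"
  then show "x \<in> generate A X"
  proof (rule zspan_minimal)
    show "0 \<in> generate A X" using generate.one[of A X] by (simp add: one_zero)
    fix x y assume xy: "x \<in> generate A X" "y \<in> generate A X"
    then have "x \<in> carrier A" "y \<in> carrier A" using assms generate_in_carrier by auto
    then have "x - y = x \<otimes> inv y" by (simp add: mult_plus inv_uminus)
    then show "x - y \<in> generate A X"
      using generate.eng[OF xy(1) generate_m_inv_closed[OF assms xy(2)]] by simp
  qed (rule generate.incl)
qed

lemma r_coset_eq: "K #>\<^bsub>A\<^esub> x = coset K x"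
  by (auto simp: r_coset_def coset_def mult_plus)

lemma subgroup: "add_closed K \<Longrightarrow> K \<subseteq> carrier A \<Longrightarrow> subgroup K A"
  using add_closedD(1,3,4)[of K] inv_uminus by (auto intro!: subgroupI simp: mult_plus)

text \<open>Compatibility of \<open>F\<close> with the relations makes all cosets in the union
  defining \<open>coset_map\<close> coincide, so the induced map may be computed on any
  representative.\<close>

lemma coset_map_coset:
  assumes "add_closed K'" "\<And>x y. F (x + y) = F x + F y" "\<And>x. x \<in> K \<Longrightarrow> F x \<in> K'" "0 \<in> K"
  shows "coset_map A K' F (coset K v) = coset K' (F v)"
proof -
  have "coset K' (F x) = coset K' (F v)" if "x \<in> coset K v" for x
    using that assms by (auto simp: coset_def[of K] coset_eq_iff)
  moreover have "v \<in> coset K v" using assms(4) by (force simp: coset_def)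
  ultimately show ?thesis unfolding coset_map_def r_coset_eq by blast
qed

context
  fixes K assumes K: "add_closed K" "K \<subseteq> carrier A"
begin

lemma carrier_Mod: "carrier (A Mod K) = coset K ` carrier A"
  by (auto simp: FactGroup_def RCOSETS_def r_coset_eq)

lemma mult_Mod: "coset K x \<otimes>\<^bsub>A Mod K\<^esub> coset K y = coset K (x + y)"
proof -
  have "coset K x <#> coset K y = coset K (x + y)"
  proof (intro equalityI subsetI)
    fix z assume "z \<in> coset K x <#> coset K y"
    then obtain t t' where t: "t \<in> K" "t' \<in> K" "z = (t + x) + (t' + y)"
      by (auto simp: set_mult_def coset_def mult_plus)
    then have "z = (t + t') + (x + y)" by (simp add: algebra_simps)
    then show "z \<in> coset K (x + y)"
      using add_closedD(4)[OF K(1) t(1,2)] by (auto simp: coset_def)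
  next
    fix z assume "z \<in> coset K (x + y)"
    then obtain t where t: "t \<in> K" "z = (t + x) + (0 + y)"
      by (auto simp: coset_def algebra_simps)
    moreover have "t + x \<in> coset K x" "0 + y \<in> coset K y"
      using t add_closedD(1)[OF K(1)] unfolding coset_def by blast+
    ultimately show "z \<in> coset K x <#> coset K y"
      unfolding set_mult_def mult_plus by blast
  qed
  then show ?thesis by (simp add: FactGroup_def)
qed

lemma one_Mod: "\<one>\<^bsub>A Mod K\<^esub> = coset K 0"
  by (simp add: FactGroup_def)

lemma comm_group_Mod: "comm_group (A Mod K)"
  by (rule abelian_FactGroup[OF subgroup[OF K]])

lemma inv_Mod:
  assumes "x \<in> carrier A"
  shows "inv\<^bsub>A Mod K\<^esub> (coset K x) = coset K (- x)"
proof -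
  interpret Q: comm_group "A Mod K" by (rule comm_group_Mod)
  show ?thesis
    by (rule Q.inv_equality)
       (use assms add_closedD(3)[OF closed] in \<open>auto simp: mult_Mod one_Mod carrier_Mod\<close>)
qed

end

end

lemma plus_group_additive_group: "add_closed L \<Longrightarrow> plus_group (additive_group L)"
  by unfold_locales (auto simp: additive_group_def)

lemma carrier_additive_group [simp]: "carrier (additive_group L) = L"
  by (simp add: additive_group_def)

lemma add_closed_frags: "add_closed (frags S)"
  by (auto simp: add_closed_def intro: frags_diff)

lemma carrier_free_Abelian: "carrier (free_Abelian_group S) = frags S"
  by (auto simp: frags_def)

lemma plus_group_free_Abelian: "plus_group (free_Abelian_group S)"
  by unfold_locales (auto simp: carrier_free_Abelian add_closed_frags)

lemma zspan_subset:
  assumes "X \<subseteq> S" "add_closed S"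
  shows "zspan X \<subseteq> S"
  using zspan_minimal[of _ X S] assms add_closedD(1,2)[OF assms(2)] by blast

lemma add_closed_zspan: "add_closed (zspan X)"
  by (auto simp: add_closed_def intro: zspan_zero zspan_diff)

section \<open>Exterior powers of a quotient lattice\<close>

definition ext_rel_gens :: "nat \<Rightarrow> ('a, 'c) monoid_scheme \<Rightarrow> ('a list \<Rightarrow>\<^sub>0 int) set" where
  "ext_rel_gens p G =
     {frag_of (us @ [x \<otimes>\<^bsub>G\<^esub> y] @ vs) - frag_of (us @ [x] @ vs) - frag_of (us @ [y] @ vs) | us vs x y.
         length us + 1 + length vs = p \<and> set us \<union> set vs \<union> {x, y} \<subseteq> carrier G} \<union>
      {frag_of xs | xs. length xs = p \<and> set xs \<subseteq> carrier G \<and> \<not> distinct xs}"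

lemma ext_rel_gensE:
  assumes "g \<in> ext_rel_gens p G"
  obtains (linear) us X Y vs where
    "g = frag_of (us @ [X \<otimes>\<^bsub>G\<^esub> Y] @ vs) - frag_of (us @ [X] @ vs) - frag_of (us @ [Y] @ vs)"
    "length us + 1 + length vs = p" "set us \<union> set vs \<union> {X, Y} \<subseteq> carrier G"
  | (alt) xs where "g = frag_of xs" "length xs = p" "set xs \<subseteq> carrier G" "\<not> distinct xs"
proof -
  from assms[unfolded ext_rel_gens_def] show thesis
    by (elim UnE CollectE exE conjE) ((rule that(1); assumption), (rule that(2); assumption))
qed

lemma ext_free_eq: "ext_free p G = free_Abelian_group (lsts p (carrier G))"
  by (simp add: ext_free_def lsts_def)

lemma ext_rel_zspan:
  assumes "group G"
  shows "ext_rel p G = zspan (ext_rel_gens p G)" "ext_rel_gens p G \<subseteq> frags (lsts p (carrier G))"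
proof -
  interpret group G by fact
  interpret F: plus_group "ext_free p G" unfolding ext_free_eq by (rule plus_group_free_Abelian)
  show 1: "ext_rel_gens p G \<subseteq> frags (lsts p (carrier G))"
    unfolding ext_rel_gens_def
    by (auto simp: lsts_def intro!: frags_diff)
  show "ext_rel p G = zspan (ext_rel_gens p G)"
    unfolding ext_rel_def ext_rel_gens_def[symmetric]
    by (rule F.generate_zspan) (use 1 in \<open>simp add: ext_free_eq carrier_free_Abelian\<close>)
qed

locale lattice_pair =
  fixes L T :: "'a::real_vector set"
  assumes L: "add_closed L" and T: "add_closed T" and TL: "T \<subseteq> L"
begin

abbreviation "G \<equiv> additive_group L Mod T"

sublocale AL: plus_group "additive_group L"
  by (rule plus_group_additive_group[OF L])

lemma carrier_G: "carrier G = coset T ` L"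
  using AL.carrier_Mod[of T] T TL by simp

lemma mult_G: "coset T x \<otimes>\<^bsub>G\<^esub> coset T y = coset T (x + y)"
  using AL.mult_Mod[of T] T TL by simp

lemma one_G: "\<one>\<^bsub>G\<^esub> = T"
  using AL.one_Mod[of T] T TL by simp

sublocale G: comm_group G
  using AL.comm_group_Mod[of T] T TL by simp

lemma inv_G: "x \<in> L \<Longrightarrow> inv\<^bsub>G\<^esub> coset T x = coset T (- x)"
  using AL.inv_Mod[of T] T TL by simp

abbreviation "K p \<equiv> ext_rel p G"

lemma K_gens: "ext_rel p G = zspan (ext_rel_gens p G)"
  by (rule ext_rel_zspan) (rule G.is_group)

lemma K_closed: "add_closed (K p)"
  unfolding K_gens by (rule add_closed_zspan)

sublocale FE: plus_group "ext_free p G" for p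
  unfolding ext_free_eq by (rule plus_group_free_Abelian)

lemma K_sub: "K p \<subseteq> carrier (ext_free p G)"
  unfolding K_gens ext_free_eq carrier_free_Abelian
  by (rule zspan_subset[OF ext_rel_zspan(2)[OF G.is_group] add_closed_frags])

text \<open>Elements of the exterior powers of \<open>L / T\<close> are addressed through vectors of
  \<open>L\<close>, so that the same formal sum can be used for many \<open>T\<close>.\<close>

definition cls :: "nat \<Rightarrow> ('a list \<Rightarrow>\<^sub>0 int) \<Rightarrow> ('a set list \<Rightarrow>\<^sub>0 int) set" where
  "cls p v = coset (K p) (pmap (coset T) v)"

abbreviation "E p \<equiv> ext_power p G"

lemma comm_group_E: "comm_group (E p)"
  unfolding ext_power_def by (rule FE.comm_group_Mod[OF K_closed K_sub])

sublocale E: comm_group "E p" for p by (rule comm_group_E)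

abbreviation "FL p \<equiv> frags (lsts p L)"

lemma pmap_coset: "v \<in> FL p \<Longrightarrow> pmap (coset T) v \<in> carrier (ext_free p G)"
  unfolding ext_free_eq carrier_free_Abelian pmap_def
  by (erule frags_extend) (auto simp: lsts_def carrier_G)

lemma carrier_E: "carrier (E p) = cls p ` FL p"
proof (intro equalityI subsetI)
  fix X assume "X \<in> carrier (E p)"
  then obtain w where w: "w \<in> carrier (ext_free p G)" "X = coset (K p) w"
    unfolding ext_power_def using FE.carrier_Mod[OF K_closed K_sub] by auto
  define sec where "sec X = (SOME x. x \<in> L \<and> X = coset T x)" for X
  have sec: "sec X \<in> L \<and> X = coset T (sec X)" if "X \<in> carrier G" for X
    unfolding sec_def by (rule someI_ex) (use that carrier_G in auto)
  have "pmap sec w \<in> FL p \<and> pmap (coset T) (pmap sec w) = w"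
    using w(1) unfolding ext_free_eq carrier_free_Abelian
  proof (induction rule: frags_induct)
    case (of s)
    then have "map (coset T \<circ> sec) s = s"
      using sec by (auto simp: lsts_def intro!: map_idI)
    then show ?case using of sec by (auto simp: lsts_def)
  qed (auto intro: frags_diff)
  then show "X \<in> cls p ` FL p"
    using w(2) by (intro image_eqI[of _ _ "pmap sec w"]) (auto simp: cls_def)
next
  fix X assume "X \<in> cls p ` FL p"
  then show "X \<in> carrier (E p)"
    unfolding ext_power_def using FE.carrier_Mod[OF K_closed K_sub] pmap_coset by (auto simp: cls_def)
qed

lemma cls_closed: "v \<in> FL p \<Longrightarrow> cls p v \<in> carrier (E p)"
  using carrier_E by auto

lemma cls_add: "cls p v \<otimes>\<^bsub>E p\<^esub> cls p w = cls p (v + w)"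
  unfolding ext_power_def cls_def using FE.mult_Mod[OF K_closed K_sub] by simp

lemma cls_zero: "\<one>\<^bsub>E p\<^esub> = cls p 0"
  unfolding ext_power_def cls_def using FE.one_Mod[OF K_closed K_sub] by simp

lemma cls_uminus: "v \<in> FL p \<Longrightarrow> inv\<^bsub>E p\<^esub> (cls p v) = cls p (- v)"
  unfolding ext_power_def cls_def using FE.inv_Mod[OF K_closed K_sub pmap_coset] by simp

lemma cls_pow:
  assumes "v \<in> FL p"
  shows "cls p v [^]\<^bsub>E p\<^esub> (k::int) = cls p (frag_cmul k v)"
proof (induction k rule: int_induct[where k=0])
  case base
  then show ?case by (simp add: cls_zero)
next
  case (step1 i)
  then show ?case
    using cls_closed[OF assms] by (simp add: E.int_pow_mult cls_add frag_cmul_distrib)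
next
  case (step2 i)
  have "cls p v [^]\<^bsub>E p\<^esub> (i - 1) = cls p v [^]\<^bsub>E p\<^esub> i \<otimes>\<^bsub>E p\<^esub> inv\<^bsub>E p\<^esub> (cls p v)"
    using cls_closed[OF assms] E.int_pow_diff[of "cls p v" p i 1] by simp
  then show ?case
    using step2 by (simp add: cls_uminus[OF assms] cls_add frag_cmul_diff_distrib)
qed

lemma rels_replace:
  assumes "set us \<subseteq> L" "set vs \<subseteq> L" "x \<in> L" "y \<in> L" "x - y \<in> T"
  shows "frag_of (us @ [x] @ vs) - frag_of (us @ [y] @ vs) \<in> rels L T"
proof -
  let ?v = "frag_of vs"
  have v: "?v \<in> flists L" using assms by auto
  have "wdg (x - y) ?v - (wdg (x - y) ?v - (wdg x ?v - wdg y ?v)) \<in> rels L T"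
    by (intro rels_diff[OF rels_wdg_torsion[OF v assms(5)] rels_wdg_diff] L v assms)
  then have "wdgs us (wdg x ?v - wdg y ?v) \<in> rels L T"
    using assms(1) by (intro rels_wdgs) auto
  then show ?thesis by (simp add: wdgs_of)
qed

text \<open>\<open>rels\<close> mixes degrees, whereas \<open>K p\<close> lives in degree
  \<open>p\<close>. A relation is therefore truncated to its tuples of length \<open>p\<close>; each
  generator is homogeneous, so it either survives or becomes 0.\<close>

lemma rels_imp_K:
  assumes "v \<in> rels L T" "v \<in> FL p"
  shows "pmap (coset T) v \<in> K p"
proof -
  define lp :: "('a list \<Rightarrow>\<^sub>0 int) \<Rightarrow> _" where "lp = frag_extend (\<lambda>xs. if length xs = p then frag_of xs else 0)"
  have lp_of: "lp (frag_of xs) = (if length xs = p then frag_of xs else 0)" for xs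
    by (simp add: lp_def)
  have lp_diff: "lp (v - w) = lp v - lp w" for v w
    by (simp add: lp_def frag_extend_diff)
  have "pmap (coset T) (lp v) \<in> zspan (ext_rel_gens p G)"
  proof (rule zspan_image[OF assms(1)[unfolded rels_def]])
    fix g assume "g \<in> ext_gens L T"
    then show "pmap (coset T) (lp g) \<in> zspan (ext_rel_gens p G)"
    proof cases
      case (linear us vs x y)
      show ?thesis
      proof (cases "length us + 1 + length vs = p")
        case True
        have "frag_of (map (coset T) us @ [coset T x \<otimes>\<^bsub>G\<^esub> coset T y] @ map (coset T) vs)
          - frag_of (map (coset T) us @ [coset T x] @ map (coset T) vs)
          - frag_of (map (coset T) us @ [coset T y] @ map (coset T) vs) \<in> ext_rel_gens p G"
          unfolding ext_rel_gens_def carrier_G using linear True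
          by (intro UnI1 CollectI exI conjI refl) (auto intro!: imageI)
        then show ?thesis
          using linear True by (simp add: lp_diff lp_of mult_G zspan_base)
      qed (use linear in \<open>simp add: lp_diff lp_of zspan_zero\<close>)
    next
      case (alternating xs)
      show ?thesis
      proof (cases "length xs = p")
        case True
        then have "frag_of (map (coset T) xs) \<in> ext_rel_gens p G"
          unfolding ext_rel_gens_def carrier_G using alternating
          by (intro UnI2 CollectI exI conjI refl) (auto simp: distinct_map intro!: imageI)
        then show ?thesis
          using alternating True by (simp add: lp_of zspan_base)
      qed (use alternating in \<open>simp add: lp_of zspan_zero\<close>)
    next
      case (torsion us vs t)
      show ?thesis
      proof (cases "length us + 1 + length vs = p")
        case True
        have t: "coset T t = coset T 0" using coset_eq_iff[OF T, of t 0] torsion by simp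
        \<comment> \<open>A tuple with an entry 0 is a relation because the linear relation for
          \<open>0 + 0 = 0\<close> reduces to minus this tuple.\<close>
        have "frag_of (map (coset T) us @ [coset T 0 \<otimes>\<^bsub>G\<^esub> coset T 0] @ map (coset T) vs)
          - frag_of (map (coset T) us @ [coset T 0] @ map (coset T) vs)
          - frag_of (map (coset T) us @ [coset T 0] @ map (coset T) vs) \<in> ext_rel_gens p G"
          unfolding ext_rel_gens_def carrier_G using torsion True add_closedD(1)[OF L]
          by (intro UnI1 CollectI exI conjI refl) (auto intro!: imageI simp del: coset_zero)
        then have "- frag_of (map (coset T) us @ [coset T 0] @ map (coset T) vs) \<in> ext_rel_gens p G"
          unfolding mult_G by (simp del: coset_zero)
        then have "- (- frag_of (map (coset T) us @ [coset T 0] @ map (coset T) vs)) \<in> zspan (ext_rel_gens p G)"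
          by (intro zspan_uminus zspan_base)
        then show ?thesis
          using torsion True by (simp add: lp_of t del: coset_zero)
      qed (use torsion in \<open>simp add: lp_of zspan_zero\<close>)
    qed
  qed (simp add: lp_diff)
  moreover have "lp v = v"
    using assms(2) by (induction rule: frags_induct) (auto simp: lp_def frag_extend_diff lsts_def)
  ultimately show ?thesis by (simp add: K_gens)
qed

text \<open>A set-theoretic section of the quotient map lifts relations of the quotient to
  \<open>L\<close>. It is additive only modulo \<open>T\<close>, and \<open>rels_replace\<close>
  repairs the difference. Projecting and lifting changes every entry of \<open>v\<close> by an
  element of \<open>T\<close>, which \<open>rels_pmap_scale\<close> with factor 1 makes
  harmless.\<close>

lemma K_imp_rels:
  assumes "pmap (coset T) v \<in> K p" "v \<in> FL p"
  shows "v \<in> rels L T"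
proof -
  define sec where "sec X = (SOME x. x \<in> L \<and> X = coset T x)" for X
  have sec: "sec X \<in> L" "coset T (sec X) = X" if "X \<in> carrier G" for X
  proof -
    have "sec X \<in> L \<and> X = coset T (sec X)"
      unfolding sec_def by (rule someI_ex) (use that carrier_G in auto)
    then show "sec X \<in> L" "coset T (sec X) = X" by auto
  qed
  have seq: "sec X - y \<in> T" if "X = coset T y" "y \<in> L" for X y
    using sec(2)[of X] that carrier_G by (simp flip: coset_eq_iff[OF T])
  have 1: "pmap sec (pmap (coset T) v) \<in> zspan (ext_gens L T)"
  proof (rule zspan_image[OF assms(1)[unfolded K_gens]])
    fix g assume "g \<in> ext_rel_gens p G"
    then have "pmap sec g \<in> rels L T"
    proof (cases rule: ext_rel_gensE)
      case (linear us X Y vs)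
      let ?us = "map sec us" and ?vs = "map sec vs" and ?x = "sec X" and ?y = "sec Y"
      have m: "set ?us \<subseteq> L" "set ?vs \<subseteq> L" "?x \<in> L" "?y \<in> L" "?x + ?y \<in> L" "sec (X \<otimes>\<^bsub>G\<^esub> Y) \<in> L"
        using linear sec L by (auto simp: add_closedD)
      have "X \<otimes>\<^bsub>G\<^esub> Y = coset T (?x + ?y)"
        using mult_G[of ?x ?y] sec linear by simp
      then have "sec (X \<otimes>\<^bsub>G\<^esub> Y) - (?x + ?y) \<in> T"
        using m by (intro seq)
      then have a: "frag_of (?us @ [sec (X \<otimes>\<^bsub>G\<^esub> Y)] @ ?vs) - frag_of (?us @ [?x + ?y] @ ?vs) \<in> rels L T"
        by (intro rels_replace m)
      have b: "frag_of (?us @ [?x + ?y] @ ?vs) - frag_of (?us @ [?x] @ ?vs) - frag_of (?us @ [?y] @ ?vs) \<in> rels L T"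
        unfolding rels_def by (intro zspan_base ext_gens.linear m)
      have "pmap sec g = (frag_of (?us @ [sec (X \<otimes>\<^bsub>G\<^esub> Y)] @ ?vs) - frag_of (?us @ [?x + ?y] @ ?vs))
        + (frag_of (?us @ [?x + ?y] @ ?vs) - frag_of (?us @ [?x] @ ?vs) - frag_of (?us @ [?y] @ ?vs))"
        by (simp add: linear(1))
      then show ?thesis
        using rels_add[OF a b] by (simp only:)
    next
      case (alt xs)
      have "set (map sec xs) \<subseteq> L" "\<not> distinct (map sec xs)"
        using alt(3,4) sec(1) by (auto simp: distinct_map)
      then show ?thesis
        using alt(1) by (simp add: rels_def zspan_base ext_gens.alternating)
    qed
    then show "pmap sec g \<in> zspan (ext_gens L T)" by (simp add: rels_def)
  qed simp
  have 2: "pmap (sec \<circ> coset T) v - frag_cmul (1 ^ p) v \<in> rels L T"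
    by (rule rels_pmap_scale[OF assms(2) L]) (use sec seq carrier_G in auto)
  have "pmap sec (pmap (coset T) v) = pmap (sec \<circ> coset T) v"
    by (rule frags_induct[of v UNIV]) (simp_all add: comp_def)
  then show ?thesis
    using rels_diff[OF 1[folded rels_def] 2] by simp
qed

lemma cls_eq_iff:
  assumes "v \<in> FL p" "w \<in> FL p"
  shows "cls p v = cls p w \<longleftrightarrow> v - w \<in> rels L T"
  using coset_eq_iff[OF K_closed, of p "pmap (coset T) v" "pmap (coset T) w"]
    rels_imp_K[of "v - w" p] K_imp_rels[of "v - w" p] frags_diff[OF assms]
  by (auto simp: cls_def)

lemma wedge_cls:
  assumes "x \<in> L"
  shows "wedge p G (coset T x) (cls p v) = cls (Suc p) (wdg x v)"
proof -
  have x: "coset T x \<in> carrier G" using assms carrier_G by simp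
  have "coset_map (ext_free (Suc p) G) (K (Suc p)) (wdg (coset T x)) (coset (K p) (pmap (coset T) v))
     = coset (K (Suc p)) (wdg (coset T x) (pmap (coset T) v))"
  proof (rule FE.coset_map_coset[OF K_closed])
    show "wdg (coset T x) k \<in> K (Suc p)" if "k \<in> K p" for k
      using that unfolding K_gens
    proof (rule zspan_image)
      fix g assume "g \<in> ext_rel_gens p G"
      then have "wdg (coset T x) g \<in> ext_rel_gens (Suc p) G"
      proof (cases rule: ext_rel_gensE)
        case (linear us X Y vs)
        then show ?thesis
          unfolding ext_rel_gens_def using x
          by (intro UnI1 CollectI exI[of _ "coset T x # us"] exI[of _ vs] exI[of _ X] exI[of _ Y]) auto
      next
        case (alt xs)
        then show ?thesis
          unfolding ext_rel_gens_def using x by (intro UnI2 CollectI exI[of _ "coset T x # xs"]) auto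
      qed
      then show "wdg (coset T x) g \<in> zspan (ext_rel_gens (Suc p) G)" by (rule zspan_base)
    qed simp
  qed (use add_closedD(1)[OF K_closed] in auto)
  then show ?thesis
    by (simp add: wedge_def wdg_def[abs_def] cls_def[abs_def] pmap_wdg[unfolded wdg_def])
qed

end

text \<open>Covers inclusions of sublattices and projections to further quotients alike: on
  representatives in \<open>L\<close> each of these maps is the identity.\<close>

lemma ext_map_cls:
  assumes "lattice_pair L T" "lattice_pair L' T'" "L \<subseteq> L'" "\<And>x. x \<in> L \<Longrightarrow> h (coset T x) = coset T' x"
    and "v \<in> frags (lsts p L)"
  shows "ext_map p (additive_group L' Mod T') h (lattice_pair.cls L T p v) = lattice_pair.cls L' T' p v"
proof -
  interpret A: lattice_pair L T by fact
  interpret B: lattice_pair L' T' by fact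
  have "coset_map (ext_free p B.G) (B.K p) (pmap h) (coset (A.K p) (pmap (coset T) v))
     = coset (B.K p) (pmap h (pmap (coset T) v))"
  proof (rule B.FE.coset_map_coset[OF B.K_closed])
    have h: "h X \<in> carrier B.G" if "X \<in> carrier A.G" for X
      using that assms(3,4) A.carrier_G B.carrier_G by auto
    have hm: "h (X \<otimes>\<^bsub>A.G\<^esub> Y) = h X \<otimes>\<^bsub>B.G\<^esub> h Y" if XY: "X \<in> carrier A.G" "Y \<in> carrier A.G" for X Y
    proof -
      obtain x y where "x \<in> L" "X = coset T x" "y \<in> L" "Y = coset T y"
        using XY A.carrier_G by auto
      then show ?thesis
        using assms(4)[OF add_closedD(4)[OF A.L]] by (simp add: A.mult_G B.mult_G assms(4))
    qed
    show "pmap h k \<in> B.K p" if "k \<in> A.K p" for k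
      using that unfolding A.K_gens B.K_gens
    proof (rule zspan_image)
      fix g assume "g \<in> ext_rel_gens p A.G"
      then have "pmap h g \<in> ext_rel_gens p B.G"
      proof (cases rule: ext_rel_gensE)
        case (linear us X Y vs)
        then show ?thesis
          unfolding ext_rel_gens_def using h hm
          by (intro UnI1 CollectI exI[of _ "map h us"] exI[of _ "map h vs"] exI[of _ "h X"] exI[of _ "h Y"]) auto
      next
        case (alt xs)
        then show ?thesis
          unfolding ext_rel_gens_def using h
          by (intro UnI2 CollectI exI[of _ "map h xs"]) (auto simp: distinct_map)
      qed
      then show "pmap h g \<in> zspan (ext_rel_gens p B.G)" by (rule zspan_base)
    qed simp
  qed (use add_closedD(1)[OF A.K_closed] in auto)
  moreover have "pmap h (pmap (coset T) v) = pmap (coset T') v"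
    using assms(5)
  proof (induction rule: frags_induct)
    case (of s)
    then have "map (h \<circ> coset T) s = map (coset T') s"
      using assms(4) by (auto simp: lsts_def)
    then show ?case by (simp only: pmap_of map_map)
  qed auto
  ultimately show ?thesis
    by (simp add: ext_map_def pmap_def[abs_def] A.cls_def B.cls_def)
qed

text \<open>A sum of subgroups of classes becomes the set of classes of formal sums over the union
  of the tuple sets, which is the shape of \<open>SS\<close>.\<close>

lemma (in lattice_pair) generate_cls:
  assumes "\<And>i. i \<in> I \<Longrightarrow> S i \<subseteq> lsts p L"
  shows "generate (E p) (\<Union>i\<in>I. cls p ` frags (S i)) = cls p ` frags (\<Union>i\<in>I. S i)"
proof (intro equalityI subsetI)
  have sub: "frags (\<Union>i\<in>I. S i) \<subseteq> FL p"
    using assms frags_mono[of "\<Union>i\<in>I. S i" "lsts p L"] by blast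
  have sub': "frags (S i) \<subseteq> frags (\<Union>i\<in>I. S i)" if "i \<in> I" for i
    using that frags_mono[of "S i" "\<Union>i\<in>I. S i"] by blast
  fix X assume "X \<in> generate (E p) (\<Union>i\<in>I. cls p ` frags (S i))"
  then show "X \<in> cls p ` frags (\<Union>i\<in>I. S i)"
  proof (induction rule: generate.induct)
    case one
    then show ?case using cls_zero by auto
  next
    case (incl h)
    then show ?case using sub' by blast
  next
    case (inv h)
    then obtain v where "v \<in> frags (\<Union>i\<in>I. S i)" "h = cls p v" using sub' by blast
    moreover have "v \<in> FL p" using calculation sub by blast
    ultimately show ?case using cls_uminus[of v p] frags_uminus[of v] by auto
  next
    case (eng h1 h2)
    then obtain v w where "v \<in> frags (\<Union>i\<in>I. S i)" "h1 = cls p v" "w \<in> frags (\<Union>i\<in>I. S i)" "h2 = cls p w"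
      by blast
    then show ?case using frags_add[of v _ w] by (auto simp: cls_add)
  qed
next
  have sub: "frags (\<Union>i\<in>I. S i) \<subseteq> FL p"
    using assms frags_mono[of "\<Union>i\<in>I. S i" "lsts p L"] by blast
  have gsub: "(\<Union>i\<in>I. cls p ` frags (S i)) \<subseteq> carrier (E p)"
  proof safe
    fix i v assume "i \<in> I" "v \<in> frags (S i)"
    then show "cls p v \<in> carrier (E p)"
      using frags_mono[OF assms, of i v] by (intro cls_closed)
  qed
  fix X assume "X \<in> cls p ` frags (\<Union>i\<in>I. S i)"
  then obtain v where v: "v \<in> frags (\<Union>i\<in>I. S i)" "X = cls p v" by auto
  have "v \<in> frags (\<Union>i\<in>I. S i) \<and> cls p v \<in> generate (E p) (\<Union>i\<in>I. cls p ` frags (S i))"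
    using v(1)
  proof (induction rule: frags_induct)
    case zero
    then show ?case using generate.one[of "E p"] by (simp add: cls_zero)
  next
    case (of s)
    then show ?case by (auto intro!: generate.incl)
  next
    case (diff x y)
    have "cls p (x - y) = cls p x \<otimes>\<^bsub>E p\<^esub> inv\<^bsub>E p\<^esub> (cls p y)"
      using diff sub cls_uminus[of y p] by (auto simp: cls_add)
    then show ?case
      using diff frags_diff generate.eng[of _ "E p"] E.generate_m_inv_closed[OF gsub] by auto
  qed
  then show "X \<in> generate (E p) (\<Union>i\<in>I. cls p ` frags (S i))" using v by simp
qed

section \<open>Simplicial cones and fans\<close>

abbreviation cone_hull :: "'a::real_vector set \<Rightarrow> 'a set" where
  "cone_hull B \<equiv> convex_cone hull B"

lemma cone_explicit:
  assumes "finite B"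
  shows "cone_hull B = {\<Sum>b\<in>B. c b *\<^sub>R b | c. \<forall>b\<in>B. 0 \<le> c b}" (is "_ = ?S")
proof (rule hull_unique)
  show "B \<subseteq> ?S"
  proof
    fix b assume b: "b \<in> B"
    have "(\<Sum>x\<in>B. (if x = b then 1 else 0) *\<^sub>R x) = (\<Sum>x\<in>{b}. (if x = b then 1 else 0) *\<^sub>R x)"
      using assms b by (intro sum.mono_neutral_right) auto
    then have "b = (\<Sum>x\<in>B. (if x = b then 1 else 0) *\<^sub>R x)" by simp
    then show "b \<in> ?S" by (intro CollectI exI[of _ "\<lambda>x. if x = b then 1 else 0"]) auto
  qed
  show "convex_cone ?S"
    unfolding convex_cone_iff
  proof (intro conjI ballI allI impI)
    show "0 \<in> ?S" by (auto intro!: exI[of _ "\<lambda>_. 0"])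
    fix x y assume "x \<in> ?S" "y \<in> ?S"
    then obtain c d where "x = (\<Sum>b\<in>B. c b *\<^sub>R b)" "\<forall>b\<in>B. 0 \<le> c b" "y = (\<Sum>b\<in>B. d b *\<^sub>R b)" "\<forall>b\<in>B. 0 \<le> d b"
      by auto
    then show "x + y \<in> ?S"
      by (intro CollectI exI[of _ "\<lambda>b. c b + d b"]) (auto simp: sum.distrib scaleR_add_left)
  next
    fix x and k :: real assume "x \<in> ?S" "0 \<le> k"
    then obtain c where "x = (\<Sum>b\<in>B. c b *\<^sub>R b)" "\<forall>b\<in>B. 0 \<le> c b" by auto
    then show "k *\<^sub>R x \<in> ?S"
      using \<open>0 \<le> k\<close> by (intro CollectI exI[of _ "\<lambda>b. k * c b"]) (auto simp: scaleR_sum_right)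
  qed
  fix C assume C: "B \<subseteq> C" "convex_cone C"
  show "?S \<subseteq> C"
  proof safe
    fix c assume c: "\<forall>b\<in>B. 0 \<le> (c b :: real)"
    have "(\<Sum>b\<in>I. c b *\<^sub>R b) \<in> C" if "finite I" "I \<subseteq> B" for I
      using that
      by (induction I)
         (use C c convex_cone_contains_0 convex_cone_add convex_cone_scaleR in \<open>auto intro!: convex_cone_add convex_cone_scaleR\<close>)
    then show "(\<Sum>b\<in>B. c b *\<^sub>R b) \<in> C" using assms by blast
  qed
qed

lemma cone_base: "b \<in> B \<Longrightarrow> b \<in> cone_hull B"
  by (rule hull_inc)

lemma cone_subset_span: "cone_hull B \<subseteq> span B"
  by (rule hull_minimal) (auto simp: span_superset convex_cone_span)

lemma span_cone [simp]: "span (cone_hull B) = span B"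
proof
  show "span (cone_hull B) \<subseteq> span B"
    using span_mono[OF cone_subset_span] by (simp add: span_span)
  show "span B \<subseteq> span (cone_hull B)"
    by (rule span_mono) (auto intro: cone_base)
qed

lemma dim_cone: "independent B \<Longrightarrow> dim (cone_hull B) = card B"
  by (metis dim_span span_cone dim_eq_card_independent)

lemma cone_singleton: "cone_hull {b} = {t *\<^sub>R b | t. 0 \<le> t}"
  by (subst cone_explicit) (auto intro: exI[of _ "\<lambda>_. _"])

lemma independent_coeff_unique:
  fixes B :: "'a::real_vector set"
  assumes "finite B" "independent B" "(\<Sum>b\<in>B. c b *\<^sub>R b) = (\<Sum>b\<in>B. d b *\<^sub>R b)" "b \<in> B"
  shows "c b = d b"
proof -
  have "(\<Sum>b\<in>B. (c b - d b) *\<^sub>R b) = 0"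
    using assms(3) by (simp add: scaleR_diff_left sum_subtractf)
  then show ?thesis
    using independentD[OF assms(2,1) order_refl, of "\<lambda>b. c b - d b" b] assms(4) by simp
qed

lemma sum_extend_zero:
  fixes c :: "'a::real_vector \<Rightarrow> real"
  assumes "finite B" "A \<subseteq> B"
  shows "(\<Sum>b\<in>A. c b *\<^sub>R b) = (\<Sum>b\<in>B. (if b \<in> A then c b else 0) *\<^sub>R b)"
  using assms by (intro sum.mono_neutral_cong_left) auto

lemma span_coeff_zero:
  fixes B :: "'a::real_vector set"
  assumes "finite B" "independent B" "A \<subseteq> B" "(\<Sum>b\<in>B. c b *\<^sub>R b) \<in> span A" "b \<in> B" "b \<notin> A"
  shows "c b = 0"
proof -
  have fA: "finite A" using assms finite_subset by blast
  obtain d where "(\<Sum>b\<in>B. c b *\<^sub>R b) = (\<Sum>b\<in>A. d b *\<^sub>R b)"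
    using assms(4) unfolding span_finite[OF fA] by auto
  also have "\<dots> = (\<Sum>b\<in>B. (if b \<in> A then d b else 0) *\<^sub>R b)"
    by (rule sum_extend_zero[OF assms(1,3)])
  finally show ?thesis
    using independent_coeff_unique[OF assms(1,2) _ assms(5), of c "\<lambda>b. if b \<in> A then d b else 0"] assms(6)
    by simp
qed

text \<open>Outside \<open>A\<close> the coordinates of both endpoints of a segment are nonnegative,
  and those of an interior point in \<open>cone_hull A\<close>, a weighted mean with positive
  weights, are 0; so both vanish.\<close>

lemma cone_face_subset:
  fixes B :: "'a::real_vector set"
  assumes "finite B" "independent B" "A \<subseteq> B"
  shows "cone_face (cone_hull A) (cone_hull B)"
proof -
  have "cone_hull A face_of cone_hull B"
    unfolding face_of_def
  proof (intro conjI ballI impI)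
    show "cone_hull A \<subseteq> cone_hull B" by (rule hull_mono[OF assms(3)])
    show "convex (cone_hull A)" by (rule convex_convex_cone_hull)
    fix x y z assume xyz: "x \<in> cone_hull B" "y \<in> cone_hull B" "z \<in> cone_hull A" "z \<in> open_segment x y"
    obtain c where c: "x = (\<Sum>b\<in>B. c b *\<^sub>R b)" "\<forall>b\<in>B. 0 \<le> c b"
      using xyz(1) unfolding cone_explicit[OF assms(1)] by auto
    obtain d where d: "y = (\<Sum>b\<in>B. d b *\<^sub>R b)" "\<forall>b\<in>B. 0 \<le> d b"
      using xyz(2) unfolding cone_explicit[OF assms(1)] by auto
    obtain u where u: "0 < u" "u < 1" "z = (1 - u) *\<^sub>R x + u *\<^sub>R y"
      using xyz(4) by (auto simp: in_segment)
    have "z = (\<Sum>b\<in>B. ((1 - u) * c b + u * d b) *\<^sub>R b)"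
      by (simp add: u c d scaleR_sum_right sum.distrib scaleR_add_left)
    then have z: "(1 - u) * c b + u * d b = 0" if "b \<in> B" "b \<notin> A" for b
      using span_coeff_zero[OF assms, of "\<lambda>b. (1 - u) * c b + u * d b" b] that xyz(3) cone_subset_span by auto
    have cd: "c b = 0" "d b = 0" if "b \<in> B" "b \<notin> A" for b
    proof -
      have "0 \<le> (1 - u) * c b" "0 \<le> u * d b" using c d u that by auto
      then have "(1 - u) * c b = 0" "u * d b = 0" using z[OF that] by linarith+
      then show "c b = 0" "d b = 0" using u by auto
    qed
    have fA: "finite A" using assms finite_subset by blast
    have "x = (\<Sum>b\<in>A. c b *\<^sub>R b)" "y = (\<Sum>b\<in>A. d b *\<^sub>R b)"
      unfolding c d by (rule sum.mono_neutral_right; use assms cd in auto)+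
    then show "x \<in> cone_hull A" "y \<in> cone_hull A"
      unfolding cone_explicit[OF fA] using c d assms by blast+
  qed
  then show ?thesis
    by (auto simp: cone_face_def convex_cone_hull_nonempty)
qed

text \<open>A nonzero \<open>x\<close> is interior to a segment from 0 to a far multiple of itself,
  so a face containing \<open>x\<close> contains both ends and, by convexity, everything
  between.\<close>

lemma face_scale:
  assumes "cone_face \<tau> (cone_hull B)" "x \<in> \<tau>" "0 \<le> (t::real)"
  shows "t *\<^sub>R x \<in> \<tau>"
proof -
  have f: "\<tau> face_of cone_hull B" "\<tau> \<subseteq> cone_hull B" using assms by (auto simp: cone_face_def face_of_imp_subset)
  show ?thesis
  proof (cases "x = 0 \<or> t = 1")
    case False
    have x: "x \<in> cone_hull B" using f assms by auto
    \<comment> \<open>Any multiple beyond both \<open>x\<close> and \<open>t\<close> times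
      \<open>x\<close> on the ray will do.\<close>
    define s where "s = max t 1 + 1"
    have s: "s > 1" "s > t" by (auto simp: s_def)
    have "s *\<^sub>R x \<in> cone_hull B" "t *\<^sub>R x \<in> cone_hull B" "0 \<in> cone_hull B"
      using x s assms(3) by (auto intro: convex_cone_hull_mul convex_cone_hull_contains_0)
    moreover have "x \<in> open_segment 0 (s *\<^sub>R x)"
      unfolding in_segment using False s by (auto intro!: exI[of _ "1 / s"])
    ultimately have 0: "0 \<in> \<tau>" "s *\<^sub>R x \<in> \<tau>"
      using f(1) assms(2) unfolding face_of_def by blast+
    have "convex \<tau>" using f(1) face_of_imp_convex by blast
    then have "(1 - t / s) *\<^sub>R 0 + (t / s) *\<^sub>R (s *\<^sub>R x) \<in> \<tau>"
      using 0 s assms(3) by (intro convexD) auto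
    then show ?thesis using s by simp
  qed (use assms in auto)
qed

text \<open>\<open>A\<close> collects the generators lying in the face. If a point \<open>x\<close>
  of the face has a coefficient \<open>c b > 0\<close>, then \<open>x\<close> is the midpoint of
  twice \<open>x - c b b\<close> and twice \<open>c b b\<close>, both in the cone; the face property
  then puts \<open>b\<close> into the face.\<close>

lemma cone_face_obtain:
  fixes B :: "'a::real_vector set"
  assumes "finite B" "cone_face \<tau> (cone_hull B)"
  obtains A where "A \<subseteq> B" "\<tau> = cone_hull A"
proof -
  have f: "\<tau> face_of cone_hull B" "\<tau> \<subseteq> cone_hull B" "\<tau> \<noteq> {}" "convex \<tau>"
    using assms(2) by (auto simp: cone_face_def face_of_imp_subset face_of_imp_convex)
  define A where "A = {b \<in> B. b \<in> \<tau>}"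
  have fA: "finite A" using assms by (simp add: A_def)
  have "convex_cone \<tau>"
    unfolding convex_cone_iff
  proof (intro conjI ballI allI impI)
    fix x y assume "x \<in> \<tau>" "y \<in> \<tau>"
    then have "2 *\<^sub>R ((1/2) *\<^sub>R x + (1/2) *\<^sub>R y) \<in> \<tau>"
      by (intro face_scale[OF assms(2)] convexD[OF f(4)]) auto
    then show "x + y \<in> \<tau>" by (simp add: scaleR_add_right)
  next
    obtain x where "x \<in> \<tau>" using f by blast
    then show "0 \<in> \<tau>" using face_scale[OF assms(2), of x 0] by simp
  qed (use face_scale[OF assms(2)] in auto)
  then have "cone_hull A \<subseteq> \<tau>"
    by (intro hull_minimal) (auto simp: A_def)
  moreover have "\<tau> \<subseteq> cone_hull A"
  proof
    fix x assume x: "x \<in> \<tau>"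
    obtain c where c: "x = (\<Sum>b\<in>B. c b *\<^sub>R b)" "\<forall>b\<in>B. 0 \<le> c b"
      using x f(2) unfolding cone_explicit[OF assms(1)] by auto
    have "b \<in> A" if b: "b \<in> B" "c b > 0" for b
    proof -
      define y where "y = 2 *\<^sub>R (x - c b *\<^sub>R b)"
      define z where "z = (2 * c b) *\<^sub>R b"
      have z: "z \<in> cone_hull B" unfolding z_def using b by (intro convex_cone_hull_mul cone_base) auto
      have "x - c b *\<^sub>R b = (\<Sum>a\<in>B - {b}. c a *\<^sub>R a)"
        using assms b by (simp add: c sum.remove[of B b])
      also have "\<dots> \<in> cone_hull (B - {b})"
        using c(2) by (subst cone_explicit) (use assms in auto)
      also have "\<dots> \<subseteq> cone_hull B" by (rule hull_mono) auto
      finally have y: "y \<in> cone_hull B" unfolding y_def by (intro convex_cone_hull_mul) auto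
      have mid: "x = (1 - 1/2) *\<^sub>R y + (1/2) *\<^sub>R z"
        by (simp add: y_def z_def scaleR_diff_right)
      have "z \<in> \<tau>"
      proof (cases "y = z")
        case True
        then have "x = z" using mid by (simp flip: scaleR_add_left)
        then show ?thesis using x by simp
      next
        case False
        then have "x \<in> open_segment y z" unfolding in_segment using mid by (intro conjI exI[of _ "1/2"]) auto
        then show ?thesis using f(1) x y z unfolding face_of_def by blast
      qed
      then have "(1 / (2 * c b)) *\<^sub>R z \<in> \<tau>" using b by (intro face_scale[OF assms(2)]) auto
      then show "b \<in> A" using b by (simp add: z_def A_def)
    qed
    then have "x = (\<Sum>b\<in>A. c b *\<^sub>R b)"
      unfolding c(1) using assms(1) c(2)
      by (intro sum.mono_neutral_right) (auto simp: A_def less_le)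
    then show "x \<in> cone_hull A"
      unfolding cone_explicit[OF fA] using c(2) by (auto simp: A_def)
  qed
  ultimately have "\<tau> = cone_hull A" by (rule equalityI[rotated])
  then show thesis by (rule that[rotated]) (auto simp: A_def)
qed

section \<open>Lattice bases, integral dual coordinates and primitive vectors\<close>

lemma lattice_basis_closed: "lattice_basis N B \<Longrightarrow> add_closed N"
proof -
  assume "lattice_basis N B"
  then have N: "N = {\<Sum>b\<in>B. of_int (c b) *\<^sub>R b | c. True}" by (simp add: lattice_basis_def)
  show ?thesis
    unfolding add_closed_def
  proof (intro conjI ballI)
    show "0 \<in> N" unfolding N by (auto intro!: exI[of _ "\<lambda>_. 0"])
    fix x y assume "x \<in> N" "y \<in> N"
    then obtain c d where "x = (\<Sum>b\<in>B. of_int (c b) *\<^sub>R b)" "y = (\<Sum>b\<in>B. of_int (d b) *\<^sub>R b)"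
      unfolding N by auto
    then show "x - y \<in> N"
      unfolding N by (auto intro!: exI[of _ "\<lambda>b. c b - d b"] simp: sum_subtractf scaleR_diff_left)
  qed
qed

lemma lattice_coordinate:
  assumes "lattice_basis N B"
  obtains l where "\<And>b. b \<in> B \<Longrightarrow> linear (l b :: 'a::real_vector \<Rightarrow> real)" "\<And>b x. b \<in> B \<Longrightarrow> x \<in> N \<Longrightarrow> l b x \<in> \<int>"
    "\<And>b. b \<in> B \<Longrightarrow> l b b = 1" "\<And>b b'. b \<in> B \<Longrightarrow> b' \<in> B \<Longrightarrow> b' \<noteq> b \<Longrightarrow> l b b' = 0"
    "\<And>x. x \<in> N \<Longrightarrow> x = (\<Sum>b\<in>B. l b x *\<^sub>R b)"
proof -
  have B: "finite B" "independent B" "N = {\<Sum>b\<in>B. of_int (c b) *\<^sub>R b | c. True}"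
    using assms by (auto simp: lattice_basis_def)
  have "\<exists>l. linear l \<and> (\<forall>b'\<in>B. l b' = (if b' = b then 1 else 0 :: real))" for b
    using linear_independent_extend[OF B(2), of "\<lambda>b'. if b' = b then 1 else 0 :: real"] by blast
  then obtain l where l: "\<And>b. linear (l b)" "\<And>b b'. b' \<in> B \<Longrightarrow> l b b' = (if b' = b then 1 else 0 :: real)"
    by metis
  have co: "l b (\<Sum>b\<in>B. of_int (c b) *\<^sub>R b) = of_int (c b)" if "b \<in> B" for b c
  proof -
    have "l b (\<Sum>b'\<in>B. of_int (c b') *\<^sub>R b') = (\<Sum>b'\<in>B. of_int (c b') * (if b' = b then 1 else 0))"
      using l by (simp add: linear_sum linear_cmul)
    then show ?thesis using that B(1) by (simp add: if_distrib cong: if_cong)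
  qed
  show thesis
  proof (rule that[of l])
    show "l b x \<in> \<int>" if "b \<in> B" "x \<in> N" for b x
      using that co unfolding B(3) by auto
    show "x = (\<Sum>b\<in>B. l b x *\<^sub>R b)" if "x \<in> N" for x
      using that co unfolding B(3) by auto
  qed (use l in auto)
qed

text \<open>Dual coordinates exist over the rationals; their denominators are cleared while the
  vectors are added one at a time, keeping one common diagonal value \<open>m\<close>.\<close>

lemma integral_dual_family:
  fixes A :: "'a::real_vector set"
  assumes "lattice_basis N B" "finite A" "A \<subseteq> N" "independent A"
  shows "\<exists>(m::int) l. m \<ge> 1 \<and> (\<forall>a\<in>A. linear (l a :: 'a \<Rightarrow> real) \<and> (\<forall>x\<in>N. l a x \<in> \<int>) \<and> l a a = of_int m \<and>
    (\<forall>a'\<in>A. a' \<noteq> a \<longrightarrow> l a a' = 0))"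
  using assms(2-4)
proof (induction A)
  case empty
  then show ?case by (auto intro: exI[of _ 1])
next
  case (insert a A)
  obtain lam where lam: "\<And>b. b \<in> B \<Longrightarrow> linear (lam b :: 'a \<Rightarrow> real)" "\<And>b x. b \<in> B \<Longrightarrow> x \<in> N \<Longrightarrow> lam b x \<in> \<int>"
    "\<And>x. x \<in> N \<Longrightarrow> x = (\<Sum>b\<in>B. lam b x *\<^sub>R b)"
    by (rule lattice_coordinate[OF assms(1)]) (rule that; assumption)
  note N = lattice_basis_closed[OF assms(1)]
  obtain m l where m: "m \<ge> (1::int)" and ml: "\<forall>a\<in>A. linear (l a :: 'a \<Rightarrow> real) \<and> (\<forall>x\<in>N. l a x \<in> \<int>) \<and>
      l a a = of_int m \<and> (\<forall>a'\<in>A. a' \<noteq> a \<longrightarrow> l a a' = 0)"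
    using insert.IH insert.prems independent_mono[of "insert a A" A] by blast
  have l: "\<And>e. e \<in> A \<Longrightarrow> linear (l e)" "\<And>e x. e \<in> A \<Longrightarrow> x \<in> N \<Longrightarrow> l e x \<in> \<int>"
    "\<And>e. e \<in> A \<Longrightarrow> l e e = of_int m" "\<And>e e'. e \<in> A \<Longrightarrow> e' \<in> A \<Longrightarrow> e' \<noteq> e \<Longrightarrow> l e e' = 0"
    using ml by blast+
  \<comment> \<open>\<open>f\<close> is \<open>m\<close> times a projection that annihilates
    \<open>A\<close>. It sends the new vector \<open>a\<close> to a nonzero lattice vector because
    \<open>a\<close> is not in the span of \<open>A\<close>.\<close>
  define f where "f x = of_int m *\<^sub>R x - (\<Sum>e\<in>A. l e x *\<^sub>R e)" for x
  have lf: "linear f"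
    unfolding f_def[abs_def]
    by (rule linearI)
       (use l(1) in \<open>auto simp: linear_add linear_cmul scaleR_add_left sum.distrib scaleR_sum_right algebra_simps intro!: sum.cong\<close>)
  have fN: "f x \<in> N" if "x \<in> N" for x
  proof -
    have "l e x *\<^sub>R e \<in> N" if "e \<in> A" for e
      using l(2)[OF that \<open>x \<in> N\<close>] add_closed_int[OF N] insert(4) that by (elim Ints_cases) auto
    then show ?thesis unfolding f_def
      using N that by (intro add_closedD(2) add_closed_sum add_closed_int) auto
  qed
  have f0: "f e = 0" if "e \<in> A" for e
  proof -
    have "(\<Sum>e'\<in>A. l e' e *\<^sub>R e') = (\<Sum>e'\<in>{e}. l e' e *\<^sub>R e')"
      using that insert l(4) by (intro sum.mono_neutral_right) auto
    then show ?thesis using l(3)[OF that] by (simp add: f_def)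
  qed
  have "a \<notin> span A" using insert by (simp add: independent_insert)
  have "f a \<noteq> 0"
  proof
    assume "f a = 0"
    then have "of_int m *\<^sub>R a \<in> span A"
      by (simp add: f_def span_sum span_scale span_base)
    then have "(1 / of_int m) *\<^sub>R (of_int m *\<^sub>R a) \<in> span A" by (rule span_scale)
    then show False using m \<open>a \<notin> span A\<close> by simp
  qed
  have "f a \<in> N" using fN insert by auto
  have "\<exists>b\<in>B. lam b (f a) \<noteq> 0"
  proof (rule ccontr)
    assume "\<not> (\<exists>b\<in>B. lam b (f a) \<noteq> 0)"
    then have "(\<Sum>b\<in>B. lam b (f a) *\<^sub>R b) = 0" by (intro sum.neutral) auto
    then show False using lam(3)[OF \<open>f a \<in> N\<close>] \<open>f a \<noteq> 0\<close> by simp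
  qed
  then obtain b where b: "b \<in> B" "lam b (f a) \<noteq> 0" by blast
  obtain k where k: "lam b (f a) = of_int k" using lam(2)[OF b(1) \<open>f a \<in> N\<close>] by (elim Ints_cases)
  define s where "s = sgn k"
  \<comment> \<open>Some lattice coordinate is nonzero at \<open>f a\<close>; composed with
    \<open>f\<close> and with its sign adjusted, it vanishes on \<open>A\<close> and is positive at
    \<open>a\<close>.\<close>
  define g where "g x = of_int s * lam b (f x)" for x
  have lg: "linear g"
    unfolding g_def[abs_def] using lam(1)[OF b(1)] lf
    by (auto intro!: linearI simp: linear_add linear_cmul algebra_simps)
  have ga: "g a = of_int \<bar>k\<bar>" by (simp add: g_def k s_def abs_sgn mult.commute flip: of_int_mult)
  have g0: "g e = 0" if "e \<in> A" for e
    using f0[OF that] linear_0[OF lam(1)[OF b(1)]] by (simp add: g_def)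
  have gN: "g x \<in> \<int>" if "x \<in> N" for x
    using lam(2)[OF b(1) fN[OF that]] by (auto simp: g_def intro: Ints_mult)
  \<comment> \<open>All forms are scaled to the common diagonal value
    \<open>m * \<bar>k\<bar>\<close>; subtracting \<open>l e a * g x\<close> makes the old forms
    vanish at \<open>a\<close>.\<close>
  define l' where "l' e x = (if e = a then of_int m * g x else of_int \<bar>k\<bar> * l e x - l e a * g x)" for e x
  have k0: "\<bar>k\<bar> \<ge> 1" using b k by auto
  have la: "l e a \<in> \<int>" if "e \<in> A" for e using l(2) that insert by auto
  show ?case
  proof (intro exI[of _ "m * \<bar>k\<bar>"] exI[of _ l'] conjI ballI impI)
    show "1 \<le> m * \<bar>k\<bar>" using m k0 mult_mono[of 1 m 1 "\<bar>k\<bar>"] by simp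
    fix e assume e: "e \<in> insert a A"
    show "linear (l' e)"
    proof (cases "e = a")
      case False
      then have "linear (l e)" using l e by auto
      then show ?thesis using False lg unfolding l'_def[abs_def]
        by (auto intro!: linearI simp: linear_add linear_cmul algebra_simps)
    qed (use lg in \<open>auto simp: l'_def[abs_def] linear_add linear_cmul algebra_simps intro!: linearI\<close>)
    show "l' e x \<in> \<int>" if "x \<in> N" for x
      using gN[OF that] l(2)[OF _ that] la e by (auto simp: l'_def)
    show "l' e e = of_int (m * \<bar>k\<bar>)"
      using e ga g0 l(3) insert by (auto simp: l'_def)
    show "l' e e' = 0" if "e' \<in> insert a A" "e' \<noteq> e" for e'
      using e that ga g0 l(4) insert by (auto simp: l'_def)
  qed
qed

text \<open>\<open>primitive_vector\<close> is a definite description, so existence and uniqueness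
  are both at stake. The vector is a smallest nonzero lattice point of the ray, and division with
  remainder makes all other lattice points multiples of it.\<close>

lemma ray_primitive:
  assumes "free_lattice N" "rational_cone N \<rho>" "dim \<rho> = 1"
  shows "primitive_vector N \<rho> \<in> N" "primitive_vector N \<rho> \<noteq> 0" "\<rho> = cone_hull {primitive_vector N \<rho>}"
proof -
  obtain B where lb: "lattice_basis N B" using assms(1) by (auto simp: free_lattice_def)
  note N = lattice_basis_closed[OF lb]
  obtain S where S: "finite S" "S \<subseteq> N" "\<rho> = cone_hull S" and pt: "\<And>x. x \<in> \<rho> \<Longrightarrow> - x \<in> \<rho> \<Longrightarrow> x = 0"
    using assms(2) by (auto simp: rational_cone_def)
  have "\<not> S \<subseteq> {0}"
  proof
    assume "S \<subseteq> {0}"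
    then have "\<rho> \<subseteq> {0}" unfolding S(3) by (intro hull_minimal) auto
    then have e: "span \<rho> = span {}" by (metis span_insert_0 subset_singletonD)
    have "dim \<rho> = dim ({} :: 'a set)"
      by (subst (1 2) dim_span[symmetric]) (simp only: e)
    also have "\<dots> = 0" using dim_eq_card_independent[OF independent_empty] by simp
    finally show False using assms(3) by simp
  qed
  then obtain s where s: "s \<in> S" "s \<noteq> 0" by auto
  obtain Bs where Bs: "Bs \<subseteq> \<rho>" "independent Bs" "\<rho> \<subseteq> span Bs" "card Bs = 1"
    using basis_exists[of \<rho>] assms(3) by metis
  then obtain b where b: "Bs = {b}" using card_1_singletonE by blast
  have s\<rho>: "s \<in> \<rho>" using s S cone_base by blast
  then obtain k where k: "s = k *\<^sub>R b" using Bs b by (auto simp: span_singleton)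
  then have k0: "k \<noteq> 0" using s by auto
  have in\<rho>: "t *\<^sub>R s \<in> \<rho>" if "0 \<le> t" for t
    using that s\<rho> S(3) convex_cone_hull_mul by blast
  have \<rho>s: "\<exists>t\<ge>0. x = t *\<^sub>R s" if x: "x \<in> \<rho>" for x
  proof -
    obtain t where t: "x = t *\<^sub>R b" using Bs b x by (auto simp: span_singleton)
    define r where "r = t / k"
    have r: "x = r *\<^sub>R s" using k0 by (simp add: r_def t k)
    have "0 \<le> r"
    proof (rule ccontr)
      assume "\<not> 0 \<le> r"
      then have "(1 / (- r)) *\<^sub>R x \<in> \<rho>"
        using x S(3) convex_cone_hull_mul[of x S "1 / (- r)"] by auto
      then have "- s \<in> \<rho>" using \<open>\<not> 0 \<le> r\<close> r by simp
      then show False using pt[OF s\<rho>] s by blast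
    qed
    then show ?thesis using r by blast
  qed
  obtain lam where lam: "\<And>b. b \<in> B \<Longrightarrow> linear (lam b :: 'a \<Rightarrow> real)" "\<And>b x. b \<in> B \<Longrightarrow> x \<in> N \<Longrightarrow> lam b x \<in> \<int>"
    "\<And>x. x \<in> N \<Longrightarrow> x = (\<Sum>b\<in>B. lam b x *\<^sub>R b)"
    by (rule lattice_coordinate[OF lb]) (rule that; assumption)
  have sN: "s \<in> N" using s S by auto
  have "\<exists>c\<in>B. lam c s \<noteq> 0"
  proof (rule ccontr)
    assume "\<not> (\<exists>c\<in>B. lam c s \<noteq> 0)"
    then have "(\<Sum>b\<in>B. lam b s *\<^sub>R b) = 0" by (intro sum.neutral) auto
    then show False using lam(3)[OF sN] s by simp
  qed
  then obtain c where c: "c \<in> B" "lam c s \<noteq> 0" by blast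
  \<comment> \<open>The coordinate \<open>c\<close> is nonzero on the ray. Its absolute value
    measures lattice points by natural numbers, so a nonzero lattice point of least size
    exists.\<close>
  define f where "f x = nat \<lfloor>\<bar>lam c x\<bar>\<rfloor>" for x
  have f: "real (f x) = \<bar>lam c x\<bar>" if "x \<in> N" for x
    using lam(2)[OF c(1) that] by (elim Ints_cases) (simp add: f_def)
  define P where "P x \<longleftrightarrow> x \<in> \<rho> \<inter> N \<and> x \<noteq> 0" for x
  have "P s" using s\<rho> sN s by (simp add: P_def)
  then obtain e where e: "P e" "\<And>y. P y \<Longrightarrow> f e \<le> f y"
    using exists_least_iff[of "\<lambda>n. \<exists>x. P x \<and> f x = n"] by (metis not_less)
  have eN: "e \<in> N" "e \<in> \<rho>" "e \<noteq> 0" using e by (auto simp: P_def)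
  obtain te where te: "te \<ge> 0" "e = te *\<^sub>R s" using \<rho>s eN by blast
  then have te0: "te > 0" using eN by (cases "te = 0") auto
  have lame: "lam c e \<noteq> 0" using te te0 c linear_cmul[OF lam(1)[OF c(1)]] by simp
  have mult: "\<exists>k::nat. x = of_nat k *\<^sub>R e" if x: "x \<in> \<rho>" "x \<in> N" for x
  proof -
    obtain t where t: "t \<ge> 0" "x = t *\<^sub>R s" using \<rho>s x by blast
    define r where "r = t / te"
    have r: "r \<ge> 0" "x = r *\<^sub>R e" using t te te0 by (auto simp: r_def)
    define y where "y = x - of_int \<lfloor>r\<rfloor> *\<^sub>R e"
    have y: "y = (r - of_int \<lfloor>r\<rfloor>) *\<^sub>R e" by (simp add: y_def r(2) scaleR_diff_left)
    have "y \<in> N" unfolding y_def using x eN N by (intro add_closedD(2) add_closed_int)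
    have "y = ((r - of_int \<lfloor>r\<rfloor>) * te) *\<^sub>R s" by (simp add: y te)
    then have "y \<in> \<rho>" using in\<rho> te by simp
    have "y = 0"
    proof (rule ccontr)
      assume "y \<noteq> 0"
      then have "P y" using \<open>y \<in> N\<close> \<open>y \<in> \<rho>\<close> by (simp add: P_def)
      then have "real (f e) \<le> real (f y)" using e by simp
      then have "\<bar>lam c e\<bar> \<le> \<bar>lam c y\<bar>" using f \<open>y \<in> N\<close> eN by simp
      also have "\<bar>lam c y\<bar> = \<bar>r - of_int \<lfloor>r\<rfloor>\<bar> * \<bar>lam c e\<bar>"
        using linear_cmul[OF lam(1)[OF c(1)]] by (simp add: y abs_mult)
      also have "\<dots> < 1 * \<bar>lam c e\<bar>"
        using lame by (intro mult_strict_right_mono) (auto simp: abs_if, linarith+)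
      finally show False by simp
    qed
    then have "x = of_nat (nat \<lfloor>r\<rfloor>) *\<^sub>R e"
      using r(1) by (simp add: y_def)
    then show ?thesis by blast
  qed
  have emult: "of_nat k *\<^sub>R e \<in> \<rho> \<inter> N" for k
    using in\<rho>[of "real k * te"] te add_closed_int[OF N eN(1), of "int k"] by simp
  define Q where "Q v \<longleftrightarrow> v \<in> \<rho> \<inter> N \<and> v \<noteq> 0 \<and> \<rho> \<inter> N = {of_nat k *\<^sub>R v | k :: nat. True}" for v
  have Qe: "Q e" using eN mult emult by (auto simp: Q_def)
  have "v = e" if "Q v" for v
  proof -
    have v: "v \<in> \<rho> \<inter> N" "e \<in> {of_nat k *\<^sub>R v | k :: nat. True}"
      using that eN unfolding Q_def by blast+
    then obtain k k' where k: "v = of_nat k *\<^sub>R e" "e = of_nat k' *\<^sub>R v"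
      using mult by blast
    have "real k' *\<^sub>R v = (real k' * real k) *\<^sub>R e" by (simp only: k(1) scaleR_scaleR)
    then have "e = (real k' * real k) *\<^sub>R e" using k(2) by simp
    then have "real k' * real k = 1" using eN by (metis scaleR_cancel_right scaleR_one)
    then have "k = 1" by (metis nat_mult_eq_1_iff of_nat_1 of_nat_eq_iff of_nat_mult)
    then show ?thesis using k by simp
  qed
  then have pe: "primitive_vector N \<rho> = e"
    using Qe unfolding primitive_vector_def Q_def by (intro the_equality) blast+
  show "primitive_vector N \<rho> \<in> N" "primitive_vector N \<rho> \<noteq> 0" using eN pe by auto
  have "\<rho> = {t *\<^sub>R e | t. 0 \<le> t}"
  proof (intro equalityI subsetI)
    fix x assume "x \<in> \<rho>"
    then obtain t where t: "t \<ge> 0" "x = t *\<^sub>R s" using \<rho>s by blast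
    then have "x = (t / te) *\<^sub>R e" "0 \<le> t / te" using te te0 by auto
    then show "x \<in> {t *\<^sub>R e | t. 0 \<le> t}" by blast
  next
    fix x assume "x \<in> {t *\<^sub>R e | t. 0 \<le> t}"
    then obtain t where "0 \<le> t" "x = t *\<^sub>R e" by auto
    then show "x \<in> \<rho>" using in\<rho>[of "t * te"] te by simp
  qed
  then show "\<rho> = cone_hull {primitive_vector N \<rho>}" unfolding pe cone_singleton .
qed

section \<open>Rays and faces of a simplicial rational fan\<close>

locale simplicial_rational_fan =
  fixes N :: "'a::real_vector set" and \<Sigma> :: "'a set set"
  assumes lattice: "free_lattice N" and fan: "fan N \<Sigma>" and simplicial: "simplicial_fan \<Sigma>"
begin

abbreviation gens :: "'a set \<Rightarrow> 'a set" where
  "gens \<sigma> \<equiv> primitive_vector N ` rays \<sigma>"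

lemma fan_face: "\<sigma> \<in> \<Sigma> \<Longrightarrow> cone_face \<tau> \<sigma> \<Longrightarrow> \<tau> \<in> \<Sigma>"
  using fan by (auto simp: fan_def)

text \<open>There are \<open>dim \<sigma>\<close> generating rays in \<open>R\<close>, so their
  primitive vectors are independent; by the description of faces every ray of
  \<open>\<sigma>\<close> then belongs to \<open>R\<close>. Cones are thus encoded by finite
  independent sets and their faces by subsets.\<close>

lemma gens:
  assumes "\<sigma> \<in> \<Sigma>"
  shows "finite (gens \<sigma>)" "independent (gens \<sigma>)" "cone_hull (gens \<sigma>) = \<sigma>" "gens \<sigma> \<subseteq> N"
    and gens_face: "\<And>A. A \<subseteq> gens \<sigma> \<Longrightarrow> cone_hull A \<in> \<Sigma> \<and> gens (cone_hull A) = A"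
proof -
  let ?p = "primitive_vector N"
  have ray: "?p \<rho> \<in> N" "?p \<rho> \<noteq> 0" "\<rho> = cone_hull {?p \<rho>}" if "\<rho> \<in> rays \<sigma>" for \<rho>
  proof -
    have "\<rho> \<in> \<Sigma>" using that fan_face[OF assms] by (simp add: rays_def)
    then have "rational_cone N \<rho>" "dim \<rho> = 1" using fan that by (auto simp: fan_def rays_def)
    then show "?p \<rho> \<in> N" "?p \<rho> \<noteq> 0" "\<rho> = cone_hull {?p \<rho>}"
      using ray_primitive[OF lattice] by blast+
  qed
  obtain R where R: "R \<subseteq> rays \<sigma>" "finite R" "card R = dim \<sigma>" "\<sigma> = cone_hull (\<Union>R)"
    using simplicial assms unfolding simplicial_fan_def by blast
  define B where "B = ?p ` R"
  have fB: "finite B" using R by (simp add: B_def)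
  have inj: "inj_on ?p R" by (rule inj_onI) (use ray R in \<open>metis subsetD\<close>)
  have "\<Union>R \<subseteq> cone_hull B"
  proof
    fix x assume "x \<in> \<Union>R"
    then obtain \<rho> where \<rho>: "\<rho> \<in> R" "x \<in> \<rho>" by auto
    then have "x \<in> cone_hull {?p \<rho>}" using ray(3) R by blast
    also have "\<dots> \<subseteq> cone_hull B" using \<rho> by (intro hull_mono) (auto simp: B_def)
    finally show "x \<in> cone_hull B" .
  qed
  then have "\<sigma> \<subseteq> cone_hull B" unfolding R(4) by (intro hull_minimal convex_cone_convex_cone_hull)
  moreover have "cone_hull B \<subseteq> \<sigma>"
  proof -
    have "?p \<rho> \<in> \<rho>" if "\<rho> \<in> R" for \<rho>
      using ray(3)[of \<rho>] R that cone_base[of "?p \<rho>" "{?p \<rho>}"] by blast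
    then have "B \<subseteq> \<Union>R" by (auto simp: B_def)
    then show ?thesis unfolding R(4) by (rule hull_mono)
  qed
  ultimately have \<sigma>: "\<sigma> = cone_hull B" by auto
  have cB: "card B = dim \<sigma>" using R inj by (simp add: B_def card_image)
  have iB: "independent B"
  proof -
    obtain B' where B': "B' \<subseteq> B" "independent B'" "B \<subseteq> span B'"
      using maximal_independent_subset by blast
    have "card B' = dim B" using basis_card_eq_dim[OF B'(1,3,2)] .
    also have "\<dots> = dim \<sigma>" by (metis \<sigma> dim_span span_cone)
    finally have "B' = B" using cB B'(1) fB by (metis card_subset_eq)
    then show ?thesis using B' by simp
  qed
  have rs: "rays \<sigma> = R"
  proof (intro equalityI subsetI R(1)[THEN subsetD])
    fix \<rho> assume \<rho>: "\<rho> \<in> rays \<sigma>"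
    then obtain A where A: "A \<subseteq> B" "\<rho> = cone_hull A"
      using cone_face_obtain[OF fB, of \<rho>] \<sigma> by (auto simp: rays_def)
    then have "card A = 1"
      using \<rho> dim_cone[of A] independent_mono[OF iB A(1)] by (simp add: rays_def)
    then obtain b where b: "A = {b}" using card_1_singletonE by blast
    then obtain \<rho>' where \<rho>': "\<rho>' \<in> R" "b = ?p \<rho>'" using A by (auto simp: B_def)
    then have "\<rho>' = cone_hull {b}" using ray(3)[of \<rho>'] R by auto
    then show "\<rho> \<in> R" using \<rho>' A b by simp
  qed
  then have gB: "gens \<sigma> = B" by (simp add: B_def)
  show "finite (gens \<sigma>)" "independent (gens \<sigma>)" "cone_hull (gens \<sigma>) = \<sigma>"
    using fB iB \<sigma> gB by auto
  show "gens \<sigma> \<subseteq> N" using ray by auto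
  fix A assume "A \<subseteq> gens \<sigma>"
  then have A: "A \<subseteq> B" using gB by simp
  have f: "cone_face (cone_hull A) \<sigma>" unfolding \<sigma> by (rule cone_face_subset[OF fB iB A])
  have fA: "finite A" using A fB finite_subset by blast
  have iA: "independent A" using independent_mono[OF iB A] .
  have sub: "rays (cone_hull A) = (\<lambda>a. cone_hull {a}) ` A"
  proof (intro equalityI subsetI)
    fix \<rho> assume \<rho>: "\<rho> \<in> rays (cone_hull A)"
    then obtain A' where A': "A' \<subseteq> A" "\<rho> = cone_hull A'"
      using cone_face_obtain[OF fA, of \<rho>] by (auto simp: rays_def)
    then have "card A' = 1"
      using \<rho> dim_cone[of A'] independent_mono[OF iA A'(1)] by (simp add: rays_def)
    then show "\<rho> \<in> (\<lambda>a. cone_hull {a}) ` A" using A' card_1_singletonE by blast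
  next
    fix \<rho> assume "\<rho> \<in> (\<lambda>a. cone_hull {a}) ` A"
    then obtain a where a: "a \<in> A" "\<rho> = cone_hull {a}" by auto
    then have "independent {a}" using independent_mono[OF iA, of "{a}"] by simp
    then show "\<rho> \<in> rays (cone_hull A)"
      using a cone_face_subset[OF fA iA, of "{a}"] dim_cone[of "{a}"] by (simp add: rays_def)
  qed
  have "?p (cone_hull {a}) = a" if a: "a \<in> A" for a
  proof -
    obtain \<rho> where "\<rho> \<in> R" "a = ?p \<rho>" using a A unfolding B_def by blast
    then show ?thesis using ray(3)[of \<rho>] R by auto
  qed
  then show "cone_hull A \<in> \<Sigma> \<and> gens (cone_hull A) = A"
    using fan_face[OF assms f] by (force simp: sub image_image)
qed

lemma cone_face_iff:
  assumes "\<tau> \<in> \<Sigma>" "\<sigma> \<in> \<Sigma>"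
  shows "cone_face \<tau> \<sigma> \<longleftrightarrow> gens \<tau> \<subseteq> gens \<sigma>"
proof
  assume "cone_face \<tau> \<sigma>"
  then obtain A where "A \<subseteq> gens \<sigma>" "\<tau> = cone_hull A"
    using cone_face_obtain[OF gens(1)[OF assms(2)], of \<tau>] gens(3)[OF assms(2)] by auto
  then show "gens \<tau> \<subseteq> gens \<sigma>" using gens_face[OF assms(2)] by blast
next
  assume "gens \<tau> \<subseteq> gens \<sigma>"
  then show "cone_face \<tau> \<sigma>"
    using cone_face_subset[OF gens(1,2)[OF assms(2)], of "gens \<tau>"] gens(3) assms by simp
qed

lemma dim_gens: "\<sigma> \<in> \<Sigma> \<Longrightarrow> dim \<sigma> = card (gens \<sigma>)"
  using dim_cone[OF gens(2)] gens(3) by metis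

text \<open>Each cone has dual forms with a diagonal value \<open>m B\<close> of its own;
  multiplication by the values of the other cones gives the product \<open>M\<close> for all. In a
  unimodular fan the vectors of a cone extend to a lattice basis, whose coordinates have
  \<open>m B = 1\<close>.\<close>

lemma exists_toric_model:
  "\<exists>idx M ell. toric_model N (gens ` \<Sigma>) idx M ell \<and> (unimodular_fan N \<Sigma> \<longrightarrow> M = 1)"
proof -
  let ?\<Delta> = "gens ` \<Sigma>"
  obtain B0 where B0: "lattice_basis N B0" using lattice by (auto simp: free_lattice_def)
  have "finite \<Sigma>" using fan by (auto simp: fan_def)
  then have fU: "finite (\<Union>?\<Delta>)" using gens(1) by auto
  obtain idx :: "'a \<Rightarrow> nat" where idx: "inj_on idx (\<Union>?\<Delta>)"
    using finite_imp_inj_to_nat_seg[OF fU] by blast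
  define P where "P B m l \<longleftrightarrow> m \<ge> (1::int) \<and> (unimodular_fan N \<Sigma> \<longrightarrow> m = 1) \<and>
    (\<forall>a\<in>B. linear (l a :: 'a \<Rightarrow> real) \<and> (\<forall>x\<in>N. l a x \<in> \<int>) \<and> l a a = of_int m \<and>
    (\<forall>a'\<in>B. a' \<noteq> a \<longrightarrow> l a a' = 0))" for B m l
  have "\<exists>m l. P B m l" if B: "B \<in> ?\<Delta>" for B
  proof (cases "unimodular_fan N \<Sigma>")
    case True
    then obtain B' where B': "lattice_basis N B'" "B \<subseteq> B'" using B unfolding unimodular_fan_def by blast
    obtain l where "\<And>b. b \<in> B' \<Longrightarrow> linear (l b :: 'a \<Rightarrow> real)" "\<And>b x. b \<in> B' \<Longrightarrow> x \<in> N \<Longrightarrow> l b x \<in> \<int>"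
      "\<And>b. b \<in> B' \<Longrightarrow> l b b = 1" "\<And>b b'. b \<in> B' \<Longrightarrow> b' \<in> B' \<Longrightarrow> b' \<noteq> b \<Longrightarrow> l b b' = 0"
      by (rule lattice_coordinate[OF B'(1)]) (rule that; assumption)
    then show ?thesis using B'(2) by (intro exI[of _ 1] exI[of _ l]) (simp add: P_def subset_iff)
  next
    case False
    obtain \<sigma> where \<sigma>: "\<sigma> \<in> \<Sigma>" "B = gens \<sigma>" using B by blast
    have "finite B" "B \<subseteq> N" "independent B" unfolding \<sigma>(2) by (rule gens[OF \<sigma>(1)])+
    from integral_dual_family[OF B0 this] show ?thesis using False unfolding P_def by blast
  qed
  then have "\<forall>B\<in>?\<Delta>. \<exists>ml. P B (fst ml) (snd ml)" by simp
  from bchoice[OF this] obtain f where f: "\<forall>B\<in>?\<Delta>. P B (fst (f B)) (snd (f B))" by blast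
  define m where "m B = fst (f B)" for B
  define l where "l B = snd (f B)" for B
  have P: "P B (m B) (l B)" if "B \<in> ?\<Delta>" for B using bspec[OF f that] by (simp add: m_def l_def)
  have m: "\<And>B. B \<in> ?\<Delta> \<Longrightarrow> m B \<ge> (1::int)" "\<And>B. B \<in> ?\<Delta> \<Longrightarrow> unimodular_fan N \<Sigma> \<Longrightarrow> m B = 1"
    using P unfolding P_def by blast+
  have l: "linear (l B a)" "x \<in> N \<Longrightarrow> l B a x \<in> \<int>" "l B a a = of_int (m B)"
    "a' \<in> B \<Longrightarrow> a' \<noteq> a \<Longrightarrow> l B a a' = 0" if "B \<in> ?\<Delta>" "a \<in> B" for B a a' x
    using P[OF that(1)] that(2) unfolding P_def by blast+
  have f\<Delta>: "finite ?\<Delta>" using \<open>finite \<Sigma>\<close> by simp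
  define M where "M = (\<Prod>B\<in>?\<Delta>. m B)"
  define r where "r B = (\<Prod>B'\<in>?\<Delta> - {B}. m B')" for B
  have r: "m B * r B = M" if "B \<in> ?\<Delta>" for B
    using f\<Delta> that by (simp add: M_def r_def prod.remove)
  define ell where "ell B b x = of_int (r B) * l B b x" for B b x
  have "toric_model N ?\<Delta> idx M ell"
  proof (rule toric_model.intro)
    show "add_closed N" by (rule lattice_basis_closed[OF B0])
    show "finite B" "B \<subseteq> N" if B: "B \<in> ?\<Delta>" for B
    proof -
      obtain \<sigma> where \<sigma>: "\<sigma> \<in> \<Sigma>" "B = gens \<sigma>" using B by blast
      show "finite B" "B \<subseteq> N" unfolding \<sigma>(2) by (rule gens[OF \<sigma>(1)])+
    qed
    show "A \<in> ?\<Delta>" if "B \<in> ?\<Delta>" "A \<subseteq> B" for A B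
      using that gens_face by (metis (no_types, lifting) imageE imageI)
    show "1 \<le> M" unfolding M_def using m by (intro prod_ge_1) auto
    show "linear (ell B b)" if "B \<in> ?\<Delta>" "b \<in> B" for B b
      unfolding ell_def[abs_def] using l(1)[OF that]
      by (auto intro!: linearI simp: linear_add linear_cmul algebra_simps)
    show "ell B b b = of_int M" if "B \<in> ?\<Delta>" "b \<in> B" for B b
      using l(3)[OF that] r[OF that(1)] by (simp add: ell_def mult.commute flip: of_int_mult)
  qed (use f\<Delta> idx l(2,4) in \<open>simp_all add: ell_def\<close>)
  moreover have "M = 1" if "unimodular_fan N \<Sigma>"
    using m(2) that by (simp add: M_def)
  ultimately show ?thesis by blast
qed

end

section \<open>Orientations\<close>

locale toric_fan = simplicial_rational_fan N \<Sigma> + toric_model N "(`) (primitive_vector N) ` rays ` \<Sigma>" idx M ell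
  for N :: "'a::real_vector set" and \<Sigma> idx M ell
begin

abbreviation \<Delta> :: "'a set set" where
  "\<Delta> \<equiv> (`) (primitive_vector N) ` rays ` \<Sigma>"

lemma \<Delta>_iff: "B \<in> \<Delta> \<longleftrightarrow> cone_hull B \<in> \<Sigma> \<and> gens (cone_hull B) = B"
proof
  assume "B \<in> \<Delta>"
  then obtain \<sigma> where \<sigma>: "\<sigma> \<in> \<Sigma>" "B = gens \<sigma>" by blast
  then show "cone_hull B \<in> \<Sigma> \<and> gens (cone_hull B) = B" using gens(3) by simp
next
  assume "cone_hull B \<in> \<Sigma> \<and> gens (cone_hull B) = B"
  then show "B \<in> \<Delta>" by (metis imageI)
qed

lemma cone_\<Delta>: "B \<in> \<Delta> \<Longrightarrow> cone_hull B \<in> \<Sigma>" "B \<in> \<Delta> \<Longrightarrow> gens (cone_hull B) = B"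
  using \<Delta>_iff by auto

lemma gens_\<Delta>: "\<sigma> \<in> \<Sigma> \<Longrightarrow> gens \<sigma> \<in> \<Delta>"
  by auto

lemma dim_\<Delta>: "B \<in> \<Delta> \<Longrightarrow> dim (cone_hull B) = card B"
  using dim_gens[OF cone_\<Delta>(1)] cone_\<Delta>(2) by simp

lemma NL_cone [simp]: "cone_lattice N (cone_hull B) = NL B"
  by (simp add: cone_lattice_def)

lemma face_\<Delta>: "A \<in> \<Delta> \<Longrightarrow> B \<in> \<Delta> \<Longrightarrow> cone_face (cone_hull A) (cone_hull B) \<longleftrightarrow> A \<subseteq> B"
  using cone_face_iff[OF cone_\<Delta>(1) cone_\<Delta>(1)] cone_\<Delta>(2) by simp

lemma rel_lattice_cone: "rel_lattice N (cone_hull B) (cone_hull A) = additive_group (NL B) Mod NL A"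
  by (simp add: rel_lattice_def)

lemma quot_lattice_cone: "quot_lattice N (cone_hull A) = additive_group N Mod NL A"
  by (simp add: quot_lattice_def)

lemma pair_rel: "A \<subseteq> B \<Longrightarrow> lattice_pair (NL B) (NL A)"
  by unfold_locales (use NL_closed NL_mono in auto)

lemma pair_quot: "lattice_pair N (NL A)"
  by unfold_locales (use NL_closed N NL_sub in auto)

lemma lattice_proj_coset:
  assumes "A \<subseteq> A'"
  shows "lattice_proj N (cone_hull A') (coset (NL A) x) = coset (NL A') x"
proof -
  have "NL A \<subseteq> NL A'" by (rule NL_mono[OF assms])
  note c = add_closedD[OF NL_closed[of A']]
  show ?thesis
  proof (intro equalityI subsetI)
    fix y assume "y \<in> lattice_proj N (cone_hull A') (coset (NL A) x)"
    then obtain t t' where "t' \<in> NL A'" "t \<in> NL A" "y = t' + (t + x)"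
      by (auto simp: lattice_proj_def set_mult_def coset_def additive_group_def)
    moreover from this have "t' + t \<in> NL A'" using c(4) \<open>NL A \<subseteq> NL A'\<close> by blast
    ultimately show "y \<in> coset (NL A') x"
      unfolding coset_def by (intro image_eqI[of _ _ "t' + t"]) (auto simp: add.assoc)
  next
    fix y assume "y \<in> coset (NL A') x"
    then obtain t where t: "t \<in> NL A'" "y = t + x" by (auto simp: coset_def)
    moreover have "x \<in> coset (NL A) x" by (rule coset_self[OF NL_closed])
    ultimately show "y \<in> lattice_proj N (cone_hull A') (coset (NL A) x)"
      unfolding lattice_proj_def set_mult_def NL_cone additive_group_def by auto
  qed
qed

end

lemma (in lattice_pair) coset_pow:
  assumes "x \<in> L"
  shows "coset T x [^]\<^bsub>G\<^esub> (k::int) = coset T (of_int k *\<^sub>R x)"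
proof (induction k rule: int_induct[where k=0])
  case base
  then show ?case by (simp add: one_G)
next
  case (step1 i)
  then show ?case
    using assms carrier_G by (simp add: G.int_pow_mult mult_G scaleR_add_left)
next
  case (step2 i)
  have "coset T x [^]\<^bsub>G\<^esub> (i - 1) = coset T x [^]\<^bsub>G\<^esub> i \<otimes>\<^bsub>G\<^esub> inv\<^bsub>G\<^esub> (coset T x)"
    using assms carrier_G G.int_pow_diff[of "coset T x" i 1] by simp
  then show ?case
    using step2 by (simp add: inv_G[OF assms] mult_G scaleR_diff_left)
qed

section \<open>Lattice normals of facets\<close>

context toric_fan
begin

text \<open>\<open>n\<close> lifts the generator \<open>e^\<tau>_\<sigma>\<close> for the facet
  without \<open>b\<close>, and \<open>c\<close> measures how far the primitive vector
  \<open>b\<close> is from being such a lift.\<close>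

definition nrm_spec :: "'a set \<Rightarrow> 'a \<Rightarrow> 'a \<Rightarrow> int \<Rightarrow> bool" where
  "nrm_spec B b n c \<longleftrightarrow> n \<in> NL B \<and> c \<ge> 1 \<and> of_int c *\<^sub>R n - b \<in> NL (B - {b}) \<and> (M = 1 \<longrightarrow> c = 1) \<and>
     (\<forall>x\<in>NL B. \<exists>k::int. x - of_int k *\<^sub>R n \<in> NL (B - {b})) \<and>
     normal_gen N (cone_hull (B - {b})) (cone_hull B) = coset (NL (B - {b})) n"

text \<open>On \<open>NL B\<close> the form \<open>li B b\<close> has kernel
  \<open>NL (B - {b})\<close>. By division with remainder, a vector \<open>n\<close> with the least
  positive value \<open>g\<close> generates the quotient. The value of the form at \<open>b\<close>
  is \<open>M\<close>, a multiple \<open>e g\<close> of \<open>g\<close>, and \<open>e\<close> is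
  the required factor.\<close>

lemma nrm_exists:
  assumes B: "B \<in> \<Delta>" "b \<in> B"
  shows "\<exists>n c. nrm_spec B b n c"
proof -
  let ?A = "B - {b}"
  note c = NL_closed[of B]
  have bL: "b \<in> NL B" by (rule NL_base[OF B])
  have liN: "of_int (li B b x) = ell B b x" if "x \<in> NL B" for x
    using li[OF B] that NL_sub by blast
  have lin: "linear (ell B b)" by (rule ell_linear[OF B])
  define P where "P k \<longleftrightarrow> k > 0 \<and> (\<exists>x\<in>NL B. li B b x = int k)" for k
  have "P (nat M)" using bL li_self[OF B] M by (auto simp: P_def intro!: bexI[of _ b])
  then obtain g where g: "P g" "\<And>k. k < g \<Longrightarrow> \<not> P k"
    using exists_least_iff[of P] by blast
  then obtain n where n: "n \<in> NL B" "li B b n = int g" "g > 0" by (auto simp: P_def)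
  have gen: "\<exists>k. li B b x = k * int g \<and> x - of_int k *\<^sub>R n \<in> NL ?A" if x: "x \<in> NL B" for x
  proof -
    define k where "k = li B b x div int g"
    define y where "y = x - of_int k *\<^sub>R n"
    have y: "y \<in> NL B" unfolding y_def by (intro add_closedD(2)[OF c] add_closed_int[OF c] x n)
    have "of_int (li B b y) = (of_int (li B b x mod int g) :: real)"
      using liN[OF x] liN[OF n(1)] liN[OF y] n(2) lin
      by (simp add: y_def linear_diff linear_cmul k_def minus_mult_div_eq_mod flip: of_int_mult of_int_diff)
         (metis minus_div_mult_eq_mod of_int_diff of_int_mult of_int_of_nat_eq)
    then have ly: "li B b y = li B b x mod int g" by simp
    have r: "0 \<le> li B b y" "li B b y < int g" using ly n(3) by auto
    have "li B b y = 0"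
    proof (rule ccontr)
      assume "li B b y \<noteq> 0"
      then have "P (nat (li B b y))" using r y by (auto simp: P_def intro!: bexI[of _ y])
      then show False using g(2)[of "nat (li B b y)"] r by simp
    qed
    then have "ell B b y = 0" using liN[OF y] by simp
    then have "y \<in> NL ?A"
      using span_remove[OF B, of y] y by (auto simp: cone_lattice_def)
    moreover have "li B b x = k * int g"
      using ly \<open>li B b y = 0\<close> div_mult_mod_eq[of "li B b x" "int g"] by (simp add: k_def)
    ultimately show ?thesis by (auto simp: y_def)
  qed
  obtain e where e: "M = e * int g" "b - of_int e *\<^sub>R n \<in> NL ?A"
    using gen[OF bL] li_self[OF B] by auto
  have e1: "e \<ge> 1" using e(1) M n(3) by (simp add: zero_less_mult_iff int_one_le_iff_zero_less)
  have e2: "of_int e *\<^sub>R n - b \<in> NL ?A"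
    using add_closedD(3)[OF NL_closed e(2)] by simp
  have eM: "e = 1" if "M = 1" using e(1) e1 that by (simp add: zmult_eq_1_iff)
  interpret Q: lattice_pair "NL B" "NL ?A" by (rule pair_rel) auto
  let ?X = "coset (NL ?A) n" and ?R = "rel_lattice N (cone_hull B) (cone_hull ?A)"
  have R: "?R = Q.G" by (rule rel_lattice_cone)
  have "normal_gen N (cone_hull ?A) (cone_hull B) = ?X"
    unfolding normal_gen_def R
  proof (rule the_equality)
    have Xc: "?X \<in> carrier Q.G" using n Q.carrier_G by auto
    have "carrier Q.G \<subseteq> generate Q.G {?X}"
    proof
      fix Y assume "Y \<in> carrier Q.G"
      then obtain x where x: "x \<in> NL B" "Y = coset (NL ?A) x" using Q.carrier_G by auto
      obtain k where "x - of_int k *\<^sub>R n \<in> NL ?A" using gen[OF x(1)] by auto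
      then have "Y = ?X [^]\<^bsub>Q.G\<^esub> k"
        using x(2) by (simp add: Q.coset_pow[OF n(1)] coset_eq_iff[OF NL_closed])
      then show "Y \<in> generate Q.G {?X}" using Q.G.generate_pow[OF Xc] by auto
    qed
    moreover have "generate Q.G {?X} \<subseteq> carrier Q.G" using Xc Q.G.generate_in_carrier by blast
    moreover have "\<exists>n\<in>?X. \<exists>s\<in>cone_hull B. s - n \<in> span (cone_hull ?A)"
    proof (intro bexI)
      show "n \<in> ?X" by (rule coset_self[OF NL_closed])
      show "(1 / of_int e) *\<^sub>R b \<in> cone_hull B"
        using e1 B by (intro convex_cone_hull_mul cone_base) auto
      have "- (1 / of_int e) *\<^sub>R (of_int e *\<^sub>R n - b) \<in> span ?A"
        using e2 by (intro span_scale) (simp add: cone_lattice_def)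
      then show "(1 / of_int e) *\<^sub>R b - n \<in> span (cone_hull ?A)"
        using e1 by (simp add: scaleR_diff_right)
    qed
    ultimately show "?X \<in> carrier Q.G \<and> generate Q.G {?X} = carrier Q.G \<and>
        (\<exists>n\<in>?X. \<exists>s\<in>cone_hull B. s - n \<in> span (cone_hull ?A))"
      using Xc by blast
  next
    fix Y assume Y: "Y \<in> carrier Q.G \<and> generate Q.G {Y} = carrier Q.G \<and>
        (\<exists>n\<in>Y. \<exists>s\<in>cone_hull B. s - n \<in> span (cone_hull ?A))"
    then obtain y where y: "y \<in> NL B" "Y = coset (NL ?A) y" using Q.carrier_G by auto
    have "?X \<in> generate Q.G {Y}" using Y n Q.carrier_G by auto
    then obtain k where "?X = Y [^]\<^bsub>Q.G\<^esub> (k::int)" using Q.G.generate_pow[of Y] Y by auto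
    then have k: "n - of_int k *\<^sub>R y \<in> NL ?A"
      by (simp add: y(2) Q.coset_pow[OF y(1)] coset_eq_iff[OF NL_closed])
    obtain k' where k': "li B b y = k' * int g" "y - of_int k' *\<^sub>R n \<in> NL ?A" using gen[OF y(1)] by auto
    have z: "ell B b x = 0" if "x \<in> span ?A" for x
      using ell_zero[OF B, of ?A x] that by simp
    have "ell B b n = of_int k * ell B b y"
      using z[of "n - of_int k *\<^sub>R y"] k lin by (simp add: cone_lattice_def linear_diff linear_cmul)
    then have "real_of_int (int g) = of_int k * of_int (k' * int g)"
      using liN[OF n(1)] liN[OF y(1)] n k' by simp
    then have "int g = k * (k' * int g)" by (simp only: of_int_mult[symmetric] of_int_eq_iff)
    then have kk: "k * k' = 1" using n(3) by simp
    \<comment> \<open>Another generator could only be the opposite one. A point of the cone in its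
      class forces a nonnegative value of \<open>ell B b\<close>, which excludes this.\<close>
    obtain y' s where s: "y' \<in> Y" "s \<in> cone_hull B" "s - y' \<in> span ?A" using Y by auto
    then obtain t where t: "t \<in> NL ?A" "y' = t + y" by (auto simp: y coset_def)
    obtain f where f: "s = (\<Sum>b\<in>B. f b *\<^sub>R b)" "\<forall>b\<in>B. 0 \<le> f b"
      using s(2) unfolding cone_explicit[OF fin[OF B(1)]] by auto
    have "ell B b s = (\<Sum>b'\<in>B. f b' * ell B b b')" using lin by (simp add: f linear_sum linear_cmul)
    also have "\<dots> \<ge> 0"
      using f(2) ell_self[OF B] ell_other[OF B] M by (intro sum_nonneg) (case_tac "x = b", auto)
    finally have "0 \<le> ell B b s" .
    moreover have "ell B b s = ell B b y'" using z[OF s(3)] lin by (simp add: linear_diff)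
    moreover have "ell B b y' = ell B b y" using z[of t] t lin by (simp add: cone_lattice_def linear_add)
    ultimately have "0 \<le> k' * int g" using liN[OF y(1)] k'(1) by (metis of_int_0_le_iff)
    then have "0 \<le> k'" using n(3) by (simp add: zero_le_mult_iff)
    then have "k' = 1" using kk by (auto simp: zmult_eq_1_iff)
    then show "Y = ?X" using k'(2) y(2) by (simp add: coset_eq_iff[OF NL_closed])
  qed
  then have "nrm_spec B b n e"
    unfolding nrm_spec_def using n(1) e1 e2 eM gen by blast
  then show ?thesis by blast
qed

definition nrm :: "'a set \<Rightarrow> 'a \<Rightarrow> 'a" where
  "nrm B b = (SOME n. \<exists>c. nrm_spec B b n c)"

definition nrm_mult :: "'a set \<Rightarrow> 'a \<Rightarrow> int" where
  "nrm_mult B b = (SOME c. nrm_spec B b (nrm B b) c)"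

lemma nrm:
  assumes "B \<in> \<Delta>" "b \<in> B"
  shows "nrm B b \<in> NL B" "nrm_mult B b \<ge> 1" "of_int (nrm_mult B b) *\<^sub>R nrm B b - b \<in> NL (B - {b})" "M = 1 \<Longrightarrow> nrm_mult B b = 1"
    "x \<in> NL B \<Longrightarrow> \<exists>k::int. x - of_int k *\<^sub>R nrm B b \<in> NL (B - {b})"
    "normal_gen N (cone_hull (B - {b})) (cone_hull B) = coset (NL (B - {b})) (nrm B b)"
proof -
  have "\<exists>c. nrm_spec B b (nrm B b) c"
    unfolding nrm_def by (rule someI_ex) (rule nrm_exists[OF assms])
  then have "nrm_spec B b (nrm B b) (nrm_mult B b)"
    unfolding nrm_mult_def by (rule someI_ex)
  then show "nrm B b \<in> NL B" "nrm_mult B b \<ge> 1" "of_int (nrm_mult B b) *\<^sub>R nrm B b - b \<in> NL (B - {b})" "M = 1 \<Longrightarrow> nrm_mult B b = 1"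
    "x \<in> NL B \<Longrightarrow> \<exists>k::int. x - of_int k *\<^sub>R nrm B b \<in> NL (B - {b})"
    "normal_gen N (cone_hull (B - {b})) (cone_hull B) = coset (NL (B - {b})) (nrm B b)"
    unfolding nrm_spec_def by blast+
qed

section \<open>Flags and top exterior powers\<close>

text \<open>The normals along a descending chain of cones form a lattice basis of
  \<open>NL B\<close> modulo \<open>NL (B - set cs)\<close>, which the primitive vectors need not
  do.\<close>

fun flag :: "'a set \<Rightarrow> 'a list \<Rightarrow> 'a list" where
  "flag B [] = []"
| "flag B (c # cs) = nrm B c # flag (B - {c}) cs"

lemma flag_length [simp]: "length (flag B cs) = length cs"
  by (induction cs arbitrary: B) auto

lemma flag_NL: "B \<in> \<Delta> \<Longrightarrow> set cs \<subseteq> B \<Longrightarrow> distinct cs \<Longrightarrow> set (flag B cs) \<subseteq> NL B"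
proof (induction cs arbitrary: B)
  case (Cons c cs)
  have "set (flag (B - {c}) cs) \<subseteq> NL (B - {c})"
    using Cons.prems down[of B "B - {c}"] by (intro Cons.IH) auto
  then show ?case using nrm(1)[of B c] Cons.prems NL_mono[of "B - {c}" B] by auto
qed simp

lemma flag_append: "flag B (cs @ ds) = flag B cs @ flag (B - set cs) ds"
  by (induction cs arbitrary: B) (auto simp: Diff_insert[symmetric] Diff_insert2[symmetric])

text \<open>Every entry is a multiple of the normal plus a vector of the facet lattice. A product
  with two normals vanishes, so at most one survives, and it is moved to the front.\<close>

lemma split_normal:
  assumes B: "B \<in> \<Delta>" "b \<in> B" and v: "v \<in> frags (lsts p (NL B))"
  shows "\<exists>w\<in>frags {ys. Suc (length ys) = p \<and> set ys \<subseteq> NL (B - {b})}. \<exists>w'\<in>frags (lsts p (NL (B - {b}))).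
    v - wdg (nrm B b) w - w' \<in> rels (NL B) T"
  using v
proof (induction rule: frags_induct)
  let ?A = "B - {b}" and ?n = "nrm B b"
  have sub: "NL ?A \<subseteq> NL B" by (rule NL_mono) auto
  note cl = NL_closed[of B]
  case (of s)
  then show ?case
  proof (induction s arbitrary: p)
    case Nil
    then show ?case by (intro bexI[of _ 0] bexI[of _ "frag_of []"]) (auto simp: lsts_def)
  next
    case (Cons x xs)
    then obtain q where q: "p = Suc q" "xs \<in> lsts q (NL B)" "x \<in> NL B" by (auto simp: lsts_def)
    from Cons.IH[OF q(2)] obtain w w' where
      w: "w \<in> frags {ys. Suc (length ys) = q \<and> set ys \<subseteq> NL ?A}" and w': "w' \<in> frags (lsts q (NL ?A))"
      and r: "frag_of xs - wdg ?n w - w' \<in> rels (NL B) T" by blast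
    obtain k :: int where k: "x - of_int k *\<^sub>R ?n \<in> NL ?A" using nrm(5)[OF B q(3)] by blast
    define h where "h = x - of_int k *\<^sub>R ?n"
    have h: "h \<in> NL ?A" "h \<in> NL B" using k sub by (auto simp: h_def)
    have n: "?n \<in> NL B" by (rule nrm(1)[OF B])
    have f: "w \<in> flists (NL B)" "w' \<in> flists (NL B)"
      using w w' sub by (auto elim!: frags_mono[rotated] simp: lsts_def)
    define y where "y = wdg ?n w + w'"
    have y: "y \<in> flists (NL B)" unfolding y_def by (intro frags_add flists_wdg f n)
    have x: "x = of_int k *\<^sub>R ?n + h" by (simp add: h_def)
    have 1: "wdg x (frag_of xs - y) \<in> rels (NL B) T"
      using r by (intro rels_wdg q) (simp add: y_def algebra_simps)
    have 2: "wdg x y - wdg (of_int k *\<^sub>R ?n) y - wdg h y \<in> rels (NL B) T"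
      unfolding x by (rule rels_wdg_add) (use y h n cl in \<open>auto intro: add_closed_int\<close>)
    have 3: "wdg (of_int k *\<^sub>R ?n) y - frag_cmul k (wdg ?n y) \<in> rels (NL B) T"
      by (rule rels_wdg_scale) (use y n cl in auto)
    have 4: "frag_cmul k (wdg ?n (wdg ?n w)) \<in> rels (NL B) T"
      by (intro rels_cmul rels_wdg_twice f n)
    have 5: "wdg h (wdg ?n w) + wdg ?n (wdg h w) \<in> rels (NL B) T"
      by (intro rels_wdg_swap f n h cl)
    let ?w = "frag_cmul k w' - wdg h w" and ?w' = "wdg h w'"
    have "frag_of (x # xs) - wdg ?n ?w - ?w' =
       wdg x (frag_of xs - y) + (wdg x y - wdg (of_int k *\<^sub>R ?n) y - wdg h y)
       + (wdg (of_int k *\<^sub>R ?n) y - frag_cmul k (wdg ?n y)) + frag_cmul k (wdg ?n (wdg ?n w))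
       + (wdg h (wdg ?n w) + wdg ?n (wdg h w))"
      by (simp add: y_def)
    also have "\<dots> \<in> rels (NL B) T"
      by (intro rels_add 1 2 3 4 5)
    finally have "frag_of (x # xs) - wdg ?n ?w - ?w' \<in> rels (NL B) T" .
    moreover have "?w \<in> frags {ys. Suc (length ys) = p \<and> set ys \<subseteq> NL ?A}"
    proof (intro frags_diff frags_cmul)
      show "w' \<in> frags {ys. Suc (length ys) = p \<and> set ys \<subseteq> NL ?A}"
        using w' q by (auto simp: lsts_def)
      show "wdg h w \<in> frags {ys. Suc (length ys) = p \<and> set ys \<subseteq> NL ?A}"
        using w unfolding wdg_def by (rule frags_extend) (use h q in auto)
    qed
    moreover have "?w' \<in> frags (lsts p (NL ?A))"
      using w' unfolding wdg_def by (rule frags_extend) (use h q in \<open>auto simp: lsts_def\<close>)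
    ultimately show ?case by blast
  qed
next
  case (diff x y)
  then obtain w w' z z' where
    "w \<in> frags {ys. Suc (length ys) = p \<and> set ys \<subseteq> NL (B - {b})}" "w' \<in> frags (lsts p (NL (B - {b})))"
    "z \<in> frags {ys. Suc (length ys) = p \<and> set ys \<subseteq> NL (B - {b})}" "z' \<in> frags (lsts p (NL (B - {b})))"
    "x - wdg (nrm B b) w - w' \<in> rels (NL B) T" "y - wdg (nrm B b) z - z' \<in> rels (NL B) T"
    by blast
  moreover have "x - y - wdg (nrm B b) (w - z) - (w' - z') =
     (x - wdg (nrm B b) w - w') - (y - wdg (nrm B b) z - z')" by simp
  ultimately show ?case
    by (intro bexI[of _ "w - z"] bexI[of _ "w' - z'"]) (auto intro: frags_diff rels_diff simp only:)
qed (auto intro!: bexI[of _ 0])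

text \<open>Iterating \<open>split_normal\<close> uses each normal of the flag once. The two claims
  need each other: in top degree the summand \<open>w'\<close> without the normal exceeds the rank
  left in the facet, so the second claim for the facet removes it.\<close>

lemma flag_generates:
  assumes "A \<subseteq> B" "B \<in> \<Delta>" "set cs = B - A" "distinct cs"
  shows "(\<forall>v\<in>frags (lsts (length cs) (NL B)). \<exists>k. v - frag_cmul k (frag_of (flag B cs)) \<in> rels (NL B) (NL A)) \<and>
    (\<forall>p>length cs. \<forall>v\<in>frags (lsts p (NL B)). v \<in> rels (NL B) (NL A))"
  using assms
proof (induction cs arbitrary: B)
  case Nil
  then have AB: "A = B" by auto
  show ?case
  proof (intro conjI ballI allI impI)
    fix v assume "v \<in> frags (lsts (length []) (NL B))"
    then have "\<exists>k. v = frag_cmul k (frag_of (flag B []))"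
    proof (induction rule: frags_induct)
      case zero then show ?case by (auto intro: exI[of _ 0])
    next
      case (of s) then show ?case by (auto intro: exI[of _ 1] simp: lsts_def)
    next
      case (diff x y)
      then show ?case by (metis frag_cmul_diff_distrib)
    qed
    then obtain k where "v = frag_cmul k (frag_of (flag B []))" by blast
    then have "v - frag_cmul k (frag_of (flag B [])) \<in> rels (NL B) (NL A)" by simp
    then show "\<exists>k. v - frag_cmul k (frag_of (flag B [])) \<in> rels (NL B) (NL A)" by blast
  next
    fix p v assume p: "length ([] :: 'a list) < p" and "v \<in> frags (lsts p (NL B))"
    from this(2) show "v \<in> rels (NL B) (NL A)"
    proof (induction rule: frags_induct)
      case (of s)
      then obtain x xs where "s = x # xs" "x \<in> NL A" "set xs \<subseteq> NL B" using p AB by (cases s) (auto simp: lsts_def)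
      then show ?case using rels_wdg_torsion[of "frag_of xs" "NL B" x "NL A"] by auto
    qed (auto intro: rels_diff)
  qed
next
  case (Cons c cs)
  let ?B = "B - {c}"
  have c: "c \<in> B" "A \<subseteq> ?B" "?B \<in> \<Delta>" "set cs = ?B - A" "distinct cs"
    using Cons.prems down[of B ?B] by auto
  have n: "nrm B c \<in> NL B" using nrm(1) Cons.prems(2) c(1) by blast
  have R: "v \<in> rels (NL B) (NL A)" if "v \<in> rels (NL ?B) (NL A)" for v
    using that by (rule rels_mono[rotated -1]) (auto intro: NL_mono[THEN subsetD, rotated])
  note IH = Cons.IH[OF c(2-5)]
  show ?case
  proof (intro conjI ballI allI impI)
    fix v assume "v \<in> frags (lsts (length (c # cs)) (NL B))"
    from split_normal[OF Cons.prems(2) c(1) this] obtain w w' where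
      w: "w \<in> frags {ys. Suc (length ys) = length (c # cs) \<and> set ys \<subseteq> NL ?B}" "w' \<in> frags (lsts (length (c # cs)) (NL ?B))"
      "v - wdg (nrm B c) w - w' \<in> rels (NL B) (NL A)" by blast
    have "w \<in> frags (lsts (length cs) (NL ?B))" using w(1) by (simp add: lsts_def)
    then obtain k where k: "w - frag_cmul k (frag_of (flag ?B cs)) \<in> rels (NL ?B) (NL A)" using IH by blast
    have "w' \<in> rels (NL ?B) (NL A)"
      using conjunct2[OF IH, rule_format, of "Suc (length cs)" w'] w(2) by simp
    then have 1: "w' \<in> rels (NL B) (NL A)" by (rule R)
    have 2: "wdg (nrm B c) (w - frag_cmul k (frag_of (flag ?B cs))) \<in> rels (NL B) (NL A)"
      by (intro rels_wdg R[OF k] n)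
    have "v - frag_cmul k (frag_of (flag B (c # cs))) =
      (v - wdg (nrm B c) w - w') + w' + wdg (nrm B c) (w - frag_cmul k (frag_of (flag ?B cs)))" by simp
    also have "\<dots> \<in> rels (NL B) (NL A)" by (intro rels_add w 1 2)
    finally show "\<exists>k. v - frag_cmul k (frag_of (flag B (c # cs))) \<in> rels (NL B) (NL A)" by blast
  next
    fix p v assume p: "length (c # cs) < p" and "v \<in> frags (lsts p (NL B))"
    from split_normal[OF Cons.prems(2) c(1) this(2)] obtain w w' where
      w: "w \<in> frags {ys. Suc (length ys) = p \<and> set ys \<subseteq> NL ?B}" "w' \<in> frags (lsts p (NL ?B))"
      "v - wdg (nrm B c) w - w' \<in> rels (NL B) (NL A)" by blast
    have "w \<in> frags (lsts (p - 1) (NL ?B))" using w(1) by (rule frags_mono[rotated]) (auto simp: lsts_def)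
    then have "w \<in> rels (NL ?B) (NL A)" "w' \<in> rels (NL ?B) (NL A)"
      using conjunct2[OF IH, rule_format, of "p - 1" w] conjunct2[OF IH, rule_format, of p w'] w(2) p by simp_all
    then have "wdg (nrm B c) w \<in> rels (NL B) (NL A)" "w' \<in> rels (NL B) (NL A)"
      using R rels_wdg n by blast+
    then have "(v - wdg (nrm B c) w - w') + w' + wdg (nrm B c) w \<in> rels (NL B) (NL A)"
      by (intro rels_add w)
    then show "v \<in> rels (NL B) (NL A)" by simp
  qed
qed

text \<open>\<open>D A B\<close> evaluates a top-degree element of \<open>NL B / NL A\<close> on the dual forms; it detects torsion.\<close>

definition D :: "'a set \<Rightarrow> 'a set \<Rightarrow> ('a list \<Rightarrow>\<^sub>0 int) \<Rightarrow> int" where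
  "D A B v = Poly_Mapping.lookup (contrs B (sl (B - A)) v) []"

lemma D_simps: "D A B (v - w) = D A B v - D A B w" "D A B (frag_cmul k v) = k * D A B v"
  by (simp_all add: D_def lookup_minus)

lemma D_rel:
  assumes "A \<subseteq> B" "B \<in> \<Delta>" "v \<in> RR A"
  shows "D A B v = 0"
proof -
  have "B - A \<in> \<Delta>" by (rule down[OF assms(2)]) auto
  then have "contrs B (sl (B - A)) v \<in> rels N (NL A)"
    using rels_contrs[OF assms(2) _ assms(1) NL_sub order_refl N] assms(3) sl(1) unfolding RR_def by auto
  then show ?thesis unfolding D_def by (rule rels_lookup_Nil)
qed

lemma D_sl:
  assumes "A \<subseteq> B" "B \<in> \<Delta>"
  shows "D A B (frag_of (sl (B - A))) = M ^ card (B - A)"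
proof -
  have d: "B - A \<in> \<Delta>" by (rule down[OF assms(2)]) auto
  note s = sl[OF d]
  have "contrs B (sl (B - A)) (wdgs (sl (B - A)) (frag_of [])) - frag_cmul (M ^ length (sl (B - A))) (frag_of []) \<in> RR (set (sl (B - A)))"
    by (rule contrs_wdgs) (use assms s in auto)
  from rels_lookup_Nil[OF this[unfolded RR_def]] show ?thesis
    by (simp add: D_def wdgs_of lookup_minus s)
qed

lemma card_face:
  assumes "B \<in> \<Delta>" "b \<in> B - A"
  shows "card (B - A) = Suc (card (B - {b} - A))"
proof -
  have "B - {b} - A = B - A - {b}" by auto
  then show ?thesis using card.remove[of "B - A" b] assms(2) fin[OF assms(1)] by simp
qed

lemma SS_lists:
  assumes "B \<in> \<Delta>" "v \<in> frags (lsts q (NL B))"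
  shows "v \<in> SS (int q) B"
  unfolding SS_def
proof (rule frags_mono[OF subsetI assms(2)])
  fix xs assume "xs \<in> lsts q (NL B)"
  then have "int (length xs) = int q" "set xs \<subseteq> NL B" by (auto simp: lsts_def)
  with assms(1) show "xs \<in> {xs. int (length xs) = int q \<and> (\<exists>C\<in>\<Delta>. B \<subseteq> C \<and> set xs \<subseteq> NL C)}"
    by blast
qed

lemma wdg_lsts: "v \<in> frags (lsts q L) \<Longrightarrow> x \<in> L \<Longrightarrow> wdg x v \<in> frags (lsts (Suc q) L)"
  unfolding wdg_def by (erule frags_extend) (auto simp: lsts_def)

lemma lsts_flists: "v \<in> frags (lsts q L) \<Longrightarrow> v \<in> flists L"
  by (erule frags_mono[rotated]) (auto simp: lsts_def)

lemma rels_RR: "v \<in> rels (NL B) (NL A) \<Longrightarrow> v \<in> RR A"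
  unfolding RR_def by (rule rels_mono[OF NL_sub order_refl])

lemma wdg_normal:
  assumes "v \<in> flists N" "n \<in> N" "b \<in> N" "of_int c *\<^sub>R n - b \<in> NL A"
  shows "frag_cmul c (wdg n v) - wdg b v \<in> RR A"
proof -
  let ?t = "of_int c *\<^sub>R n - b"
  have 1: "wdg ?t v - (wdg (of_int c *\<^sub>R n) v - wdg b v) \<in> RR A"
    unfolding RR_def by (rule rels_wdg_diff) (use N assms add_closed_int[OF N] in auto)
  have 2: "wdg (of_int c *\<^sub>R n) v - frag_cmul c (wdg n v) \<in> RR A"
    unfolding RR_def by (rule rels_wdg_scale) (use N assms in auto)
  have 3: "wdg ?t v \<in> RR A"
    unfolding RR_def by (rule rels_wdg_torsion) (use assms in auto)
  have "frag_cmul c (wdg n v) - wdg b v = wdg ?t v -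
     (wdg ?t v - (wdg (of_int c *\<^sub>R n) v - wdg b v)) - (wdg (of_int c *\<^sub>R n) v - frag_cmul c (wdg n v))"
    by simp
  also have "\<dots> \<in> RR A" by (intro RR_closed(2) 1 2 3)
  finally show ?thesis .
qed

text \<open>Up to terms that vanish modulo \<open>A\<close>, the multiple \<open>M ^ d v\<close> is
  \<open>b\<close> wedge something, because \<open>v\<close> is zero modulo \<open>b\<close>. The
  vector \<open>c n\<close> agrees with \<open>b\<close> modulo \<open>A\<close>, so its wedge with
  this is zero. Wedging with the normal is thus well defined on classes modulo \<open>b\<close>, up
  to a nonzero multiple.\<close>

lemma wdg_normal_torsion:
  assumes "A \<subseteq> B" "B \<in> \<Delta>" "b \<in> B" "v \<in> SS d B" "v \<in> RR (insert b A)"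
    and "n \<in> N" "of_int c *\<^sub>R n - b \<in> NL A"
  shows "frag_cmul (M ^ nat d * c) (wdg n v) \<in> RR A"
proof -
  have b: "b \<in> N" using assms \<Delta>N by auto
  obtain w where w: "w \<in> SS (d - 1) B" "frag_cmul (M ^ nat d) v - pmap (sx B b) v - wdg b w \<in> RR {}"
    using sx_exterior[OF assms(2,3,4)] by auto
  have 1: "wdg b (frag_cmul (M ^ nat d) v - pmap (sx B b) v - wdg b w) \<in> RR A"
    using RR_mono[OF empty_subsetI w(2), of A] b unfolding RR_def by (rule rels_wdg)
  have 2: "wdg b (pmap (sx B b) v) \<in> RR A"
    using RR_sx[OF assms(2,3,1,5)] b unfolding RR_def by (rule rels_wdg)
  have 3: "wdg b (wdg b w) \<in> RR A"
    unfolding RR_def by (rule rels_wdg_twice[OF SS_flists[OF w(1)] b])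
  have 4: "frag_cmul (M ^ nat d) (frag_cmul c (wdg n v) - wdg b v) \<in> RR A"
    by (intro RR_closed(5) wdg_normal SS_flists[OF assms(4)] assms b)
  have "frag_cmul (M ^ nat d * c) (wdg n v) = frag_cmul (M ^ nat d) (frag_cmul c (wdg n v) - wdg b v) +
     (wdg b (frag_cmul (M ^ nat d) v - pmap (sx B b) v - wdg b w) + wdg b (pmap (sx B b) v) + wdg b (wdg b w))"
    by simp
  also have "\<dots> \<in> RR A" by (intro RR_closed(3) 1 2 3 4)
  finally show ?thesis .
qed

text \<open>\<open>M t\<close> is an integral combination of vectors of \<open>B\<close>, each of
  which is either zero modulo \<open>A\<close> or a factor already present.\<close>

lemma wdg_sl_torsion:
  assumes "A \<subseteq> B" "B \<in> \<Delta>" "t \<in> NL B"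
  shows "frag_cmul M (wdg t (frag_of (sl (B - A)))) \<in> RR A"
proof -
  have d: "B - A \<in> \<Delta>" by (rule down[OF assms(2)]) auto
  let ?v = "frag_of (sl (B - A))"
  have t: "t \<in> N" "t \<in> span B" "B \<subseteq> N" using assms \<Delta>N by (auto simp: cone_lattice_def)
  have v: "?v \<in> flists N" using sl(1)[OF d] t by auto
  have "of_int M *\<^sub>R t = (\<Sum>b\<in>B. of_int (li B b t) *\<^sub>R b)"
    using coords[OF assms(2) t(2)] li[OF assms(2)] t by (auto intro!: sum.cong)
  then have 1: "wdg (of_int M *\<^sub>R t) ?v - (\<Sum>b\<in>B. frag_cmul (li B b t) (wdg b ?v)) \<in> RR A"
    unfolding RR_def using rels_wdg_sum[OF fin[OF assms(2)] N v, of "\<lambda>b. b" "\<lambda>b. li B b t" "NL A"] t by auto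
  have 2: "wdg (of_int M *\<^sub>R t) ?v - frag_cmul M (wdg t ?v) \<in> RR A"
    unfolding RR_def by (rule rels_wdg_scale) (use N t v in auto)
  have 3: "wdg b ?v \<in> RR A" if b: "b \<in> B" for b
  proof (cases "b \<in> A")
    case True
    then have "b \<in> NL A" using NL_base[OF down[OF assms(2,1)]] by simp
    then show ?thesis unfolding RR_def by (rule rels_wdg_torsion[OF v])
  next
    case False
    then have "wdg b (wdgs (sl (B - A)) (frag_of [])) \<in> rels N (NL A)"
      using b sl(1)[OF d] t by (intro rels_wdgs_repeat) auto
    then show ?thesis unfolding RR_def by (simp add: wdgs_of)
  qed
  have 4: "(\<Sum>b\<in>B. frag_cmul (li B b t) (wdg b ?v)) \<in> RR A"
    by (intro RR_sum RR_closed(5) 3)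
  have "frag_cmul M (wdg t ?v) = (wdg (of_int M *\<^sub>R t) ?v - (\<Sum>b\<in>B. frag_cmul (li B b t) (wdg b ?v)))
    + (\<Sum>b\<in>B. frag_cmul (li B b t) (wdg b ?v)) - (wdg (of_int M *\<^sub>R t) ?v - frag_cmul M (wdg t ?v))" by simp
  also have "\<dots> \<in> RR A" by (intro RR_closed(2,3) 1 2 4)
  finally show ?thesis .
qed

lemma D_cong: "A \<subseteq> B \<Longrightarrow> B \<in> \<Delta> \<Longrightarrow> v - w \<in> RR A \<Longrightarrow> D A B v = D A B w"
  using D_rel[of A B "v - w"] D_simps(1) by simp

lemma D_torsion: "A \<subseteq> B \<Longrightarrow> B \<in> \<Delta> \<Longrightarrow> frag_cmul k v \<in> RR A \<Longrightarrow> k \<noteq> 0 \<Longrightarrow> D A B v = 0"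
  using D_rel[of A B "frag_cmul k v"] D_simps(2) by simp

lemma faces_\<Delta>:
  assumes "A \<subseteq> B" "B \<in> \<Delta>"
  shows "(cone_hull A, cone_hull B) \<in> faces \<Sigma> (card (B - A))"
  using assms down[OF assms(2,1)] cone_\<Delta> face_\<Delta> dim_\<Delta> card_Diff_subset[of A B] fin
  by (auto simp: faces_def)

end

section \<open>Orientation generators and incidence signs\<close>

locale oriented_fan = toric_fan N \<Sigma> idx M ell
  for N :: "'a::real_vector set" and \<Sigma> idx M ell +
  fixes \<nu> assumes ori: "orientation N \<Sigma> \<nu>"
begin

definition nu :: "'a set \<Rightarrow> 'a set \<Rightarrow> ('a list \<Rightarrow>\<^sub>0 int)" where
  "nu A B = (SOME v. v \<in> frags (lsts (card (B - A)) (NL B)) \<and>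
     \<nu> (cone_hull A, cone_hull B) = lattice_pair.cls (NL B) (NL A) (card (B - A)) v)"

text \<open>The ordered wedge of \<open>B - A\<close> is this multiple of the chosen generator. Its
  absolute value is the index of the sublattice generated by \<open>B - A\<close> in
  \<open>NL B\<close> modulo \<open>NL A\<close>; its sign compares the two orientations.\<close>

definition nu_coeff :: "'a set \<Rightarrow> 'a set \<Rightarrow> int" where
  "nu_coeff A B = (SOME z. frag_of (sl (B - A)) - frag_cmul z (nu A B) \<in> rels (NL B) (NL A))"

context
  fixes A B assumes AB: "A \<subseteq> B" "B \<in> \<Delta>"
begin

interpretation lattice_pair "NL B" "NL A" by (rule pair_rel[OF AB(1)])

lemma nu:
  shows "nu A B \<in> frags (lsts (card (B - A)) (NL B))"
    "\<nu> (cone_hull A, cone_hull B) = cls (card (B - A)) (nu A B)"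
    and nu_gen: "v \<in> frags (lsts (card (B - A)) (NL B)) \<Longrightarrow> \<exists>k. v - frag_cmul k (nu A B) \<in> rels (NL B) (NL A)"
proof -
  let ?q = "card (B - A)" and ?n = "\<nu> (cone_hull A, cone_hull B)"
  have o: "?n \<in> carrier (E ?q)" "generate (E ?q) {?n} = carrier (E ?q)"
    using ori faces_\<Delta>[OF AB] unfolding orientation_def by (force simp: rel_lattice_cone)+
  then have "\<exists>v. v \<in> FL ?q \<and> ?n = cls ?q v" using carrier_E by auto
  then have "nu A B \<in> FL ?q \<and> ?n = cls ?q (nu A B)"
    unfolding nu_def by (rule someI_ex)
  then show 1: "nu A B \<in> FL ?q" "?n = cls ?q (nu A B)" by auto
  assume v: "v \<in> FL ?q"
  then have "cls ?q v \<in> generate (E ?q) {?n}" using o carrier_E by auto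
  then obtain k where "cls ?q v = ?n [^]\<^bsub>E ?q\<^esub> (k::int)"
    using E.generate_pow[OF o(1)] by auto
  then have "cls ?q v = cls ?q (frag_cmul k (nu A B))" by (simp add: 1(2) cls_pow[OF 1(1)])
  then show "\<exists>k. v - frag_cmul k (nu A B) \<in> rels (NL B) (NL A)"
    using cls_eq_iff[OF v frags_cmul[OF 1(1)]] by blast
qed

lemma sl_lsts: "frag_of (sl (B - A)) \<in> frags (lsts (card (B - A)) (NL B))"
proof -
  have "B - A \<in> \<Delta>" by (rule down[OF AB(2)]) auto
  then show ?thesis using sl[of "B - A"] NL_base[OF AB(2)] by (auto simp: lsts_def)
qed

lemma nu_coeff: "frag_of (sl (B - A)) - frag_cmul (nu_coeff A B) (nu A B) \<in> rels (NL B) (NL A)"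
  unfolding nu_coeff_def by (rule someI_ex) (rule nu_gen[OF sl_lsts])

lemma D_nu: "nu_coeff A B * D A B (nu A B) = M ^ card (B - A)"
  using D_cong[OF AB rels_RR[OF nu_coeff]] D_sl[OF AB] D_simps(2) by simp

lemma D_nu_nonzero: "D A B (nu A B) \<noteq> 0" "nu_coeff A B \<noteq> 0"
proof -
  have "M ^ card (B - A) \<noteq> 0" using M by simp
  then show "D A B (nu A B) \<noteq> 0" "nu_coeff A B \<noteq> 0" using D_nu by auto
qed

text \<open>The top power is generated by \<open>nu A B\<close>, on which \<open>D\<close> is
  nonzero, so \<open>D\<close> is injective there and equations between classes become equations
  between integers.\<close>

lemma top_eq:
  assumes "v \<in> frags (lsts (card (B - A)) (NL B))" "D A B v = k * D A B (nu A B)"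
  shows "v - frag_cmul k (nu A B) \<in> rels (NL B) (NL A)"
proof -
  obtain j where j: "v - frag_cmul j (nu A B) \<in> rels (NL B) (NL A)" using nu_gen[OF assms(1)] by blast
  then have "D A B v = j * D A B (nu A B)" using D_cong[OF AB rels_RR[OF j]] D_simps(2) by simp
  then have "j = k" using assms(2) D_nu_nonzero(1) by simp
  then show ?thesis using j by simp
qed

lemma top_eq_iff:
  assumes "v \<in> frags (lsts (card (B - A)) (NL B))"
  shows "cls (card (B - A)) v = \<nu> (cone_hull A, cone_hull B) [^]\<^bsub>E (card (B - A))\<^esub> (k::int)
    \<longleftrightarrow> D A B v = k * D A B (nu A B)"
  unfolding nu(2) cls_pow[OF nu(1)] cls_eq_iff[OF assms frags_cmul[OF nu(1)]]
  using top_eq[OF assms] D_cong[OF AB rels_RR, of v "frag_cmul k (nu A B)"] D_simps(2) by auto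

end

text \<open>Signs and absolute values are separated: the signs will give the incidence numbers, the
  absolute values the index formula behind the weights.\<close>

lemma sign_arith:
  fixes c z z' k e :: int
  assumes "c * z' * k = e * z" "c \<ge> 1" "k = 1 \<or> k = -1" "e = 1 \<or> e = -1" "z' \<noteq> 0"
  shows "k = e * sgn z' * sgn z" "\<bar>z\<bar> = c * \<bar>z'\<bar>"
proof -
  have "\<bar>c\<bar> * \<bar>z'\<bar> * \<bar>k\<bar> = \<bar>e\<bar> * \<bar>z\<bar>" using assms(1) by (metis abs_mult)
  moreover have "\<bar>c\<bar> = c" "\<bar>k\<bar> = 1" "\<bar>e\<bar> = 1" using assms by auto
  ultimately show "\<bar>z\<bar> = c * \<bar>z'\<bar>" by simp
  have "sgn c * sgn z' * sgn k = sgn e * sgn z" using assms(1) by (metis sgn_mult)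
  then have "sgn z' * (sgn z' * k) = sgn z' * (e * sgn z)" using assms by auto
  moreover have "sgn z' * sgn z' = 1" using assms(5) by (simp add: sgn_if)
  ultimately show "k = e * sgn z' * sgn z" by (metis mult.assoc mult.commute mult_1)
qed

lemma eps_cases: "eps b S = 1 \<or> eps b S = -1"
  unfolding eps_def by (metis neg_one_even_power neg_one_odd_power)

definition osgn :: "'a set \<Rightarrow> 'a set \<Rightarrow> int" where
  "osgn A B = sgn (nu_coeff A B)"

lemma unit_of_mult:
  fixes i j k x :: int
  assumes "x = i * (j * (k * x))" "x \<noteq> 0"
  shows "k = 1 \<or> k = -1"
proof -
  have "x * ((i * j) * k) = x * 1" using assms(1) by (simp add: ac_simps)
  then have "(i * j) * k = 1" using assms(2) by (simp only: mult_cancel_left) simp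
  then show ?thesis using pos_zmult_eq_1_iff_lemma by (metis mult.commute zmult_eq_1_iff)
qed

text \<open>The wedge of the normal with the generator of the facet is \<open>k0\<close> times the
  generator for \<open>B\<close>. This \<open>k0\<close> is a unit because a flag starting with the
  normal generates the top power. Comparing \<open>nrm_mult B b\<close> times the normal with
  \<open>b\<close>, both wedged with the ordered product of the facet, then determines the sign of
  \<open>k0\<close> and shows how the index changes.\<close>

lemma normal_left:
  assumes "A \<subseteq> B" "B \<in> \<Delta>" "b \<in> B - A"
  defines "k \<equiv> eps b (B - A) * osgn A (B - {b}) * osgn A B"
  shows "D A B (wdg (nrm B b) (nu A (B - {b}))) = k * D A B (nu A B)" "k = 1 \<or> k = -1"
    "\<bar>nu_coeff A B\<bar> = nrm_mult B b * \<bar>nu_coeff A (B - {b})\<bar>"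
proof -
  let ?B = "B - {b}" and ?n = "nrm B b" and ?D = "D A B"
  have B': "A \<subseteq> ?B" "?B \<in> \<Delta>" "b \<in> B" "b \<in> N" using assms down[OF assms(2), of ?B] \<Delta>N by auto
  have q: "card (B - A) = Suc (card (?B - A))"
    by (rule card_face[OF assms(2,3)])
  have n: "?n \<in> NL B" "?n \<in> N" using nrm(1)[OF assms(2) B'(3)] NL_sub by auto
  have sub: "NL ?B \<subseteq> NL B" by (rule NL_mono) auto
  have nu': "nu A ?B \<in> frags (lsts (card (?B - A)) (NL B))"
    using nu(1)[OF B'(1,2)] sub by (elim frags_mono[rotated]) (auto simp: lsts_def)
  have wn: "wdg ?n (nu A ?B) \<in> frags (lsts (card (B - A)) (NL B))"
    unfolding q by (rule wdg_lsts[OF nu' n(1)])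
  obtain k0 where k0: "wdg ?n (nu A ?B) - frag_cmul k0 (nu A B) \<in> rels (NL B) (NL A)"
    using nu_gen[OF assms(1,2) wn] by blast
  have Dk0: "?D (wdg ?n (nu A ?B)) = k0 * ?D (nu A B)"
    using D_cong[OF assms(1,2) rels_RR[OF k0]] D_simps(2) by simp
  have DW: "?D (wdg ?n v) = ?D (wdg ?n w)" if "v - w \<in> RR A" for v w
  proof (rule D_cong[OF assms(1,2)])
    have "wdg ?n (v - w) \<in> RR A" using that n(2) unfolding RR_def by (rule rels_wdg)
    then show "wdg ?n v - wdg ?n w \<in> RR A" by simp
  qed
  have B'A: "?B - A = B - A - {b}" "B - A \<in> \<Delta>" "?B - A \<in> \<Delta>"
    by (auto intro!: down[OF assms(2)])
  have unit: "k0 = 1 \<or> k0 = -1"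
  proof -
    let ?cs = "sl (?B - A)"
    note s = sl[OF B'A(3)]
    obtain j where "nu A B - frag_cmul j (frag_of (flag B (b # ?cs))) \<in> rels (NL B) (NL A)"
      using flag_generates[OF assms(1,2), of "b # ?cs"] s assms nu(1)[OF assms(1,2)] q by auto
    then have 1: "?D (nu A B) = j * ?D (wdg ?n (frag_of (flag ?B ?cs)))"
      using D_cong[OF assms(1,2) rels_RR] D_simps(2) by fastforce
    have "frag_of (flag ?B ?cs) \<in> frags (lsts (card (?B - A)) (NL ?B))"
      using flag_NL[OF B'(2), of ?cs] s by (auto simp: lsts_def)
    then obtain i where "frag_of (flag ?B ?cs) - frag_cmul i (nu A ?B) \<in> rels (NL ?B) (NL A)"
      using nu_gen[OF B'(1,2)] by blast
    then have 2: "?D (wdg ?n (frag_of (flag ?B ?cs))) = i * ?D (wdg ?n (nu A ?B))"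
      using DW[OF rels_RR] D_simps(2) by fastforce
    show ?thesis by (rule unit_of_mult[OF 1[unfolded 2 Dk0] D_nu_nonzero(1)[OF assms(1,2)]])
  qed
  let ?f = "frag_of (sl (?B - A))"
  have f: "?f \<in> flists N" using sl(1)[OF B'A(3)] \<Delta>N[OF assms(2)] by auto
  have "nu_coeff A ?B * ?D (wdg ?n (nu A ?B)) = ?D (wdg ?n ?f)"
    using DW[OF rels_RR[OF nu_coeff[OF B'(1,2)]]] D_simps(2) by simp
  moreover have "nrm_mult B b * ?D (wdg ?n ?f) = ?D (wdg b ?f)"
  proof -
    let ?t = "of_int (nrm_mult B b) *\<^sub>R ?n - b"
    have "wdg ?t ?f - (wdg (of_int (nrm_mult B b) *\<^sub>R ?n) ?f - wdg b ?f) \<in> RR A"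
      unfolding RR_def by (rule rels_wdg_diff) (use N f n B' add_closed_int[OF N] in auto)
    then have "?D (wdg ?t ?f) = ?D (wdg (of_int (nrm_mult B b) *\<^sub>R ?n) ?f) - ?D (wdg b ?f)"
      using D_cong[OF assms(1,2)] D_simps(1) by fastforce
    moreover have "?D (wdg (of_int (nrm_mult B b) *\<^sub>R ?n) ?f) = nrm_mult B b * ?D (wdg ?n ?f)"
      using D_cong[OF assms(1,2), of "wdg (of_int (nrm_mult B b) *\<^sub>R ?n) ?f" "frag_cmul (nrm_mult B b) (wdg ?n ?f)"]
        rels_wdg_scale[OF N f n(2), of "nrm_mult B b" "NL A"] D_simps(2) unfolding RR_def by simp
    moreover have "?D (wdg ?t ?f) = 0"
      using D_torsion[OF assms(1,2) wdg_sl_torsion[OF B'(1,2) nrm(3)[OF assms(2) B'(3)]]] M by simp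
    ultimately show ?thesis by simp
  qed
  moreover have "?D (wdg b ?f) = eps b (B - A) * ?D (frag_of (sl (B - A)))"
  proof -
    have "wdg b (wdgs (sl (B - A - {b})) (frag_of [])) - frag_cmul (eps b (B - A)) (wdgs (sl (B - A)) (frag_of [])) \<in> rels N (NL A)"
      by (rule wdgs_sl_split) (use B'A assms \<Delta>N N in auto)
    then have "wdg b ?f - frag_cmul (eps b (B - A)) (frag_of (sl (B - A))) \<in> RR A"
      unfolding RR_def B'A(1) by (simp add: wdgs_of)
    from D_cong[OF assms(1,2) this] show ?thesis by (simp add: D_simps)
  qed
  moreover have "?D (frag_of (sl (B - A))) = nu_coeff A B * ?D (nu A B)"
    using D_nu[OF assms(1,2)] D_sl[OF assms(1,2)] by simp
  ultimately have "nrm_mult B b * nu_coeff A ?B * k0 * ?D (nu A B) = eps b (B - A) * nu_coeff A B * ?D (nu A B)"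
    unfolding Dk0 by (metis mult.assoc)
  then have e: "nrm_mult B b * nu_coeff A ?B * k0 = eps b (B - A) * nu_coeff A B"
    using D_nu_nonzero(1)[OF assms(1,2)] by simp
  note r = sign_arith[OF e nrm(2)[OF assms(2) B'(3)] unit eps_cases D_nu_nonzero(2)[OF B'(1,2)]]
  have "k0 = k" using r(1) by (simp add: k_def osgn_def)
  then show "?D (wdg ?n (nu A ?B)) = k * ?D (nu A B)" "k = 1 \<or> k = -1" using Dk0 unit by auto
  show "\<bar>nu_coeff A B\<bar> = nrm_mult B b * \<bar>nu_coeff A ?B\<bar>" by (rule r(2))
qed

text \<open>The generator of the subface is given only modulo \<open>b\<close>, but \<open>D\<close>
  ignores torsion, so by \<open>wdg_normal_torsion\<close> the choice of a lift does not matter. The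
  flag is taken with \<open>b\<close> last, so that it ends with the normal of
  \<open>insert b A\<close>, which is then moved to the front; the sign this costs is harmless,
  since only the unit property is wanted.\<close>

lemma normal_right:
  assumes "A \<subseteq> B" "B \<in> \<Delta>" "b \<in> B - A"
  defines "k \<equiv> eps b (B - A) * osgn (insert b A) B * osgn A B"
  shows "D A B (wdg (nrm (insert b A) b) (nu (insert b A) B)) = k * D A B (nu A B)" "k = 1 \<or> k = -1"
    "v \<in> frags (lsts (card (B - insert b A)) (NL B)) \<Longrightarrow> v \<in> RR (insert b A) \<Longrightarrow>
       D A B (wdg (nrm (insert b A) b) v) = 0"
proof -
  let ?A = "insert b A" and ?D = "D A B"
  let ?n = "nrm ?A b" and ?c = "nrm_mult ?A b"
  have A': "?A \<subseteq> B" "?A \<in> \<Delta>" "b \<in> B" "b \<in> ?A" "?A - {b} = A" "b \<in> N" using assms down[OF assms(2), of ?A] \<Delta>N by auto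
  have q: "card (B - A) = Suc (card (B - ?A))"
    using drop_card[OF A'(1) assms(2) A'(4)] A'(5) by simp
  have n: "?n \<in> NL ?A" "?n \<in> NL B" "?n \<in> N" using nrm(1)[OF A'(2,4)] NL_sub NL_mono[OF A'(1)] by auto
  note cn = nrm(3)[OF A'(2,4), unfolded A'(5)]
  have c0: "M ^ m * ?c \<noteq> 0" for m using nrm(2)[OF A'(2,4)] M by auto
  have kill: "?D (wdg ?n v) = 0" if "v \<in> frags (lsts (card (B - ?A)) (NL B))" "v \<in> RR ?A" for v
    by (rule D_torsion[OF assms(1,2) wdg_normal_torsion[OF assms(1,2) A'(3) SS_lists[OF assms(2) that(1)] that(2) n(3) cn] c0])
  then show "v \<in> frags (lsts (card (B - ?A)) (NL B)) \<Longrightarrow> v \<in> RR ?A \<Longrightarrow> ?D (wdg ?n v) = 0" .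
  have DW: "?D (wdg ?n v) = ?D (wdg ?n w)" if "v \<in> frags (lsts (card (B - ?A)) (NL B))"
    "w \<in> frags (lsts (card (B - ?A)) (NL B))" "v - w \<in> RR ?A" for v w
    using kill[OF frags_diff[OF that(1,2)] that(3)] D_simps(1) by simp
  note nu' = nu(1)[OF A'(1) assms(2)]
  have wn: "wdg ?n (nu ?A B) \<in> frags (lsts (card (B - A)) (NL B))"
    unfolding q by (rule wdg_lsts[OF nu' n(2)])
  obtain k0 where k0: "wdg ?n (nu ?A B) - frag_cmul k0 (nu A B) \<in> rels (NL B) (NL A)"
    using nu_gen[OF assms(1,2) wn] by blast
  have Dk0: "?D (wdg ?n (nu ?A B)) = k0 * ?D (nu A B)"
    using D_cong[OF assms(1,2) rels_RR[OF k0]] D_simps(2) by simp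
  have BA: "B - ?A = B - A - {b}" "B - A \<in> \<Delta>" "B - ?A \<in> \<Delta>"
    by (auto intro!: down[OF assms(2)])
  have unit: "k0 = 1 \<or> k0 = -1"
  proof -
    let ?cs = "sl (B - ?A)"
    note s = sl[OF BA(3)]
    let ?F = "flag B ?cs"
    have F: "set ?F \<subseteq> NL B" "length ?F = card (B - ?A)"
      using flag_NL[OF assms(2), of ?cs] s by auto
    have fl: "flag B (?cs @ [b]) = ?F @ [?n]"
      using A' s by (simp add: flag_append double_diff)
    obtain j where j: "nu A B - frag_cmul j (frag_of (flag B (?cs @ [b]))) \<in> rels (NL B) (NL A)"
    proof -
      have cs: "set (?cs @ [b]) = B - A" "distinct (?cs @ [b])" "length (?cs @ [b]) = card (B - A)"
        using s assms(1,3) q by auto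
      have "nu A B \<in> frags (lsts (length (?cs @ [b])) (NL B))"
        using nu(1)[OF assms(1,2)] cs(3) by simp
      from conjunct1[OF flag_generates[OF assms(1,2) cs(1,2)], rule_format, OF this] that show ?thesis by blast
    qed
    have 1: "?D (nu A B) = j * ?D (frag_of (?F @ [?n]))"
      using D_cong[OF assms(1,2) rels_RR[OF j]] D_simps(2) by (simp add: fl)
    have "wdgs ?F (wdg ?n (frag_of [])) - frag_cmul ((-1) ^ length ?F) (wdg ?n (wdgs ?F (frag_of []))) \<in> rels (NL B) (NL A)"
      by (rule rels_wdgs_move) (use F n NL_closed in auto)
    then have "frag_of (?F @ [?n]) - frag_cmul ((-1) ^ length ?F) (wdg ?n (frag_of ?F)) \<in> rels (NL B) (NL A)"
      by (simp add: wdgs_of)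
    from D_cong[OF assms(1,2) rels_RR[OF this]]
    have 2: "?D (frag_of (?F @ [?n])) = (-1) ^ length ?F * ?D (wdg ?n (frag_of ?F))" by (simp only: D_simps(2))
    have Fl: "frag_of ?F \<in> frags (lsts (card (B - ?A)) (NL B))"
      using F by (auto simp: lsts_def)
    then obtain i where i: "frag_of ?F - frag_cmul i (nu ?A B) \<in> rels (NL B) (NL ?A)"
      using nu_gen[OF A'(1) assms(2)] by blast
    have 3: "?D (wdg ?n (frag_of ?F)) = i * ?D (wdg ?n (nu ?A B))"
      using DW[OF Fl frags_cmul[OF nu'] rels_RR[OF i]] D_simps(2) by simp
    have "?D (nu A B) = (j * (-1) ^ length ?F) * (i * (k0 * ?D (nu A B)))"
      using 1[unfolded 2 3 Dk0] by (simp only: mult.assoc)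
    then show ?thesis by (rule unit_of_mult[OF _ D_nu_nonzero(1)[OF assms(1,2)]])
  qed
  let ?f = "frag_of (sl (B - ?A))"
  have f: "?f \<in> flists N" using sl(1)[OF BA(3)] \<Delta>N[OF assms(2)] by auto
  have "nu_coeff ?A B * ?D (wdg ?n (nu ?A B)) = ?D (wdg ?n ?f)"
    using DW[OF sl_lsts[OF A'(1) assms(2)] frags_cmul[OF nu'] rels_RR[OF nu_coeff[OF A'(1) assms(2)]]] D_simps(2) by simp
  moreover have "?c * ?D (wdg ?n ?f) = ?D (wdg b ?f)"
    using D_cong[OF assms(1,2) wdg_normal[OF f n(3) A'(6) cn]] D_simps(2) by simp
  moreover have "?D (wdg b ?f) = eps b (B - A) * ?D (frag_of (sl (B - A)))"
  proof -
    have "wdg b (wdgs (sl (B - A - {b})) (frag_of [])) - frag_cmul (eps b (B - A)) (wdgs (sl (B - A)) (frag_of [])) \<in> rels N (NL A)"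
      by (rule wdgs_sl_split) (use BA assms \<Delta>N N in auto)
    then have "wdg b ?f - frag_cmul (eps b (B - A)) (frag_of (sl (B - A))) \<in> RR A"
      unfolding RR_def BA(1) by (simp add: wdgs_of)
    from D_cong[OF assms(1,2) this] show ?thesis by (simp add: D_simps)
  qed
  moreover have "?D (frag_of (sl (B - A))) = nu_coeff A B * ?D (nu A B)"
    using D_nu[OF assms(1,2)] D_sl[OF assms(1,2)] by simp
  ultimately have "?c * nu_coeff ?A B * k0 * ?D (nu A B) = eps b (B - A) * nu_coeff A B * ?D (nu A B)"
    unfolding Dk0 by (metis mult.assoc)
  then have e: "?c * nu_coeff ?A B * k0 = eps b (B - A) * nu_coeff A B"
    using D_nu_nonzero(1)[OF assms(1,2)] by simp
  note r = sign_arith[OF e nrm(2)[OF A'(2,4)] unit eps_cases D_nu_nonzero(2)[OF A'(1) assms(2)]]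
  have "k0 = k" using r(1) by (simp add: k_def osgn_def)
  then show "?D (wdg ?n (nu ?A B)) = k * ?D (nu A B)" "k = 1 \<or> k = -1" using Dk0 unit by auto
qed

text \<open>The lifts over which the definition quantifies differ from \<open>nrm B b\<close> by
  vectors of the facet lattice, and the wedge of such a vector with the generator of the facet is
  zero because its degree exceeds the rank. So \<open>normal_left\<close> decides for every
  lift.\<close>

lemma face_sign_left:
  assumes "A \<subseteq> B" "B \<in> \<Delta>" "b \<in> B - A"
  shows "face_sign N \<nu> (cone_hull A, cone_hull (B - {b})) (cone_hull A, cone_hull B)
    = eps b (B - A) * osgn A (B - {b}) * osgn A B" (is "_ = ?k")
proof -
  let ?B = "B - {b}" and ?n = "nrm B b" and ?q = "card (B - {b} - A)"
  have B': "A \<subseteq> ?B" "?B \<in> \<Delta>" "b \<in> B" "A \<in> \<Delta>" using assms down[OF assms(2)] by auto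
  have q: "card (B - A) = Suc ?q"
    by (rule card_face[OF assms(2,3)])
  have d: "dim (cone_hull ?B) - dim (cone_hull A) = ?q"
    using dim_\<Delta> B' card_Diff_subset[of A ?B] fin by simp
  interpret P: lattice_pair "NL B" "NL A" by (rule pair_rel[OF assms(1)])
  have n: "?n \<in> NL B" by (rule nrm(1)[OF assms(2) B'(3)])
  have sub: "NL ?B \<subseteq> NL B" by (rule NL_mono) auto
  note nu0 = nu(1)[OF B'(1,2)]
  have nu': "nu A ?B \<in> frags (lsts ?q (NL B))"
    using nu0 sub by (elim frags_mono[rotated]) (auto simp: lsts_def)
  have em: "ext_map ?q P.G (\<lambda>x. x) (\<nu> (cone_hull A, cone_hull ?B)) = P.cls ?q (nu A ?B)"
    unfolding nu(2)[OF B'(1,2)]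
    by (rule ext_map_cls[OF pair_rel[OF B'(1)] P.lattice_pair_axioms sub _ nu0]) simp
  have main: "wedge ?q P.G (coset (NL A) x) (P.cls ?q (nu A ?B)) = \<nu> (cone_hull A, cone_hull B) [^]\<^bsub>P.E (Suc ?q)\<^esub> (s::int)
     \<longleftrightarrow> s = ?k" if x: "x \<in> NL B" "x - ?n \<in> NL ?B" for x s
  proof -
    have "wdg x (nu A ?B) \<in> frags (lsts (card (B - A)) (NL B))"
      unfolding q by (rule wdg_lsts[OF nu' x(1)])
    from top_eq_iff[OF assms(1,2) this, of s]
    have "P.cls (Suc ?q) (wdg x (nu A ?B)) = \<nu> (cone_hull A, cone_hull B) [^]\<^bsub>P.E (Suc ?q)\<^esub> s
      \<longleftrightarrow> D A B (wdg x (nu A ?B)) = s * D A B (nu A B)" unfolding q .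
    moreover have "D A B (wdg x (nu A ?B)) = ?k * D A B (nu A B)"
    proof -
      have "wdg (x - ?n) (nu A ?B) \<in> frags (lsts (Suc ?q) (NL ?B))" by (rule wdg_lsts[OF nu0 x(2)])
      then have "wdg (x - ?n) (nu A ?B) \<in> rels (NL ?B) (NL A)"
        using flag_generates[OF B'(1,2), of "sl (?B - A)"] sl[OF down[OF B'(2), of "?B - A"]] by auto
      then have 1: "D A B (wdg (x - ?n) (nu A ?B)) = 0" by (intro D_rel[OF assms(1,2)] rels_RR)
      have "wdg (x - ?n) (nu A ?B) - (wdg x (nu A ?B) - wdg ?n (nu A ?B)) \<in> rels (NL B) (NL A)"
        by (rule rels_wdg_diff[OF NL_closed lsts_flists[OF nu'] x(1) n])
      from D_cong[OF assms(1,2) rels_RR[OF this]] 1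
      have "D A B (wdg x (nu A ?B)) = D A B (wdg ?n (nu A ?B))" by (simp add: D_simps)
      then show ?thesis using normal_left(1)[OF assms] by simp
    qed
    ultimately show ?thesis using D_nu_nonzero(1)[OF assms(1,2)] P.wedge_cls[OF x(1)] by auto
  qed
  have proj: "lattice_proj N (cone_hull ?B) (coset (NL A) x) = normal_gen N (cone_hull ?B) (cone_hull B) \<longleftrightarrow> x - ?n \<in> NL ?B" for x
    using lattice_proj_coset[OF B'(1)] nrm(6)[OF assms(2) B'(3)] by (simp add: coset_eq_iff[OF NL_closed])
  let ?P = "\<lambda>s. s \<in> {1, -1} \<and> (\<forall>n\<in>carrier P.G. lattice_proj N (cone_hull ?B) n = normal_gen N (cone_hull ?B) (cone_hull B) \<longrightarrow>
      wedge ?q P.G n (P.cls ?q (nu A ?B)) = \<nu> (cone_hull A, cone_hull B) [^]\<^bsub>P.E (Suc ?q)\<^esub> (s::int))"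
  have "face_sign N \<nu> (cone_hull A, cone_hull ?B) (cone_hull A, cone_hull B) = (THE s. ?P s)"
    by (simp add: d em rel_lattice_cone Let_def)
  also have "\<dots> = ?k"
  proof (rule the_equality)
    show "?P ?k"
      using normal_left(2)[OF assms] main by (auto simp: P.carrier_G proj)
    fix s assume s: "?P s"
    have "coset (NL A) ?n \<in> carrier P.G" using n P.carrier_G by auto
    moreover have "lattice_proj N (cone_hull ?B) (coset (NL A) ?n) = normal_gen N (cone_hull ?B) (cone_hull B)"
      using proj[of ?n] add_closedD(1)[OF NL_closed] by simp
    ultimately show "s = ?k" using s main[OF n] add_closedD(1)[OF NL_closed] by auto
  qed
  finally show ?thesis .
qed

text \<open>Two lifts of the generator differ by a relation modulo \<open>b\<close>, and the third
  part of \<open>normal_right\<close> makes this invisible. The leading minus is the one in the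
  convention for subfaces at infinity.\<close>

lemma face_sign_right:
  assumes "A \<subseteq> B" "B \<in> \<Delta>" "b \<in> B - A"
  shows "face_sign N \<nu> (cone_hull (insert b A), cone_hull B) (cone_hull A, cone_hull B)
    = - (eps b (B - A) * osgn (insert b A) B * osgn A B)" (is "_ = - ?k")
proof -
  let ?A = "insert b A" and ?q = "card (B - insert b A)"
  let ?n = "nrm ?A b"
  have A': "?A \<subseteq> B" "?A \<in> \<Delta>" "b \<in> ?A" "?A - {b} = A" "A \<in> \<Delta>" using assms down[OF assms(2)] by auto
  have q: "card (B - A) = Suc ?q"
    using drop_card[OF A'(1) assms(2) A'(3)] A'(4) by simp
  have d: "dim (cone_hull B) - dim (cone_hull ?A) = ?q"
    using dim_\<Delta> A' assms card_Diff_subset[of ?A B] fin by simp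
  have ne: "cone_hull ?A \<noteq> cone_hull A"
    using cone_\<Delta>(2)[OF A'(2)] cone_\<Delta>(2)[OF A'(5)] assms(3) by auto
  interpret P: lattice_pair "NL B" "NL A" by (rule pair_rel[OF assms(1)])
  interpret Q: lattice_pair "NL B" "NL ?A" by (rule pair_rel[OF A'(1)])
  have n: "?n \<in> NL B" using nrm(1)[OF A'(2,3)] NL_mono[OF A'(1)] by auto
  have ng: "normal_gen N (cone_hull A) (cone_hull ?A) = coset (NL A) ?n"
    using nrm(6)[OF A'(2,3)] A'(4) by simp
  note nu' = nu(1)[OF A'(1) assms(2)]
  have pr: "ext_map ?q Q.G (lattice_proj N (cone_hull ?A)) (P.cls ?q v) = Q.cls ?q v"
    if "v \<in> frags (lsts ?q (NL B))" for v
    by (rule ext_map_cls[OF P.lattice_pair_axioms Q.lattice_pair_axioms order_refl _ that])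
       (rule lattice_proj_coset, auto)
  have main: "wedge ?q P.G (coset (NL A) ?n) (P.cls ?q v) = \<nu> (cone_hull A, cone_hull B) [^]\<^bsub>P.E (Suc ?q)\<^esub> (- s::int)
     \<longleftrightarrow> s = - ?k" if v: "v \<in> frags (lsts ?q (NL B))" "Q.cls ?q v = \<nu> (cone_hull ?A, cone_hull B)" for v s
  proof -
    have "wdg ?n v \<in> frags (lsts (card (B - A)) (NL B))"
      unfolding q by (rule wdg_lsts[OF v(1) n])
    from top_eq_iff[OF assms(1,2) this, of "- s"]
    have "P.cls (Suc ?q) (wdg ?n v) = \<nu> (cone_hull A, cone_hull B) [^]\<^bsub>P.E (Suc ?q)\<^esub> (- s)
      \<longleftrightarrow> D A B (wdg ?n v) = - s * D A B (nu A B)" unfolding q .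
    moreover have "D A B (wdg ?n v) = ?k * D A B (nu A B)"
    proof -
      have "v - nu ?A B \<in> rels (NL B) (NL ?A)"
        using v(2) Q.cls_eq_iff[OF v(1) nu'] nu(2)[OF A'(1) assms(2)] by simp
      then have "D A B (wdg ?n (v - nu ?A B)) = 0"
        by (intro normal_right(3)[OF assms] frags_diff v(1) nu' rels_RR)
      then show ?thesis using normal_right(1)[OF assms] by (simp add: D_simps)
    qed
    moreover have "- s = ?k \<longleftrightarrow> s = - ?k" by auto
    ultimately show ?thesis using D_nu_nonzero(1)[OF assms(1,2)] P.wedge_cls[OF n]
      by (metis mult_cancel_right)
  qed
  let ?P = "\<lambda>s. s \<in> {1, -1} \<and> (\<forall>\<nu>'\<in>carrier (P.E ?q).
      ext_map ?q Q.G (lattice_proj N (cone_hull ?A)) \<nu>' = \<nu> (cone_hull ?A, cone_hull B) \<longrightarrow>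
      wedge ?q P.G (coset (NL A) ?n) \<nu>' = \<nu> (cone_hull A, cone_hull B) [^]\<^bsub>P.E (Suc ?q)\<^esub> (- s::int))"
  have "face_sign N \<nu> (cone_hull ?A, cone_hull B) (cone_hull A, cone_hull B) = (THE s. ?P s)"
    using ne by (simp add: d rel_lattice_cone Let_def ng)
  also have "\<dots> = - ?k"
  proof (rule the_equality)
    show "?P (- ?k)"
      using normal_right(2)[OF assms] main[of _ "- ?k"] pr by (auto simp: P.carrier_E)
    fix s assume s: "?P s"
    show "s = - ?k"
      using s main[OF nu', of s] pr[OF nu'] nu(2)[OF A'(1) assms(2)] P.cls_closed[OF nu'] by auto
  qed
  finally show ?thesis .
qed

end

section \<open>Cohomology and rational coefficients\<close>

definition boundaries :: "(nat \<Rightarrow> 'a monoid) \<Rightarrow> (nat \<Rightarrow> 'a \<Rightarrow> 'a) \<Rightarrow> nat \<Rightarrow> 'a set" where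
  "boundaries A d q = (case q of 0 \<Rightarrow> {\<one>\<^bsub>A 0\<^esub>} | Suc r \<Rightarrow> d r ` carrier (A r))"

locale cochain_complex =
  fixes A :: "nat \<Rightarrow> 'a monoid" and d :: "nat \<Rightarrow> 'a \<Rightarrow> 'a"
  assumes comm: "comm_group (A q)" and d_hom: "d q \<in> hom (A q) (A (Suc q))"
    and dd: "x \<in> carrier (A q) \<Longrightarrow> d (Suc q) (d q x) = \<one>\<^bsub>A (Suc (Suc q))\<^esub>"
begin

sublocale A: comm_group "A q" for q by (rule comm)

sublocale d: group_hom "A q" "A (Suc q)" "d q" for q
  by unfold_locales (rule d_hom)

abbreviation Z :: "nat \<Rightarrow> 'a monoid" where
  "Z q \<equiv> (A q)\<lparr>carrier := kernel (A q) (A (Suc q)) (d q)\<rparr>"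

lemma cohomology_group_eq: "cohomology_group A d q = Z q Mod boundaries A d q"
  by (simp add: cohomology_group_def boundaries_def)

lemma comm_Z: "comm_group (Z q)"
  by (rule comm_group.intro, rule comm_monoid.intro)
     (use A.subgroup_imp_group[OF d.subgroup_kernel] group.is_monoid
      in \<open>auto intro!: comm_monoid_axioms.intro simp: kernel_def A.m_comm\<close>)

lemma boundaries_subgroup: "subgroup (boundaries A d q) (Z q)"
proof (cases q)
  case 0
  then show ?thesis
    using group.triv_subgroup[OF comm_group.axioms(2)[OF comm_Z], of q] by (simp add: boundaries_def)
next
  case (Suc r)
  have "subgroup (d r ` carrier (A r)) (A (Suc r))"
    by (rule d.img_is_subgroup)
  moreover have "d r ` carrier (A r) \<subseteq> kernel (A (Suc r)) (A (Suc (Suc r))) (d (Suc r))"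
    using dd by (auto simp: kernel_def)
  ultimately have "subgroup (d r ` carrier (A r)) (Z (Suc r))"
    by (simp add: A.subgroup_incl d.subgroup_kernel)
  then show ?thesis by (simp add: Suc boundaries_def)
qed

lemma group_cohomology: "group (cohomology_group A d q)"
  unfolding cohomology_group_eq
  by (rule comm_group.axioms(2)[OF comm_group.abelian_FactGroup[OF comm_Z boundaries_subgroup]])

end

locale complex_hom = A: cochain_complex A dA + B: cochain_complex B dB
  for A :: "nat \<Rightarrow> 'a monoid" and dA and B :: "nat \<Rightarrow> 'b monoid" and dB +
  fixes \<phi> :: "nat \<Rightarrow> 'a \<Rightarrow> 'b"
  assumes \<phi>_hom: "\<phi> q \<in> hom (A q) (B q)"
    and chain: "x \<in> carrier (A q) \<Longrightarrow> \<phi> (Suc q) (dA q x) = dB q (\<phi> q x)"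
begin

sublocale \<phi>: group_hom "A q" "B q" "\<phi> q" for q
  by unfold_locales (rule \<phi>_hom)

lemma cohomology_iso:
  assumes surj: "\<And>b. b \<in> carrier (B q) \<Longrightarrow> dB q b = \<one>\<^bsub>B (Suc q)\<^esub> \<Longrightarrow>
      \<exists>a\<in>carrier (A q). dA q a = \<one>\<^bsub>A (Suc q)\<^esub> \<and> \<phi> q a = b"
    and inj: "\<And>a. a \<in> carrier (A q) \<Longrightarrow> dA q a = \<one>\<^bsub>A (Suc q)\<^esub> \<Longrightarrow> \<phi> q a \<in> boundaries B dB q \<Longrightarrow>
      a \<in> boundaries A dA q"
  shows "cohomology_group B dB q \<cong> cohomology_group A dA q"
proof -
  let ?ZA = "A.Z q" and ?ZB = "B.Z q" and ?bB = "boundaries B dB q"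
  interpret ZA: comm_group ?ZA by (rule A.comm_Z)
  interpret ZB: comm_group ?ZB by (rule B.comm_Z)
  interpret NB: normal ?bB ?ZB
    by (rule ZB.subgroup_imp_normal[OF B.boundaries_subgroup])
  define h where "h a = ?bB #>\<^bsub>?ZB\<^esub> \<phi> q a" for a
  have \<phi>Z: "\<phi> q a \<in> carrier ?ZB" if "a \<in> carrier ?ZA" for a
  proof -
    have a: "a \<in> carrier (A q)" "dA q a = \<one>\<^bsub>A (Suc q)\<^esub>" using that by (auto simp: kernel_def)
    have "dB q (\<phi> q a) = \<phi> (Suc q) \<one>\<^bsub>A (Suc q)\<^esub>" using chain[OF a(1)] a(2) by simp
    then show ?thesis using a \<phi>.hom_closed by (simp add: kernel_def)
  qed
  have "\<phi> q \<in> hom ?ZA ?ZB"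
    using \<phi>Z \<phi>.hom_mult by (auto simp: hom_def kernel_def)
  then have h1: "h \<in> hom ?ZA (?ZB Mod ?bB)"
    using hom_compose[OF _ NB.r_coset_hom_Mod, of "\<phi> q" ?ZA] by (simp add: h_def[abs_def] comp_def)
  interpret h: group_hom ?ZA "?ZB Mod ?bB" h
    by (intro group_hom.intro group_hom_axioms.intro h1 NB.factorgroup_is_group ZA.is_group)
  have surjh: "h ` carrier ?ZA = carrier (?ZB Mod ?bB)"
  proof (intro equalityI subsetI)
    fix X assume "X \<in> carrier (?ZB Mod ?bB)"
    then obtain b where b: "b \<in> carrier ?ZB" "X = ?bB #>\<^bsub>?ZB\<^esub> b"
      by (auto simp: FactGroup_def RCOSETS_def)
    then obtain a where "a \<in> carrier (A q)" "dA q a = \<one>\<^bsub>A (Suc q)\<^esub>" "\<phi> q a = b"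
      using surj[of b] by (auto simp: kernel_def)
    then show "X \<in> h ` carrier ?ZA" using b by (auto simp: h_def kernel_def)
  qed (use h.hom_closed in auto)
  have "kernel ?ZA (?ZB Mod ?bB) h = boundaries A dA q"
  proof (intro equalityI subsetI)
    fix a assume "a \<in> kernel ?ZA (?ZB Mod ?bB) h"
    then have a: "a \<in> carrier ?ZA" "?bB #>\<^bsub>?ZB\<^esub> \<phi> q a = ?bB"
      by (auto simp: kernel_def h_def FactGroup_def)
    then have "\<phi> q a \<in> ?bB"
      using ZB.coset_join1[OF _ \<phi>Z[OF a(1)] B.boundaries_subgroup] NB.subset by simp
    then show "a \<in> boundaries A dA q" using inj[of a] a by (simp add: kernel_def)
  next
    fix a assume a: "a \<in> boundaries A dA q"
    then have aZ: "a \<in> carrier ?ZA" using subgroup.subset[OF A.boundaries_subgroup] by blast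
    have "\<phi> q a \<in> ?bB"
    proof (cases q)
      case 0 then show ?thesis using a by (simp add: boundaries_def)
    next
      case (Suc r)
      then obtain x where "x \<in> carrier (A r)" "a = dA r x" using a by (auto simp: boundaries_def)
      then show ?thesis using chain[of x r] \<phi>.hom_closed[of x r] Suc by (auto simp: boundaries_def)
    qed
    then have "?bB #>\<^bsub>?ZB\<^esub> \<phi> q a = ?bB"
      using ZB.coset_join2[OF \<phi>Z[OF aZ] B.boundaries_subgroup] by blast
    then show "a \<in> kernel ?ZA (?ZB Mod ?bB) h" using aZ by (simp add: kernel_def h_def FactGroup_def)
  qed
  then have "cohomology_group A dA q \<cong> cohomology_group B dB q"
    using h.FactGroup_iso[OF surjh] unfolding A.cohomology_group_eq B.cohomology_group_eq is_iso_def by auto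
  then show ?thesis
    using group.iso_sym[OF A.group_cohomology] by blast
qed

end

text \<open>A map of complexes that is onto with acyclic kernel up to multiples \<open>K \<ge> 1\<close>, where \<open>K = 1\<close>
  under the condition \<open>u\<close>.\<close>

locale quasi_iso = complex_hom A dA B dB \<phi>
  for A :: "nat \<Rightarrow> 'a monoid" and dA and B :: "nat \<Rightarrow> 'b monoid" and dB and \<phi> +
  fixes u :: bool
  assumes onto: "b \<in> carrier (B q) \<Longrightarrow> \<exists>K\<ge>1::int. (u \<longrightarrow> K = 1) \<and> (\<exists>a\<in>carrier (A q). \<phi> q a = b [^]\<^bsub>B q\<^esub> K)"
    and acyclic_0: "a \<in> carrier (A 0) \<Longrightarrow> dA 0 a = \<one>\<^bsub>A (Suc 0)\<^esub> \<Longrightarrow> \<phi> 0 a = \<one>\<^bsub>B 0\<^esub> \<Longrightarrow>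
      \<exists>K\<ge>1::int. (u \<longrightarrow> K = 1) \<and> a [^]\<^bsub>A 0\<^esub> K = \<one>\<^bsub>A 0\<^esub>"
    and acyclic_Suc: "a \<in> carrier (A (Suc q)) \<Longrightarrow> dA (Suc q) a = \<one>\<^bsub>A (Suc (Suc q))\<^esub> \<Longrightarrow> \<phi> (Suc q) a = \<one>\<^bsub>B (Suc q)\<^esub> \<Longrightarrow>
      \<exists>K\<ge>1::int. (u \<longrightarrow> K = 1) \<and> (\<exists>a'\<in>carrier (A q). \<phi> q a' = \<one>\<^bsub>B q\<^esub> \<and> dA q a' = a [^]\<^bsub>A (Suc q)\<^esub> K)"
begin

definition good :: "int \<Rightarrow> bool" where
  "good K \<longleftrightarrow> K \<ge> 1 \<and> (u \<longrightarrow> K = 1)"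

lemma good_mult: "good K \<Longrightarrow> good K' \<Longrightarrow> good (K * K')"
  using mult_mono[of 1 K 1 K'] by (auto simp: good_def)

text \<open>A multiple of \<open>b\<close> lifts to \<open>a0\<close>, whose coboundary is a cocycle
  in the kernel of \<open>\<phi>\<close>. A multiple of this coboundary is the coboundary of some
  \<open>a'\<close> in the kernel, and subtracting \<open>a'\<close> corrects the lift to a
  cocycle.\<close>

lemma quasi_surj:
  assumes "b \<in> carrier (B q)" "dB q b = \<one>\<^bsub>B (Suc q)\<^esub>"
  shows "\<exists>K a. good K \<and> a \<in> carrier (A q) \<and> dA q a = \<one>\<^bsub>A (Suc q)\<^esub> \<and> \<phi> q a = b [^]\<^bsub>B q\<^esub> K"
proof -
  obtain K a0 where K: "good K" and a0: "a0 \<in> carrier (A q)" "\<phi> q a0 = b [^]\<^bsub>B q\<^esub> K"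
    using onto[OF assms(1)] by (auto simp: good_def)
  have "\<phi> (Suc q) (dA q a0) = \<one>\<^bsub>B (Suc q)\<^esub>"
    using chain[OF a0(1)] a0(2) assms by (simp add: B.d.hom_int_pow[symmetric] flip: )
       (metis B.A.int_pow_one B.d.hom_int_pow assms)
  then obtain K' a' where K': "good K'" and a': "a' \<in> carrier (A q)" "\<phi> q a' = \<one>\<^bsub>B q\<^esub>"
      "dA q a' = dA q a0 [^]\<^bsub>A (Suc q)\<^esub> K'"
    using acyclic_Suc[OF A.d.hom_closed[OF a0(1)] A.dd[OF a0(1)]] by (auto simp: good_def)
  define a where "a = a0 [^]\<^bsub>A q\<^esub> K' \<otimes>\<^bsub>A q\<^esub> inv\<^bsub>A q\<^esub> a'"
  have "a \<in> carrier (A q)" using a0 a' by (simp add: a_def)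
  moreover have "dA q a = \<one>\<^bsub>A (Suc q)\<^esub>"
    using a0(1) a' by (simp add: a_def A.d.hom_mult A.d.hom_int_pow)
  moreover have "\<phi> q a = b [^]\<^bsub>B q\<^esub> (K * K')"
    using a0 a'(1,2) assms(1) by (simp add: a_def \<phi>.hom_mult \<phi>.hom_int_pow B.A.int_pow_pow)
  ultimately show ?thesis using good_mult[OF K K'] by blast
qed

text \<open>If \<open>\<phi> a\<close> is the coboundary of \<open>b\<close>, lift a multiple of
  \<open>b\<close> to \<open>a1\<close>. The same multiple of \<open>a\<close> minus the coboundary
  of \<open>a1\<close> is a cocycle in the kernel, hence a coboundary up to a further
  multiple.\<close>

lemma quasi_inj:
  assumes "a \<in> carrier (A q)" "dA q a = \<one>\<^bsub>A (Suc q)\<^esub>" "\<phi> q a \<in> boundaries B dB q"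
  shows "\<exists>K. good K \<and> a [^]\<^bsub>A q\<^esub> K \<in> boundaries A dA q"
proof (cases q)
  case 0
  then show ?thesis using acyclic_0[of a] assms by (auto simp: boundaries_def good_def)
next
  case (Suc r)
  then obtain b where b: "b \<in> carrier (B r)" "\<phi> q a = dB r b" using assms(3) by (auto simp: boundaries_def)
  obtain K a1 where K: "good K" and a1: "a1 \<in> carrier (A r)" "\<phi> r a1 = b [^]\<^bsub>B r\<^esub> K"
    using onto[OF b(1)] by (auto simp: good_def)
  define x where "x = a [^]\<^bsub>A q\<^esub> K \<otimes>\<^bsub>A q\<^esub> inv\<^bsub>A q\<^esub> (dA r a1)"
  have d1: "dA r a1 \<in> carrier (A q)" using A.d.hom_closed[OF a1(1)] Suc by simp
  have x: "x \<in> carrier (A q)" using assms d1 by (simp add: x_def)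
  have "dA q x = \<one>\<^bsub>A (Suc q)\<^esub>"
    using assms d1 A.dd[OF a1(1)] Suc by (simp add: x_def A.d.hom_mult A.d.hom_int_pow)
  moreover have "\<phi> q x = \<one>\<^bsub>B q\<^esub>"
  proof -
    have "\<phi> q (dA r a1) = dB r b [^]\<^bsub>B q\<^esub> K"
      using chain[OF a1(1)] a1(2) b(1) B.d.hom_int_pow[of b r K] Suc by simp
    moreover have "dB r b \<in> carrier (B q)" using b Suc B.d.hom_closed[of b r] by simp
    ultimately show ?thesis
      using assms(1) d1 b by (simp add: x_def \<phi>.hom_mult \<phi>.hom_int_pow)
  qed
  ultimately obtain K' a' where K': "good K'" and a': "a' \<in> carrier (A r)" "dA r a' = x [^]\<^bsub>A q\<^esub> K'"
    using acyclic_Suc[of x r] x Suc by (auto simp: good_def)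
  have "a [^]\<^bsub>A q\<^esub> (K * K') = (x \<otimes>\<^bsub>A q\<^esub> dA r a1) [^]\<^bsub>A q\<^esub> K'"
    using assms(1) d1 by (simp add: x_def A.A.m_assoc A.A.int_pow_pow)
  also have "\<dots> = dA r a' \<otimes>\<^bsub>A q\<^esub> dA r (a1 [^]\<^bsub>A r\<^esub> K')"
    using x d1 a' a1 Suc A.d.hom_int_pow[of a1 r K'] by (simp add: A.A.int_pow_distrib)
  also have "\<dots> = dA r (a' \<otimes>\<^bsub>A r\<^esub> a1 [^]\<^bsub>A r\<^esub> K')"
    using a' a1 Suc A.d.hom_mult[of a' r "a1 [^]\<^bsub>A r\<^esub> K'"] by simp
  finally have e: "a [^]\<^bsub>A q\<^esub> (K * K') = dA r (a' \<otimes>\<^bsub>A r\<^esub> a1 [^]\<^bsub>A r\<^esub> K')" .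
  have "a' \<otimes>\<^bsub>A r\<^esub> a1 [^]\<^bsub>A r\<^esub> K' \<in> carrier (A r)" using a' a1 by simp
  then have "a [^]\<^bsub>A q\<^esub> (K * K') \<in> boundaries A dA q"
    unfolding e by (simp add: Suc boundaries_def)
  then show ?thesis using good_mult[OF K K'] by blast
qed

lemma quasi_iso_integral:
  assumes u
  shows "cohomology_group B dB q \<cong> cohomology_group A dA q"
proof (rule cohomology_iso)
  fix b assume "b \<in> carrier (B q)" "dB q b = \<one>\<^bsub>B (Suc q)\<^esub>"
  then show "\<exists>a\<in>carrier (A q). dA q a = \<one>\<^bsub>A (Suc q)\<^esub> \<and> \<phi> q a = b"
  proof -
    assume "b \<in> carrier (B q)" "dB q b = \<one>\<^bsub>B (Suc q)\<^esub>"
    from quasi_surj[OF this] obtain K a where "good K" "a \<in> carrier (A q)" "dA q a = \<one>\<^bsub>A (Suc q)\<^esub>"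
      "\<phi> q a = b [^]\<^bsub>B q\<^esub> K" by blast
    moreover from this have "K = 1" using assms unfolding good_def by blast
    ultimately show ?thesis using \<open>b \<in> carrier (B q)\<close> by auto
  qed
next
  fix a assume "a \<in> carrier (A q)" "dA q a = \<one>\<^bsub>A (Suc q)\<^esub>" "\<phi> q a \<in> boundaries B dB q"
  then show "a \<in> boundaries A dA q"
  proof -
    assume "a \<in> carrier (A q)" "dA q a = \<one>\<^bsub>A (Suc q)\<^esub>" "\<phi> q a \<in> boundaries B dB q"
    from quasi_inj[OF this] obtain K where "good K" "a [^]\<^bsub>A q\<^esub> K \<in> boundaries A dA q" by blast
    moreover from this have "K = 1" using assms unfolding good_def by blast
    ultimately show ?thesis using \<open>a \<in> carrier (A q)\<close> by auto
  qed
qed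

end

section \<open>Tensor product with the rationals\<close>

text \<open>A strong form of torsion-freeness that is evident for groups of integer-valued
  functionals and lets equations in the tensor product be tested by homomorphisms to the
  integers.\<close>

definition torsionless :: "'a monoid \<Rightarrow> bool" where
  "torsionless A \<longleftrightarrow> (\<forall>x\<in>carrier A. x \<noteq> \<one>\<^bsub>A\<^esub> \<longrightarrow> (\<exists>h\<in>hom A integer_group. h x \<noteq> 0))"

definition tensor_gens :: "'a monoid \<Rightarrow> ('a \<times> rat \<Rightarrow>\<^sub>0 int) set" where
  "tensor_gens A = {frag_of (a \<otimes>\<^bsub>A\<^esub> b, r) - frag_of (a, r) - frag_of (b, r) | a b r.
         a \<in> carrier A \<and> b \<in> carrier A} \<union>
      {frag_of (a, r + s) - frag_of (a, r) - frag_of (a, s) | a r s. a \<in> carrier A}"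

definition tens :: "'a monoid \<Rightarrow> 'a \<Rightarrow> rat \<Rightarrow> ('a \<times> rat \<Rightarrow>\<^sub>0 int) set" where
  "tens A a r = coset (tensor_rel A) (frag_of (a, r))"

lemma tensor_free_plus: "plus_group (tensor_free A)"
  unfolding tensor_free_def by (rule plus_group_free_Abelian)

lemma carrier_tensor_free: "carrier (tensor_free A) = frags (carrier A \<times> UNIV)"
  by (simp add: tensor_free_def carrier_free_Abelian)

locale tensor_group = comm_group A for A :: "'a monoid" (structure)
begin

interpretation F: plus_group "tensor_free A" by (rule tensor_free_plus)

lemma tensor_gens_sub: "tensor_gens A \<subseteq> carrier (tensor_free A)"
  unfolding tensor_gens_def carrier_tensor_free by (auto intro!: frags_diff)

lemma tensor_rel_zspan: "tensor_rel A = zspan (tensor_gens A)"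
  unfolding tensor_rel_def tensor_gens_def[symmetric] by (rule F.generate_zspan[OF tensor_gens_sub])

lemma rel_closed: "add_closed (tensor_rel A)"
  unfolding tensor_rel_zspan by (rule add_closed_zspan)

lemma rel_sub: "tensor_rel A \<subseteq> carrier (tensor_free A)"
  unfolding tensor_rel_zspan carrier_tensor_free
  using zspan_subset[OF tensor_gens_sub[unfolded carrier_tensor_free] add_closed_frags] .

lemma comm_group_tensor: "comm_group (tensor_rat A)"
  unfolding tensor_rat_def by (rule F.comm_group_Mod[OF rel_closed rel_sub])

sublocale T: comm_group "tensor_rat A" by (rule comm_group_tensor)

lemma tens_closed: "a \<in> carrier A \<Longrightarrow> tens A a r \<in> carrier (tensor_rat A)"
  unfolding tensor_rat_def tens_def F.carrier_Mod[OF rel_closed rel_sub] carrier_tensor_free by auto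

lemma mult_T: "coset (tensor_rel A) x \<otimes>\<^bsub>tensor_rat A\<^esub> coset (tensor_rel A) y = coset (tensor_rel A) (x + y)"
  unfolding tensor_rat_def by (rule F.mult_Mod[OF rel_closed rel_sub])

lemma one_T: "\<one>\<^bsub>tensor_rat A\<^esub> = coset (tensor_rel A) 0"
  unfolding tensor_rat_def by (rule F.one_Mod[OF rel_closed rel_sub])

lemma tens_mult:
  assumes "a \<in> carrier A" "b \<in> carrier A"
  shows "tens A (a \<otimes> b) r = tens A a r \<otimes>\<^bsub>tensor_rat A\<^esub> tens A b r"
proof -
  have "frag_of (a \<otimes> b, r) - frag_of (a, r) - frag_of (b, r) \<in> tensor_rel A"
    unfolding tensor_rel_zspan tensor_gens_def using assms by (intro zspan_base) blast
  then show ?thesis unfolding tens_def mult_T coset_eq_iff[OF rel_closed] by (simp add: algebra_simps)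
qed

lemma tens_add:
  assumes "a \<in> carrier A"
  shows "tens A a (r + s) = tens A a r \<otimes>\<^bsub>tensor_rat A\<^esub> tens A a s"
proof -
  have "frag_of (a, r + s) - frag_of (a, r) - frag_of (a, s) \<in> tensor_rel A"
    unfolding tensor_rel_zspan tensor_gens_def using assms by (intro zspan_base) blast
  then show ?thesis unfolding tens_def mult_T coset_eq_iff[OF rel_closed] by (simp add: algebra_simps)
qed

lemma tens_hom: "(\<lambda>a. tens A a r) \<in> hom A (tensor_rat A)"
  by (auto simp: hom_def tens_closed tens_mult)

lemma tens_one: "tens A \<one> r = \<one>\<^bsub>tensor_rat A\<^esub>"
  using group_hom.hom_one[OF group_hom.intro[OF is_group T.is_group group_hom_axioms.intro[OF tens_hom]]] .

lemma tens_pow_left: "a \<in> carrier A \<Longrightarrow> tens A (a [^] (k::int)) r = tens A a r [^]\<^bsub>tensor_rat A\<^esub> k"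
  using group_hom.hom_int_pow[OF group_hom.intro[OF is_group T.is_group group_hom_axioms.intro[OF tens_hom]]] .

lemma tens_zero: "a \<in> carrier A \<Longrightarrow> tens A a 0 = \<one>\<^bsub>tensor_rat A\<^esub>"
  using tens_add[of a 0 0] tens_closed[of a 0] T.l_cancel_one[of "tens A a 0" "tens A a 0"] by simp

lemma tens_pow_right:
  assumes "a \<in> carrier A"
  shows "tens A a (of_int k * r) = tens A a r [^]\<^bsub>tensor_rat A\<^esub> (k::int)"
proof -
  have *: "tens A a (of_nat n * r) = tens A a r [^]\<^bsub>tensor_rat A\<^esub> int n" for n
  proof (induction n)
    case (Suc n)
    have "of_nat (Suc n) * r = of_nat n * r + r" by (simp add: algebra_simps)
    then show ?case
      using Suc tens_add[OF assms] tens_closed[OF assms] T.int_pow_mult[of "tens A a r" "int n" 1]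
      by (simp add: add.commute T.m_comm)
  qed (simp add: tens_zero assms)
  have neg: "tens A a (- s) = inv\<^bsub>tensor_rat A\<^esub> (tens A a s)" for s
    using tens_add[OF assms, of "- s" s] tens_zero[OF assms] tens_closed[OF assms]
    by (intro T.inv_equality[symmetric]) auto
  show ?thesis
  proof (cases "k \<ge> 0")
    case True
    then show ?thesis using *[of "nat k"] by simp
  next
    case False
    have "tens A a (of_int k * r) = tens A a (- (of_nat (nat (- k)) * r))" using False by simp
    also have "\<dots> = inv\<^bsub>tensor_rat A\<^esub> (tens A a (of_nat (nat (- k)) * r))" by (rule neg)
    also have "\<dots> = inv\<^bsub>tensor_rat A\<^esub> (tens A a r [^]\<^bsub>tensor_rat A\<^esub> (- k))"
      by (subst *) (use False in simp)
    finally show ?thesis using tens_closed[OF assms] by (simp add: T.int_pow_neg)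
  qed
qed

lemma tens_scale:
  assumes "a \<in> carrier A" "k \<noteq> 0"
  shows "tens A (a [^] (k::int)) (r / of_int k) = tens A a r"
  using assms tens_pow_left[OF assms(1), of k] tens_pow_right[OF assms(1), of k "r / of_int k"] by simp

text \<open>Common denominators: a difference of \<open>a \<otimes> 1/n\<close> and
  \<open>b \<otimes> 1/m\<close> is a single fraction with denominator \<open>n * m\<close>.\<close>

lemma tens_fraction:
  assumes "X \<in> carrier (tensor_rat A)"
  shows "\<exists>a\<in>carrier A. \<exists>n\<ge>1::int. X = tens A a (1 / of_int n)"
proof -
  obtain v where v: "v \<in> frags (carrier A \<times> UNIV)" "X = coset (tensor_rel A) v"
    using assms unfolding tensor_rat_def F.carrier_Mod[OF rel_closed rel_sub] carrier_tensor_free by auto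
  have "v \<in> frags (carrier A \<times> UNIV) \<and> (\<exists>a\<in>carrier A. \<exists>n\<ge>1::int. coset (tensor_rel A) v = tens A a (1 / of_int n))"
    using v(1)
  proof (induction rule: frags_induct)
    case zero
    then show ?case using tens_one[of 1] one_T by (auto intro!: bexI[of _ \<one>] exI[of _ 1])
  next
    case (of s)
    then obtain a r where s: "s = (a, r)" "a \<in> carrier A" by auto
    obtain m n where r: "quotient_of r = (m, n)" by (cases "quotient_of r")
    then have n: "n > 0" and rmn: "r = of_int m * (1 / of_int n)"
      using quotient_of_denom_pos quotient_of_div by auto
    have "tens A a (of_int m * (1 / of_int n)) = tens A (a [^] m) (1 / of_int n)"
      by (simp only: tens_pow_left[OF s(2)] tens_pow_right[OF s(2)])
    then have "tens A a r = tens A (a [^] m) (1 / of_int n)" by (simp only: rmn)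
    then show ?case using s of n by (auto simp: tens_def[symmetric] intro!: bexI[of _ "a [^] m"] exI[of _ n])
  next
    case (diff x y)
    then obtain a n b m where ab: "a \<in> carrier A" "n \<ge> (1::int)" "coset (tensor_rel A) x = tens A a (1 / of_int n)"
      "b \<in> carrier A" "m \<ge> (1::int)" "coset (tensor_rel A) y = tens A b (1 / of_int m)" by blast
    let ?a = "a [^] m" and ?b = "b [^] n" and ?r = "1 / of_int (n * m) :: rat"
    have e: "tens A a (1 / of_int n) = tens A ?a ?r" "tens A b (1 / of_int m) = tens A ?b ?r"
      using tens_scale[OF ab(1), of m "1 / of_int n"] tens_scale[OF ab(4), of n "1 / of_int m"] ab
      by (simp_all add: mult.commute)
    have y: "coset (tensor_rel A) (- y) = inv\<^bsub>tensor_rat A\<^esub> (coset (tensor_rel A) y)"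
      unfolding tensor_rat_def using diff F.inv_Mod[OF rel_closed rel_sub, of y] by (simp add: carrier_tensor_free)
    have "coset (tensor_rel A) (x - y) = tens A ?a ?r \<otimes>\<^bsub>tensor_rat A\<^esub> inv\<^bsub>tensor_rat A\<^esub> (tens A ?b ?r)"
      using mult_T[of x "- y"] y ab e by simp
    also have "\<dots> = tens A (?a \<otimes> inv ?b) ?r"
      using ab tens_mult[of ?a "inv ?b" ?r]
        group_hom.hom_inv[OF group_hom.intro[OF is_group T.is_group group_hom_axioms.intro[OF tens_hom]], of ?b ?r]
      by simp
    finally have "coset (tensor_rel A) (x - y) = tens A (?a \<otimes> inv ?b) (1 / of_int (n * m))" .
    moreover have "n * m \<ge> 1" using ab mult_mono[of 1 n 1 m] by simp
    ultimately show ?case using diff ab frags_diff by blast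
  qed
  then show ?thesis using v(2) by simp
qed

text \<open>A homomorphism \<open>h\<close> that is nonzero at \<open>a\<close> extends to the
  rational functional with value \<open>r * h a\<close> at \<open>a \<otimes> r\<close>; it kills
  the tensor relations but not this element.\<close>

lemma tens_eq_one:
  assumes "torsionless A" "a \<in> carrier A" "r \<noteq> 0" "tens A a r = \<one>\<^bsub>tensor_rat A\<^esub>"
  shows "a = \<one>"
proof (rule ccontr)
  assume "a \<noteq> \<one>"
  then obtain h where h: "h \<in> hom A integer_group" "h a \<noteq> 0" using assms(1,2) by (auto simp: torsionless_def)
  define f where "f v = (\<Sum>x\<in>Poly_Mapping.keys v. of_int (Poly_Mapping.lookup v x) * (snd x * of_int (h (fst x))))"
    for v :: "'a \<times> rat \<Rightarrow>\<^sub>0 int"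
  have f_of: "f (frag_of (b, s)) = s * of_int (h b)" for b s by (simp add: f_def)
  have f_sup: "f v = (\<Sum>x\<in>S. of_int (Poly_Mapping.lookup v x) * (snd x * of_int (h (fst x))))"
    if "finite S" "Poly_Mapping.keys v \<subseteq> S" for v S
    unfolding f_def using that by (intro sum.mono_neutral_left) (auto simp: in_keys_iff)
  have f_diff: "f (v - w) = f v - f w" for v w
  proof -
    let ?S = "Poly_Mapping.keys v \<union> Poly_Mapping.keys w"
    have "f (v - w) = (\<Sum>x\<in>?S. of_int (Poly_Mapping.lookup (v - w) x) * (snd x * of_int (h (fst x))))"
      by (rule f_sup) (use keys_diff[of v w] in auto)
    moreover have "f v = (\<Sum>x\<in>?S. of_int (Poly_Mapping.lookup v x) * (snd x * of_int (h (fst x))))"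
      "f w = (\<Sum>x\<in>?S. of_int (Poly_Mapping.lookup w x) * (snd x * of_int (h (fst x))))"
      by (rule f_sup; simp)+
    ultimately show ?thesis
      by (simp add: lookup_minus left_diff_distrib sum_subtractf)
  qed
  have f0: "f 0 = 0" by (simp add: f_def)
  have "frag_of (a, r) \<in> tensor_rel A"
    using assms(4) coset_eq_iff[OF rel_closed, of "frag_of (a, r)" 0] by (simp add: tens_def one_T)
  then have "frag_of (a, r) \<in> {v. f v = 0}"
    unfolding tensor_rel_zspan
  proof (rule zspan_minimal)
    fix x assume "x \<in> tensor_gens A"
    then show "x \<in> {v. f v = 0}"
      unfolding tensor_gens_def
    proof (elim UnE CollectE exE conjE)
      fix a b r assume "x = frag_of (a \<otimes> b, r) - frag_of (a, r) - frag_of (b, r)" "a \<in> carrier A" "b \<in> carrier A"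
      then show ?thesis using hom_mult[OF h(1), of a b] by (simp add: f_diff f_of distrib_left)
    next
      fix a r s assume "x = frag_of (a, r + s) - frag_of (a, r) - frag_of (a, s)"
      then show ?thesis by (simp add: f_diff f_of distrib_right)
    qed
  qed (auto simp: f0 f_diff)
  then show False using h assms(3) by (simp add: f_of)
qed

end

lemma tensor_rat_map_tens:
  assumes "comm_group A" "comm_group B" "f \<in> hom A B"
  shows "tensor_rat_map B f (coset (tensor_rel A) v) = coset (tensor_rel B) (frag_extend (\<lambda>(a, r). frag_of (f a, r)) v)"
    "tensor_rat_map B f (tens A a r) = tens B (f a) r"
    "tensor_rat_map B f \<in> hom (tensor_rat A) (tensor_rat B)"
proof -
  interpret A: tensor_group A by (rule tensor_group.intro) fact
  interpret B: tensor_group B by (rule tensor_group.intro) fact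
  interpret FA: plus_group "tensor_free A" by (rule tensor_free_plus)
  interpret FB: plus_group "tensor_free B" by (rule tensor_free_plus)
  let ?F = "frag_extend (\<lambda>(a, r). frag_of (f a, r))"
  show 1: "tensor_rat_map B f (coset (tensor_rel A) v) = coset (tensor_rel B) (?F v)" for v
    unfolding tensor_rat_map_def
  proof (rule FB.coset_map_coset[OF B.rel_closed])
    show "?F x \<in> tensor_rel B" if "x \<in> tensor_rel A" for x
      using that unfolding A.tensor_rel_zspan B.tensor_rel_zspan
    proof (rule zspan_image)
      fix g assume g: "g \<in> tensor_gens A"
      have "?F g \<in> tensor_gens B"
        using g unfolding tensor_gens_def
      proof (elim UnE CollectE exE conjE)
        fix a b r assume "g = frag_of (a \<otimes>\<^bsub>A\<^esub> b, r) - frag_of (a, r) - frag_of (b, r)" "a \<in> carrier A" "b \<in> carrier A"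
        then show "?F g \<in> {frag_of (a \<otimes>\<^bsub>B\<^esub> b, r) - frag_of (a, r) - frag_of (b, r) | a b r.
             a \<in> carrier B \<and> b \<in> carrier B} \<union>
          {frag_of (a, r + s) - frag_of (a, r) - frag_of (a, s) | a r s. a \<in> carrier B}"
          using hom_mult[OF assms(3)] hom_in_carrier[OF assms(3)]
          by (intro UnI1 CollectI exI[of _ "f a"] exI[of _ "f b"] exI[of _ r]) (simp add: frag_extend_diff)
      next
        fix a r s assume "g = frag_of (a, r + s) - frag_of (a, r) - frag_of (a, s)" "a \<in> carrier A"
        then show "?F g \<in> {frag_of (a \<otimes>\<^bsub>B\<^esub> b, r) - frag_of (a, r) - frag_of (b, r) | a b r.
             a \<in> carrier B \<and> b \<in> carrier B} \<union>
          {frag_of (a, r + s) - frag_of (a, r) - frag_of (a, s) | a r s. a \<in> carrier B}"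
          using hom_in_carrier[OF assms(3)]
          by (intro UnI2 CollectI exI[of _ "f a"] exI[of _ r] exI[of _ s]) (simp add: frag_extend_diff)
      qed
      then show "?F g \<in> zspan (tensor_gens B)" by (rule zspan_base)
    qed (simp add: frag_extend_diff)
  qed (use add_closedD(1)[OF A.rel_closed] in \<open>simp_all add: frag_extend_add\<close>)
  show "tensor_rat_map B f (tens A a r) = tens B (f a) r"
    by (simp add: tens_def 1)
  show "tensor_rat_map B f \<in> hom (tensor_rat A) (tensor_rat B)"
  proof (rule homI)
    fix X assume "X \<in> carrier (tensor_rat A)"
    then obtain v where v: "v \<in> frags (carrier A \<times> UNIV)" "X = coset (tensor_rel A) v"
      unfolding tensor_rat_def FA.carrier_Mod[OF A.rel_closed A.rel_sub] carrier_tensor_free by auto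
    have "?F v \<in> frags (carrier B \<times> UNIV)"
      by (rule frags_extend[OF v(1)]) (use hom_in_carrier[OF assms(3)] in auto)
    then show "tensor_rat_map B f X \<in> carrier (tensor_rat B)"
      unfolding tensor_rat_def FB.carrier_Mod[OF B.rel_closed B.rel_sub] carrier_tensor_free
      by (auto simp: v 1)
  next
    fix X Y assume "X \<in> carrier (tensor_rat A)" "Y \<in> carrier (tensor_rat A)"
    then obtain v w where "X = coset (tensor_rel A) v" "Y = coset (tensor_rel A) w"
      unfolding tensor_rat_def FA.carrier_Mod[OF A.rel_closed A.rel_sub] by auto
    then show "tensor_rat_map B f (X \<otimes>\<^bsub>tensor_rat A\<^esub> Y) = tensor_rat_map B f X \<otimes>\<^bsub>tensor_rat B\<^esub> tensor_rat_map B f Y"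
      by (simp add: A.mult_T B.mult_T 1 frag_extend_add)
  qed
qed

lemma cochain_complex_tensor:
  assumes "cochain_complex A d"
  shows "cochain_complex (\<lambda>q. tensor_rat (A q)) (\<lambda>q. tensor_rat_map (A (Suc q)) (d q))"
proof -
  interpret A: cochain_complex A d by fact
  have tg: "tensor_group (A q)" for q by (rule tensor_group.intro) (rule A.comm)
  show ?thesis
  proof (rule cochain_complex.intro)
    show "comm_group (tensor_rat (A q))" for q by (rule tensor_group.comm_group_tensor[OF tg])
    show "tensor_rat_map (A (Suc q)) (d q) \<in> hom (tensor_rat (A q)) (tensor_rat (A (Suc q)))" for q
      by (rule tensor_rat_map_tens(3)[OF A.comm A.comm A.d_hom])
    fix X q assume "X \<in> carrier (tensor_rat (A q))"
    then obtain a r where a: "a \<in> carrier (A q)" "X = tens (A q) a r"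
      using tensor_group.tens_fraction[OF tg] by blast
    then show "tensor_rat_map (A (Suc (Suc q))) (d (Suc q)) (tensor_rat_map (A (Suc q)) (d q) X)
        = \<one>\<^bsub>tensor_rat (A (Suc (Suc q)))\<^esub>"
      by (simp add: tensor_rat_map_tens(2)[OF A.comm A.comm A.d_hom] A.dd tensor_group.tens_one[OF tg])
  qed
qed

text \<open>Every cochain is a single fraction, and torsionlessness turns equations between
  fractions into integral ones. The multiples in \<open>quasi_surj\<close> and
  \<open>quasi_inj\<close> are then absorbed into the denominators.\<close>

lemma (in quasi_iso) quasi_iso_rational:
  fixes q :: nat
  assumes tA: "\<And>q. torsionless (A q)" and tB: "\<And>q. torsionless (B q)"
  shows "cohomology_group (\<lambda>q. tensor_rat (B q)) (\<lambda>q. tensor_rat_map (B (Suc q)) (dB q)) q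
       \<cong> cohomology_group (\<lambda>q. tensor_rat (A q)) (\<lambda>q. tensor_rat_map (A (Suc q)) (dA q)) q"
proof -
  interpret TA: tensor_group "A i" for i by (rule tensor_group.intro) (rule A.comm)
  interpret TB: tensor_group "B i" for i by (rule tensor_group.intro) (rule B.comm)
  interpret CA: cochain_complex "\<lambda>q. tensor_rat (A q)" "\<lambda>q. tensor_rat_map (A (Suc q)) (dA q)"
    by (rule cochain_complex_tensor) (rule A.cochain_complex_axioms)
  interpret CB: cochain_complex "\<lambda>q. tensor_rat (B q)" "\<lambda>q. tensor_rat_map (B (Suc q)) (dB q)"
    by (rule cochain_complex_tensor) (rule B.cochain_complex_axioms)
  note md = tensor_rat_map_tens(2)[OF A.comm A.comm A.d_hom] tensor_rat_map_tens(2)[OF B.comm B.comm B.d_hom]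
    tensor_rat_map_tens(2)[OF A.comm B.comm \<phi>_hom]
  interpret CT: complex_hom "\<lambda>q. tensor_rat (A q)" "\<lambda>q. tensor_rat_map (A (Suc q)) (dA q)"
    "\<lambda>q. tensor_rat (B q)" "\<lambda>q. tensor_rat_map (B (Suc q)) (dB q)" "\<lambda>q. tensor_rat_map (B q) (\<phi> q)"
  proof (intro complex_hom.intro complex_hom_axioms.intro CA.cochain_complex_axioms CB.cochain_complex_axioms)
    show "tensor_rat_map (B q) (\<phi> q) \<in> hom (tensor_rat (A q)) (tensor_rat (B q))" for q
      by (rule tensor_rat_map_tens(3)[OF A.comm B.comm \<phi>_hom])
    fix X q assume "X \<in> carrier (tensor_rat (A q))"
    then obtain a r where a: "a \<in> carrier (A q)" "X = tens (A q) a r"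
      using TA.tens_fraction by blast
    then show "tensor_rat_map (B (Suc q)) (\<phi> (Suc q)) (tensor_rat_map (A (Suc q)) (dA q) X) =
        tensor_rat_map (B (Suc q)) (dB q) (tensor_rat_map (B q) (\<phi> q) X)"
      by (simp add: md chain)
  qed
  have surj: "\<exists>a\<in>carrier (tensor_rat (A q)). tensor_rat_map (A (Suc q)) (dA q) a = \<one>\<^bsub>tensor_rat (A (Suc q))\<^esub> \<and>
        tensor_rat_map (B q) (\<phi> q) a = Y"
    if Y: "Y \<in> carrier (tensor_rat (B q))"
      "tensor_rat_map (B (Suc q)) (dB q) Y = \<one>\<^bsub>tensor_rat (B (Suc q))\<^esub>" for Y
  proof -
    obtain b n where b: "b \<in> carrier (B q)" "n \<ge> (1::int)" "Y = tens (B q) b (1 / of_int n)"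
      using TB.tens_fraction[OF Y(1)] by blast
    then have "dB q b = \<one>\<^bsub>B (Suc q)\<^esub>"
      using Y(2) TB.tens_eq_one[OF tB B.d.hom_closed[OF b(1)], of "1 / of_int n"] by (simp add: md)
    then obtain K a where a: "good K" "a \<in> carrier (A q)" "dA q a = \<one>\<^bsub>A (Suc q)\<^esub>" "\<phi> q a = b [^]\<^bsub>B q\<^esub> K"
      using quasi_surj[OF b(1)] by blast
    then have K: "K \<noteq> 0" by (auto simp: good_def)
    show ?thesis
      using TB.tens_scale[OF b(1) K, of "1 / of_int n"] a
      by (intro bexI[of _ "tens (A q) a (1 / of_int n / of_int K)"])
         (auto simp: md b(3) TA.tens_one TA.tens_closed)
  qed
  have inj: "X \<in> boundaries (\<lambda>q. tensor_rat (A q)) (\<lambda>q. tensor_rat_map (A (Suc q)) (dA q)) q"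
    if X: "X \<in> carrier (tensor_rat (A q))"
      "tensor_rat_map (A (Suc q)) (dA q) X = \<one>\<^bsub>tensor_rat (A (Suc q))\<^esub>"
      "tensor_rat_map (B q) (\<phi> q) X \<in> boundaries (\<lambda>q. tensor_rat (B q)) (\<lambda>q. tensor_rat_map (B (Suc q)) (dB q)) q" for X
  proof -
    obtain a n where a: "a \<in> carrier (A q)" "n \<ge> (1::int)" "X = tens (A q) a (1 / of_int n)"
      using TA.tens_fraction[OF X(1)] by blast
    have da: "dA q a = \<one>\<^bsub>A (Suc q)\<^esub>"
      using X(2) a TA.tens_eq_one[OF tA A.d.hom_closed[OF a(1)], of "1 / of_int n"] by (simp add: md)
    \<comment> \<open>A rational coboundary becomes an integral one after clearing the denominator
      \<open>m\<close> of its primitive; in degree 0 there is no primitive and \<open>m = 1\<close>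
      suffices.\<close>
    have "\<exists>m\<ge>1::int. \<phi> q (a [^]\<^bsub>A q\<^esub> m) \<in> boundaries B dB q"
    proof (cases q)
      case 0
      then have "\<phi> q a = \<one>\<^bsub>B q\<^esub>"
        using X(3) a TB.tens_eq_one[OF tB \<phi>.hom_closed[OF a(1)], of "1 / of_int n"]
        by (simp add: md boundaries_def)
      then show ?thesis using 0 a by (intro exI[of _ 1]) (simp add: boundaries_def)
    next
      case (Suc r)
      then obtain Y where Y: "Y \<in> carrier (tensor_rat (B r))"
        "tens (B q) (\<phi> q a) (1 / of_int n) = tensor_rat_map (B (Suc r)) (dB r) Y"
        using X(3) a by (auto simp: md boundaries_def)
      obtain b m where b: "b \<in> carrier (B r)" "m \<ge> (1::int)" "Y = tens (B r) b (1 / of_int m)"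
        using TB.tens_fraction[OF Y(1)] by blast
      let ?x = "\<phi> q a [^]\<^bsub>B q\<^esub> m" and ?y = "dB r b [^]\<^bsub>B q\<^esub> n"
      have c: "\<phi> q a \<in> carrier (B q)" "dB r b \<in> carrier (B q)"
        using \<phi>.hom_closed[OF a(1)] B.d.hom_closed[OF b(1)] Suc by auto
      have "tens (B q) (\<phi> q a) (1 / of_int n) = tens (B q) (dB r b) (1 / of_int m)"
        using Y(2) b Suc by (simp add: md)
      then have "tens (B q) ?x (1 / of_int (n * m)) = tens (B q) ?y (1 / of_int (n * m))"
        using TB.tens_scale[OF c(1), of m "1 / of_int n"] TB.tens_scale[OF c(2), of n "1 / of_int m"] a(2) b(2)
        by (simp add: mult.commute)
      then have "tens (B q) (?x \<otimes>\<^bsub>B q\<^esub> inv\<^bsub>B q\<^esub> ?y) (1 / of_int (n * m)) = \<one>\<^bsub>tensor_rat (B q)\<^esub>"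
        using c TB.tens_closed TB.tens_mult[of ?y q "inv\<^bsub>B q\<^esub> ?y" "1 / of_int (n * m)"]
        by (simp add: TB.tens_mult TB.tens_one)
      then have "?x \<otimes>\<^bsub>B q\<^esub> inv\<^bsub>B q\<^esub> ?y = \<one>\<^bsub>B q\<^esub>"
        using a(2) b(2) c by (intro TB.tens_eq_one[OF tB]) auto
      then have "?x = ?y" using c by (metis B.A.inv_closed B.A.inv_inv B.A.int_pow_closed B.A.inv_equality)
      then have "\<phi> q (a [^]\<^bsub>A q\<^esub> m) = dB r (b [^]\<^bsub>B r\<^esub> n)"
        using a(1) b(1) Suc \<phi>.hom_int_pow[of a q m] B.d.hom_int_pow[of b r n] by simp
      then show ?thesis using b Suc by (auto simp: boundaries_def)
    qed
    then obtain m where m: "m \<ge> (1::int)" "\<phi> q (a [^]\<^bsub>A q\<^esub> m) \<in> boundaries B dB q" by blast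
    have "dA q (a [^]\<^bsub>A q\<^esub> m) = \<one>\<^bsub>A (Suc q)\<^esub>" using da a(1) by (simp add: A.d.hom_int_pow)
    then obtain K where K: "good K" "(a [^]\<^bsub>A q\<^esub> m) [^]\<^bsub>A q\<^esub> K \<in> boundaries A dA q"
      using quasi_inj[of "a [^]\<^bsub>A q\<^esub> m" q] m a by auto
    define k where "k = m * K"
    have k: "k \<noteq> 0" "a [^]\<^bsub>A q\<^esub> k \<in> boundaries A dA q"
      using K m a(1) by (auto simp: good_def k_def A.A.int_pow_pow)
    have Xk: "X = tens (A q) (a [^]\<^bsub>A q\<^esub> k) (1 / of_int n / of_int k)"
      unfolding a(3) by (rule TA.tens_scale[OF a(1) k(1), symmetric])
    show ?thesis
    proof (cases q)
      case 0
      then show ?thesis using k(2) Xk TA.tens_one[of 0] by (simp add: boundaries_def)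
    next
      case (Suc r)
      then obtain x where "x \<in> carrier (A r)" "a [^]\<^bsub>A q\<^esub> k = dA r x" using k(2) by (auto simp: boundaries_def)
      then show ?thesis
        using Xk Suc TA.tens_closed[of x r "1 / of_int n / of_int k"] by (auto simp: boundaries_def md intro!: image_eqI)
    qed
  qed
  show ?thesis
    by (rule CT.cohomology_iso[OF surj inj])
qed

section \<open>Cochains as families of functionals\<close>

lemma hom_group_carrier: "f \<in> carrier (hom_group G H) \<longleftrightarrow> f \<in> hom G H \<and> f \<in> extensional (carrier G)"
  by (simp add: hom_group_def)

lemma hom_group_mult: "x \<in> carrier G \<Longrightarrow> (f \<otimes>\<^bsub>hom_group G integer_group\<^esub> g) x = f x + g x"
  by (simp add: hom_group_def)

lemma hom_group_one: "x \<in> carrier G \<Longrightarrow> \<one>\<^bsub>hom_group G integer_group\<^esub> x = 0"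
  by (simp add: hom_group_def)

lemma comm_group_hom_group:
  assumes "group G"
  shows "comm_group (hom_group G integer_group)"
proof (rule comm_groupI)
  interpret group G by fact
  let ?H = "hom_group G integer_group"
  have ext: "f = g" if "f \<in> carrier ?H" "g \<in> carrier ?H" "\<And>x. x \<in> carrier G \<Longrightarrow> f x = g x" for f g
    using that by (auto simp: hom_group_carrier intro: extensionalityI)
  show cl: "f \<otimes>\<^bsub>?H\<^esub> g \<in> carrier ?H" if "f \<in> carrier ?H" "g \<in> carrier ?H" for f g
    using that by (auto simp: hom_group_def hom_def)
  show one: "\<one>\<^bsub>?H\<^esub> \<in> carrier ?H"
    by (auto simp: hom_group_def hom_def)
  show "f \<otimes>\<^bsub>?H\<^esub> g \<otimes>\<^bsub>?H\<^esub> h = f \<otimes>\<^bsub>?H\<^esub> (g \<otimes>\<^bsub>?H\<^esub> h)"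
    if "f \<in> carrier ?H" "g \<in> carrier ?H" "h \<in> carrier ?H" for f g h
    by (rule ext) (use that cl in \<open>auto simp: hom_group_mult\<close>)
  show "f \<otimes>\<^bsub>?H\<^esub> g = g \<otimes>\<^bsub>?H\<^esub> f" if "f \<in> carrier ?H" "g \<in> carrier ?H" for f g
    by (rule ext) (use that cl in \<open>auto simp: hom_group_mult\<close>)
  show "\<one>\<^bsub>?H\<^esub> \<otimes>\<^bsub>?H\<^esub> f = f" if "f \<in> carrier ?H" for f
    by (rule ext) (use that cl one in \<open>auto simp: hom_group_mult hom_group_one\<close>)
  show "\<exists>g\<in>carrier ?H. g \<otimes>\<^bsub>?H\<^esub> f = \<one>\<^bsub>?H\<^esub>" if f: "f \<in> carrier ?H" for f
  proof
    show g: "(\<lambda>x\<in>carrier G. - f x) \<in> carrier ?H"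
      using f by (auto simp: hom_group_def hom_def)
    show "(\<lambda>x\<in>carrier G. - f x) \<otimes>\<^bsub>?H\<^esub> f = \<one>\<^bsub>?H\<^esub>"
      by (rule ext) (use f g cl one in \<open>auto simp: hom_group_mult hom_group_one\<close>)
  qed
qed

lemma hom_group_finprod:
  assumes "group G" "finite I" "\<And>i. i \<in> I \<Longrightarrow> h i \<in> carrier (hom_group G integer_group)" "x \<in> carrier G"
  shows "finprod (hom_group G integer_group) h I x = (\<Sum>i\<in>I. h i x)"
proof -
  interpret H: comm_group "hom_group G integer_group" by (rule comm_group_hom_group[OF assms(1)])
  show ?thesis
    using assms(2,3)
  proof (induction I)
    case (insert i I)
    then show ?case
      by (subst H.finprod_insert) (auto simp: hom_group_mult[OF assms(4)])
  qed (simp add: hom_group_one[OF assms(4)])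
qed

lemma group_hom_intI: "group G \<Longrightarrow> f \<in> hom G integer_group \<Longrightarrow> group_hom G integer_group f"
  by (intro group_hom.intro group_hom_axioms.intro) auto

lemma hom_int_finprod:
  assumes "comm_group G" "f \<in> hom G integer_group" "finite I" "\<And>i. i \<in> I \<Longrightarrow> g i \<in> carrier G"
  shows "f (finprod G g I) = (\<Sum>i\<in>I. f (g i))"
proof -
  interpret comm_group G by fact
  interpret group_hom G integer_group f by (rule group_hom_intI[OF is_group assms(2)])
  show ?thesis
    using assms(3,4)
  proof (induction I)
    case (insert i I)
    then show ?case
      by (subst finprod_insert) (auto simp: hom_mult)
  qed (use hom_one in auto)
qed

lemma hom_int_pow_int:
  assumes "group G" "f \<in> hom G integer_group" "x \<in> carrier G"
  shows "f (x [^]\<^bsub>G\<^esub> (k::int)) = k * f x"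
proof -
  interpret group_hom G integer_group f by (rule group_hom_intI[OF assms(1,2)])
  show ?thesis using hom_int_pow[OF assms(3), of k] by simp
qed

definition single :: "'i set \<Rightarrow> ('i \<Rightarrow> 'b monoid) \<Rightarrow> 'i \<Rightarrow> 'b \<Rightarrow> ('i \<Rightarrow> 'b)" where
  "single I G i x = (\<lambda>j\<in>I. if j = i then x else \<one>\<^bsub>G j\<^esub>)"

locale finite_sum_group =
  fixes I :: "'i set" and G :: "'i \<Rightarrow> 'b monoid"
  assumes fin_I: "finite I" and comm_G: "i \<in> I \<Longrightarrow> comm_group (G i)"
begin

abbreviation "SG \<equiv> sum_group I G"

lemma grp: "i \<in> I \<Longrightarrow> group (G i)"
  using comm_G comm_group.axioms(2) by blast

lemma carrier_SG: "carrier SG = (\<Pi>\<^sub>E i\<in>I. carrier (G i))"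
  using carrier_sum_group[of I G] grp fin_I by auto

lemma group_SG: "group SG"
  by (rule sum_group) (rule grp)

lemma comm_group_SG: "comm_group SG"
proof (rule group.group_comm_groupI[OF group_SG])
  fix x y assume xy: "x \<in> carrier SG" "y \<in> carrier SG"
  have "x i \<otimes>\<^bsub>G i\<^esub> y i = y i \<otimes>\<^bsub>G i\<^esub> x i" if i: "i \<in> I" for i
  proof -
    interpret comm_group "G i" by (rule comm_G[OF i])
    show ?thesis by (rule m_comm) (use xy i in \<open>auto simp: carrier_SG\<close>)
  qed
  then show "x \<otimes>\<^bsub>SG\<^esub> y = y \<otimes>\<^bsub>SG\<^esub> x"
    by (auto simp: fun_eq_iff)
qed

lemma single_closed:
  assumes "i \<in> I" "x \<in> carrier (G i)"
  shows "single I G i x \<in> carrier SG"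
  unfolding carrier_SG single_def using assms(2)
  by (auto simp: group.is_monoid[OF grp] monoid.one_closed)

lemma single_hom:
  assumes "i \<in> I"
  shows "single I G i \<in> hom (G i) SG"
proof (rule homI)
  fix x y assume "x \<in> carrier (G i)" "y \<in> carrier (G i)"
  show "single I G i (x \<otimes>\<^bsub>G i\<^esub> y) = single I G i x \<otimes>\<^bsub>SG\<^esub> single I G i y"
    by (auto simp: single_def fun_eq_iff monoid.r_one[OF group.is_monoid[OF grp]] monoid.one_closed[OF group.is_monoid[OF grp]])
qed (rule single_closed[OF assms])

lemma hom_single:
  assumes "f \<in> hom SG integer_group" "i \<in> I"
  shows "(\<lambda>x. f (single I G i x)) \<in> hom (G i) integer_group"
  using hom_compose[OF single_hom[OF assms(2)] assms(1)] by (simp add: comp_def)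

lemma hom_expand:
  assumes f: "f \<in> hom SG integer_group" and c: "c \<in> carrier SG"
  shows "f c = (\<Sum>i\<in>I. f (single I G i (c i)))"
proof -
  interpret f: group_hom SG integer_group f by (rule group_hom_intI[OF group_SG f])
  define r where "r J = (\<lambda>i\<in>I. if i \<in> J then c i else \<one>\<^bsub>G i\<^esub>)" for J
  note one = monoid.one_closed[OF group.is_monoid[OF grp]]
  have rc: "r J \<in> carrier SG" for J
    using c one by (auto simp: r_def carrier_SG)
  have "f (r J) = (\<Sum>i\<in>J. f (single I G i (c i)))" if "J \<subseteq> I" for J
    using finite_subset[OF that fin_I] that
  proof (induction J)
    case empty
    have "r {} = \<one>\<^bsub>SG\<^esub>" by (auto simp: r_def)
    then have "f (r {}) = 0" using f.hom_one by (simp del: one_sum_group)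
    then show ?case by simp
  next
    case (insert j J)
    have "r (insert j J) = single I G j (c j) \<otimes>\<^bsub>SG\<^esub> r J"
    proof -
      have "r (insert j J) i = (single I G j (c j) \<otimes>\<^bsub>SG\<^esub> r J) i" if i: "i \<in> I" for i
      proof -
        interpret group "G i" by (rule grp[OF i])
        have "c i \<in> carrier (G i)" using c i by (auto simp: carrier_SG)
        then have "c i \<otimes>\<^bsub>G i\<^esub> \<one>\<^bsub>G i\<^esub> = c i" "\<one>\<^bsub>G i\<^esub> \<otimes>\<^bsub>G i\<^esub> c i = c i" "\<one>\<^bsub>G i\<^esub> \<otimes>\<^bsub>G i\<^esub> \<one>\<^bsub>G i\<^esub> = \<one>\<^bsub>G i\<^esub>"
          by simp_all
        then show ?thesis using i insert(2) by (cases "i = j") (simp_all add: r_def single_def)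
      qed
      then show ?thesis by (auto simp: r_def fun_eq_iff)
    qed
    moreover have "single I G j (c j) \<in> carrier SG"
      using insert c by (intro single_closed) (auto simp: carrier_SG)
    ultimately have "f (r (insert j J)) = f (single I G j (c j)) + f (r J)"
      using f.hom_mult[OF _ rc[of J]] by (simp del: mult_sum_group)
    then show ?case using insert by simp
  qed
  from this[of I] have "f (r I) = (\<Sum>i\<in>I. f (single I G i (c i)))" by simp
  moreover have "r I = c" using c unfolding r_def carrier_SG by (auto simp: fun_eq_iff PiE_def extensional_def)
  ultimately show ?thesis by simp
qed

lemma sum_hom:
  assumes "\<And>i. i \<in> I \<Longrightarrow> g i \<in> hom (G i) integer_group"
  shows "(\<lambda>c\<in>carrier SG. \<Sum>i\<in>I. g i (c i)) \<in> hom SG integer_group"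
proof (rule homI)
  fix x y assume xy: "x \<in> carrier SG" "y \<in> carrier SG"
  have "x \<otimes>\<^bsub>SG\<^esub> y \<in> carrier SG" using xy monoid.m_closed[OF group.is_monoid[OF group_SG]] by blast
  moreover have "g i ((x \<otimes>\<^bsub>SG\<^esub> y) i) = g i (x i) + g i (y i)" if "i \<in> I" for i
    using hom_mult[OF assms[OF that], of "x i" "y i"] that xy by (auto simp: carrier_SG)
  ultimately show "(\<lambda>c\<in>carrier SG. \<Sum>i\<in>I. g i (c i)) (x \<otimes>\<^bsub>SG\<^esub> y) =
     (\<lambda>c\<in>carrier SG. \<Sum>i\<in>I. g i (c i)) x \<otimes>\<^bsub>integer_group\<^esub> (\<lambda>c\<in>carrier SG. \<Sum>i\<in>I. g i (c i)) y"
    using xy by (simp del: mult_sum_group add: sum.distrib)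
qed simp

end

declare F_lower.simps [simp del]

section \<open>Coefficient groups in terms of representatives\<close>

context toric_fan
begin

abbreviation Fl :: "nat \<Rightarrow> 'a set \<Rightarrow> 'a set \<Rightarrow> 'a multivec monoid" where
  "Fl p A B \<equiv> F_lower N \<Sigma> p (cone_hull A, cone_hull B)"

definition fcls :: "nat \<Rightarrow> 'a set \<Rightarrow> ('a list \<Rightarrow>\<^sub>0 int) \<Rightarrow> 'a multivec" where
  "fcls p A = lattice_pair.cls N (NL A) p"

lemma SS_union: "SS (int p) B = frags (\<Union>D\<in>{D \<in> \<Delta>. B \<subseteq> D}. lsts p (NL D))"
  unfolding SS_def by (rule arg_cong[where f=frags]) (auto simp: lsts_def simp del: image_iff)

lemma SS_FL: "v \<in> SS (int p) B \<Longrightarrow> v \<in> frags (lsts p N)"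
  using SS_lsts[of v "int p" B] by simp

context
  fixes A B assumes AB: "A \<subseteq> B" "B \<in> \<Delta>"
begin

interpretation P: lattice_pair N "NL A" by (rule pair_quot)

text \<open>The cones containing \<open>cone_hull B\<close> correspond to the sets of
  \<open>\<Delta>\<close> containing \<open>B\<close>, and the inclusions of their exterior powers
  are identities on representatives; so the sum of the images consists of the classes of
  \<open>SS\<close>.\<close>

lemma Fl_def: "Fl p A B = subgroup_generated (P.E p) (P.cls p ` SS (int p) B)"
  and carrier_Fl: "carrier (Fl p A B) = fcls p A ` SS (int p) B"
proof -
  have em: "ext_map p P.G (\<lambda>x. x) ` carrier (ext_power p (rel_lattice N (cone_hull D) (cone_hull A))) = P.cls p ` frags (lsts p (NL D))"
    if D: "B \<subseteq> D" for D
  proof -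
    interpret Q: lattice_pair "NL D" "NL A" by (rule pair_rel) (use AB D in auto)
    have "ext_map p P.G (\<lambda>x. x) (Q.cls p v) = P.cls p v" if "v \<in> frags (lsts p (NL D))" for v
      by (rule ext_map_cls[OF Q.lattice_pair_axioms P.lattice_pair_axioms NL_sub _ that]) simp
    then show ?thesis unfolding rel_lattice_cone Q.carrier_E image_image by (rule image_cong[OF refl])
  qed
  have "{\<eta> \<in> \<Sigma>. cone_face (cone_hull B) \<eta>} = cone_hull ` {D \<in> \<Delta>. B \<subseteq> D}"
  proof (intro equalityI subsetI)
    fix \<eta> assume "\<eta> \<in> {\<eta> \<in> \<Sigma>. cone_face (cone_hull B) \<eta>}"
    then have e: "\<eta> \<in> \<Sigma>" "cone_face (cone_hull B) \<eta>" by auto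
    have g: "gens \<eta> \<in> \<Delta>" by (rule gens_\<Delta>[OF e(1)])
    moreover have "cone_hull (gens \<eta>) = \<eta>" by (rule gens(3)[OF e(1)])
    ultimately show "\<eta> \<in> cone_hull ` {D \<in> \<Delta>. B \<subseteq> D}"
      using face_\<Delta>[OF AB(2) g] e(2) by (intro image_eqI[of _ _ "gens \<eta>"]) simp_all
  next
    fix \<eta> assume "\<eta> \<in> cone_hull ` {D \<in> \<Delta>. B \<subseteq> D}"
    then obtain D where D: "\<eta> = cone_hull D" "D \<in> \<Delta>" "B \<subseteq> D" by blast
    then show "\<eta> \<in> {\<eta> \<in> \<Sigma>. cone_face (cone_hull B) \<eta>}"
      using face_\<Delta>[OF AB(2) D(2)] cone_\<Delta>(1)[OF D(2)] by simp
  qed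
  moreover have "(\<Union>D\<in>{D \<in> \<Delta>. B \<subseteq> D}. ext_map p P.G (\<lambda>x. x) ` carrier (ext_power p (rel_lattice N (cone_hull D) (cone_hull A))))
      = (\<Union>D\<in>{D \<in> \<Delta>. B \<subseteq> D}. P.cls p ` frags (lsts p (NL D)))"
    by (rule SUP_cong[OF refl]) (rule em, blast)
  ultimately have F: "Fl p A B = subgroup_generated (P.E p) (\<Union>D\<in>{D \<in> \<Delta>. B \<subseteq> D}. P.cls p ` frags (lsts p (NL D)))"
    by (simp add: F_lower.simps quot_lattice_cone del: image_iff)
  have sub: "(\<Union>D\<in>{D \<in> \<Delta>. B \<subseteq> D}. P.cls p ` frags (lsts p (NL D))) \<subseteq> carrier (P.E p)"
  proof safe
    fix D v assume "v \<in> frags (lsts p (NL D))"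
    then have "v \<in> frags (lsts p N)" by (rule frags_mono[rotated]) (use NL_sub[of D] in \<open>auto simp: lsts_def\<close>)
    then show "P.cls p v \<in> carrier (P.E p)" by (rule P.cls_closed)
  qed
  have gen: "generate (P.E p) (\<Union>D\<in>{D \<in> \<Delta>. B \<subseteq> D}. P.cls p ` frags (lsts p (NL D))) = P.cls p ` SS (int p) B"
    unfolding SS_union by (rule P.generate_cls) (use NL_sub in \<open>auto simp: lsts_def\<close>)
  have c: "carrier (Fl p A B) = P.cls p ` SS (int p) B"
    unfolding F carrier_subgroup_generated using sub gen by (simp add: Int_absorb1)
  then show "carrier (Fl p A B) = fcls p A ` SS (int p) B"
    by (simp add: fcls_def)
  have "subgroup (P.cls p ` SS (int p) B) (P.E p)"
    unfolding gen[symmetric] by (rule P.E.generate_is_subgroup[OF sub])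
  then have "carrier (subgroup_generated (P.E p) (P.cls p ` SS (int p) B)) = P.cls p ` SS (int p) B"
    by (rule subgroup.carrier_subgroup_generated_subgroup)
  then show "Fl p A B = subgroup_generated (P.E p) (P.cls p ` SS (int p) B)"
    using c unfolding F subgroup_generated_def by simp
qed

lemma comm_group_Fl: "comm_group (Fl p A B)"
  unfolding Fl_def by (rule P.E.abelian_subgroup_generated) (rule P.comm_group_E)

lemma fcls_closed: "v \<in> SS (int p) B \<Longrightarrow> fcls p A v \<in> carrier (Fl p A B)"
  by (simp add: carrier_Fl)

lemma fcls_add: "fcls p A v \<otimes>\<^bsub>Fl p A B\<^esub> fcls p A w = fcls p A (v + w)"
  unfolding Fl_def fcls_def by (simp add: P.cls_add)

lemma fcls_hom_Fun:
  assumes "h \<in> hom (Fl p A B) integer_group"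
  shows "Fun (int p) A B (\<lambda>v. h (fcls p A v))"
proof -
  have add: "h (fcls p A (v + w)) = h (fcls p A v) + h (fcls p A w)" if "v \<in> SS (int p) B" "w \<in> SS (int p) B" for v w
    using hom_mult[OF assms fcls_closed[OF that(1)] fcls_closed[OF that(2)]] by (simp add: fcls_add)
  show ?thesis
  proof (rule FunI)
    fix v w assume vw: "v \<in> SS (int p) B" "w \<in> SS (int p) B"
    then show "h (fcls p A (v - w)) = h (fcls p A v) - h (fcls p A w)"
      using add[of "v - w" w] by (auto simp: SS_closed)
  next
    fix v assume v: "v \<in> SS (int p) B" "v \<in> RR A"
    then have "fcls p A v = fcls p A 0"
      unfolding fcls_def using P.cls_eq_iff[OF SS_FL[OF v(1)], of 0] by (simp add: RR_def)
    moreover have "h (fcls p A 0) = 0" using add[of 0 0] by (auto simp: SS_closed)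
    ultimately show "h (fcls p A v) = 0" by simp
  qed
qed

text \<open>The functional on classes evaluates \<open>u\<close> at a chosen representative, and
  \<open>Fun_cong\<close> makes the choice irrelevant.\<close>

lemma Fun_fcls_hom:
  assumes "Fun (int p) A B u"
  obtains h where "h \<in> hom (Fl p A B) integer_group" "h \<in> extensional (carrier (Fl p A B))"
    "\<And>v. v \<in> SS (int p) B \<Longrightarrow> h (fcls p A v) = u v"
proof -
  define h where "h = (\<lambda>X\<in>carrier (Fl p A B). u (SOME v. v \<in> SS (int p) B \<and> X = fcls p A v))"
  have hv: "h (fcls p A v) = u v" if v: "v \<in> SS (int p) B" for v
  proof -
    define w where "w = (SOME w. w \<in> SS (int p) B \<and> fcls p A v = fcls p A w)"
    have "w \<in> SS (int p) B \<and> fcls p A v = fcls p A w"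
      unfolding w_def by (rule someI[of _ v]) (use v in simp)
    then have "u w = u v"
      using P.cls_eq_iff[OF SS_FL[OF v], of w] SS_FL[of w p B] v
      by (intro Fun_cong[OF assms, symmetric]) (auto simp: fcls_def RR_def)
    then show ?thesis using fcls_closed[OF v] by (simp add: h_def w_def)
  qed
  have "h \<in> hom (Fl p A B) integer_group"
  proof (rule homI)
    fix X Y assume "X \<in> carrier (Fl p A B)" "Y \<in> carrier (Fl p A B)"
    then obtain v w where "v \<in> SS (int p) B" "X = fcls p A v" "w \<in> SS (int p) B" "Y = fcls p A w"
      by (auto simp: carrier_Fl)
    then show "h (X \<otimes>\<^bsub>Fl p A B\<^esub> Y) = h X \<otimes>\<^bsub>integer_group\<^esub> h Y"
      using Fun_add[OF assms] SS_closed(3) by (simp add: fcls_add hv)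
  qed simp
  then show thesis using that[of h] hv by (simp add: h_def)
qed

lemma F_proj_fcls:
  assumes "A \<subseteq> A'" "v \<in> SS (int p) B"
  shows "F_proj N p (cone_hull A', X) (fcls p A v) = fcls p A' v"
  unfolding F_proj_def fcls_def quot_lattice_cone fst_conv
  by (rule ext_map_cls[OF P.lattice_pair_axioms pair_quot order_refl lattice_proj_coset[OF assms(1)] SS_FL[OF assms(2)]])

lemma wedge_fcls:
  assumes "n \<in> N"
  shows "wedge p (quot_lattice N (cone_hull A)) (coset (NL A) n) (fcls p A v) = fcls (Suc p) A (wdg n v)"
  unfolding quot_lattice_cone fcls_def by (rule P.wedge_cls[OF assms])

lemma fcls_eq_iff:
  assumes "v \<in> SS (int p) B" "w \<in> SS (int p) B"
  shows "fcls p A v = fcls p A w \<longleftrightarrow> v - w \<in> RR A"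
  unfolding fcls_def RR_def by (rule P.cls_eq_iff[OF SS_FL[OF assms(1)] SS_FL[OF assms(2)]])

end

lemma cell_D: "cell q A B \<Longrightarrow> A \<subseteq> B" "cell q A B \<Longrightarrow> B \<in> \<Delta>" "cell q A B \<Longrightarrow> A \<in> \<Delta>"
  unfolding cell_def using down by blast+

lemma faces_cell: "cell q A B \<Longrightarrow> (cone_hull A, cone_hull B) \<in> faces \<Sigma> q"
  using faces_\<Delta>[of A B] by (auto simp: cell_def simp del: image_iff)

lemma faces_obtain:
  assumes "\<delta> \<in> faces \<Sigma> q"
  obtains A B where "cell q A B" "\<delta> = (cone_hull A, cone_hull B)"
proof -
  obtain \<tau> \<sigma> where d: "\<delta> = (\<tau>, \<sigma>)" "\<tau> \<in> \<Sigma>" "\<sigma> \<in> \<Sigma>" "cone_face \<tau> \<sigma>" "dim \<sigma> - dim \<tau> = q"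
    using assms by (auto simp: faces_def)
  have s: "gens \<tau> \<subseteq> gens \<sigma>" using cone_face_iff d by simp
  have "card (gens \<sigma> - gens \<tau>) = q"
    using d dim_gens card_Diff_subset[OF gens(1)[OF d(2)] s] by simp
  then have "cell q (gens \<tau>) (gens \<sigma>)" unfolding cell_def using s gens_\<Delta>[OF d(3)] by blast
  then show thesis using that[of "gens \<tau>" "gens \<sigma>"] gens(3) d by simp
qed

lemma cone_inj_\<Delta>: "A \<in> \<Delta> \<Longrightarrow> B \<in> \<Delta> \<Longrightarrow> cone_hull A = cone_hull B \<longleftrightarrow> A = B"
  using cone_\<Delta>(2)[of A] cone_\<Delta>(2)[of B] by metis

lemma finite_faces: "finite (faces \<Sigma> q)"
proof (rule finite_subset)
  show "faces \<Sigma> q \<subseteq> \<Sigma> \<times> \<Sigma>" by (auto simp: faces_def)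
  show "finite (\<Sigma> \<times> \<Sigma>)" using fan by (simp add: fan_def)
qed

lemma chain_group: "finite_sum_group (faces \<Sigma> q) (F_lower N \<Sigma> p)"
proof (rule finite_sum_group.intro)
  show "comm_group (F_lower N \<Sigma> p \<delta>)" if d: "\<delta> \<in> faces \<Sigma> q" for \<delta>
  proof -
    obtain A B where AB: "cell q A B" "\<delta> = (cone_hull A, cone_hull B)" by (rule faces_obtain[OF d])
    show ?thesis unfolding AB(2) by (rule comm_group_Fl[OF cell_D(1,2)[OF AB(1)]])
  qed
qed (rule finite_faces)

end

section \<open>Tropical cochains and their coboundary\<close>

context oriented_fan
begin

lemma osgn_sq: "cell q A B \<Longrightarrow> osgn A B * osgn A B = 1"
  using D_nu_nonzero(2)[OF cell_D(1,2)] by (simp add: osgn_def sgn_if)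

context
  fixes p :: nat
begin

abbreviation "T \<equiv> trop_cochain N \<Sigma> p"
abbreviation "dT \<equiv> trop_coboundary N \<Sigma> \<nu> p"
abbreviation "sg q \<equiv> single (faces \<Sigma> q) (F_lower N \<Sigma> p)"

interpretation CG: finite_sum_group "faces \<Sigma> i" "F_lower N \<Sigma> p" for i by (rule chain_group)

text \<open>A cochain on one summand, read on representatives. The factor \<open>osgn\<close> passes
  from the given orientation to that of the ordered rays, which turns the coboundary into
  \<open>dl\<close>.\<close>

definition trop_value :: "nat \<Rightarrow> (('a cface \<Rightarrow> 'a multivec) \<Rightarrow> int) \<Rightarrow> 'a set \<Rightarrow> 'a set \<Rightarrow> ('a list \<Rightarrow>\<^sub>0 int) \<Rightarrow> int" where
  "trop_value q f A B v = osgn A B * f (sg q (cone_hull A, cone_hull B) (fcls p A v))"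

lemma T_carrier: "f \<in> carrier (T q) \<longleftrightarrow> f \<in> hom (CG.SG q) integer_group \<and> f \<in> extensional (carrier (CG.SG q))"
  by (simp add: trop_cochain_def trop_chain_def hom_group_carrier)

lemma comm_group_T: "comm_group (T q)"
  unfolding trop_cochain_def trop_chain_def by (rule comm_group_hom_group[OF CG.group_SG])

lemma Fam_trop_value:
  assumes "f \<in> carrier (T q)"
  shows "Fam (int p) q (trop_value q f)"
  unfolding Fam_def
proof (intro allI impI)
  fix A B assume c: "cell q A B"
  have "Fun (int p) A B (\<lambda>v. f (sg q (cone_hull A, cone_hull B) (fcls p A v)))"
    by (rule fcls_hom_Fun[OF cell_D(1,2)[OF c] CG.hom_single[OF _ faces_cell[OF c]]])
       (use assms T_carrier in blast)
  from Fun_lin[OF this Fun_zero, of "osgn A B" 0] show "Fun (int p) A B (trop_value q f A B)"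
    by (simp add: trop_value_def[abs_def])
qed

lemma sg_closed: "cell q A B \<Longrightarrow> v \<in> SS (int p) B \<Longrightarrow> sg q (cone_hull A, cone_hull B) (fcls p A v) \<in> carrier (CG.SG q)"
  by (rule CG.single_closed[OF faces_cell fcls_closed[OF cell_D(1,2)]])

lemma trop_value_hom:
  assumes "cell q A B" "v \<in> SS (int p) B"
  shows "(\<lambda>f. trop_value q f A B v) \<in> hom (T q) integer_group"
  by (rule homI) (use hom_group_mult[OF sg_closed[OF assms]] in
      \<open>auto simp: trop_value_def trop_cochain_def trop_chain_def distrib_left\<close>)

lemma faces_element:
  assumes "c \<in> carrier (CG.SG q)" "\<delta> \<in> faces \<Sigma> q"
  obtains A B v where "cell q A B" "\<delta> = (cone_hull A, cone_hull B)" "v \<in> SS (int p) B" "c \<delta> = fcls p A v"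
proof -
  obtain A B where AB: "cell q A B" "\<delta> = (cone_hull A, cone_hull B)" by (rule faces_obtain[OF assms(2)])
  have "c \<delta> \<in> carrier (Fl p A B)" using assms AB unfolding CG.carrier_SG by (auto simp: PiE_iff)
  then obtain v where "v \<in> SS (int p) B" "c \<delta> = fcls p A v"
    unfolding carrier_Fl[OF cell_D(1,2)[OF AB(1)]] by auto
  then show thesis using that AB by blast
qed

lemma trop_value_ext:
  assumes "f \<in> carrier (T q)" "g \<in> carrier (T q)"
    and eq: "\<And>A B v. cell q A B \<Longrightarrow> v \<in> SS (int p) B \<Longrightarrow> trop_value q f A B v = trop_value q g A B v"
  shows "f = g"
proof (rule extensionalityI)
  show "f \<in> extensional (carrier (CG.SG q))" "g \<in> extensional (carrier (CG.SG q))"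
    using assms T_carrier by auto
  have fg: "f \<in> hom (CG.SG q) integer_group" "g \<in> hom (CG.SG q) integer_group" using assms T_carrier by auto
  fix c assume c: "c \<in> carrier (CG.SG q)"
  have "f (sg q \<delta> (c \<delta>)) = g (sg q \<delta> (c \<delta>))" if d: "\<delta> \<in> faces \<Sigma> q" for \<delta>
  proof -
    obtain A B v where AB: "cell q A B" "\<delta> = (cone_hull A, cone_hull B)" "v \<in> SS (int p) B" "c \<delta> = fcls p A v"
      by (rule faces_element[OF c d])
    have "osgn A B \<noteq> 0" using osgn_sq[OF AB(1)] by auto
    then show ?thesis using eq[OF AB(1,3)] AB(4) unfolding AB(2) trop_value_def by simp
  qed
  then show "f c = g c"
    unfolding CG.hom_expand[OF fg(1) c] CG.hom_expand[OF fg(2) c] by (intro sum.cong) auto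
qed

text \<open>Inverts \<open>trop_value\<close> on families: the signs are their own inverses, and the
  functionals of the single faces are summed over the direct sum.\<close>

lemma trop_value_exists:
  assumes "Fam (int p) q u"
  shows "\<exists>f\<in>carrier (T q). \<forall>A B v. cell q A B \<longrightarrow> v \<in> SS (int p) B \<longrightarrow> trop_value q f A B v = u A B v"
proof -
  have "\<forall>\<delta>\<in>faces \<Sigma> q. \<exists>h. h \<in> hom (F_lower N \<Sigma> p \<delta>) integer_group \<and>
    (\<forall>A B v. cell q A B \<longrightarrow> \<delta> = (cone_hull A, cone_hull B) \<longrightarrow> v \<in> SS (int p) B \<longrightarrow> h (fcls p A v) = osgn A B * u A B v)"
  proof
    fix \<delta> assume "\<delta> \<in> faces \<Sigma> q"
    then obtain A B where AB: "cell q A B" "\<delta> = (cone_hull A, cone_hull B)" by (rule faces_obtain)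
    have "Fun (int p) A B (u A B)" using assms AB by (simp add: Fam_def)
    from Fun_lin[OF this Fun_zero, of "osgn A B" 0] have "Fun (int p) A B (\<lambda>v. osgn A B * u A B v)" by simp
    from Fun_fcls_hom[OF cell_D(1,2)[OF AB(1)] this] obtain h where
      h: "h \<in> hom (Fl p A B) integer_group" "\<And>v. v \<in> SS (int p) B \<Longrightarrow> h (fcls p A v) = osgn A B * u A B v" by metis
    have "A' = A \<and> B' = B" if "cell q A' B'" "\<delta> = (cone_hull A', cone_hull B')" for A' B'
      using that AB cone_inj_\<Delta>[OF cell_D(3)[OF that(1)] cell_D(3)[OF AB(1)]]
        cone_inj_\<Delta>[OF cell_D(2)[OF that(1)] cell_D(2)[OF AB(1)]] by simp
    then show "\<exists>h. h \<in> hom (F_lower N \<Sigma> p \<delta>) integer_group \<and>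
      (\<forall>A B v. cell q A B \<longrightarrow> \<delta> = (cone_hull A, cone_hull B) \<longrightarrow> v \<in> SS (int p) B \<longrightarrow> h (fcls p A v) = osgn A B * u A B v)"
      using h AB(2) by (intro exI[of _ h]) blast
  qed
  from bchoice[OF this] obtain g where g: "\<And>\<delta>. \<delta> \<in> faces \<Sigma> q \<Longrightarrow> g \<delta> \<in> hom (F_lower N \<Sigma> p \<delta>) integer_group"
    "\<And>A B v. cell q A B \<Longrightarrow> v \<in> SS (int p) B \<Longrightarrow> g (cone_hull A, cone_hull B) (fcls p A v) = osgn A B * u A B v"
    using faces_cell by blast
  define f where "f = (\<lambda>c\<in>carrier (CG.SG q). \<Sum>\<delta>\<in>faces \<Sigma> q. g \<delta> (c \<delta>))"
  have "f \<in> carrier (T q)"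
    unfolding T_carrier f_def by (intro conjI CG.sum_hom g(1) restrict_extensional)
  moreover have "trop_value q f A B v = u A B v" if c: "cell q A B" and v: "v \<in> SS (int p) B" for A B v
  proof -
    let ?\<delta> = "(cone_hull A, cone_hull B)"
    have z: "g \<delta> \<one>\<^bsub>F_lower N \<Sigma> p \<delta>\<^esub> = 0" if "\<delta> \<in> faces \<Sigma> q" for \<delta>
      using group_hom.hom_one[OF group_hom_intI[OF CG.grp[OF that] g(1)[OF that]]] by simp
    have "f (sg q ?\<delta> (fcls p A v)) = (\<Sum>\<delta>\<in>faces \<Sigma> q. g \<delta> (sg q ?\<delta> (fcls p A v) \<delta>))"
      using sg_closed[OF c v] by (simp add: f_def)
    also have "\<dots> = (\<Sum>\<delta>\<in>faces \<Sigma> q. if \<delta> = ?\<delta> then g ?\<delta> (fcls p A v) else 0)"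
      by (rule sum.cong) (auto simp: single_def z)
    also have "\<dots> = g ?\<delta> (fcls p A v)"
      using faces_cell[OF c] finite_faces by simp
    finally have "f (sg q ?\<delta> (fcls p A v)) = osgn A B * u A B v" using g(2)[OF c v] by simp
    then show ?thesis using osgn_sq[OF c] by (simp add: trop_value_def mult.assoc[symmetric])
  qed
  ultimately show ?thesis by blast
qed

lemma subface_cells:
  assumes "cell q A B" "cell q' A' B'"
  shows "subface (cone_hull A, cone_hull B) (cone_hull A', cone_hull B') \<longleftrightarrow> A' \<subseteq> A \<and> B \<subseteq> B'"
  using face_\<Delta>[OF cell_D(3)[OF assms(2)] cell_D(3)[OF assms(1)]] face_\<Delta>[OF cell_D(3)[OF assms(1)] cell_D(2)[OF assms(1)]]
    face_\<Delta>[OF cell_D(2)[OF assms(1)] cell_D(2)[OF assms(2)]] cell_D(1)[OF assms(1)] by simp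

lemma F_proj_face:
  assumes "\<gamma> \<in> faces \<Sigma> q" "\<delta> \<in> faces \<Sigma> (Suc q)" "subface \<gamma> \<delta>"
  shows "F_proj N p \<gamma> \<in> hom (F_lower N \<Sigma> p \<delta>) (F_lower N \<Sigma> p \<gamma>)"
proof -
  obtain A B where AB: "cell q A B" "\<gamma> = (cone_hull A, cone_hull B)" by (rule faces_obtain[OF assms(1)])
  obtain A' B' where AB': "cell (Suc q) A' B'" "\<delta> = (cone_hull A', cone_hull B')" by (rule faces_obtain[OF assms(2)])
  have s: "A' \<subseteq> A" "B \<subseteq> B'" using assms(3) subface_cells[OF AB(1) AB'(1)] AB(2) AB'(2) by auto
  note pr = F_proj_fcls[OF cell_D(1,2)[OF AB'(1)] s(1)]
  show ?thesis
    unfolding AB(2) AB'(2)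
  proof (rule homI)
    fix X assume "X \<in> carrier (Fl p A' B')"
    then obtain v where "v \<in> SS (int p) B'" "X = fcls p A' v"
      unfolding carrier_Fl[OF cell_D(1,2)[OF AB'(1)]] by auto
    then show "F_proj N p (cone_hull A, cone_hull B) X \<in> carrier (Fl p A B)"
      using fcls_closed[OF cell_D(1,2)[OF AB(1)] SS_anti[OF s(2)]] by (simp add: pr)
  next
    fix X Y assume "X \<in> carrier (Fl p A' B')" "Y \<in> carrier (Fl p A' B')"
    then obtain v w where "v \<in> SS (int p) B'" "X = fcls p A' v" "w \<in> SS (int p) B'" "Y = fcls p A' w"
      unfolding carrier_Fl[OF cell_D(1,2)[OF AB'(1)]] by auto
    then show "F_proj N p (cone_hull A, cone_hull B) (X \<otimes>\<^bsub>Fl p A' B'\<^esub> Y) =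
      F_proj N p (cone_hull A, cone_hull B) X \<otimes>\<^bsub>Fl p A B\<^esub> F_proj N p (cone_hull A, cone_hull B) Y"
      using SS_closed(3) by (simp add: pr fcls_add[OF cell_D(1,2)[OF AB'(1)]] fcls_add[OF cell_D(1,2)[OF AB(1)]])
  qed
qed

lemma boundary_formula:
  assumes f: "f \<in> hom (CG.SG q) integer_group" and c: "c \<in> carrier (CG.SG (Suc q))"
  shows "f (trop_boundary N \<Sigma> \<nu> p q c) =
    (\<Sum>\<gamma>\<in>faces \<Sigma> q. \<Sum>\<delta>\<in>{\<delta> \<in> faces \<Sigma> (Suc q). subface \<gamma> \<delta>}. face_sign N \<nu> \<gamma> \<delta> * f (sg q \<gamma> (F_proj N p \<gamma> (c \<delta>))))"
proof -
  let ?D = "\<lambda>\<gamma>. {\<delta> \<in> faces \<Sigma> (Suc q). subface \<gamma> \<delta>}"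
  let ?x = "\<lambda>\<gamma> \<delta>. F_proj N p \<gamma> (c \<delta>)"
  let ?t = "\<lambda>\<gamma> \<delta>. ?x \<gamma> \<delta> [^]\<^bsub>F_lower N \<Sigma> p \<gamma>\<^esub> face_sign N \<nu> \<gamma> \<delta>"
  have x: "?x \<gamma> \<delta> \<in> carrier (F_lower N \<Sigma> p \<gamma>)" if "\<gamma> \<in> faces \<Sigma> q" "\<delta> \<in> ?D \<gamma>" for \<gamma> \<delta>
    using hom_in_carrier[OF F_proj_face[OF that(1)], of \<delta> "c \<delta>"] that c by (auto simp: CG.carrier_SG PiE_iff)
  have t: "?t \<gamma> \<delta> \<in> carrier (F_lower N \<Sigma> p \<gamma>)" if "\<gamma> \<in> faces \<Sigma> q" "\<delta> \<in> ?D \<gamma>" for \<gamma> \<delta>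
    using group.int_pow_closed[OF CG.grp[OF that(1)] x[OF that]] .
  have "finprod (F_lower N \<Sigma> p \<gamma>) (?t \<gamma>) (?D \<gamma>) \<in> carrier (F_lower N \<Sigma> p \<gamma>)" if "\<gamma> \<in> faces \<Sigma> q" for \<gamma>
  proof -
    interpret comm_group "F_lower N \<Sigma> p \<gamma>" by (rule CG.comm_G[OF that])
    show ?thesis by (rule finprod_closed) (use t that in auto)
  qed
  then have b: "trop_boundary N \<Sigma> \<nu> p q c \<in> carrier (CG.SG q)"
    unfolding trop_boundary_def CG.carrier_SG by auto
  have "f (trop_boundary N \<Sigma> \<nu> p q c) = (\<Sum>\<gamma>\<in>faces \<Sigma> q. f (sg q \<gamma> (finprod (F_lower N \<Sigma> p \<gamma>) (?t \<gamma>) (?D \<gamma>))))"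
    unfolding CG.hom_expand[OF f b] by (rule sum.cong) (auto simp: trop_boundary_def)
  also have "\<dots> = (\<Sum>\<gamma>\<in>faces \<Sigma> q. \<Sum>\<delta>\<in>?D \<gamma>. face_sign N \<nu> \<gamma> \<delta> * f (sg q \<gamma> (?x \<gamma> \<delta>)))"
  proof (rule sum.cong[OF refl])
    fix \<gamma> assume g: "\<gamma> \<in> faces \<Sigma> q"
    note h = CG.hom_single[OF f g]
    have "f (sg q \<gamma> (finprod (F_lower N \<Sigma> p \<gamma>) (?t \<gamma>) (?D \<gamma>))) = (\<Sum>\<delta>\<in>?D \<gamma>. f (sg q \<gamma> (?t \<gamma> \<delta>)))"
      by (rule hom_int_finprod[OF CG.comm_G[OF g] h]) (use t g finite_faces in auto)
    also have "\<dots> = (\<Sum>\<delta>\<in>?D \<gamma>. face_sign N \<nu> \<gamma> \<delta> * f (sg q \<gamma> (?x \<gamma> \<delta>)))"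
      by (rule sum.cong[OF refl]) (rule hom_int_pow_int[OF CG.grp[OF g] h x[OF g]])
    finally show "f (sg q \<gamma> (finprod (F_lower N \<Sigma> p \<gamma>) (?t \<gamma>) (?D \<gamma>))) =
      (\<Sum>\<delta>\<in>?D \<gamma>. face_sign N \<nu> \<gamma> \<delta> * f (sg q \<gamma> (?x \<gamma> \<delta>)))" .
  qed
  finally show ?thesis .
qed

lemma dT_closed:
  assumes "f \<in> carrier (T q)"
  shows "dT q f \<in> carrier (T (Suc q))"
proof -
  have f: "f \<in> hom (CG.SG q) integer_group" using assms T_carrier by blast
  have "dT q f \<in> hom (CG.SG (Suc q)) integer_group"
  proof (rule homI)
    fix c d assume cd: "c \<in> carrier (CG.SG (Suc q))" "d \<in> carrier (CG.SG (Suc q))"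
    have m: "c \<otimes>\<^bsub>CG.SG (Suc q)\<^esub> d \<in> carrier (CG.SG (Suc q))"
      using monoid.m_closed[OF group.is_monoid[OF CG.group_SG] cd] .
    have "f (sg q \<gamma> (F_proj N p \<gamma> ((c \<otimes>\<^bsub>CG.SG (Suc q)\<^esub> d) \<delta>))) =
      f (sg q \<gamma> (F_proj N p \<gamma> (c \<delta>))) + f (sg q \<gamma> (F_proj N p \<gamma> (d \<delta>)))"
      if g: "\<gamma> \<in> faces \<Sigma> q" and dl: "\<delta> \<in> faces \<Sigma> (Suc q)" "subface \<gamma> \<delta>" for \<gamma> \<delta>
    proof -
      have x: "c \<delta> \<in> carrier (F_lower N \<Sigma> p \<delta>)" "d \<delta> \<in> carrier (F_lower N \<Sigma> p \<delta>)"
        using cd dl by (auto simp: CG.carrier_SG PiE_iff)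
      have "(\<lambda>x. f (sg q \<gamma> (F_proj N p \<gamma> x))) \<in> hom (F_lower N \<Sigma> p \<delta>) integer_group"
        using hom_compose[OF F_proj_face[OF g dl] CG.hom_single[OF f g]] by (simp add: comp_def)
      from hom_mult[OF this x] show ?thesis using dl(1) by simp
    qed
    then show "dT q f (c \<otimes>\<^bsub>CG.SG (Suc q)\<^esub> d) = dT q f c \<otimes>\<^bsub>integer_group\<^esub> dT q f d"
      using cd m boundary_formula[OF f m] boundary_formula[OF f cd(1)] boundary_formula[OF f cd(2)]
      by (simp add: trop_coboundary_def trop_chain_def sum.distrib[symmetric] distrib_left[symmetric] del: mult_sum_group)
  qed simp
  then show ?thesis
    unfolding T_carrier by (simp add: trop_coboundary_def trop_chain_def)
qed

text \<open>For a subface \<open>(A', B')\<close> the set \<open>B - A\<close> is the disjoint union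
  of \<open>B - B'\<close>, \<open>B' - A'\<close> and \<open>A' - A\<close>. In codimension one
  exactly one vector is therefore removed from \<open>B\<close> or added to
  \<open>A\<close>.\<close>

lemma codim_one_cells:
  assumes "cell (Suc q) A B"
  shows "{\<gamma> \<in> faces \<Sigma> q. subface \<gamma> (cone_hull A, cone_hull B)} =
    (\<lambda>b. (cone_hull A, cone_hull (B - {b}))) ` (B - A) \<union> (\<lambda>b. (cone_hull (insert b A), cone_hull B)) ` (B - A)"
proof (intro equalityI subsetI)
  fix \<gamma> assume "\<gamma> \<in> {\<gamma> \<in> faces \<Sigma> q. subface \<gamma> (cone_hull A, cone_hull B)}"
  then have g: "\<gamma> \<in> faces \<Sigma> q" "subface \<gamma> (cone_hull A, cone_hull B)" by auto
  obtain A' B' where c: "cell q A' B'" "\<gamma> = (cone_hull A', cone_hull B')" by (rule faces_obtain[OF g(1)])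
  have s: "A \<subseteq> A'" "B' \<subseteq> B" "A' \<subseteq> B'" using g(2) subface_cells[OF c(1) assms] c cell_D(1) by auto
  have f: "finite B" using fin[OF cell_D(2)[OF assms]] .
  have "B - A = (B - B') \<union> ((B' - A') \<union> (A' - A))" using s by auto
  also have "card \<dots> = card (B - B') + (card (B' - A') + card (A' - A))"
    using f s by (subst card_Un_disjoint; auto intro: finite_subset)+
  finally have "card (B - B') + card (A' - A) = 1" using assms c(1) by (simp add: cell_def)
  then consider "card (B - B') = 1" "card (A' - A) = 0" | "card (B - B') = 0" "card (A' - A) = 1" by linarith
  then show "\<gamma> \<in> (\<lambda>b. (cone_hull A, cone_hull (B - {b}))) ` (B - A) \<union> (\<lambda>b. (cone_hull (insert b A), cone_hull B)) ` (B - A)"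
  proof cases
    case 1
    then obtain b where b: "B - B' = {b}" using card_1_singletonE by blast
    have "finite (A' - A)" by (rule finite_subset[OF _ f]) (use s in blast)
    then have "A' - A = {}" using 1(2) by simp
    then have e: "A' = A" using s(1) by blast
    have "B' = B - {b}" "b \<in> B - A" using b s by blast+
    then show ?thesis unfolding c(2) e by (intro UnI1 image_eqI[of _ _ b]) simp_all
  next
    case 2
    then obtain b where b: "A' - A = {b}" using card_1_singletonE by blast
    have "finite (B - B')" using f by simp
    then have "B - B' = {}" using 2(1) by simp
    then have e: "B' = B" using s(2) by blast
    have "A' = insert b A" "b \<in> B - A" using b s by blast+
    then show ?thesis unfolding c(2) e by (intro UnI2 image_eqI[of _ _ b]) simp_all
  qed
next
  fix \<gamma> assume "\<gamma> \<in> (\<lambda>b. (cone_hull A, cone_hull (B - {b}))) ` (B - A) \<union> (\<lambda>b. (cone_hull (insert b A), cone_hull B)) ` (B - A)"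
  then obtain A' B' where c: "cell q A' B'" "\<gamma> = (cone_hull A', cone_hull B')" "A \<subseteq> A'" "B' \<subseteq> B"
    using cell_faces[OF assms] by blast
  then show "\<gamma> \<in> {\<gamma> \<in> faces \<Sigma> q. subface \<gamma> (cone_hull A, cone_hull B)}"
    using subface_cells[OF c(1) assms] faces_cell[OF c(1)] by simp
qed

text \<open>On an element supported at one face only the facets of this face contribute. Their
  incidence signs contain \<open>osgn\<close> of both faces: one is part of the value at the facet,
  the other is squared away by the normalisation at the large face.\<close>

lemma trop_value_dT:
  assumes f: "f \<in> carrier (T q)" and c: "cell (Suc q) A B" and v: "v \<in> SS (int p) B"
  shows "trop_value (Suc q) (dT q f) A B v = dl (trop_value q f) A B v"
proof -
  let ?\<delta> = "(cone_hull A, cone_hull B)" and ?x = "fcls p A v"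
  have fh: "f \<in> hom (CG.SG q) integer_group" using f T_carrier by blast
  note sgc = sg_closed[OF c v]
  define h where "h \<gamma> = face_sign N \<nu> \<gamma> ?\<delta> * f (sg q \<gamma> (F_proj N p \<gamma> ?x))" for \<gamma>
  have zero: "f (sg q \<gamma> (F_proj N p \<gamma> \<one>\<^bsub>F_lower N \<Sigma> p \<delta>\<^esub>)) = 0"
    if "\<gamma> \<in> faces \<Sigma> q" "\<delta> \<in> faces \<Sigma> (Suc q)" "subface \<gamma> \<delta>" for \<gamma> \<delta>
  proof -
    have "(\<lambda>x. f (sg q \<gamma> (F_proj N p \<gamma> x))) \<in> hom (F_lower N \<Sigma> p \<delta>) integer_group"
      using hom_compose[OF F_proj_face[OF that] CG.hom_single[OF fh that(1)]] by (simp add: comp_def)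
    from group_hom.hom_one[OF group_hom_intI[OF CG.grp[OF that(2)] this]] show ?thesis by simp
  qed
  have "f (trop_boundary N \<Sigma> \<nu> p q (sg (Suc q) ?\<delta> ?x)) = (\<Sum>\<gamma>\<in>faces \<Sigma> q. if subface \<gamma> ?\<delta> then h \<gamma> else 0)"
    unfolding boundary_formula[OF fh sgc]
  proof (rule sum.cong[OF refl])
    fix \<gamma> assume g: "\<gamma> \<in> faces \<Sigma> q"
    let ?D = "{\<delta> \<in> faces \<Sigma> (Suc q). subface \<gamma> \<delta>}"
    have "(\<Sum>\<delta>\<in>?D. face_sign N \<nu> \<gamma> \<delta> * f (sg q \<gamma> (F_proj N p \<gamma> (sg (Suc q) ?\<delta> ?x \<delta>)))) =
      (\<Sum>\<delta>\<in>?D. if \<delta> = ?\<delta> then h \<gamma> else 0)"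
      by (rule sum.cong[OF refl]) (use zero[OF g] in \<open>auto simp: single_def h_def\<close>)
    also have "\<dots> = (if subface \<gamma> ?\<delta> then h \<gamma> else 0)"
      using finite_faces faces_cell[OF c] by simp
    finally show "(\<Sum>\<delta>\<in>?D. face_sign N \<nu> \<gamma> \<delta> * f (sg q \<gamma> (F_proj N p \<gamma> (sg (Suc q) ?\<delta> ?x \<delta>)))) =
      (if subface \<gamma> ?\<delta> then h \<gamma> else 0)" .
  qed
  also have "\<dots> = sum h {\<gamma> \<in> faces \<Sigma> q. subface \<gamma> ?\<delta>}"
    using finite_faces by (simp add: sum.If_cases Int_def)
  also have "\<dots> = sum h ((\<lambda>b. (cone_hull A, cone_hull (B - {b}))) ` (B - A))
      + sum h ((\<lambda>b. (cone_hull (insert b A), cone_hull B)) ` (B - A))"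
    unfolding codim_one_cells[OF c]
  proof (rule sum.union_disjoint)
    have fB: "finite (B - A)" using fin[OF cell_D(2)[OF c]] by simp
    then show "finite ((\<lambda>b. (cone_hull A, cone_hull (B - {b}))) ` (B - A))"
      "finite ((\<lambda>b. (cone_hull (insert b A), cone_hull B)) ` (B - A))" by auto
    show "(\<lambda>b. (cone_hull A, cone_hull (B - {b}))) ` (B - A) \<inter> (\<lambda>b. (cone_hull (insert b A), cone_hull B)) ` (B - A) = {}"
    proof -
      have "cone_hull A \<noteq> cone_hull (insert b A)" if "b \<in> B - A" for b
        using cone_inj_\<Delta>[OF cell_D(3)[OF c] cell_D(3)[OF cell_faces(2)[OF c that]]] that by auto
      then show ?thesis by auto
    qed
  qed
  also have "sum h ((\<lambda>b. (cone_hull A, cone_hull (B - {b}))) ` (B - A)) = (\<Sum>b\<in>B - A. h (cone_hull A, cone_hull (B - {b})))"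
  proof (rule sum.reindex_cong[OF _ refl refl])
    show "inj_on (\<lambda>b. (cone_hull A, cone_hull (B - {b}))) (B - A)"
    proof (rule inj_onI)
      fix b b' assume b: "b \<in> B - A" "b' \<in> B - A" "(cone_hull A, cone_hull (B - {b})) = (cone_hull A, cone_hull (B - {b'}))"
      then have "B - {b} = B - {b'}"
        using cone_inj_\<Delta>[OF cell_D(2)[OF cell_faces(1)[OF c b(1)]] cell_D(2)[OF cell_faces(1)[OF c b(2)]]] by simp
      then show "b = b'" using b(1,2) by blast
    qed
  qed
  also have "sum h ((\<lambda>b. (cone_hull (insert b A), cone_hull B)) ` (B - A)) = (\<Sum>b\<in>B - A. h (cone_hull (insert b A), cone_hull B))"
  proof (rule sum.reindex_cong[OF _ refl refl])
    show "inj_on (\<lambda>b. (cone_hull (insert b A), cone_hull B)) (B - A)"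
    proof (rule inj_onI)
      fix b b' assume b: "b \<in> B - A" "b' \<in> B - A" "(cone_hull (insert b A), cone_hull B) = (cone_hull (insert b' A), cone_hull B)"
      then have "insert b A = insert b' A"
        using cone_inj_\<Delta>[OF cell_D(3)[OF cell_faces(2)[OF c b(1)]] cell_D(3)[OF cell_faces(2)[OF c b(2)]]] by simp
      then show "b = b'" using b(1,2) by blast
    qed
  qed
  finally have 1: "f (trop_boundary N \<Sigma> \<nu> p q (sg (Suc q) ?\<delta> ?x)) =
    (\<Sum>b\<in>B - A. h (cone_hull A, cone_hull (B - {b}))) + (\<Sum>b\<in>B - A. h (cone_hull (insert b A), cone_hull B))" .
  note AB = cell_D(1,2)[OF c]
  have h1: "osgn A B * h (cone_hull A, cone_hull (B - {b})) = eps b (B - A) * trop_value q f A (B - {b}) v" if b: "b \<in> B - A" for b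
  proof -
    have pr: "F_proj N p (cone_hull A, cone_hull (B - {b})) ?x = ?x"
      by (rule F_proj_fcls[OF AB order_refl v])
    have "osgn A B * h (cone_hull A, cone_hull (B - {b})) =
      (osgn A B * osgn A B) * (eps b (B - A) * trop_value q f A (B - {b}) v)"
      unfolding h_def pr face_sign_left[OF AB b] trop_value_def by (simp only: ac_simps)
    then show ?thesis by (simp add: osgn_sq[OF c])
  qed
  have h2: "osgn A B * h (cone_hull (insert b A), cone_hull B) = - (eps b (B - A) * trop_value q f (insert b A) B v)" if b: "b \<in> B - A" for b
  proof -
    have pr: "F_proj N p (cone_hull (insert b A), cone_hull B) ?x = fcls p (insert b A) v"
      by (rule F_proj_fcls[OF AB subset_insertI v])
    have "osgn A B * h (cone_hull (insert b A), cone_hull B) =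
      - ((osgn A B * osgn A B) * (eps b (B - A) * trop_value q f (insert b A) B v))"
      unfolding h_def pr face_sign_right[OF AB b] trop_value_def by (simp only: ac_simps mult_minus_left mult_minus_right)
    then show ?thesis by (simp add: osgn_sq[OF c])
  qed
  have "trop_value (Suc q) (dT q f) A B v = osgn A B * f (trop_boundary N \<Sigma> \<nu> p q (sg (Suc q) ?\<delta> ?x))"
    using sgc by (simp add: trop_value_def trop_coboundary_def trop_chain_def)
  also have "\<dots> = (\<Sum>b\<in>B - A. osgn A B * h (cone_hull A, cone_hull (B - {b})))
     + (\<Sum>b\<in>B - A. osgn A B * h (cone_hull (insert b A), cone_hull B))"
    unfolding 1 distrib_left sum_distrib_left ..
  also have "\<dots> = dl (trop_value q f) A B v"
    unfolding dl_def sum.distrib[symmetric]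
    by (rule sum.cong[OF refl]) (simp add: h1 h2 right_diff_distrib)
  finally show ?thesis .
qed

end

end

section \<open>The complex of the points at infinity\<close>

context toric_fan
begin

text \<open>For \<open>q > p\<close> the coefficient group is trivial and the only representative in
  degree \<open>p - q\<close> is 0, so the value 0 keeps all formulas uniform in
  \<open>q\<close>.\<close>

definition square_value :: "nat \<Rightarrow> nat \<Rightarrow> ('a set \<Rightarrow> 'a multivec \<Rightarrow> int) \<Rightarrow> 'a set \<Rightarrow> ('a list \<Rightarrow>\<^sub>0 int) \<Rightarrow> int" where
  "square_value p q a B w = (if q \<le> p then a (cone_hull B) (fcls (p - q) B w) else 0)"

abbreviation FU :: "nat \<Rightarrow> nat \<Rightarrow> 'a set \<Rightarrow> ('a multivec \<Rightarrow> int) monoid" where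
  "FU p q \<sigma> \<equiv> F_upper N \<Sigma> (int p - int q) (\<sigma>, \<sigma>)"

abbreviation cones :: "nat \<Rightarrow> 'a set set" where
  "cones q \<equiv> {\<sigma> \<in> \<Sigma>. dim \<sigma> = q}"

lemma FU_le: "q \<le> p \<Longrightarrow> FU p q (cone_hull B) = hom_group (Fl (p - q) B B) integer_group"
  by (simp add: F_upper_def flip: of_nat_diff)

lemma FU_gt: "\<not> q \<le> p \<Longrightarrow> FU p q \<sigma> = singleton_group undefined"
  by (simp add: F_upper_def)

lemma cones_cone: "B \<in> \<Delta> \<Longrightarrow> cone_hull B \<in> cones (card B)"
  using cone_\<Delta>(1) dim_\<Delta> by simp

lemma cones_obtain:
  assumes "\<sigma> \<in> cones q"
  obtains B where "B \<in> \<Delta>" "card B = q" "\<sigma> = cone_hull B"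
proof
  show "gens \<sigma> \<in> \<Delta>" by (rule gens_\<Delta>) (use assms in simp)
  show "card (gens \<sigma>) = q" using dim_gens[of \<sigma>] assms by simp
  show "\<sigma> = cone_hull (gens \<sigma>)" using gens(3)[of \<sigma>] assms by simp
qed

lemma comm_group_FU:
  assumes "B \<in> \<Delta>"
  shows "comm_group (FU p q (cone_hull B))"
proof (cases "q \<le> p")
  case True
  show ?thesis
    unfolding FU_le[OF True]
    by (rule comm_group_hom_group) (rule comm_group.axioms(2)[OF comm_group_Fl[OF order_refl assms]])
next
  case False
  show ?thesis unfolding FU_gt[OF False] by (rule singleton_abelian_group)
qed

lemma square_group: "finite_sum_group (cones q) (FU p q)"
proof (rule finite_sum_group.intro)
  show "finite (cones q)" using fan by (simp add: fan_def)
  show "comm_group (FU p q \<sigma>)" if s: "\<sigma> \<in> cones q" for \<sigma>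
  proof -
    obtain B where B: "B \<in> \<Delta>" "card B = q" "\<sigma> = cone_hull B" by (rule cones_obtain[OF s])
    show ?thesis unfolding B(3) by (rule comm_group_FU[OF B(1)])
  qed
qed

context
  fixes p :: nat
begin

interpretation SG: finite_sum_group "cones i" "FU p i" for i by (rule square_group)

abbreviation "sq \<equiv> square_cochain N \<Sigma> p"
abbreviation "dsq \<equiv> square_diff N \<Sigma> p"

lemma comm_group_sq: "comm_group (sq q)"
  unfolding square_cochain_def by (rule SG.comm_group_SG)

lemma sq_carrier: "a \<in> carrier (sq q) \<longleftrightarrow> a \<in> (\<Pi>\<^sub>E \<sigma>\<in>cones q. carrier (FU p q \<sigma>))"
  unfolding square_cochain_def SG.carrier_SG ..

lemma sq_at: "a \<in> carrier (sq q) \<Longrightarrow> B \<in> \<Delta> \<Longrightarrow> card B = q \<Longrightarrow> a (cone_hull B) \<in> carrier (FU p q (cone_hull B))"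
  using cones_cone[of B] by (auto simp: sq_carrier PiE_iff simp del: image_iff)

lemma sq_hom:
  assumes "a \<in> carrier (sq q)" "B \<in> \<Delta>" "card B = q" "q \<le> p"
  shows "a (cone_hull B) \<in> hom (Fl (p - q) B B) integer_group"
    "a (cone_hull B) \<in> extensional (carrier (Fl (p - q) B B))"
  using sq_at[OF assms(1-3)] by (simp_all add: FU_le[OF assms(4)] hom_group_carrier)

lemma ss_Fun:
  assumes "a \<in> carrier (sq q)" "B \<in> \<Delta>" "card B = q"
  shows "Fun (int p - int q) B B (square_value p q a B)"
proof (cases "q \<le> p")
  case True
  have "int (p - q) = int p - int q" using True by simp
  then show ?thesis
    using fcls_hom_Fun[OF order_refl assms(2) sq_hom(1)[OF assms True]] True by (simp add: square_value_def[abs_def])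
next
  case False
  then show ?thesis using Fun_zero by (simp add: square_value_def[abs_def])
qed

lemma square_value_hom:
  assumes "B \<in> \<Delta>" "card B = q" "w \<in> SS (int p - int q) B"
  shows "(\<lambda>a. square_value p q a B w) \<in> hom (sq q) integer_group"
proof (cases "q \<le> p")
  case True
  have "w \<in> SS (int (p - q)) B" using assms(3) True by simp
  then have x: "fcls (p - q) B w \<in> carrier (Fl (p - q) B B)"
    by (rule fcls_closed[OF order_refl assms(1)])
  show ?thesis
  proof (rule homI)
    fix a b
    have "(a \<otimes>\<^bsub>sq q\<^esub> b) (cone_hull B) = a (cone_hull B) \<otimes>\<^bsub>FU p q (cone_hull B)\<^esub> b (cone_hull B)"
      using cones_cone[OF assms(1)] assms(2) unfolding square_cochain_def by simp
    then show "square_value p q (a \<otimes>\<^bsub>sq q\<^esub> b) B w = square_value p q a B w \<otimes>\<^bsub>integer_group\<^esub> square_value p q b B w"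
      using True hom_group_mult[OF x] by (simp add: square_value_def FU_le)
  qed simp
next
  case False
  then show ?thesis by (intro homI) (simp_all add: square_value_def)
qed

lemma square_value_ext:
  assumes ab: "a \<in> carrier (sq q)" "b \<in> carrier (sq q)"
    and eq: "\<And>B w. B \<in> \<Delta> \<Longrightarrow> card B = q \<Longrightarrow> w \<in> SS (int p - int q) B \<Longrightarrow> square_value p q a B w = square_value p q b B w"
  shows "a = b"
proof (rule PiE_ext)
  show "a \<in> (\<Pi>\<^sub>E \<sigma>\<in>cones q. carrier (FU p q \<sigma>))" "b \<in> (\<Pi>\<^sub>E \<sigma>\<in>cones q. carrier (FU p q \<sigma>))"
    using ab sq_carrier by auto
  fix \<sigma> assume "\<sigma> \<in> cones q"
  then obtain B where B: "B \<in> \<Delta>" "card B = q" "\<sigma> = cone_hull B" by (rule cones_obtain)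
  show "a \<sigma> = b \<sigma>"
  proof (cases "q \<le> p")
    case True
    show ?thesis
      unfolding B(3)
    proof (rule extensionalityI)
      show "a (cone_hull B) \<in> extensional (carrier (Fl (p - q) B B))"
        "b (cone_hull B) \<in> extensional (carrier (Fl (p - q) B B))"
        using sq_hom(2)[OF _ B(1,2) True] ab by auto
      fix x assume "x \<in> carrier (Fl (p - q) B B)"
      then obtain w where w: "w \<in> SS (int (p - q)) B" "x = fcls (p - q) B w"
        unfolding carrier_Fl[OF order_refl B(1)] by auto
      then have "w \<in> SS (int p - int q) B" using True by simp
      from eq[OF B(1,2) this] show "a (cone_hull B) x = b (cone_hull B) x" using True w(2) by (simp add: square_value_def)
    qed
  next
    case False
    then show ?thesis
      using sq_at[OF ab(1) B(1,2)] sq_at[OF ab(2) B(1,2)] unfolding B(3) FU_gt[OF False] by simp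
  qed
qed

lemma square_value_exists:
  assumes u: "\<And>B. B \<in> \<Delta> \<Longrightarrow> card B = q \<Longrightarrow> Fun (int p - int q) B B (u B)"
  shows "\<exists>a\<in>carrier (sq q). \<forall>B w. B \<in> \<Delta> \<longrightarrow> card B = q \<longrightarrow> w \<in> SS (int p - int q) B \<longrightarrow> square_value p q a B w = u B w"
proof -
  have "\<forall>\<sigma>\<in>cones q. \<exists>h. h \<in> carrier (FU p q \<sigma>) \<and>
    (\<forall>B w. B \<in> \<Delta> \<longrightarrow> \<sigma> = cone_hull B \<longrightarrow> w \<in> SS (int p - int q) B \<longrightarrow> q \<le> p \<longrightarrow> h (fcls (p - q) B w) = u B w)"
  proof
    fix \<sigma> assume "\<sigma> \<in> cones q"
    then obtain B where B: "B \<in> \<Delta>" "card B = q" "\<sigma> = cone_hull B" by (rule cones_obtain)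
    have same: "B' = B" if "B' \<in> \<Delta>" "\<sigma> = cone_hull B'" for B'
      using cone_inj_\<Delta>[OF that(1) B(1)] that(2) B(3) by simp
    show "\<exists>h. h \<in> carrier (FU p q \<sigma>) \<and>
      (\<forall>B w. B \<in> \<Delta> \<longrightarrow> \<sigma> = cone_hull B \<longrightarrow> w \<in> SS (int p - int q) B \<longrightarrow> q \<le> p \<longrightarrow> h (fcls (p - q) B w) = u B w)"
    proof (cases "q \<le> p")
      case True
      have i: "int (p - q) = int p - int q" using True by simp
      obtain h where h: "h \<in> hom (Fl (p - q) B B) integer_group" "h \<in> extensional (carrier (Fl (p - q) B B))"
        "\<And>w. w \<in> SS (int (p - q)) B \<Longrightarrow> h (fcls (p - q) B w) = u B w"
        using Fun_fcls_hom[OF order_refl B(1) u[OF B(1,2), folded i]] by metis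
      have "h \<in> carrier (FU p q \<sigma>)"
        unfolding B(3) FU_le[OF True] hom_group_carrier using h(1,2) by simp
      moreover have "h (fcls (p - q) B' w) = u B' w" if "B' \<in> \<Delta>" "\<sigma> = cone_hull B'" "w \<in> SS (int p - int q) B'" for B' w
        using h(3)[of w] that(3) unfolding same[OF that(1,2)] i .
      ultimately show ?thesis by (intro exI[of _ h]) blast
    next
      case False
      then show ?thesis by (intro exI[of _ undefined]) (simp add: FU_gt[OF False] del: image_iff)
    qed
  qed
  then obtain g where G: "\<forall>\<sigma>\<in>cones q. g \<sigma> \<in> carrier (FU p q \<sigma>) \<and>
    (\<forall>B w. B \<in> \<Delta> \<longrightarrow> \<sigma> = cone_hull B \<longrightarrow> w \<in> SS (int p - int q) B \<longrightarrow> q \<le> p \<longrightarrow> g \<sigma> (fcls (p - q) B w) = u B w)"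
    by (rule bchoice[THEN exE])
  note g = bspec[OF G, THEN conjunct1] bspec[OF G, THEN conjunct2, rule_format, OF _ _ refl]
  define a where "a = restrict g (cones q)"
  have "a \<in> carrier (sq q)" unfolding sq_carrier a_def restrict_PiE_iff by (rule ballI) (rule g(1))
  moreover have "square_value p q a B w = u B w" if B: "B \<in> \<Delta>" "card B = q" and w: "w \<in> SS (int p - int q) B" for B w
  proof (cases "q \<le> p")
    case True
    have c: "cone_hull B \<in> cones q" using cones_cone[OF B(1)] unfolding B(2) .
    then have "a (cone_hull B) = g (cone_hull B)" unfolding a_def by (rule restrict_apply')
    then show ?thesis using g(2)[OF c B(1) w True] True by (simp add: square_value_def)
  next
    case False
    then have "w = 0" using SS_negative[OF w] by simp
    then show ?thesis using Fun_0[OF u[OF B]] False by (simp add: square_value_def)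
  qed
  ultimately show ?thesis by blast
qed

text \<open>A relation modulo \<open>B\<close> wedged with the normal becomes a relation modulo the
  facet up to a nonzero multiple, by \<open>wdg_normal_torsion\<close>; the integer values of
  \<open>u\<close> absorb the multiple. This is the well-definedness of contraction with
  \<open>e^\<tau>_\<sigma>\<close>.\<close>

lemma contract_Fun:
  assumes B: "B \<in> \<Delta>" "b \<in> B" and u: "Fun (int (Suc m)) (B - {b}) (B - {b}) u"
  shows "Fun (int m) B B (\<lambda>w. u (wdg (nrm B b) w))"
proof -
  let ?A = "B - {b}" and ?n = "nrm B b"
  have S: "wdg ?n v \<in> SS (int (Suc m)) ?A" if "v \<in> SS (int m) B" for v
    using SS_anti[OF _ SS_wdg[OF that nrm(1)[OF B]], of ?A] by (auto simp: add.commute)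
  show ?thesis
  proof (rule FunI)
    show "u (wdg ?n (v - w)) = u (wdg ?n v) - u (wdg ?n w)" if "v \<in> SS (int m) B" "w \<in> SS (int m) B" for v w
      using Fun_diff[OF u S[OF that(1)] S[OF that(2)]] by simp
    fix v assume v: "v \<in> SS (int m) B" "v \<in> RR B"
    have v': "v \<in> RR (insert b ?A)" using v(2) B(2) by (simp add: insert_absorb)
    have n: "?n \<in> N" using nrm(1)[OF B] NL_sub by blast
    have "frag_cmul (M ^ nat (int m) * nrm_mult B b) (wdg ?n v) \<in> RR ?A"
      by (rule wdg_normal_torsion[OF Diff_subset B v(1) v' n nrm(3)[OF B]])
    then have "u (frag_cmul (M ^ m * nrm_mult B b) (wdg ?n v)) = 0"
      using Fun_rel[OF u SS_closed(5)[OF S[OF v(1)]], of "M ^ m * nrm_mult B b"] by simp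
    then have "(M ^ m * nrm_mult B b) * u (wdg ?n v) = 0"
      unfolding Fun_cmul[OF u S[OF v(1)]] .
    moreover have "M ^ m * nrm_mult B b \<noteq> 0" using M nrm(2)[OF B] by simp
    ultimately show "u (wdg ?n v) = 0" by (metis mult_eq_0_iff)
  qed
qed

text \<open>All lifts that \<open>SOME\<close> may pick are classes of representatives that agree
  modulo \<open>RR B\<close>, so \<open>contract_Fun\<close> gives the value at any of them.\<close>

lemma contract_map_square_value:
  assumes B: "B \<in> \<Delta>" "b \<in> B" "card B = Suc q" and p: "Suc q \<le> p" and a: "a \<in> carrier (sq q)"
  defines "k \<equiv> contract_map N \<Sigma> (int p - int q) (cone_hull (B - {b})) (cone_hull B) (a (cone_hull (B - {b})))"
  shows "k \<in> carrier (FU p (Suc q) (cone_hull B))"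
    "w \<in> SS (int p - int (Suc q)) B \<Longrightarrow> k (fcls (p - Suc q) B w) = square_value p q a (B - {b}) (wdg (nrm B b) w)"
proof -
  let ?A = "B - {b}" and ?n = "nrm B b"
  define m where "m = p - Suc q"
  have m: "Suc m = p - q" "int p - int q = int (Suc m)" "int p - int (Suc q) = int m" "q \<le> p"
    using p by (auto simp: m_def)
  have A: "?A \<in> \<Delta>" by (rule down[OF B(1)]) blast
  have cA: "card ?A = q" using B(2,3) fin[OF B(1)] by simp
  have Fa: "Fun (int (Suc m)) ?A ?A (square_value p q a ?A)" by (rule ss_Fun[OF a A cA, unfolded m(2)])
  note Fc = contract_Fun[OF B(1,2) Fa]
  obtain h where h: "h \<in> hom (Fl m B B) integer_group" "h \<in> extensional (carrier (Fl m B B))"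
    "\<And>v. v \<in> SS (int m) B \<Longrightarrow> h (fcls m B v) = square_value p q a ?A (wdg ?n v)"
    using Fun_fcls_hom[OF order_refl B(1) Fc] by metis
  have kd: "k = (\<lambda>\<beta>\<in>carrier (Fl m B B). a (cone_hull ?A) (wedge m (quot_lattice N (cone_hull ?A)) (normal_gen N (cone_hull ?A) (cone_hull B))
               (SOME \<beta>'. \<beta>' \<in> carrier (Fl m ?A B) \<and> F_proj N m (cone_hull B, cone_hull B) \<beta>' = \<beta>)))"
    unfolding k_def contract_map_def m(2) by (simp add: Let_def)
  have kv: "k (fcls m B v) = square_value p q a ?A (wdg ?n v)" if v: "v \<in> SS (int m) B" for v
  proof -
    define \<beta>' where "\<beta>' = (SOME \<beta>'. \<beta>' \<in> carrier (Fl m ?A B) \<and> F_proj N m (cone_hull B, cone_hull B) \<beta>' = fcls m B v)"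
    have "\<beta>' \<in> carrier (Fl m ?A B) \<and> F_proj N m (cone_hull B, cone_hull B) \<beta>' = fcls m B v"
      unfolding \<beta>'_def
    proof (rule someI[of _ "fcls m ?A v"], rule conjI)
      show "fcls m ?A v \<in> carrier (Fl m ?A B)" by (rule fcls_closed[OF Diff_subset B(1) v])
      show "F_proj N m (cone_hull B, cone_hull B) (fcls m ?A v) = fcls m B v"
        by (rule F_proj_fcls[OF Diff_subset B(1) Diff_subset v])
    qed
    then obtain v' where v': "v' \<in> SS (int m) B" "\<beta>' = fcls m ?A v'" "fcls m B v' = fcls m B v"
      unfolding carrier_Fl[OF Diff_subset B(1)] using F_proj_fcls[OF Diff_subset B(1) Diff_subset] by auto
    have "v' - v \<in> RR B" using fcls_eq_iff[OF order_refl B(1) v'(1) v] v'(3) by simp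
    then have "square_value p q a ?A (wdg ?n v') = square_value p q a ?A (wdg ?n v)"
      by (rule Fun_cong[OF Fc v'(1) v])
    moreover have "wedge m (quot_lattice N (cone_hull ?A)) (normal_gen N (cone_hull ?A) (cone_hull B)) \<beta>' = fcls (Suc m) ?A (wdg ?n v')"
      unfolding nrm(6)[OF B(1,2)] v'(2)
      by (rule wedge_fcls[OF Diff_subset B(1)]) (use nrm(1)[OF B(1,2)] NL_sub in blast)
    ultimately show ?thesis
      unfolding kd using fcls_closed[OF order_refl B(1) v] m(4) by (simp add: \<beta>'_def[symmetric] square_value_def m(1)[symmetric])
  qed
  have "k = h"
  proof (rule extensionalityI)
    show "k \<in> extensional (carrier (Fl m B B))" unfolding kd by (rule restrict_extensional)
    fix x assume "x \<in> carrier (Fl m B B)"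
    then obtain v where "v \<in> SS (int m) B" "x = fcls m B v" unfolding carrier_Fl[OF order_refl B(1)] by auto
    then show "k x = h x" using kv h(3) by simp
  qed (rule h(2))
  then show "k \<in> carrier (FU p (Suc q) (cone_hull B))"
    unfolding FU_le[OF p] m_def[symmetric] hom_group_carrier using h(1,2) by simp
  show "k (fcls (p - Suc q) B w) = square_value p q a ?A (wdg ?n w)" if "w \<in> SS (int p - int (Suc q)) B"
    using kv[of w] that unfolding m(3) m_def[symmetric] .
qed

lemma contract_map_closed:
  assumes "B \<in> \<Delta>" "b \<in> B" "card B = Suc q" "a \<in> carrier (sq q)"
  shows "contract_map N \<Sigma> (int p - int q) (cone_hull (B - {b})) (cone_hull B) (a (cone_hull (B - {b})))
    \<in> carrier (FU p (Suc q) (cone_hull B))"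
proof (cases "Suc q \<le> p")
  case True
  then show ?thesis by (rule contract_map_square_value(1)[OF assms(1-3) _ assms(4)])
next
  case False
  have e: "int p - int q - 1 = int p - int (Suc q)" by simp
  show ?thesis
    unfolding contract_map_def e using False FU_gt[OF False, of "cone_hull B"] by (simp add: singleton_group_def)
qed

lemma facets:
  assumes "B \<in> \<Delta>" "card B = Suc q"
  shows "{\<tau> \<in> \<Sigma>. dim \<tau> = q \<and> cone_face \<tau> (cone_hull B)} = (\<lambda>b. cone_hull (B - {b})) ` B"
    "inj_on (\<lambda>b. cone_hull (B - {b})) B"
proof -
  have A: "B - {b} \<in> \<Delta>" for b by (rule down[OF assms(1)]) blast
  show "inj_on (\<lambda>b. cone_hull (B - {b})) B"
  proof (rule inj_onI)
    fix b b' assume b: "b \<in> B" "b' \<in> B" "cone_hull (B - {b}) = cone_hull (B - {b'})"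
    then have "B - {b} = B - {b'}" using cone_inj_\<Delta>[OF A A] by simp
    then show "b = b'" using b(1,2) by blast
  qed
  show "{\<tau> \<in> \<Sigma>. dim \<tau> = q \<and> cone_face \<tau> (cone_hull B)} = (\<lambda>b. cone_hull (B - {b})) ` B"
  proof (intro equalityI subsetI)
    fix \<tau> assume "\<tau> \<in> {\<tau> \<in> \<Sigma>. dim \<tau> = q \<and> cone_face \<tau> (cone_hull B)}"
    then have t: "\<tau> \<in> cones q" "cone_face \<tau> (cone_hull B)" by auto
    obtain A where A': "A \<in> \<Delta>" "card A = q" "\<tau> = cone_hull A" by (rule cones_obtain[OF t(1)])
    have s: "A \<subseteq> B" using face_\<Delta>[OF A'(1) assms(1)] t(2) A'(3) by simp
    then have "card (B - A) = 1" using card_Diff_subset[OF fin[OF A'(1)] s] A'(2) assms(2) by simp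
    then obtain b where "B - A = {b}" using card_1_singletonE by blast
    then have "A = B - {b}" "b \<in> B" using s by auto
    then show "\<tau> \<in> (\<lambda>b. cone_hull (B - {b})) ` B" using A'(3) by blast
  next
    fix \<tau> assume "\<tau> \<in> (\<lambda>b. cone_hull (B - {b})) ` B"
    then obtain b where b: "b \<in> B" "\<tau> = cone_hull (B - {b})" by blast
    have "card (B - {b}) = q" using b(1) assms(2) fin[OF assms(1)] by simp
    then show "\<tau> \<in> {\<tau> \<in> \<Sigma>. dim \<tau> = q \<and> cone_face \<tau> (cone_hull B)}"
      using cones_cone[OF A[of b]] face_\<Delta>[OF A[of b] assms(1)] b(2) by auto
  qed
qed

lemma dsq_closed:
  assumes a: "a \<in> carrier (sq q)"
  shows "dsq q a \<in> carrier (sq (Suc q))"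
  unfolding sq_carrier square_diff_def
proof (rule restrict_PiE_iff[THEN iffD2], rule ballI)
  fix \<sigma> assume "\<sigma> \<in> cones (Suc q)"
  then obtain B where B: "B \<in> \<Delta>" "card B = Suc q" "\<sigma> = cone_hull B" by (rule cones_obtain)
  interpret G: comm_group "FU p (Suc q) (cone_hull B)" by (rule comm_group_FU[OF B(1)])
  show "finprod (FU p (Suc q) \<sigma>) (\<lambda>\<tau>. contract_map N \<Sigma> (int p - int q) \<tau> \<sigma> (a \<tau>)) {\<tau> \<in> \<Sigma>. dim \<tau> = q \<and> cone_face \<tau> \<sigma>}
     \<in> carrier (FU p (Suc q) \<sigma>)"
    unfolding B(3) facets(1)[OF B(1,2)]
    by (rule G.finprod_closed) (use contract_map_closed[OF B(1) _ B(2) a] in blast)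
qed

lemma square_value_dsq:
  assumes a: "a \<in> carrier (sq q)" and B: "B \<in> \<Delta>" "card B = Suc q" and w: "w \<in> SS (int p - int (Suc q)) B"
  shows "square_value p (Suc q) (dsq q a) B w = (\<Sum>b\<in>B. square_value p q a (B - {b}) (wdg (nrm B b) w))"
proof (cases "Suc q \<le> p")
  case True
  let ?k = "\<lambda>\<tau>. contract_map N \<Sigma> (int p - int q) \<tau> (cone_hull B) (a \<tau>)"
  let ?G = "Fl (p - Suc q) B B"
  have "w \<in> SS (int (p - Suc q)) B" using w True by simp
  then have x: "fcls (p - Suc q) B w \<in> carrier ?G" by (rule fcls_closed[OF order_refl B(1)])
  have c: "cone_hull B \<in> cones (Suc q)" using cones_cone[OF B(1)] unfolding B(2) .
  have "dsq q a (cone_hull B) = finprod (hom_group ?G integer_group) ?k ((\<lambda>b. cone_hull (B - {b})) ` B)"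
    unfolding square_diff_def restrict_apply'[OF c] FU_le[OF True] facets(1)[OF B] ..
  moreover have "finprod (hom_group ?G integer_group) ?k ((\<lambda>b. cone_hull (B - {b})) ` B) (fcls (p - Suc q) B w)
      = (\<Sum>\<tau>\<in>(\<lambda>b. cone_hull (B - {b})) ` B. ?k \<tau> (fcls (p - Suc q) B w))"
  proof (rule hom_group_finprod[OF comm_group.axioms(2)[OF comm_group_Fl[OF order_refl B(1)]] _ _ x])
    show "finite ((\<lambda>b. cone_hull (B - {b})) ` B)" using fin[OF B(1)] by (rule finite_imageI)
    show "?k \<tau> \<in> carrier (hom_group ?G integer_group)" if "\<tau> \<in> (\<lambda>b. cone_hull (B - {b})) ` B" for \<tau>
      using that contract_map_closed[OF B(1) _ B(2) a] unfolding FU_le[OF True] by blast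
  qed
  ultimately have "square_value p (Suc q) (dsq q a) B w = (\<Sum>\<tau>\<in>(\<lambda>b. cone_hull (B - {b})) ` B. ?k \<tau> (fcls (p - Suc q) B w))"
    using True by (simp only: square_value_def if_True)
  also have "\<dots> = (\<Sum>b\<in>B. ?k (cone_hull (B - {b})) (fcls (p - Suc q) B w))"
    by (rule sum.reindex_cong[OF facets(2)[OF B] refl refl])
  also have "\<dots> = (\<Sum>b\<in>B. square_value p q a (B - {b}) (wdg (nrm B b) w))"
    by (rule sum.cong[OF refl]) (rule contract_map_square_value(2)[OF B(1) _ B(2) True a w])
  finally show ?thesis .
next
  case False
  then have "w = 0" using SS_negative[OF w] by simp
  moreover have "square_value p q a (B - {b}) 0 = 0" if "b \<in> B" for b
    using that B fin[OF B(1)] by (intro Fun_0[OF ss_Fun[OF a down[OF B(1)]]]) auto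
  ultimately show ?thesis using False by (simp add: square_value_def)
qed

end

end

section \<open>The comparison map\<close>

context toric_model
begin

text \<open>Linear and alternating relations hold in \<open>N\<close> already. In a torsion relation
  the entry \<open>t\<close> from \<open>NL B\<close> is moved next to \<open>e_B\<close>, which
  annihilates \<open>M t\<close>.\<close>

lemma wdgs_sl_RR:
  assumes B: "B \<in> \<Delta>" and w: "w \<in> RR B"
  shows "frag_cmul M (wdgs (sl B) w) \<in> RR {}"
  using w unfolding RR_def
proof (rule rels_image)
  have s: "set (sl B) \<subseteq> N" using sl(1)[OF B] \<Delta>N[OF B] by simp
  fix g assume "g \<in> ext_gens N (NL B)"
  then show "frag_cmul M (wdgs (sl B) g) \<in> rels N (NL {})"
  proof cases
    case (linear us vs x y)
    have "g \<in> rels N (NL {})"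
      unfolding linear(1) rels_def by (rule zspan_base[OF ext_gens.linear[OF linear(2-5)]])
    then show ?thesis by (intro rels_cmul rels_wdgs s)
  next
    case (alternating xs)
    have "g \<in> rels N (NL {})"
      unfolding alternating(1) rels_def by (rule zspan_base[OF ext_gens.alternating[OF alternating(2,3)]])
    then show ?thesis by (intro rels_cmul rels_wdgs s)
  next
    case (torsion us vs t)
    define y where "y = wdgs us (frag_of vs)"
    have v: "frag_of vs \<in> flists N" using torsion(3) by auto
    have y: "y \<in> flists N" unfolding y_def by (rule flists_wdgs[OF v torsion(2)])
    have t: "t \<in> N" using torsion(4) NL_sub by blast
    let ?e = "(-1) ^ length us :: int"
    have "g = wdgs us (wdg t (frag_of vs))" unfolding torsion(1) by (simp add: wdgs_of)
    then have "g - frag_cmul ?e (wdg t y) \<in> rels N (NL {})"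
      unfolding y_def using rels_wdgs_move[OF v torsion(2) t N] by simp
    then have 1: "frag_cmul M (wdgs (sl B) (g - frag_cmul ?e (wdg t y))) \<in> rels N (NL {})"
      by (intro rels_cmul rels_wdgs s)
    have 2: "frag_cmul ?e (frag_cmul M (wdgs (sl B) (wdg t y))) \<in> rels N (NL {})"
      by (rule rels_cmul) (rule wdgs_sl_torsion[OF B torsion(4) y, unfolded RR_def])
    have "frag_cmul M (wdgs (sl B) g) = frag_cmul M (wdgs (sl B) (g - frag_cmul ?e (wdg t y)))
      + frag_cmul ?e (frag_cmul M (wdgs (sl B) (wdg t y)))"
      by (simp add: mult.commute)
    then show ?thesis using rels_add[OF 1 2] by simp
  qed
qed simp

text \<open>By \<open>wdgs_sl_RR\<close> a relation modulo \<open>B\<close> is killed by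
  \<open>e_B\<close> up to the factor \<open>M\<close>, which integer values absorb. Hence
  evaluation on multiples of \<open>e_B\<close> gives a functional at
  \<open>\<infinity>_\<sigma>\<close>.\<close>

lemma wdgs_sl_Fun:
  assumes B: "B \<in> \<Delta>" "card B = q" and u: "Fun (int p) {} B u"
  shows "Fun (int p - int q) B B (\<lambda>w. u (wdgs (sl B) w))"
proof (rule FunI)
  have S: "wdgs (sl B) w \<in> SS (int p) B" if "w \<in> SS (int p - int q) B" for w
    by (rule SS_sl[OF B(1)]) (simp add: B(2) that)
  show "u (wdgs (sl B) (v - w)) = u (wdgs (sl B) v) - u (wdgs (sl B) w)"
    if "v \<in> SS (int p - int q) B" "w \<in> SS (int p - int q) B" for v w
    using Fun_diff[OF u S[OF that(1)] S[OF that(2)]] by simp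
  fix v assume v: "v \<in> SS (int p - int q) B" "v \<in> RR B"
  have "u (frag_cmul M (wdgs (sl B) v)) = 0"
    by (rule Fun_rel[OF u SS_closed(5)[OF S[OF v(1)]] wdgs_sl_RR[OF B(1) v(2)]])
  then have "M * u (wdgs (sl B) v) = 0" unfolding Fun_cmul[OF u S[OF v(1)]] .
  then show "u (wdgs (sl B) v) = 0" using M by simp
qed

lemma dl_cong:
  assumes c: "cell (Suc q) A B" and v: "v \<in> SS d B"
    and eq: "\<And>A B v. cell q A B \<Longrightarrow> v \<in> SS d B \<Longrightarrow> u A B v = u' A B v"
  shows "dl u A B v = dl u' A B v"
  unfolding dl_def
proof (rule sum.cong[OF refl])
  fix b assume b: "b \<in> B - A"
  show "eps b (B - A) * (u A (B - {b}) v - u (insert b A) B v) = eps b (B - A) * (u' A (B - {b}) v - u' (insert b A) B v)"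
    unfolding eq[OF cell_faces(1)[OF c b] SS_anti[OF Diff_subset v]] eq[OF cell_faces(2)[OF c b] v] ..
qed

lemma cell_empty: "B \<in> \<Delta> \<Longrightarrow> card B = q \<Longrightarrow> cell q {} B"
  unfolding cell_def Diff_empty by (intro conjI empty_subsetI)

end

lemma torsionless_pow:
  assumes "comm_group A" "torsionless A" "x \<in> carrier A" "x [^]\<^bsub>A\<^esub> (k::int) = \<one>\<^bsub>A\<^esub>" "k \<noteq> 0"
  shows "x = \<one>\<^bsub>A\<^esub>"
proof (rule ccontr)
  assume "x \<noteq> \<one>\<^bsub>A\<^esub>"
  then obtain h where h: "h \<in> hom A integer_group" "h x \<noteq> 0" using assms(2,3) unfolding torsionless_def by blast
  note g = comm_group.axioms(2)[OF assms(1)]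
  have "h \<one>\<^bsub>A\<^esub> = 0" using group_hom.hom_one[OF group_hom_intI[OF g h(1)]] by simp
  then have "k * h x = 0" using hom_int_pow_int[OF g h(1) assms(3), of k] assms(4) by simp
  then show False using h(2) assms(5) by simp
qed

context toric_fan
begin

lemma SS_nrm:
  assumes "B \<in> \<Delta>" "b \<in> B" "w \<in> SS (int p - int (Suc q)) B"
  shows "wdg (nrm B b) w \<in> SS (int p - int q) (B - {b})"
proof -
  have "int p - int (Suc q) + 1 = int p - int q" by simp
  then show ?thesis
    using SS_anti[OF Diff_subset SS_wdg[OF assms(3) nrm(1)[OF assms(1,2)]]] by simp
qed

context
  fixes p :: nat
begin

interpretation S: comm_group "sq p q" for q by (rule comm_group_sq)

lemma square_value_one: "B \<in> \<Delta> \<Longrightarrow> card B = q \<Longrightarrow> w \<in> SS (int p - int q) B \<Longrightarrow> square_value p q \<one>\<^bsub>sq p q\<^esub> B w = 0"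
  using group_hom.hom_one[OF group_hom_intI[OF S.is_group square_value_hom]] by simp

lemma square_value_mult:
  assumes "B \<in> \<Delta>" "card B = q" "w \<in> SS (int p - int q) B" "a \<in> carrier (sq p q)" "b \<in> carrier (sq p q)"
  shows "square_value p q (a \<otimes>\<^bsub>sq p q\<^esub> b) B w = square_value p q a B w + square_value p q b B w"
  using hom_mult[OF square_value_hom[OF assms(1-3)] assms(4,5)] by simp

lemma square_value_pow:
  assumes "B \<in> \<Delta>" "card B = q" "w \<in> SS (int p - int q) B" "a \<in> carrier (sq p q)"
  shows "square_value p q (a [^]\<^bsub>sq p q\<^esub> (k::int)) B w = k * square_value p q a B w"
  by (rule hom_int_pow_int[OF S.is_group square_value_hom[OF assms(1-3)] assms(4)])

lemma torsionless_sq: "torsionless (sq p q)"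
  unfolding torsionless_def
proof (intro ballI impI)
  fix x assume x: "x \<in> carrier (sq p q)" "x \<noteq> \<one>\<^bsub>sq p q\<^esub>"
  then obtain B w where B: "B \<in> \<Delta>" "card B = q" "w \<in> SS (int p - int q) B" "square_value p q x B w \<noteq> square_value p q \<one>\<^bsub>sq p q\<^esub> B w"
    using square_value_ext[OF x(1) S.one_closed] by blast
  then have "square_value p q x B w \<noteq> 0" using square_value_one by simp
  then show "\<exists>h\<in>hom (sq p q) integer_group. h x \<noteq> 0"
    using square_value_hom[OF B(1-3)] by (intro bexI[of _ "\<lambda>a. square_value p q a B w"]) simp_all
qed

lemma dsq_hom: "dsq p q \<in> hom (sq p q) (sq p (Suc q))"
proof (rule homI)
  fix a b assume ab: "a \<in> carrier (sq p q)" "b \<in> carrier (sq p q)"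
  note m = S.m_closed[OF ab] S.m_closed[OF dsq_closed[OF ab(1)] dsq_closed[OF ab(2)]]
  show "dsq p q (a \<otimes>\<^bsub>sq p q\<^esub> b) = dsq p q a \<otimes>\<^bsub>sq p (Suc q)\<^esub> dsq p q b"
  proof (rule square_value_ext[OF dsq_closed[OF m(1)] m(2)])
    fix B w assume B: "B \<in> \<Delta>" "card B = Suc q" and w: "w \<in> SS (int p - int (Suc q)) B"
    have "square_value p q (a \<otimes>\<^bsub>sq p q\<^esub> b) (B - {c}) (wdg (nrm B c) w) =
      square_value p q a (B - {c}) (wdg (nrm B c) w) + square_value p q b (B - {c}) (wdg (nrm B c) w)" if c: "c \<in> B" for c
      by (rule square_value_mult[OF down[OF B(1) Diff_subset] _ SS_nrm[OF B(1) c w] ab]) (use B fin[OF B(1)] c in simp)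
    then show "square_value p (Suc q) (dsq p q (a \<otimes>\<^bsub>sq p q\<^esub> b)) B w = square_value p (Suc q) (dsq p q a \<otimes>\<^bsub>sq p (Suc q)\<^esub> dsq p q b) B w"
      unfolding square_value_dsq[OF m(1) B w] square_value_mult[OF B w dsq_closed[OF ab(1)] dsq_closed[OF ab(2)]]
        square_value_dsq[OF ab(1) B w] square_value_dsq[OF ab(2) B w] sum.distrib[symmetric]
      by (intro sum.cong refl)
  qed
qed (rule dsq_closed)

end

end

text \<open>The sign with exponent \<open>q * (q - 1) / 2\<close>. It accumulates the signs
  \<open>(-1) ^ q\<close> of \<open>dl_wdgs\<close>.\<close>

fun esgn :: "nat \<Rightarrow> int" where
  "esgn 0 = 1"
| "esgn (Suc q) = (-1) ^ q * esgn q"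

lemma esgn_sq: "esgn q * esgn q = 1"
proof (induction q)
  case (Suc q)
  have "esgn (Suc q) * esgn (Suc q) = ((-1) ^ q * (-1) ^ q) * (esgn q * esgn q)" by (simp add: ac_simps)
  then show ?case unfolding Suc by (simp flip: power_mult_distrib)
qed simp

context oriented_fan
begin

text \<open>Modulo the facet, \<open>b\<close> is \<open>nrm_mult B b\<close> times the normal vector \<open>nrm B b\<close>; the weights absorb this
  factor, so that the comparison map commutes with the differentials.\<close>

definition weight :: "'a set \<Rightarrow> int" where
  "weight B = (\<Prod>B'\<in>\<Delta>. \<bar>nu_coeff {} B'\<bar>) div \<bar>nu_coeff {} B\<bar>"

lemma nu_coeff_pos: "B \<in> \<Delta> \<Longrightarrow> \<bar>nu_coeff {} B\<bar> > 0"
  using D_nu_nonzero(2)[OF empty_subsetI] by simp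

lemma weight_mult: "B \<in> \<Delta> \<Longrightarrow> \<bar>nu_coeff {} B\<bar> * weight B = (\<Prod>B'\<in>\<Delta>. \<bar>nu_coeff {} B'\<bar>)"
  unfolding weight_def by (rule dvd_mult_div_cancel) (rule dvd_prodI[OF fin\<Delta>])

lemma weight_pos:
  assumes "B \<in> \<Delta>"
  shows "weight B \<ge> 1"
proof -
  have "(\<Prod>B'\<in>\<Delta>. \<bar>nu_coeff {} B'\<bar>) > 0" by (rule prod_pos) (rule nu_coeff_pos)
  then have "\<bar>nu_coeff {} B\<bar> * weight B > 0" unfolding weight_mult[OF assms] .
  then have "weight B > 0" using nu_coeff_pos[OF assms] zero_less_mult_pos by blast
  then show ?thesis by linarith
qed

text \<open>The index of \<open>B\<close> is \<open>nrm_mult B b\<close> times the index of its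
  facet, by \<open>normal_left\<close>; the weights, quotients of a common product by these indices,
  are in the inverse ratio.\<close>

lemma weight_facet:
  assumes "B \<in> \<Delta>" "b \<in> B"
  shows "weight (B - {b}) = nrm_mult B b * weight B"
proof -
  have A: "B - {b} \<in> \<Delta>" by (rule down[OF assms(1) Diff_subset])
  have "\<bar>nu_coeff {} B\<bar> = nrm_mult B b * \<bar>nu_coeff {} (B - {b})\<bar>"
    by (rule normal_left(3)[OF empty_subsetI assms(1)]) (use assms(2) in simp)
  then have "\<bar>nu_coeff {} (B - {b})\<bar> * weight (B - {b}) = \<bar>nu_coeff {} (B - {b})\<bar> * (nrm_mult B b * weight B)"
    unfolding weight_mult[OF A] weight_mult[OF assms(1), symmetric] by (simp only: ac_simps)
  then show ?thesis using nu_coeff_pos[OF A] mult_cancel_left by (metis less_irrefl)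
qed

text \<open>For \<open>M = 1\<close> the formula \<open>D_nu\<close> makes every
  \<open>nu_coeff\<close> a unit, so all indices are 1.\<close>

lemma weight_unimodular:
  assumes "M = 1" "B \<in> \<Delta>"
  shows "weight B = 1"
proof -
  have z: "\<bar>nu_coeff {} B'\<bar> = 1" if "B' \<in> \<Delta>" for B'
  proof -
    have "nu_coeff {} B' * D {} B' (nu {} B') = 1"
      using D_nu[OF empty_subsetI that] unfolding assms(1) by simp
    then show ?thesis by (auto simp: zmult_eq_1_iff)
  qed
  have "(\<Prod>B'\<in>\<Delta>. \<bar>nu_coeff {} B'\<bar>) = 1" by (rule prod.neutral) (use z in blast)
  then show ?thesis unfolding weight_def z[OF assms(2)] by simp
qed

context
  fixes p :: nat
begin

interpretation S: comm_group "sq p q" for q by (rule comm_group_sq)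
interpretation T: comm_group "T p q" for q by (rule comm_group_T)

lemma trop_value_one: "cell q A B \<Longrightarrow> v \<in> SS (int p) B \<Longrightarrow> trop_value p q \<one>\<^bsub>T p q\<^esub> A B v = 0"
  using group_hom.hom_one[OF group_hom_intI[OF T.is_group trop_value_hom]] by simp

lemma trop_value_mult:
  assumes "cell q A B" "v \<in> SS (int p) B" "f \<in> carrier (T p q)" "g \<in> carrier (T p q)"
  shows "trop_value p q (f \<otimes>\<^bsub>T p q\<^esub> g) A B v = trop_value p q f A B v + trop_value p q g A B v"
  using hom_mult[OF trop_value_hom[OF assms(1,2)] assms(3,4)] by simp

lemma trop_value_pow:
  assumes "cell q A B" "v \<in> SS (int p) B" "f \<in> carrier (T p q)"
  shows "trop_value p q (f [^]\<^bsub>T p q\<^esub> (k::int)) A B v = k * trop_value p q f A B v"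
  by (rule hom_int_pow_int[OF T.is_group trop_value_hom[OF assms(1,2)] assms(3)])

lemma torsionless_T: "torsionless (T p q)"
  unfolding torsionless_def
proof (intro ballI impI)
  fix x assume x: "x \<in> carrier (T p q)" "x \<noteq> \<one>\<^bsub>T p q\<^esub>"
  then obtain A B v where B: "cell q A B" "v \<in> SS (int p) B" "trop_value p q x A B v \<noteq> trop_value p q \<one>\<^bsub>T p q\<^esub> A B v"
    using trop_value_ext[OF x(1) T.one_closed] by blast
  then have "trop_value p q x A B v \<noteq> 0" using trop_value_one by simp
  then show "\<exists>h\<in>hom (T p q) integer_group. h x \<noteq> 0"
    using trop_value_hom[OF B(1,2)] by (intro bexI[of _ "\<lambda>f. trop_value p q f A B v"]) simp_all
qed

lemma dT_hom: "dT p q \<in> hom (T p q) (T p (Suc q))"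
proof (rule homI)
  fix f g assume fg: "f \<in> carrier (T p q)" "g \<in> carrier (T p q)"
  note m = T.m_closed[OF fg] T.m_closed[OF dT_closed[OF fg(1)] dT_closed[OF fg(2)]]
  show "dT p q (f \<otimes>\<^bsub>T p q\<^esub> g) = dT p q f \<otimes>\<^bsub>T p (Suc q)\<^esub> dT p q g"
  proof (rule trop_value_ext[OF dT_closed[OF m(1)] m(2)])
    fix A B v assume c: "cell (Suc q) A B" "v \<in> SS (int p) B"
    have "dl (trop_value p q (f \<otimes>\<^bsub>T p q\<^esub> g)) A B v = dl (\<lambda>A B v. 1 * trop_value p q f A B v + 1 * trop_value p q g A B v) A B v"
      by (rule dl_cong[OF c]) (simp add: trop_value_mult fg)
    then show "trop_value p (Suc q) (dT p q (f \<otimes>\<^bsub>T p q\<^esub> g)) A B v = trop_value p (Suc q) (dT p q f \<otimes>\<^bsub>T p (Suc q)\<^esub> dT p q g) A B v"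
      unfolding trop_value_mult[OF c dT_closed[OF fg(1)] dT_closed[OF fg(2)]] trop_value_dT[OF fg(1) c] trop_value_dT[OF fg(2) c] trop_value_dT[OF m(1) c] dl_lin
      by simp
  qed
qed (rule dT_closed)

lemma dT_dT:
  assumes f: "f \<in> carrier (T p q)"
  shows "dT p (Suc q) (dT p q f) = \<one>\<^bsub>T p (Suc (Suc q))\<^esub>"
proof (rule trop_value_ext[OF dT_closed[OF dT_closed[OF f]] T.one_closed])
  fix A B v assume c: "cell (Suc (Suc q)) A B" "v \<in> SS (int p) B"
  have "trop_value p (Suc (Suc q)) (dT p (Suc q) (dT p q f)) A B v = dl (dl (trop_value p q f)) A B v"
    unfolding trop_value_dT[OF dT_closed[OF f] c] by (rule dl_cong[OF c trop_value_dT[OF f]])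
  then show "trop_value p (Suc (Suc q)) (dT p (Suc q) (dT p q f)) A B v = trop_value p (Suc (Suc q)) \<one>\<^bsub>T p (Suc (Suc q))\<^esub> A B v"
    unfolding trop_value_one[OF c] dl_dl[OF cell_D(1,2)[OF c(1)]] .
qed

text \<open>Prescribed through its values, which determine it by \<open>square_value_ext\<close>.
  The factors \<open>esgn\<close> and \<open>weight\<close> adapt the evaluation on multiples of
  \<open>e_B\<close> to the differentials.\<close>

definition comparison :: "nat \<Rightarrow> (('a cface \<Rightarrow> 'a multivec) \<Rightarrow> int) \<Rightarrow> ('a set \<Rightarrow> 'a multivec \<Rightarrow> int)" where
  "comparison q f = (SOME a. a \<in> carrier (sq p q) \<and> (\<forall>B w. B \<in> \<Delta> \<longrightarrow> card B = q \<longrightarrow> w \<in> SS (int p - int q) B \<longrightarrow>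
     square_value p q a B w = esgn q * weight B * trop_value p q f {} B (wdgs (sl B) w)))"

lemma comparison:
  assumes f: "f \<in> carrier (T p q)"
  shows comparison_closed: "comparison q f \<in> carrier (sq p q)"
    and square_value_comparison: "B \<in> \<Delta> \<Longrightarrow> card B = q \<Longrightarrow> w \<in> SS (int p - int q) B \<Longrightarrow>
      square_value p q (comparison q f) B w = esgn q * weight B * trop_value p q f {} B (wdgs (sl B) w)"
proof -
  have F: "Fun (int p - int q) B B (\<lambda>w. esgn q * weight B * trop_value p q f {} B (wdgs (sl B) w))" if B: "B \<in> \<Delta>" "card B = q" for B
  proof -
    have "Fun (int p) {} B (trop_value p q f {} B)" using Fam_trop_value[OF f] cell_empty[OF B] unfolding Fam_def by blast
    from Fun_lin[OF wdgs_sl_Fun[OF B this] Fun_zero, of "esgn q * weight B" 0] show ?thesis by simp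
  qed
  have "\<exists>a. a \<in> carrier (sq p q) \<and> (\<forall>B w. B \<in> \<Delta> \<longrightarrow> card B = q \<longrightarrow> w \<in> SS (int p - int q) B \<longrightarrow>
     square_value p q a B w = esgn q * weight B * trop_value p q f {} B (wdgs (sl B) w))"
    using square_value_exists[OF F] unfolding Bex_def .
  then have e: "comparison q f \<in> carrier (sq p q) \<and> (\<forall>B w. B \<in> \<Delta> \<longrightarrow> card B = q \<longrightarrow> w \<in> SS (int p - int q) B \<longrightarrow>
     square_value p q (comparison q f) B w = esgn q * weight B * trop_value p q f {} B (wdgs (sl B) w))"
    unfolding comparison_def by (rule someI_ex)
  then show "comparison q f \<in> carrier (sq p q)" by (rule conjunct1)
  show "square_value p q (comparison q f) B w = esgn q * weight B * trop_value p q f {} B (wdgs (sl B) w)"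
    if "B \<in> \<Delta>" "card B = q" "w \<in> SS (int p - int q) B"
    by (rule e[THEN conjunct2, rule_format, OF that])
qed

lemma SS_sl_card: "B \<in> \<Delta> \<Longrightarrow> card B = q \<Longrightarrow> w \<in> SS (int p - int q) B \<Longrightarrow> wdgs (sl B) w \<in> SS (int p) B"
  by (rule SS_sl) simp_all

lemma comparison_hom: "comparison q \<in> hom (T p q) (sq p q)"
proof (rule homI)
  fix f g assume fg: "f \<in> carrier (T p q)" "g \<in> carrier (T p q)"
  note m = T.m_closed[OF fg] S.m_closed[OF comparison_closed[OF fg(1)] comparison_closed[OF fg(2)]]
  show "comparison q (f \<otimes>\<^bsub>T p q\<^esub> g) = comparison q f \<otimes>\<^bsub>sq p q\<^esub> comparison q g"
  proof (rule square_value_ext[OF comparison_closed[OF m(1)] m(2)])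
    fix B w assume B: "B \<in> \<Delta>" "card B = q" "w \<in> SS (int p - int q) B"
    show "square_value p q (comparison q (f \<otimes>\<^bsub>T p q\<^esub> g)) B w = square_value p q (comparison q f \<otimes>\<^bsub>sq p q\<^esub> comparison q g) B w"
      unfolding square_value_mult[OF B comparison_closed[OF fg(1)] comparison_closed[OF fg(2)]] square_value_comparison[OF m(1) B] square_value_comparison[OF fg(1) B] square_value_comparison[OF fg(2) B]
        trop_value_mult[OF cell_empty[OF B(1,2)] SS_sl_card[OF B] fg]
      by (rule distrib_left)
  qed
qed (rule comparison_closed)

text \<open>\<open>dl_wdgs\<close> reduces the coboundary to the facets \<open>B - {b}\<close>,
  evaluated on \<open>e_{B - b} \<and> b \<and> w\<close>. Replacing \<open>b\<close> by the normal
  costs \<open>nrm_mult B b\<close>, which is the ratio of the weights, and the sign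
  \<open>(-1) ^ q\<close> is the ratio of consecutive values of \<open>esgn\<close>.\<close>

lemma comparison_chain:
  assumes f: "f \<in> carrier (T p q)"
  shows "comparison (Suc q) (dT p q f) = dsq p q (comparison q f)"
proof (rule square_value_ext[OF comparison_closed[OF dT_closed[OF f]] dsq_closed[OF comparison_closed[OF f]]])
  fix B w assume B: "B \<in> \<Delta>" "card B = Suc q" and w: "w \<in> SS (int p - int (Suc q)) B"
  have fb: "square_value p q (comparison q f) (B - {b}) (wdg (nrm B b) w) =
    esgn q * weight B * trop_value p q f {} (B - {b}) (wdgs (sl (B - {b})) (wdg b w))" if b: "b \<in> B" for b
  proof -
    have A: "B - {b} \<in> \<Delta>" "card (B - {b}) = q"
      using down[OF B(1) Diff_subset] B(2) b fin[OF B(1)] by simp_all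
    have F: "Fun (int p) {} (B - {b}) (trop_value p q f {} (B - {b}))"
      using Fam_trop_value[OF f] cell_empty[OF A] unfolding Fam_def by blast
    have "trop_value p q f {} (B - {b}) (wdgs (sl (B - {b})) (wdg b w)) =
      nrm_mult B b * trop_value p q f {} (B - {b}) (wdgs (sl (B - {b})) (wdg (nrm B b) w))"
      by (rule Fun_wdgs_normal[OF F A b B(1) refl nrm(1)[OF B(1) b] nrm(3)[OF B(1) b] w])
    then show ?thesis
      unfolding square_value_comparison[OF f A SS_nrm[OF B(1) b w]] weight_facet[OF B(1) b] by (simp only: ac_simps)
  qed
  have "square_value p (Suc q) (comparison (Suc q) (dT p q f)) B w =
    esgn (Suc q) * weight B * dl (trop_value p q f) {} B (wdgs (sl B) w)"
    unfolding square_value_comparison[OF dT_closed[OF f] B w] trop_value_dT[OF f cell_empty[OF B] SS_sl_card[OF B w]] ..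
  also have "\<dots> = ((-1) ^ q * (-1) ^ q) * (esgn q * weight B) *
      (\<Sum>b\<in>B. trop_value p q f {} (B - {b}) (wdgs (sl (B - {b})) (wdg b w)))"
    unfolding dl_wdgs[OF Fam_trop_value[OF f] B w] esgn.simps by (simp only: ac_simps)
  also have "\<dots> = (\<Sum>b\<in>B. esgn q * weight B * trop_value p q f {} (B - {b}) (wdgs (sl (B - {b})) (wdg b w)))"
    by (simp add: sum_distrib_left flip: power_mult_distrib)
  also have "\<dots> = square_value p (Suc q) (dsq p q (comparison q f)) B w"
    unfolding square_value_dsq[OF comparison_closed[OF f] B w] by (rule sum.cong[OF refl]) (simp only: fb)
  finally show "square_value p (Suc q) (comparison (Suc q) (dT p q f)) B w = square_value p (Suc q) (dsq p q (comparison q f)) B w" .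
qed

lemma comparison_onto:
  assumes b: "b \<in> carrier (sq p q)"
  shows "\<exists>K\<ge>1::int. (M = 1 \<longrightarrow> K = 1) \<and> (\<exists>f\<in>carrier (T p q). comparison q f = b [^]\<^bsub>sq p q\<^esub> K)"
proof -
  \<comment> \<open>\<open>M ^ q\<close> comes from the contraction in \<open>surjective\<close>.
    The product equalises the weights: the cofactor \<open>r B\<close> completes the weight of
    \<open>B\<close> to it, so that the same \<open>K\<close> serves all cones.\<close>
  define K where "K = M ^ q * (\<Prod>B\<in>\<Delta>. weight B)"
  have "(\<Prod>B\<in>\<Delta>. weight B) \<ge> 1" by (rule prod_ge_1) (rule weight_pos)
  moreover have "M ^ q \<ge> 1" using M by simp
  ultimately have K1: "K \<ge> 1" unfolding K_def using mult_mono[of 1 "M ^ q" 1 "\<Prod>B\<in>\<Delta>. weight B"] by simp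
  have Ku: "M = 1 \<longrightarrow> K = 1"
  proof
    assume m: "M = 1"
    have "(\<Prod>B\<in>\<Delta>. weight B) = 1" by (rule prod.neutral) (use weight_unimodular[OF m] in blast)
    then show "K = 1" unfolding K_def m by simp
  qed
  define r where "r B = esgn q * (\<Prod>B'\<in>\<Delta> - {B}. weight B')" for B
  have r: "esgn q * weight B * (r B * M ^ q) = K" if "B \<in> \<Delta>" for B
  proof -
    have "esgn q * weight B * (r B * M ^ q) = (esgn q * esgn q) * M ^ q * (weight B * (\<Prod>B'\<in>\<Delta> - {B}. weight B'))"
      unfolding r_def by (simp only: ac_simps)
    then show ?thesis unfolding esgn_sq prod.remove[OF fin\<Delta> that, symmetric] K_def by simp
  qed
  \<comment> \<open>The comparison only sees the faces with \<open>A = {}\<close>, so the lift may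
    be 0 at all others.\<close>
  define u :: "'a set \<Rightarrow> 'a set \<Rightarrow> ('a list \<Rightarrow>\<^sub>0 int) \<Rightarrow> int"
    where "u A B v = (if A = {} then r B * square_value p q b B (contrs B (sl B) v) else 0)" for A B v
  have Fb: "Fun (int p - int q) B B (square_value p q b B)" if "B \<in> \<Delta>" "card B = q" for B
    by (rule ss_Fun[OF b that])
  have "Fam (int p) q u"
    unfolding Fam_def
  proof (intro allI impI)
    fix A B assume c: "cell q A B"
    show "Fun (int p) A B (u A B)"
    proof (cases "A = {}")
      case True
      then have B: "B \<in> \<Delta>" "card B = q" using c unfolding cell_def by simp_all
      from Fun_lin[OF surjective(1)[OF B Fb[OF B]] Fun_zero, of "r B" 0] show ?thesis
        unfolding True u_def by simp
    next
      case False
      then show ?thesis unfolding u_def using Fun_zero by simp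
    qed
  qed
  then obtain f where f: "f \<in> carrier (T p q)" "\<And>A B v. cell q A B \<Longrightarrow> v \<in> SS (int p) B \<Longrightarrow> trop_value p q f A B v = u A B v"
    using trop_value_exists by blast
  have "comparison q f = b [^]\<^bsub>sq p q\<^esub> K"
  proof (rule square_value_ext[OF comparison_closed[OF f(1)] S.int_pow_closed[OF b]])
    fix B w assume B: "B \<in> \<Delta>" "card B = q" "w \<in> SS (int p - int q) B"
    have "square_value p q (comparison q f) B w = esgn q * weight B * (r B * (M ^ q * square_value p q b B w))"
      unfolding square_value_comparison[OF f(1) B] f(2)[OF cell_empty[OF B(1,2)] SS_sl_card[OF B]] u_def
        surjective(2)[OF B(1,2) Fb[OF B(1,2)] B(3), symmetric] by simp
    also have "\<dots> = (esgn q * weight B * (r B * M ^ q)) * square_value p q b B w" by (simp only: ac_simps)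
    finally show "square_value p q (comparison q f) B w = square_value p q (b [^]\<^bsub>sq p q\<^esub> K) B w"
      unfolding r[OF B(1)] square_value_pow[OF B b] .
  qed
  then show ?thesis using K1 Ku f(1) by blast
qed

text \<open>After cancelling the sign and the positive weight, a trivial image under the comparison
  is the kernel condition of \<open>acyclic\<close>.\<close>

lemma cocycle_homotopy:
  assumes a: "a \<in> carrier (T p q)" and da: "dT p q a = \<one>\<^bsub>T p (Suc q)\<^esub>" and pa: "comparison q a = \<one>\<^bsub>sq p q\<^esub>"
  obtains h K where "K \<ge> 1" "M = 1 \<Longrightarrow> K = 1"
    "\<And>A B. A \<subseteq> B \<Longrightarrow> B \<in> \<Delta> \<Longrightarrow> Suc (card (B - A)) = q \<Longrightarrow> Fun (int p) A B (h A B)"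
    "\<And>B v. h {} B v = 0"
    "\<And>A B v. cell q A B \<Longrightarrow> v \<in> SS (int p) B \<Longrightarrow> K * trop_value p q a A B v = dl h A B v"
proof (rule acyclic[OF Fam_trop_value[OF a]])
  show "dl (trop_value p q a) A B v = 0" if "cell (Suc q) A B" "v \<in> SS (int p) B" for A B v
    using trop_value_dT[OF a that] trop_value_one[OF that] unfolding da by simp
  show "trop_value p q a {} B (wdgs (sl B) w) = 0" if B: "B \<in> \<Delta>" "card B = q" "w \<in> SS (int p - int q) B" for B w
  proof -
    have "esgn q * weight B * trop_value p q a {} B (wdgs (sl B) w) = 0"
      using square_value_comparison[OF a B] square_value_one[OF B] unfolding pa by simp
    moreover have "esgn q \<noteq> 0" using esgn_sq[of q] by auto
    moreover have "weight B \<noteq> 0" using weight_pos[OF B(1)] by simp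
    ultimately show ?thesis by (metis mult_eq_0_iff)
  qed
qed (rule that)

lemma comparison_quasi_iso: "quasi_iso (T p) (dT p) (sq p) (dsq p) comparison (M = 1)"
proof -
  interpret TT: cochain_complex "T p" "dT p"
    by (rule cochain_complex.intro) (rule comm_group_T dT_hom dT_dT | assumption)+
  \<comment> \<open>That \<open>d_\<square>\<close> squares to zero is inherited from the tropical
    complex: a positive multiple of \<open>b\<close> lifts along the comparison, and the target
    group is torsionless.\<close>
  have dd: "dsq p (Suc q) (dsq p q b) = \<one>\<^bsub>sq p (Suc (Suc q))\<^esub>" if b: "b \<in> carrier (sq p q)" for q b
  proof -
    obtain K f where K: "K \<ge> (1::int)" and f: "f \<in> carrier (T p q)" "comparison q f = b [^]\<^bsub>sq p q\<^esub> K"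
      using comparison_onto[OF b] by blast
    interpret d: group_hom "sq p i" "sq p (Suc i)" "dsq p i" for i
      by (intro group_hom.intro group_hom_axioms.intro S.is_group dsq_hom)
    interpret P: group_hom "T p i" "sq p i" "comparison i" for i
      by (intro group_hom.intro group_hom_axioms.intro S.is_group T.is_group comparison_hom)
    let ?x = "dsq p (Suc q) (dsq p q b)"
    have "?x [^]\<^bsub>sq p (Suc (Suc q))\<^esub> K = dsq p (Suc q) (dsq p q (comparison q f))"
      unfolding f(2) d.hom_int_pow[OF b] d.hom_int_pow[OF dsq_closed[OF b]] ..
    also have "\<dots> = comparison (Suc (Suc q)) (dT p (Suc q) (dT p q f))"
      unfolding comparison_chain[OF f(1), symmetric] comparison_chain[OF dT_closed[OF f(1)], symmetric] ..
    also have "\<dots> = \<one>\<^bsub>sq p (Suc (Suc q))\<^esub>" unfolding dT_dT[OF f(1)] by (rule P.hom_one)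
    finally show ?thesis
      by (rule torsionless_pow[OF comm_group_sq torsionless_sq dsq_closed[OF dsq_closed[OF b]]]) (use K in simp)
  qed
  interpret SS: cochain_complex "sq p" "dsq p"
    by (rule cochain_complex.intro) (rule comm_group_sq dsq_hom dd | assumption)+
  have 0: "\<exists>K\<ge>1::int. (M = 1 \<longrightarrow> K = 1) \<and> a [^]\<^bsub>T p 0\<^esub> K = \<one>\<^bsub>T p 0\<^esub>"
    if a: "a \<in> carrier (T p 0)" and da: "dT p 0 a = \<one>\<^bsub>T p (Suc 0)\<^esub>" and pa: "comparison 0 a = \<one>\<^bsub>sq p 0\<^esub>" for a
  proof -
    obtain h K where K: "K \<ge> 1" "M = 1 \<Longrightarrow> K = 1"
      and "\<And>A B. A \<subseteq> B \<Longrightarrow> B \<in> \<Delta> \<Longrightarrow> Suc (card (B - A)) = 0 \<Longrightarrow> Fun (int p) A B (h A B)"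
      and "\<And>B v. h {} B v = 0"
      and h: "\<And>A B v. cell 0 A B \<Longrightarrow> v \<in> SS (int p) B \<Longrightarrow> K * trop_value p 0 a A B v = dl h A B v"
      by (rule cocycle_homotopy[OF a da pa]) (rule that)
    have "a [^]\<^bsub>T p 0\<^esub> K = \<one>\<^bsub>T p 0\<^esub>"
    proof (rule trop_value_ext[OF T.int_pow_closed[OF a] T.one_closed])
      fix A B v assume c: "cell 0 A B" "v \<in> SS (int p) B"
      \<comment> \<open>Cells of degree 0 are points, so \<open>dl h\<close> is an empty sum and the
        homotopy formula says that \<open>K\<close> times the cocycle is zero.\<close>
      have "B - A = {}" using c(1) fin[OF cell_D(2)[OF c(1)]] unfolding cell_def by simp
      then have "dl h A B v = 0" unfolding dl_def by (simp only: sum.empty)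
      then show "trop_value p 0 (a [^]\<^bsub>T p 0\<^esub> K) A B v = trop_value p 0 \<one>\<^bsub>T p 0\<^esub> A B v"
        unfolding trop_value_pow[OF c a] trop_value_one[OF c] h[OF c] .
    qed
    then show ?thesis using K by blast
  qed
  have 1: "\<exists>K\<ge>1::int. (M = 1 \<longrightarrow> K = 1) \<and>
      (\<exists>a'\<in>carrier (T p q). comparison q a' = \<one>\<^bsub>sq p q\<^esub> \<and> dT p q a' = a [^]\<^bsub>T p (Suc q)\<^esub> K)"
    if a: "a \<in> carrier (T p (Suc q))" and da: "dT p (Suc q) a = \<one>\<^bsub>T p (Suc (Suc q))\<^esub>"
      and pa: "comparison (Suc q) a = \<one>\<^bsub>sq p (Suc q)\<^esub>" for a q
  proof -
    obtain h K where K: "K \<ge> 1" "M = 1 \<Longrightarrow> K = 1"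
      and h: "\<And>A B. A \<subseteq> B \<Longrightarrow> B \<in> \<Delta> \<Longrightarrow> Suc (card (B - A)) = Suc q \<Longrightarrow> Fun (int p) A B (h A B)"
      and h0: "\<And>B v. h {} B v = 0"
      and hd: "\<And>A B v. cell (Suc q) A B \<Longrightarrow> v \<in> SS (int p) B \<Longrightarrow> K * trop_value p (Suc q) a A B v = dl h A B v"
      by (rule cocycle_homotopy[OF a da pa]) (rule that)
    have "Fam (int p) q h"
      unfolding Fam_def
    proof (intro allI impI)
      fix A B assume c: "cell q A B"
      then have "Suc (card (B - A)) = Suc q" unfolding cell_def by simp
      with cell_D(1,2)[OF c] show "Fun (int p) A B (h A B)" by (rule h)
    qed
    then obtain f where f: "f \<in> carrier (T p q)" "\<And>A B v. cell q A B \<Longrightarrow> v \<in> SS (int p) B \<Longrightarrow> trop_value p q f A B v = h A B v"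
      using trop_value_exists by blast
    \<comment> \<open>The primitive lies in the kernel because the family \<open>h\<close> vanishes
      at \<open>A = {}\<close>.\<close>
    have "comparison q f = \<one>\<^bsub>sq p q\<^esub>"
    proof (rule square_value_ext[OF comparison_closed[OF f(1)] S.one_closed])
      fix B w assume B: "B \<in> \<Delta>" "card B = q" "w \<in> SS (int p - int q) B"
      show "square_value p q (comparison q f) B w = square_value p q \<one>\<^bsub>sq p q\<^esub> B w"
        unfolding square_value_comparison[OF f(1) B] f(2)[OF cell_empty[OF B(1,2)] SS_sl_card[OF B]] h0 square_value_one[OF B] by simp
    qed
    moreover have "dT p q f = a [^]\<^bsub>T p (Suc q)\<^esub> K"
    proof (rule trop_value_ext[OF dT_closed[OF f(1)] T.int_pow_closed[OF a]])
      fix A B v assume c: "cell (Suc q) A B" "v \<in> SS (int p) B"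
      show "trop_value p (Suc q) (dT p q f) A B v = trop_value p (Suc q) (a [^]\<^bsub>T p (Suc q)\<^esub> K) A B v"
        unfolding trop_value_dT[OF f(1) c] trop_value_pow[OF c a] hd[OF c] by (rule dl_cong[OF c f(2)])
    qed
    ultimately show ?thesis using K f(1) by blast
  qed
  show ?thesis
    by (intro quasi_iso.intro complex_hom.intro complex_hom_axioms.intro quasi_iso_axioms.intro
        TT.cochain_complex_axioms SS.cochain_complex_axioms)
       (rule comparison_hom comparison_chain comparison_onto 0 1 | assumption)+
qed

end

end

theorem theorem1p7:
  fixes N :: "'a::real_vector set" and \<Sigma> :: "'a set set"
    and \<nu> :: "'a cface \<Rightarrow> 'a multivec" and p :: nat
  assumes "free_lattice N" and "fan N \<Sigma>" and "orientation N \<Sigma> \<nu>"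
  shows "(unimodular_fan N \<Sigma> \<longrightarrow>
            (\<forall>q::nat. square_cohomology N \<Sigma> p q \<cong> trop_cohomology N \<Sigma> \<nu> p q)) \<and>
         (simplicial_fan \<Sigma> \<longrightarrow>
            (\<forall>q::nat. square_cohomology_rat N \<Sigma> p q \<cong> trop_cohomology_rat N \<Sigma> \<nu> p q))"
proof -
  have main: "(unimodular_fan N \<Sigma> \<longrightarrow> square_cohomology N \<Sigma> p q \<cong> trop_cohomology N \<Sigma> \<nu> p q) \<and>
      square_cohomology_rat N \<Sigma> p q \<cong> trop_cohomology_rat N \<Sigma> \<nu> p q"
    if s: "simplicial_fan \<Sigma>" for q
  proof -
    interpret simplicial_rational_fan N \<Sigma>
      by (rule simplicial_rational_fan.intro[OF assms(1,2) s])
    obtain idx M ell where m: "toric_model N ((`) (primitive_vector N) ` rays ` \<Sigma>) idx M ell" and uM: "unimodular_fan N \<Sigma> \<longrightarrow> M = 1"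
      using exists_toric_model unfolding image_image by blast
    interpret oriented_fan N \<Sigma> idx M ell \<nu>
      by (intro oriented_fan.intro toric_fan.intro oriented_fan_axioms.intro
          simplicial_rational_fan_axioms m assms(3))
    interpret Q: quasi_iso "T p" "dT p" "sq p" "dsq p" "comparison p" "M = 1" by (rule comparison_quasi_iso)
    show ?thesis
      unfolding square_cohomology_def trop_cohomology_def square_cohomology_rat_def trop_cohomology_rat_def
    proof (intro conjI impI)
      assume "unimodular_fan N \<Sigma>"
      with uM have "M = 1" by (rule mp)
      then show "cohomology_group (sq p) (dsq p) q \<cong> cohomology_group (T p) (dT p) q"
        by (rule Q.quasi_iso_integral)
    qed (rule Q.quasi_iso_rational[OF torsionless_T torsionless_sq])
  qed
  \<comment> \<open>Unimodular fans are simplicial by definition, so both claims are instances of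
    \<open>main\<close>.\<close>
  then show ?thesis unfolding unimodular_fan_def by blast
qed

end
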